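(* Suppose $I^{\sigma,\alpha}:=\int_{\mathbb{R}} \sigma(x)^{-\alpha}|x|^{\alpha-1}\,dx<\infty$. Then $Y^0$ has a unique quasi-stationary distribution (QSD), given by $$\nu(A)=\frac{\int_A\psi_0\,d\mu}{\int_{\mathbb{R}^0}\psi_0\,d\mu},\qquad A\in\mathscr{B}(\mathbb{R}^0).$$ Furthermore, $\nu$ is a Yaglom limit of $Y^0$, that is, for any $x\in\mathbb{R}^0$ and any $A\in\mathscr{B}(\mathbb{R}^0)$, $$\lim_{t\to\infty}\mathbb{P}_x[Y_t\in A\mid t<T_0]=\nu(A).$$ Moreover, for every $x\in\mathbb{R}^0$ there exists $0<C(x)<\infty$ such that for all $t\ge 0$ $$\big\|\mathbb{P}_x[Y_t\in\cdot\mid t<T_0]-\nu\big\|_{TV}\le C(x)\,e^{-(\lambda_1-\lambda_0)t}.$$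
   Context: Let $\alpha\in(1,2)$ and let $X=(X_t)_{t\ge 0}$ be a symmetric $\alpha$-stable process on $\mathbb{R}$ with generator $-(-\Delta)^{\alpha/2}$ (fractional Laplacian). Let $\sigma$ be a strictly positive continuous function on $\mathbb{R}$ such that $\mu(dx):=\sigma(x)^{-\alpha}dx$ is a probability measure on $\mathbb{R}$. Let $Y=(Y_t)_{t\ge 0}$ be the time-changed process $Y_t:=X_{\zeta_t}$, where $\zeta_t:=\inf\{s>0:\int_0^s\sigma(X_u)^{-\alpha}\,du>t\}$; it is the unique weak solution of the SDE $dY_t=\sigma(Y_{t-})\,dX_t$. $\mathbb{P}_x$ is the law with $Y_0=x$. Put $\mathbb{R}^0:=\mathbb{R}\setminus\{0\}$ with Borel $\sigma$-algebra $\mathscr{B}(\mathbb{R}^0)$, and $T_0:=\inf\{t>0:Y_t=0\}$. The process $Y^0$, i.e. $Y$ killed upon hitting $0$, has transition function $P_t^0(x,A)=\mathbb{P}_x[Y_t\in A,\ t<T_0]$ for $x\in\mathbb{R}^0$, $A\in\mathscr{B}(\mathbb{R}^0)$; it is symmetric with respect to $\mu$ and acts as a semigroup on $L^2(\mathbb{R}^0;\mu)$. For a probability measure $\eta$ on $\mathbb{R}^0$ write $\mathbb{P}_\eta(\cdot)=\int_{\mathbb{R}^0}\mathbb{P}_x(\cdot)\,\eta(dx)$. A probability measure $\nu$ on $\mathbb{R}^0$ is a QSD for $Y^0$ if $\mathbb{P}_\nu[Y_t\in A\mid t<T_0]=\frac{\mathbb{P}_\nu[Y_t\in A,\,t<T_0]}{\mathbb{P}_\nu[t<T_0]}=\nu(A)$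 for all $t\ge 0$ and $A\in\mathscr{B}(\mathbb{R}^0)$. When $I^{\sigma,\alpha}<\infty$, each $P_t^0$ ($t>0$) is compact on $L^2(\mathbb{R}^0;\mu)$, and there is a complete orthonormal set $\{\psi_n\}_{n\ge 0}$ of $L^2(\mathbb{R}^0;\mu)$ with $P_t^0\psi_n=e^{-\lambda_n t}\psi_n$ for all $n\geq 0$, $t\ge 0$, where $0<\lambda_0<\lambda_1\le\lambda_2\le\cdots\to+\infty$ are the eigenvalues, counted with multiplicity, of minus the $L^2$-generator of $(P^0_t)_{t\ge0}$. The function $\psi_0$ is called the ground state; it can be, and is, chosen strictly positive and continuous on $\mathbb{R}^0$. The total variation norm of a signed measure $\eta$ is $\|\eta\|_{TV}:=\sup_{|f|\le 1}|\eta(f)|$. *)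

theory Defs
  imports "HOL-Probability.Probability"
begin

text \<open>
  A real-valued symmetric stable process started at 0, as a Levy process. Its generator is
  the fractional Laplacian with symbol \<open>- \<bar>\<theta>\<bar> powr \<alpha>\<close>, which fixes the normalisation of
  the characteristic exponent. Time is a real parameter; only times \<open>t \<ge> 0\<close> matter.
\<close>

definition symmetric_stable_process ::
    "real \<Rightarrow> 'w measure \<Rightarrow> (real \<Rightarrow> 'w \<Rightarrow> real) \<Rightarrow> bool" where
  "symmetric_stable_process \<alpha> M X \<longleftrightarrow>
     prob_space M \<and>
     (\<forall>t\<ge>0. X t \<in> borel_measurable M) \<and>
     (AE \<omega> in M. X 0 \<omega> = 0) \<and>
     (AE \<omega> in M.
        (\<forall>t\<ge>0. continuous (at_right t) (\<lambda>s. X s \<omega>)) \<and>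
        (\<forall>t>0. \<exists>l. ((\<lambda>s. X s \<omega>) \<longlongrightarrow> l) (at_left t))) \<and>
     (\<forall>ts. sorted ts \<and> (\<forall>t\<in>set ts. 0 \<le> t) \<longrightarrow>
        prob_space.indep_vars M (\<lambda>_. borel)
          (\<lambda>i \<omega>. X (ts ! Suc i) \<omega> - X (ts ! i) \<omega>) {i. Suc i < length ts}) \<and>
     (\<forall>s t. 0 \<le> s \<and> s \<le> t \<longrightarrow>
        (\<forall>\<theta>. char (distr M borel (\<lambda>\<omega>. X t \<omega> - X s \<omega>)) \<theta>
               = complex_of_real (exp (- (t - s) * \<bar>\<theta>\<bar> powr \<alpha>))))"

definition speed_measure :: "real \<Rightarrow> (real \<Rightarrow> real) \<Rightarrow> real measure" where
  "speed_measure \<alpha> \<sigma> = density lborel (\<lambda>x. ennreal (\<sigma> x powr (- \<alpha>)))"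

abbreviation borel0 :: "real measure" where
  "borel0 \<equiv> restrict_space borel (- {0})"

definition speed_measure0 :: "real \<Rightarrow> (real \<Rightarrow> real) \<Rightarrow> real measure" where
  "speed_measure0 \<alpha> \<sigma> = restrict_space (speed_measure \<alpha> \<sigma>) (- {0})"

text \<open>
  By spatial homogeneity, the stable process under the law \<open>P\<^sub>x\<close> is realised as \<open>x + X\<close>. Below,
  \<open>x\<close> is therefore always the starting point, and a probability under \<open>P\<^sub>x\<close> is one under \<open>M\<close>.
\<close>

definition additive_functional ::
    "real \<Rightarrow> (real \<Rightarrow> real) \<Rightarrow> (real \<Rightarrow> 'w \<Rightarrow> real) \<Rightarrow> real \<Rightarrow> real \<Rightarrow> 'w \<Rightarrow> ennreal" where
  "additive_functional \<alpha> \<sigma> X x s \<omega> =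
     (\<integral>\<^sup>+ u \<in> {0..s}. ennreal (\<sigma> (x + X u \<omega>) powr (- \<alpha>)) \<partial>lborel)"

definition time_change ::
    "real \<Rightarrow> (real \<Rightarrow> real) \<Rightarrow> (real \<Rightarrow> 'w \<Rightarrow> real) \<Rightarrow> real \<Rightarrow> real \<Rightarrow> 'w \<Rightarrow> ereal" where
  "time_change \<alpha> \<sigma> X x t \<omega> =
     Inf {ereal s | s. 0 < s \<and> ennreal t < additive_functional \<alpha> \<sigma> X x s \<omega>}"

text \<open>
  For \<open>1 < \<alpha> < 2\<close> the process \<open>X\<close> is recurrent, so the time change is almost surely finite; the
  value \<open>real_of_ereal \<infinity> = 0\<close> is used on a null set only.
\<close>

definition time_changed ::
    "real \<Rightarrow> (real \<Rightarrow> real) \<Rightarrow> (real \<Rightarrow> 'w \<Rightarrow> real) \<Rightarrow> real \<Rightarrow> real \<Rightarrow> 'w \<Rightarrow> real" where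
  "time_changed \<alpha> \<sigma> X x t \<omega> = x + X (real_of_ereal (time_change \<alpha> \<sigma> X x t \<omega>)) \<omega>"

definition hitting_time0 ::
    "real \<Rightarrow> (real \<Rightarrow> real) \<Rightarrow> (real \<Rightarrow> 'w \<Rightarrow> real) \<Rightarrow> real \<Rightarrow> 'w \<Rightarrow> ereal" where
  "hitting_time0 \<alpha> \<sigma> X x \<omega> = Inf {ereal t | t. 0 < t \<and> time_changed \<alpha> \<sigma> X x t \<omega> = 0}"

text \<open>
  Probabilities are taken in the completion of \<open>M\<close>, as usual for hitting times: without further
  assumptions on \<open>M\<close>, the hitting time of a point need only be measurable up to null sets.
\<close>

definition survival_prob ::
    "real \<Rightarrow> (real \<Rightarrow> real) \<Rightarrow> 'w measure \<Rightarrow> (real \<Rightarrow> 'w \<Rightarrow> real) \<Rightarrow> real \<Rightarrow> real \<Rightarrow> real" where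
  "survival_prob \<alpha> \<sigma> M X t x =
     \<P>(\<omega> in completion M. ereal t < hitting_time0 \<alpha> \<sigma> X x \<omega>)"

definition killed_transition ::
    "real \<Rightarrow> (real \<Rightarrow> real) \<Rightarrow> 'w measure \<Rightarrow> (real \<Rightarrow> 'w \<Rightarrow> real)
       \<Rightarrow> real \<Rightarrow> real \<Rightarrow> real set \<Rightarrow> real" where
  "killed_transition \<alpha> \<sigma> M X t x A =
     \<P>(\<omega> in completion M. time_changed \<alpha> \<sigma> X x t \<omega> \<in> A \<and> ereal t < hitting_time0 \<alpha> \<sigma> X x \<omega>)"

definition killed_kernel ::
    "real \<Rightarrow> (real \<Rightarrow> real) \<Rightarrow> 'w measure \<Rightarrow> (real \<Rightarrow> 'w \<Rightarrow> real) \<Rightarrow> real \<Rightarrow> real \<Rightarrow> real measure" where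
  "killed_kernel \<alpha> \<sigma> M X t x =
     measure_of (- {0}) (sets borel0) (\<lambda>A. ennreal (killed_transition \<alpha> \<sigma> M X t x A))"

definition conditional_prob ::
    "real \<Rightarrow> (real \<Rightarrow> real) \<Rightarrow> 'w measure \<Rightarrow> (real \<Rightarrow> 'w \<Rightarrow> real)
       \<Rightarrow> real \<Rightarrow> real \<Rightarrow> real set \<Rightarrow> real" where
  "conditional_prob \<alpha> \<sigma> M X t x A =
     \<P>(\<omega> in completion M. time_changed \<alpha> \<sigma> X x t \<omega> \<in> A \<bar> ereal t < hitting_time0 \<alpha> \<sigma> X x \<omega>)"

definition conditional_law ::
    "real \<Rightarrow> (real \<Rightarrow> real) \<Rightarrow> 'w measure \<Rightarrow> (real \<Rightarrow> 'w \<Rightarrow> real) \<Rightarrow> real \<Rightarrow> real \<Rightarrow> real measure" where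
  "conditional_law \<alpha> \<sigma> M X t x =
     measure_of (- {0}) (sets borel0) (\<lambda>A. ennreal (conditional_prob \<alpha> \<sigma> M X t x A))"

definition quasi_stationary ::
    "real \<Rightarrow> (real \<Rightarrow> real) \<Rightarrow> 'w measure \<Rightarrow> (real \<Rightarrow> 'w \<Rightarrow> real) \<Rightarrow> real measure \<Rightarrow> bool" where
  "quasi_stationary \<alpha> \<sigma> M X \<nu> \<longleftrightarrow>
     prob_space \<nu> \<and> sets \<nu> = sets borel0 \<and>
     (\<forall>t\<ge>0. \<forall>A\<in>sets borel0.
        (\<integral>x. killed_transition \<alpha> \<sigma> M X t x A \<partial>\<nu>) / (\<integral>x. survival_prob \<alpha> \<sigma> M X t x \<partial>\<nu>)
          = measure \<nu> A)"

definition square_integrable_on :: "real measure \<Rightarrow> (real \<Rightarrow> real) \<Rightarrow> bool" where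
  "square_integrable_on N f \<longleftrightarrow> f \<in> borel_measurable N \<and> integrable N (\<lambda>x. (f x)\<^sup>2)"

definition complete_orthonormal_on :: "real measure \<Rightarrow> (nat \<Rightarrow> real \<Rightarrow> real) \<Rightarrow> bool" where
  "complete_orthonormal_on N \<psi> \<longleftrightarrow>
     (\<forall>n. square_integrable_on N (\<psi> n)) \<and>
     (\<forall>m n. (\<integral>x. \<psi> m x * \<psi> n x \<partial>N) = (if m = n then 1 else 0)) \<and>
     (\<forall>f. square_integrable_on N f \<and> (\<forall>n. (\<integral>x. f x * \<psi> n x \<partial>N) = 0)
          \<longrightarrow> (AE x in N. f x = 0))"

text \<open>
  Spectral data of the killed semigroup. The eigenvalue equation is an identity in \<open>L\<^sup>2\<close>, hence
  holds almost everywhere for each \<open>t\<close>. As \<open>\<psi>\<close> is complete and orthonormal, \<open>lam\<close> lists the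
  eigenvalues of minus the \<open>L\<^sup>2\<close>-generator with multiplicity. The ground state \<open>\<psi> 0\<close> is the
  strictly positive continuous representative.
\<close>

definition spectral_data ::
    "real \<Rightarrow> (real \<Rightarrow> real) \<Rightarrow> 'w measure \<Rightarrow> (real \<Rightarrow> 'w \<Rightarrow> real)
       \<Rightarrow> (nat \<Rightarrow> real) \<Rightarrow> (nat \<Rightarrow> real \<Rightarrow> real) \<Rightarrow> bool" where
  "spectral_data \<alpha> \<sigma> M X lam \<psi> \<longleftrightarrow>
     complete_orthonormal_on (speed_measure0 \<alpha> \<sigma>) \<psi> \<and>
     (\<forall>n. \<forall>t\<ge>0. AE x in speed_measure0 \<alpha> \<sigma>.
        (\<integral>y. \<psi> n y \<partial>killed_kernel \<alpha> \<sigma> M X t x) = exp (- lam n * t) * \<psi> n x) \<and>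
     0 < lam 0 \<and> lam 0 < lam 1 \<and> incseq lam \<and> filterlim lam at_top sequentially \<and>
     continuous_on (- {0}) (\<psi> 0) \<and> (\<forall>x. x \<noteq> 0 \<longrightarrow> 0 < \<psi> 0 x)"

text \<open>The total variation norm of the signed measure \<open>P - Q\<close>, for finite \<open>P\<close>, \<open>Q\<close> on the same
  sigma-algebra.\<close>

definition tv_norm_diff :: "'a measure \<Rightarrow> 'a measure \<Rightarrow> real" where
  "tv_norm_diff P Q =
     (SUP f \<in> {f \<in> borel_measurable Q. \<forall>x\<in>space Q. \<bar>f x\<bar> \<le> 1}.
        \<bar>(\<integral>x. f x \<partial>P) - (\<integral>x. f x \<partial>Q)\<bar>)"

end

theory Submission
 imports Defs
begin

text \<open>
 The Green function of the stable process killed at \<open>0\<close> is \<open>g x y = a x + a y - a (x - y)\<close>, where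
 \<open>a z\<close> is a multiple of \<open>\<bar>z\<bar> powr (\<alpha> - 1)\<close>. Hence \<open>0 \<le> g x y \<le> 2 * min (a x) (a y)\<close>, and the
 hypothesis says that \<open>a\<close> is integrable for the speed measure \<open>\<mu>\<close>; in particular \<open>g x\<close> is square
 integrable for every \<open>x\<close>. Let \<open>G\<close> be the operator with kernel \<open>g\<close>. The eigenvalue equation for the
 semigroup yields \<open>G \<psi>\<^sub>n = \<psi>\<^sub>n / \<lambda>\<^sub>n\<close>, so the resolvent equation \<open>G f = R\<^sub>\<beta> f + \<beta> * G (R\<^sub>\<beta> f)\<close> gives
 \<open>R\<^sub>\<beta> f x = (\<Sum>n. \<lambda>\<^sub>n / (\<lambda>\<^sub>n + \<beta>) * G \<psi>\<^sub>n x * \<langle>f, \<psi>\<^sub>n\<rangle>)\<close>, and by uniqueness of Laplace transforms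
 \<open>P\<^sub>t f x = (\<Sum>n. \<lambda>\<^sub>n * exp (- \<lambda>\<^sub>n * t) * G \<psi>\<^sub>n x * \<langle>f, \<psi>\<^sub>n\<rangle>)\<close> for every \<open>x \<noteq> 0\<close>, not only almost every
 one. The first term dominates, uniformly over \<open>\<bar>f\<bar> \<le> 1\<close>, which gives the rate of convergence.
 Integrating the defining equation of a quasi-stationary distribution over time shows that it has a
 density \<open>h\<close> with \<open>h = s * G h\<close>; such an \<open>h\<close> is bounded, hence square integrable, and comparing
 coefficients shows that it is a multiple of \<open>\<psi>\<^sub>0\<close>. Neither the semigroup property nor the strong
 Markov property of the time-changed process is needed.
\<close>

section \<open>Laplace transforms and time changes\<close>

text \<open>Expansions are wanted at every point \<open>x\<close>, while the eigenvalue equation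
  holds only almost everywhere, with an exceptional set that may depend on \<open>t\<close>.
  Integration over time merges these sets, and for each single \<open>x\<close> the function
  \<open>g x\<close> is a genuine element of L2, so Parseval's identity against it gives values at
  that very point. The Green function needs a limit of its own. For \<open>1 < \<alpha>\<close> the
  stable process is recurrent and its potential is infinite; hence potentials are discounted at rate
  \<open>\<beta>\<close>, corrected by first passage to \<open>0\<close>, and only then is
  \<open>\<beta>\<close> sent to \<open>0\<close>, where the divergent parts cancel. First passage
  is reached through entry into shrinking intervals, because hitting a point need not be a
  measurable event before completion. Identifying the two notions requires that a path with left
  limit \<open>0\<close> does not jump away from \<open>0\<close>; this follows from a tail bound
  combined with an occupation bound. All probabilistic work is done in the time scale of
  \<open>X\<close>, where independent increments give the Markov property at fixed times. The clock
  enters only as a change of variables on each path.\<close>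

lemma laplace_moments_zero:
 fixes F :: "real \<Rightarrow> real" and \<phi> :: "real \<Rightarrow> real"
 assumes int: "integrable lborel F"
  and supp: "\<And>t. t \<le> 0 \<Longrightarrow> F t = 0"
  and lap: "\<And>k::nat. (\<integral>t. exp (- real k * t) * F t \<partial>lborel) = 0"
  and cont: "continuous_on {0..1} \<phi>"
 shows "(\<integral>t. \<phi> (exp (- max 0 t)) * F t \<partial>lborel) = 0"
proof -
 \<comment> \<open>In the variable \<open>exp (- t)\<close> the hypothesis says that all moments of
   a signed measure on the unit interval vanish, so Weierstrass approximation applies. The cut-off
   \<open>max 0\<close> keeps the variable in \<open>{0..1}\<close> for every real \<open>t\<close>;
   it is harmless, as \<open>F\<close> vanishes for \<open>t \<le> 0\<close>.\<close>
 let ?e = "\<lambda>t::real. exp (- max 0 t)"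
 have e01: "?e t \<in> {0..1}" for t by auto
 have bint: "integrable lborel (\<lambda>t. g (?e t) * F t)" if "continuous_on {0..1} g" for g :: "real \<Rightarrow> real"
 proof -
  have "compact (g ` {0..1})" using that by (intro compact_continuous_image) auto
  then obtain B where B: "\<And>x. x \<in> {0..1} \<Longrightarrow> \<bar>g x\<bar> \<le> B"
   using compact_imp_bounded[of "g ` {0..1}"] unfolding bounded_iff by fastforce
  have "continuous_on UNIV (\<lambda>t. g (?e t))"
   by (intro continuous_on_compose2[OF that] continuous_intros) (use e01 in blast)
  then have m: "(\<lambda>t. g (?e t)) \<in> borel_measurable lborel"
   by (simp add: borel_measurable_continuous_onI)
  show ?thesis
   by (rule Bochner_Integration.integrable_bound[of _ "\<lambda>t. B * F t"])
    (use int m B[OF e01] in \<open>auto intro!: AE_I2 mult_right_mono simp: abs_mult intro: order_trans[OF _ abs_ge_self]\<close>)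
 qed
 \<comment> \<open>Products of powers of \<open>u\<close> and \<open>1 - u\<close> are the building
   blocks of Bernstein polynomials. Splitting off one factor \<open>1 - u\<close> raises
   \<open>k\<close>, hence \<open>k\<close> is arbitrary in the induction.\<close>
 have mono0: "(\<integral>t. (?e t)^k * (1 - ?e t)^m * F t \<partial>lborel) = 0" for k m
 proof (induction m arbitrary: k)
  case 0
  have "(?e t)^k * (1 - ?e t)^0 * F t = exp (- real k * t) * F t" for t
   by (cases "t \<le> 0") (auto simp: supp exp_of_nat_mult[symmetric])
  then have "(\<integral>t. (?e t)^k * (1 - ?e t)^0 * F t \<partial>lborel) = (\<integral>t. exp (- real k * t) * F t \<partial>lborel)"
   by (intro Bochner_Integration.integral_cong) (simp_all only:)
  then show ?case using lap[of k] by (simp only:)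
 next
  case (Suc m)
  have i: "integrable lborel (\<lambda>t. (?e t)^k * (1 - ?e t)^m * F t)" for k m
   by (rule bint[of "\<lambda>x. x^k * (1-x)^m"]) (intro continuous_intros)
  have "(?e t)^k * (1 - ?e t)^Suc m * F t = (?e t)^k * (1 - ?e t)^m * F t - (?e t)^Suc k * (1 - ?e t)^m * F t" for t
   by (simp add: algebra_simps)
  then show ?case using Suc[of k] Suc[of "Suc k"] i[of k m] i[of "Suc k" m] by (simp del: power_Suc)
 qed
 have bern: "(\<integral>t. (\<Sum>k\<le>n. \<phi> (k/n) * Bernstein n k (?e t)) * F t \<partial>lborel) = 0" for n :: nat
 proof -
  have i: "integrable lborel (\<lambda>t. (?e t)^k * (1 - ?e t)^m * F t)" for k m
   by (rule bint[of "\<lambda>x. x^k * (1-x)^m"]) (intro continuous_intros)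
  have "(\<Sum>k\<le>n. \<phi> (k/n) * Bernstein n k (?e t)) * F t
   = (\<Sum>k\<le>n. (\<phi> (k/n) * real (n choose k)) * ((?e t)^k * (1 - ?e t)^(n-k) * F t))" for t
   by (simp add: Bernstein_def sum_distrib_left sum_distrib_right mult_ac)
  then show ?thesis by (simp add: i mono0)
 qed
 have absF: "integrable lborel (\<lambda>t. \<bar>F t\<bar>)" using int by simp
 have "\<bar>\<integral>t. \<phi> (?e t) * F t \<partial>lborel\<bar> \<le> d * (\<integral>t. \<bar>F t\<bar> \<partial>lborel)" if d: "d > 0" for d
 proof -
  obtain n where n: "\<And>x. x \<in> {0..1} \<Longrightarrow> \<bar>\<phi> x - (\<Sum>k\<le>n. \<phi>(k/n) * Bernstein n k x)\<bar> < d"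
   using Bernstein_Weierstrass[OF cont d] by blast
  let ?B = "\<lambda>x. (\<Sum>k\<le>n. \<phi> (k/n) * Bernstein n k x)"
  have cB: "continuous_on {0..1} ?B" by (simp add: Bernstein_def) (intro continuous_intros)
  have "(\<integral>t. \<phi> (?e t) * F t \<partial>lborel) = (\<integral>t. \<phi> (?e t) * F t - ?B (?e t) * F t \<partial>lborel)"
   using bint[OF cont] bint[OF cB] bern by (subst Bochner_Integration.integral_diff) auto
  also have "\<bar>\<dots>\<bar> \<le> (\<integral>t. d * \<bar>F t\<bar> \<partial>lborel)"
  proof (rule integral_abs_bound_integral)
   show "\<bar>\<phi> (?e t) * F t - ?B (?e t) * F t\<bar> \<le> d * \<bar>F t\<bar>" for t
    using n[OF e01[of t]] by (simp add: abs_mult mult_right_mono flip: left_diff_distrib)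
  qed (use bint[OF cont] bint[OF cB] absF in auto)
  finally show ?thesis by simp
 qed
 then have "\<bar>\<integral>t. \<phi> (?e t) * F t \<partial>lborel\<bar> \<le> 0"
 proof -
  assume *: "\<And>d. d > 0 \<Longrightarrow> \<bar>\<integral>t. \<phi> (?e t) * F t \<partial>lborel\<bar> \<le> d * (\<integral>t. \<bar>F t\<bar> \<partial>lborel)"
  have "((\<lambda>d. d * (\<integral>t. \<bar>F t\<bar> \<partial>lborel)) \<longlongrightarrow> 0 * (\<integral>t. \<bar>F t\<bar> \<partial>lborel)) (at_right 0)"
   by (intro tendsto_intros)
  then show ?thesis
   by (intro tendsto_lowerbound[of _ "0" "at_right (0::real)"])
    (use * in \<open>auto simp: eventually_at_right_less elim!: eventually_mono[OF eventually_at_right_less]\<close>)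
 qed
 then show ?thesis by simp
qed

text \<open>If \<open>F a\<close> were nonzero, right-continuity would fix the sign of
  \<open>F\<close> on some interval \<open>(a, b)\<close>, and a test function in
  \<open>exp (- t)\<close> living on that interval would have a nonzero integral. The conclusion is
  at the point \<open>a\<close> itself, not merely almost everywhere.\<close>

lemma laplace_uniqueness:
 fixes F :: "real \<Rightarrow> real"
 assumes int: "integrable lborel (\<lambda>t. indicator {0<..} t * F t)"
  and lap: "\<And>k::nat. (\<integral>t. indicator {0<..} t * (exp (- real k * t) * F t) \<partial>lborel) = 0"
  and rc: "continuous (at_right a) F" and a: "0 < a"
 shows "F a = 0"
proof (rule ccontr)
 assume nz: "F a \<noteq> 0"
 define s where "s = sgn (F a)"
 have sF: "s * F a > 0" using nz by (simp add: s_def sgn_mult_abs sgn_if)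
 have "((\<lambda>t. s * F t) \<longlongrightarrow> s * F a) (at_right a)"
  using rc unfolding continuous_within by (intro tendsto_intros)
 then have "\<forall>\<^sub>F t in at_right a. s * F t > s * F a / 2"
  by (rule order_tendstoD) (use sF in auto)
 then obtain b where b: "a < b" "\<And>t. a < t \<Longrightarrow> t < b \<Longrightarrow> s * F t > s * F a / 2"
  unfolding eventually_at_right[OF lt_ex[THEN someI_ex, of a, simplified]]
  by (metis eventually_at_right_field)
 \<comment> \<open>A parabola cut off at \<open>0\<close>: it is positive exactly for
   \<open>exp (- b) < x < exp (- a)\<close>, that is, at \<open>x = exp (- t)\<close> with
   \<open>a < t < b\<close>.\<close>
 define \<phi> where "\<phi> x = max 0 ((exp (-a) - x) * (x - exp (- b)))" for x :: real
 let ?G = "\<lambda>t. indicator {0<..} t * F t"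
 have z: "(\<integral>t. \<phi> (exp (- max 0 t)) * ?G t \<partial>lborel) = 0"
 proof (rule laplace_moments_zero[OF int])
  show "(\<integral>t. exp (- real k * t) * ?G t \<partial>lborel) = 0" for k :: nat
   using lap[of k] by (simp add: mult_ac)
  show "continuous_on {0..1} \<phi>" unfolding \<phi>_def by (intro continuous_intros)
 qed auto
 let ?H = "\<lambda>t. s * (\<phi> (exp (- max 0 t)) * ?G t)"
 have pos: "\<phi> (exp (- max 0 t)) > 0 \<longleftrightarrow> a < t \<and> t < b" if "t > 0" for t
  using that a b(1) by (auto simp: \<phi>_def less_max_iff_disj zero_less_mult_iff)
 have nn: "\<phi> x \<ge> 0" for x by (simp add: \<phi>_def)
 have H0: "?H t \<ge> 0" and Hp: "t \<in> {a<..<b} \<Longrightarrow> ?H t > 0" for t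
 proof -
  show Hp: "?H t > 0" if "t \<in> {a<..<b}"
  proof -
   have "\<phi> (exp (- max 0 t)) > 0" using pos[of t] that a by auto
   moreover have "s * F t > 0" using b(2)[of t] that sF by auto
   ultimately have "\<phi> (exp (- max 0 t)) * (s * F t) > 0" by (rule mult_pos_pos)
   then show ?thesis using that a by (simp add: mult_ac)
  qed
  show "?H t \<ge> 0"
  proof (cases "t > 0 \<and> t \<notin> {a<..<b}")
   case True
   then have "\<phi> (exp (- max 0 t)) = 0" using pos[of t] nn[of "exp (- max 0 t)"] by force
   then show ?thesis by simp
  next
   case False then show ?thesis using Hp by (cases "t > 0") (auto simp: less_imp_le)
  qed
 qed
 have "integrable lborel ?H"
 proof -
  have c: "continuous_on UNIV \<phi>" unfolding \<phi>_def by (intro continuous_intros)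
  have m: "(\<lambda>t. \<phi> (exp (- max 0 t))) \<in> borel_measurable lborel"
   by (auto intro!: borel_measurable_continuous_onI continuous_on_compose2[OF c] continuous_intros)
  have "\<phi> (exp (- max 0 t)) \<le> 1" for t
  proof -
   let ?x = "exp (- max 0 t)"
   have "(exp (-a) - ?x) * (?x - exp (- b)) \<le> 1"
   proof -
    have "\<bar>exp (-a) - ?x\<bar> \<le> 1" "\<bar>?x - exp (- b)\<bar> \<le> 1"
     using a b(1) exp_gt_zero[of "- max 0 t"] exp_gt_zero[of "- a"] exp_gt_zero[of "- b"]
     by (smt (verit) exp_gt_zero exp_le_one_iff max.cobounded1)+
    then have "\<bar>(exp (-a) - ?x) * (?x - exp (- b))\<bar> \<le> 1 * 1"
     unfolding abs_mult by (intro mult_mono) auto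
    then show ?thesis by linarith
   qed
   then show ?thesis by (simp add: \<phi>_def)
  qed
  then have "integrable lborel (\<lambda>t. \<phi> (exp (- max 0 t)) * ?G t)"
   by (intro Bochner_Integration.integrable_bound[OF int])
    (use int m nn in \<open>auto intro!: AE_I2 mult_left_le_one_le simp: abs_mult\<close>)
  then show ?thesis by simp
 qed
 moreover have "integral\<^sup>L lborel ?H = 0" using z by simp
 ultimately have "AE t in lborel. ?H t = 0"
  using integral_nonneg_eq_0_iff_AE[of lborel ?H] H0 by auto
 then have "AE t in lborel. t \<notin> {a<..<b}"
  by (rule AE_mp) (intro AE_I2, use Hp in force)
 then have "emeasure lborel {a<..<b} = 0"
  by (subst (asm) AE_iff_measurable[of "{a<..<b}"]) auto
 then show False using b(1) by simp
qed

text \<open>The image under \<open>A\<close> of the measure with density \<open>d\<close> on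
  \<open>[0, L)\<close> is Lebesgue measure on \<open>[0, A L)\<close>. This is checked on rays, so
  that no differentiability of \<open>A\<close> enters.\<close>

lemma nn_integral_time_change:
 fixes d :: "real \<Rightarrow> real" and A :: "real \<Rightarrow> real" and \<phi> :: "real \<Rightarrow> ennreal"
 assumes d: "d \<in> borel_measurable borel" "\<And>s. 0 \<le> d s"
  and A: "\<And>s. 0 \<le> s \<Longrightarrow> ennreal (A s) = (\<integral>\<^sup>+u\<in>{0..s}. d u \<partial>lborel)" "\<And>s. 0 \<le> s \<Longrightarrow> 0 \<le> A s"
  and mono: "strict_mono_on {0..} A" and cont: "continuous_on {0..} A" and A0: "A 0 = 0"
  and Am: "A \<in> borel_measurable borel"
  and \<phi>: "\<phi> \<in> borel_measurable borel" and L: "0 \<le> L"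
 shows "(\<integral>\<^sup>+s\<in>{0..<L}. \<phi> (A s) * d s \<partial>lborel) = (\<integral>\<^sup>+v\<in>{0..<A L}. \<phi> v \<partial>lborel)"
proof -
 let ?D = "density lborel (\<lambda>s. ennreal (d s) * indicator {0..<L} s)"
 have Am': "A \<in> borel_measurable ?D" using Am by simp
 have [measurable]: "d \<in> borel_measurable borel" "A \<in> borel_measurable borel" by fact+
 have Av: "A -` {v<..} \<in> sets borel" for v using measurable_sets[OF Am, of "{v<..}"] by simp
 have Al: "A s \<in> {0..<A L} \<longleftrightarrow> s < L" if "0 \<le> s" for s
  using that L A(2)[of s] strict_mono_on_less[OF mono, of s L] by auto
 have eq: "distr ?D borel A = density lborel (indicator {0..<A L})"
 proof (rule measure_eqI_lessThan)
  fix v :: real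
  have R: "emeasure (density lborel (indicator {0..<A L})) {v<..} = emeasure lborel ({v<..} \<inter> {0..<A L})"
   by (subst emeasure_density) (auto simp: Int_commute simp flip: indicator_inter_arith)
  have L1: "emeasure (distr ?D borel A) {v<..} = (\<integral>\<^sup>+s. ennreal (d s) * indicator {s. 0 \<le> s \<and> s < L \<and> v < A s} s \<partial>lborel)"
   by (subst emeasure_distr[OF Am'], simp, subst emeasure_density)
    (auto intro!: nn_integral_cong simp: indicator_def Av)
  have fin: "(\<integral>\<^sup>+s. ennreal (d s) * indicator {0..L} s \<partial>lborel) < \<infinity>"
   using A(1)[OF L] by (metis ennreal_less_top infinity_ennreal_def)
  show "emeasure (distr ?D borel A) {v<..} < \<infinity>"
   unfolding L1 by (rule le_less_trans[OF _ fin]) (auto intro!: nn_integral_mono simp: indicator_def)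
  show "emeasure (distr ?D borel A) {v<..} = emeasure (density lborel (indicator {0..<A L})) {v<..}"
  proof (cases "v < 0")
   case True
   then have "{s. 0 \<le> s \<and> s < L \<and> v < A s} = {0..<L}" using A(2) by force
   moreover have "(\<integral>\<^sup>+s. ennreal (d s) * indicator {0..<L} s \<partial>lborel) = (\<integral>\<^sup>+s. ennreal (d s) * indicator {0..L} s \<partial>lborel)"
    by (rule nn_integral_cong_AE, rule AE_mp[OF AE_lborel_singleton[of L]]) (auto simp: indicator_def)
   moreover have "{v<..} \<inter> {0..<A L} = {0..<A L}" using True by auto
   ultimately show ?thesis using A(1)[OF L] A(2)[OF L] by (simp add: R L1)
  next
   case False
   show ?thesis
   proof (cases "v < A L")
    case v: True
    \<comment> \<open>The intermediate value theorem turns the ray above \<open>v\<close> into the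
      time interval above \<open>s\<close>, whose mass under \<open>d\<close> is
      \<open>A L - A s\<close>.\<close>
    obtain s where s: "0 \<le> s" "s \<le> L" "A s = v"
     using IVT'[of A 0 v L] A0 False v L continuous_on_subset[OF cont, of "{0..L}"] by force
    have "{r. 0 \<le> r \<and> r < L \<and> v < A r} = {s<..<L}"
     using s strict_mono_on_less[OF mono, of s] by auto
    moreover have "(\<integral>\<^sup>+r. ennreal (d r) * indicator {0..L} r \<partial>lborel)
      = (\<integral>\<^sup>+r. ennreal (d r) * indicator {0..s} r \<partial>lborel) + (\<integral>\<^sup>+r. ennreal (d r) * indicator {s<..<L} r \<partial>lborel)"
    proof -
     have "(\<integral>\<^sup>+r. ennreal (d r) * indicator {0..L} r \<partial>lborel)
      = (\<integral>\<^sup>+r. ennreal (d r) * indicator {0..s} r + ennreal (d r) * indicator {s<..<L} r \<partial>lborel)"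
      by (rule nn_integral_cong_AE, rule AE_mp[OF AE_lborel_singleton[of L]], rule AE_mp[OF AE_lborel_singleton[of s]])
       (use s in \<open>auto simp: indicator_def\<close>)
     then show ?thesis by (simp add: nn_integral_add)
    qed
    ultimately have "ennreal (A L) = ennreal (A s) + emeasure (distr ?D borel A) {v<..}"
     using A(1)[OF L] A(1)[OF s(1)] by (simp add: L1)
    then have "emeasure (distr ?D borel A) {v<..} = ennreal (A L) - ennreal (A s)" by simp
    also have "\<dots> = ennreal (A L - v)" using s False by (simp add: ennreal_minus)
    also have "\<dots> = emeasure lborel {v<..<A L}" using v by simp
    also have "{v<..<A L} = {v<..} \<inter> {0..<A L}" using False by auto
    finally show ?thesis by (simp add: R)
   next
    case v: False
    have "{r. 0 \<le> r \<and> r < L \<and> v < A r} = {}" using Al v by fastforce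
    moreover have "{v<..} \<inter> {0..<A L} = {}" using v by auto
    ultimately show ?thesis by (simp add: R L1)
   qed
  qed
 qed auto
 have "(\<integral>\<^sup>+s\<in>{0..<L}. \<phi> (A s) * d s \<partial>lborel) = (\<integral>\<^sup>+s. \<phi> (A s) \<partial>?D)"
  using \<phi> by (subst nn_integral_density) (auto intro!: nn_integral_cong simp: mult_ac)
 also have "\<dots> = (\<integral>\<^sup>+v. \<phi> v \<partial>distr ?D borel A)"
  by (rule nn_integral_distr[OF Am' , symmetric]) (use \<phi> in simp)
 also have "\<dots> = (\<integral>\<^sup>+v\<in>{0..<A L}. \<phi> v \<partial>lborel)"
  unfolding eq using \<phi> by (subst nn_integral_density) (auto simp: mult_ac)
 finally show ?thesis .
qed

section \<open>Orthonormal expansions\<close>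

lemma square_integrable_mult:
 assumes "square_integrable_on N f" "square_integrable_on N g"
 shows "integrable N (\<lambda>x. f x * g x)"
proof (rule Bochner_Integration.integrable_bound[of _ "\<lambda>x. (f x)\<^sup>2 + (g x)\<^sup>2"])
 have "\<bar>a * b\<bar> \<le> a\<^sup>2 + b\<^sup>2" for a b :: real
 proof -
  have "2 * (\<bar>a\<bar> * \<bar>b\<bar>) \<le> \<bar>a\<bar>\<^sup>2 + \<bar>b\<bar>\<^sup>2" using sum_squares_bound[of "\<bar>a\<bar>" "\<bar>b\<bar>"] by (simp add: mult_ac)
  moreover have "0 \<le> \<bar>a\<bar> * \<bar>b\<bar>" by simp
  ultimately show ?thesis unfolding abs_mult power2_abs by linarith
 qed
 then show "AE x in N. norm (f x * g x) \<le> norm ((f x)\<^sup>2 + (g x)\<^sup>2)" by auto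
qed (use assms in \<open>auto simp: square_integrable_on_def\<close>)

lemma square_integrable_lincomb:
 assumes "square_integrable_on N f" "square_integrable_on N g"
 shows "square_integrable_on N (\<lambda>x. a * f x + b * g x)"
proof -
 have "(a * f x + b * g x)\<^sup>2 = a\<^sup>2 * (f x)\<^sup>2 + b\<^sup>2 * (g x)\<^sup>2 + (2*a*b) * (f x * g x)" for x
  by (simp add: power2_eq_square algebra_simps)
 then show ?thesis
  using assms square_integrable_mult[OF assms] by (auto simp: square_integrable_on_def)
qed

lemma square_integrable_diff:
 "square_integrable_on N f \<Longrightarrow> square_integrable_on N g \<Longrightarrow> square_integrable_on N (\<lambda>x. f x - g x)"
 using square_integrable_lincomb[of N f g 1 "-1"] by simp

lemma square_integrable_sum:
 assumes "\<And>n. n \<in> I \<Longrightarrow> square_integrable_on N (f n)"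
 shows "square_integrable_on N (\<lambda>x. \<Sum>n\<in>I. b n * f n x)"
 using assms
proof (induction I rule: infinite_finite_induct)
 case (insert i I)
 then show ?case using square_integrable_lincomb[of N "f i" "\<lambda>x. \<Sum>n\<in>I. b n * f n x" "b i" 1] by simp
qed (auto simp: square_integrable_on_def)

lemma square_integrable_on_imp_integrable:
 assumes "finite_measure N" "square_integrable_on N f"
 shows "integrable N f"
proof -
 have "square_integrable_on N (\<lambda>x. 1)"
  using assms by (auto simp: square_integrable_on_def finite_measure.integrable_const)
 from square_integrable_mult[OF assms(2) this] show ?thesis by simp
qed

lemma square_integrable_bounded:
 assumes "finite_measure N" "f \<in> borel_measurable N" "\<And>x. x \<in> space N \<Longrightarrow> \<bar>f x\<bar> \<le> B"
 shows "square_integrable_on N f"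
proof -
 have "(f x)\<^sup>2 \<le> B\<^sup>2" if "x \<in> space N" for x using assms(3)[OF that] by (metis abs_le_square_iff abs_of_nonneg order_trans abs_ge_zero)
 then have "integrable N (\<lambda>x. (f x)\<^sup>2)"
  by (intro finite_measure.integrable_const_bound[OF assms(1), of _ "B\<^sup>2"]) (use assms in \<open>auto intro: AE_I2\<close>)
 then show ?thesis using assms by (simp add: square_integrable_on_def)
qed

lemma integral_Cauchy_Schwarz:
 fixes f g :: "real \<Rightarrow> real"
 assumes f: "square_integrable_on N f" and g: "square_integrable_on N g"
 shows "\<bar>\<integral>x. f x * g x \<partial>N\<bar> \<le> sqrt (\<integral>x. (f x)\<^sup>2 \<partial>N) * sqrt (\<integral>x. (g x)\<^sup>2 \<partial>N)"
proof -
 let ?F = "\<integral>x. (f x)\<^sup>2 \<partial>N" and ?G = "\<integral>x. (g x)\<^sup>2 \<partial>N" and ?I = "\<integral>x. f x * g x \<partial>N"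
 note [simp] = square_integrable_mult[OF f g]
 have [simp]: "integrable N (\<lambda>x. (f x)\<^sup>2)" "integrable N (\<lambda>x. (g x)\<^sup>2)"
  using f g by (auto simp: square_integrable_on_def)
 \<comment> \<open>The square of \<open>t * f - g\<close> has a nonnegative integral for every
   \<open>t\<close>; the inequality is the discriminant condition, read off at suitable
   \<open>t\<close>.\<close>
 have q: "0 \<le> t\<^sup>2 * ?F + ?G - 2 * t * ?I" for t
 proof -
  have "(t * f x - g x)\<^sup>2 = t\<^sup>2 * (f x)\<^sup>2 + (g x)\<^sup>2 - (2 * t) * (f x * g x)" for x
   by (simp add: power2_eq_square algebra_simps)
  then have "(\<integral>x. (t * f x - g x)\<^sup>2 \<partial>N) = t\<^sup>2 * ?F + ?G - 2 * t * ?I" by simp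
  then show ?thesis by (metis (mono_tags, lifting) Bochner_Integration.integral_nonneg zero_le_power2)
 qed
 have "?I\<^sup>2 \<le> ?F * ?G"
 proof (cases "?F = 0")
  case True
  have "?I = 0"
  proof (rule ccontr)
   assume "?I \<noteq> 0"
   \<comment> \<open>With \<open>?F = 0\<close> the polynomial is affine in \<open>t\<close>, and
     this \<open>t\<close> gives it the value \<open>-1\<close>.\<close>
   then show False using q[of "(?G + 1) / (2 * ?I)"] True by (simp add: field_simps)
  qed
  then show ?thesis using True by simp
 next
  case False
  then have "?F > 0" by (simp add: less_le)
  then show ?thesis using q[of "?I / ?F"] by (simp add: field_simps power2_eq_square)
 qed
 then have "sqrt (?I\<^sup>2) \<le> sqrt (?F * ?G)" by (rule real_sqrt_le_mono)
 then show ?thesis by (simp add: real_sqrt_mult)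
qed

lemma integral_abs_le_sqrt:
 fixes f :: "real \<Rightarrow> real"
 assumes "prob_space N" and f: "square_integrable_on N f"
 shows "(\<integral>x. \<bar>f x\<bar> \<partial>N) \<le> sqrt (\<integral>x. (f x)\<^sup>2 \<partial>N)"
proof -
 interpret prob_space N by fact
 have s: "square_integrable_on N (\<lambda>x. \<bar>f x\<bar>)" using f by (auto simp: square_integrable_on_def)
 have o: "square_integrable_on N (\<lambda>x. 1)" by (simp add: square_integrable_on_def)
 show ?thesis using integral_Cauchy_Schwarz[OF s o] by (simp add: prob_space)
qed

lemma sqrt_quarter_power: "sqrt ((1/4)^k) = (1/2)^k"
 by (induction k) (auto simp: real_sqrt_mult real_sqrt_divide)

text \<open>Elements of L2 are represented by functions, so equality is almost everywhere.
  Completeness is triviality of the orthogonal complement; convergence of expansions is derived from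
  it below.\<close>

locale orthonormal_basis = prob_space N for N :: "real measure" +
 fixes \<psi> :: "nat \<Rightarrow> real \<Rightarrow> real"
 assumes sq: "\<And>n. square_integrable_on N (\<psi> n)"
  and orth: "\<And>m n. (\<integral>x. \<psi> m x * \<psi> n x \<partial>N) = (if m = n then 1 else 0)"
  and complete: "\<And>f. square_integrable_on N f \<Longrightarrow> (\<And>n. (\<integral>x. f x * \<psi> n x \<partial>N) = 0) \<Longrightarrow> AE x in N. f x = 0"
begin

definition coef :: "(real \<Rightarrow> real) \<Rightarrow> nat \<Rightarrow> real" where
 "coef f n = (\<integral>x. f x * \<psi> n x \<partial>N)"

definition psum :: "(nat \<Rightarrow> real) \<Rightarrow> nat \<Rightarrow> real \<Rightarrow> real" where
 "psum b k x = (\<Sum>n<k. b n * \<psi> n x)"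

lemma psum_sq: "square_integrable_on N (psum b k)"
 unfolding psum_def[abs_def] by (intro square_integrable_sum sq)


lemma integral_mult_psum:
 assumes "square_integrable_on N f"
 shows "(\<integral>x. f x * psum b k x \<partial>N) = (\<Sum>n<k. b n * coef f n)"
proof -
 have "(\<integral>x. f x * psum b k x \<partial>N) = (\<integral>x. (\<Sum>n<k. b n * (f x * \<psi> n x)) \<partial>N)"
  by (simp add: psum_def sum_distrib_left mult_ac)
 also have "\<dots> = (\<Sum>n<k. b n * coef f n)"
  by (subst Bochner_Integration.integral_sum)
   (auto simp: coef_def intro!: integrable_mult_right square_integrable_mult assms sq)
 finally show ?thesis .
qed

lemma coef_psum: "coef (psum b k) n = (if n < k then b n else 0)"
proof -
 have "coef (psum b k) n = (\<integral>x. \<psi> n x * psum b k x \<partial>N)" by (simp add: coef_def mult.commute)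
 also have "\<dots> = (\<Sum>m<k. b m * coef (\<psi> n) m)" by (rule integral_mult_psum[OF sq])
 also have "\<dots> = (\<Sum>m<k. if m = n then b m else 0)" by (intro sum.cong) (auto simp: coef_def orth)
 also have "\<dots> = (if n < k then b n else 0)" by simp
 finally show ?thesis .
qed

lemma integral_psum_square: "(\<integral>x. (psum b k x - psum b j x)\<^sup>2 \<partial>N) = (\<Sum>n\<in>{j..<k}. (b n)\<^sup>2)" if "j \<le> k"
proof -
 have i: "integrable N (\<lambda>x. psum b i x * psum b i' x)" for i i'
  by (intro square_integrable_mult psum_sq)
 have p: "(\<integral>x. psum b i x * psum b i' x \<partial>N) = (\<Sum>n<min i i'. (b n)\<^sup>2)" for i i'
 proof -
  have "(\<integral>x. psum b i x * psum b i' x \<partial>N) = (\<Sum>n<i'. b n * (if n < i then b n else 0))"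
   by (simp add: integral_mult_psum[OF psum_sq] coef_psum)
  also have "\<dots> = (\<Sum>n<min i i'. (b n)\<^sup>2)"
   by (intro sum.mono_neutral_cong_right) (auto simp: power2_eq_square)
  finally show ?thesis .
 qed
 have "(psum b k x - psum b j x)\<^sup>2 = psum b k x * psum b k x - 2 * (psum b k x * psum b j x) + psum b j x * psum b j x" for x
  by (simp add: power2_eq_square algebra_simps)
 then have "(\<integral>x. (psum b k x - psum b j x)\<^sup>2 \<partial>N) = (\<Sum>n<k. (b n)\<^sup>2) - (\<Sum>n<j. (b n)\<^sup>2)"
  using that by (simp add: i p)
 also have "\<dots> = (\<Sum>n\<in>{j..<k}. (b n)\<^sup>2)"
  using that sum.atLeastLessThan_concat[of 0 j k "\<lambda>n. (b n)\<^sup>2"] by (simp add: atLeast0LessThan)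
 finally show ?thesis .
qed

text \<open>The partial sum is the orthogonal projection of \<open>f\<close>, so squared norms
  subtract.\<close>

lemma integral_remainder_square:
 assumes f: "square_integrable_on N f"
 shows "(\<integral>x. (f x - psum (coef f) k x)\<^sup>2 \<partial>N) = (\<integral>x. (f x)\<^sup>2 \<partial>N) - (\<Sum>n<k. (coef f n)\<^sup>2)"
proof -
 have "(f x - psum (coef f) k x)\<^sup>2 = (f x)\<^sup>2 - 2 * (f x * psum (coef f) k x) + (psum (coef f) k x)\<^sup>2" for x
  by (simp add: power2_eq_square algebra_simps)
 moreover have "integrable N (\<lambda>x. (f x)\<^sup>2)" "integrable N (\<lambda>x. (psum (coef f) k x)\<^sup>2)"
  using f psum_sq by (auto simp: square_integrable_on_def)
 moreover have "(\<integral>x. (psum (coef f) k x)\<^sup>2 \<partial>N) = (\<Sum>n<k. (coef f n)\<^sup>2)"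
  using integral_psum_square[of 0 k "coef f"] by (simp add: psum_def atLeast0LessThan)
 ultimately show ?thesis
  using integral_mult_psum[OF f, of "coef f" k] square_integrable_mult[OF f psum_sq]
  by (simp add: power2_eq_square)
qed

lemma bessel:
 assumes f: "square_integrable_on N f"
 shows "(\<Sum>n<k. (coef f n)\<^sup>2) \<le> (\<integral>x. (f x)\<^sup>2 \<partial>N)" "summable (\<lambda>n. (coef f n)\<^sup>2)"
  "(\<Sum>n. (coef f n)\<^sup>2) \<le> (\<integral>x. (f x)\<^sup>2 \<partial>N)"
proof -
 show *: "(\<Sum>n<k. (coef f n)\<^sup>2) \<le> (\<integral>x. (f x)\<^sup>2 \<partial>N)" for k
 proof -
  have "0 \<le> (\<integral>x. (f x - psum (coef f) k x)\<^sup>2 \<partial>N)" by (rule Bochner_Integration.integral_nonneg) simp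
  then show ?thesis unfolding integral_remainder_square[OF f] by linarith
 qed
 show s: "summable (\<lambda>n. (coef f n)\<^sup>2)" by (rule summableI_nonneg_bounded[OF _ *]) simp
 show "(\<Sum>n. (coef f n)\<^sup>2) \<le> (\<integral>x. (f x)\<^sup>2 \<partial>N)" by (rule suminf_le_const[OF s *])
qed

text \<open>A subsequence of the partial sums with increments of norm at most \<open>2^-k\<close> converges almost
 everywhere (Riesz--Fischer); completeness identifies its limit with \<open>f\<close>.\<close>

lemma psum_subseq_limit:
 assumes f: "square_integrable_on N f"
 shows "\<exists>r. strict_mono (r :: nat \<Rightarrow> nat) \<and> (\<forall>j. (\<integral>x. (f x - psum (coef f) (r j) x)\<^sup>2 \<partial>N) \<le> (1/4)^j)"
proof -
 let ?b = "coef f"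
 note sm = bessel(2)[OF f]
 have tail: "\<exists>M. \<forall>j\<ge>M. \<forall>k\<ge>j. (\<Sum>n\<in>{j..<k}. (?b n)\<^sup>2) \<le> (1/4)^i" for i
 proof -
  obtain M where M: "\<forall>m\<ge>M. \<forall>n. norm (sum (\<lambda>n. (?b n)\<^sup>2) {m..<n}) < (1/4)^i"
   using sm[unfolded summable_Cauchy, rule_format, of "(1/4)^i"] by auto
  then have "(\<Sum>n\<in>{j..<k}. (?b n)\<^sup>2) \<le> (1/4)^i" if "j \<ge> M" for j k
   using M[rule_format, OF that, of k] by simp
  then show ?thesis by blast
 qed
 have "\<exists>M. \<forall>i. \<forall>j\<ge>M i. \<forall>k\<ge>j. (\<Sum>n\<in>{j..<k}. (?b n)\<^sup>2) \<le> (1/4)^i"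
  using tail by (intro choice allI)
 then obtain M where M: "\<And>i j k. M i \<le> j \<Longrightarrow> j \<le> k \<Longrightarrow> (\<Sum>n\<in>{j..<k}. (?b n)\<^sup>2) \<le> (1/4)^i" by blast
 \<comment> \<open>From \<open>M i\<close> on, blocks of squared coefficients sum to at most
   \<open>(1/4)^i\<close>. The recursion makes \<open>r\<close> strictly increasing and keeps
   \<open>r i\<close> above \<open>M i\<close>.\<close>
 define r where "r = rec_nat (M 0) (\<lambda>i m. Suc (max m (M (Suc i))))"
 have r0: "r 0 = M 0" and rS: "r (Suc i) = Suc (max (r i) (M (Suc i)))" for i by (simp_all add: r_def)
 have mono: "strict_mono r" by (simp add: strict_mono_Suc_iff rS less_Suc_eq_le)
 have rM: "M i \<le> r i" for i by (cases i) (auto simp: r0 rS le_Suc_eq)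
 let ?s = "\<lambda>k. psum ?b (r k)"
 have incr: "(\<integral>x. (?s k x - ?s j x)\<^sup>2 \<partial>N) \<le> (1/4)^j" if "j \<le> k" for j k
  using integral_psum_square[of "r j" "r k" ?b] M[OF rM, of j "r k"] that mono
  by (simp add: strict_mono_less_eq)
 have sd: "square_integrable_on N (\<lambda>x. ?s k x - ?s j x)" for j k
  by (intro square_integrable_diff psum_sq)
 \<comment> \<open>On a probability space the L1 norm is at most the L2 norm. The bounds are
   summable, so the increments are absolutely summable almost everywhere.\<close>
 have d1: "(\<integral>x. \<bar>?s (Suc k) x - ?s k x\<bar> \<partial>N) \<le> (1/2)^k" for k
 proof -
  have "(\<integral>x. \<bar>?s (Suc k) x - ?s k x\<bar> \<partial>N) \<le> sqrt (\<integral>x. (?s (Suc k) x - ?s k x)\<^sup>2 \<partial>N)"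
   by (rule integral_abs_le_sqrt[OF _ sd]) unfold_locales
  also have "\<dots> \<le> sqrt ((1/4)^k)" by (intro real_sqrt_le_mono incr) simp
  also have "\<dots> = (1/2)^k" by (rule sqrt_quarter_power)
  finally show ?thesis .
 qed
 have meas: "?s k \<in> borel_measurable N" for k using psum_sq by (auto simp: square_integrable_on_def)
 have "(\<integral>\<^sup>+x. (\<Sum>k. ennreal \<bar>?s (Suc k) x - ?s k x\<bar>) \<partial>N) = (\<Sum>k. \<integral>\<^sup>+x. ennreal \<bar>?s (Suc k) x - ?s k x\<bar> \<partial>N)"
  by (intro nn_integral_suminf) (use meas in measurable)
 also have "\<dots> = (\<Sum>k. ennreal (\<integral>x. \<bar>?s (Suc k) x - ?s k x\<bar> \<partial>N))"
  by (intro suminf_cong nn_integral_eq_integral integrable_abs square_integrable_on_imp_integrable[OF _ sd])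
   (auto, unfold_locales)
 also have "\<dots> \<le> (\<Sum>k. ennreal ((1/2)^k))"
  by (intro suminf_le ennreal_leI d1) auto
 also have "\<dots> < \<infinity>" by (subst suminf_ennreal2) (auto intro!: summable_geometric)
 finally have "AE x in N. (\<Sum>k. ennreal \<bar>?s (Suc k) x - ?s k x\<bar>) \<noteq> \<infinity>"
  by (intro nn_integral_PInf_AE borel_measurable_suminf) (use meas in auto)
 then have conv: "AE x in N. convergent (\<lambda>k. ?s k x)"
 proof (rule AE_mp, intro AE_I2 impI)
  fix x assume "(\<Sum>k. ennreal \<bar>?s (Suc k) x - ?s k x\<bar>) \<noteq> \<infinity>"
  then have "summable (\<lambda>k. \<bar>?s (Suc k) x - ?s k x\<bar>)"
   by (intro summable_suminf_not_top) auto
  then have "summable (\<lambda>k. ?s (Suc k) x - ?s k x)" by (rule summable_rabs_cancel)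
  then have "convergent (\<lambda>n. \<Sum>k<n. ?s (Suc k) x - ?s k x)" by (simp add: summable_iff_convergent)
  then have "convergent (\<lambda>n. ?s n x - ?s 0 x)" unfolding sum_lessThan_telescope[of "\<lambda>k. ?s k x"] .
  from convergent_add[OF this convergent_const[of "?s 0 x"]] show "convergent (\<lambda>k. ?s k x)" by simp
 qed
 define s where "s x = lim (\<lambda>k. ?s k x)" for x
 have s_meas[measurable]: "s \<in> borel_measurable N"
  unfolding s_def[abs_def] by (rule borel_measurable_lim_metric) (rule meas)
 have lims: "AE x in N. (\<lambda>k. ?s k x) \<longlonglongrightarrow> s x"
  using conv by (rule AE_mp) (auto simp: s_def convergent_LIMSEQ_iff)
 \<comment> \<open>Letting the upper index tend to infinity under the integral carries the bound for
   increments over to the distance from the limit.\<close>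
 have fatou: "(\<integral>\<^sup>+x. ennreal ((s x - ?s j x)\<^sup>2) \<partial>N) \<le> ennreal ((1/4)^j)" for j
 proof -
  have "(\<integral>\<^sup>+x. ennreal ((s x - ?s j x)\<^sup>2) \<partial>N) = (\<integral>\<^sup>+x. liminf (\<lambda>k. ennreal ((?s k x - ?s j x)\<^sup>2)) \<partial>N)"
  proof (rule nn_integral_cong_AE, rule AE_mp[OF lims], intro AE_I2 impI)
   fix x assume "(\<lambda>k. ?s k x) \<longlonglongrightarrow> s x"
   then have "(\<lambda>k. ennreal ((?s k x - ?s j x)\<^sup>2)) \<longlonglongrightarrow> ennreal ((s x - ?s j x)\<^sup>2)"
    by (intro tendsto_intros)
   then show "ennreal ((s x - ?s j x)\<^sup>2) = liminf (\<lambda>k. ennreal ((?s k x - ?s j x)\<^sup>2))"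
    by (rule lim_imp_Liminf[OF trivial_limit_sequentially, symmetric])
  qed
  also have "\<dots> \<le> liminf (\<lambda>k. \<integral>\<^sup>+x. ennreal ((?s k x - ?s j x)\<^sup>2) \<partial>N)"
   by (intro nn_integral_liminf) (use meas in measurable)
  also have "\<dots> \<le> ennreal ((1/4)^j)"
  proof (rule Liminf_le)
   show "\<forall>\<^sub>F k in sequentially. (\<integral>\<^sup>+x. ennreal ((?s k x - ?s j x)\<^sup>2) \<partial>N) \<le> ennreal ((1/4)^j)"
    using eventually_ge_at_top[of j]
   proof eventually_elim
    case (elim k)
    have "(\<integral>\<^sup>+x. ennreal ((?s k x - ?s j x)\<^sup>2) \<partial>N) = ennreal (\<integral>x. (?s k x - ?s j x)\<^sup>2 \<partial>N)"
     using sd by (intro nn_integral_eq_integral) (auto simp: square_integrable_on_def)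
    then show ?case using incr[OF elim] by (simp add: ennreal_leI)
   qed
  qed simp
  finally show ?thesis .
 qed
 have ssd: "square_integrable_on N (\<lambda>x. s x - ?s j x)" for j
 proof -
  have "integrable N (\<lambda>x. (s x - ?s j x)\<^sup>2)"
   by (rule integrableI_bounded) (use meas[of j] fatou[of j] in \<open>auto intro: le_less_trans\<close>)
  then show ?thesis using meas[of j] by (simp add: square_integrable_on_def)
 qed
 have s_sq: "square_integrable_on N s"
  using square_integrable_lincomb[OF ssd[of 0] psum_sq[of ?b "r 0"], of 1 1] by simp
 have sj: "(\<integral>x. (s x - ?s j x)\<^sup>2 \<partial>N) \<le> (1/4)^j" for j
 proof -
  have "ennreal (\<integral>x. (s x - ?s j x)\<^sup>2 \<partial>N) = (\<integral>\<^sup>+x. ennreal ((s x - ?s j x)\<^sup>2) \<partial>N)"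
   using ssd[of j] by (intro nn_integral_eq_integral[symmetric]) (auto simp: square_integrable_on_def)
  also have "\<dots> \<le> ennreal ((1/4)^j)" by (rule fatou)
  finally show ?thesis by (subst (asm) ennreal_le_iff) auto
 qed
 \<comment> \<open>The \<open>n\<close>-th coefficient of a partial sum is constant once
   \<open>n < r j\<close>, and coefficients are continuous in the L2 norm. So \<open>s\<close> has
   the coefficients of \<open>f\<close>, and completeness gives \<open>f = s\<close> almost
   everywhere.\<close>
 have cs: "coef s n = ?b n" for n
 proof -
  have "(\<lambda>j. \<integral>x. (s x - ?s j x) * \<psi> n x \<partial>N) \<longlonglongrightarrow> 0"
  proof (rule Lim_null_comparison[OF always_eventually])
   show "\<forall>j. norm (\<integral>x. (s x - ?s j x) * \<psi> n x \<partial>N) \<le> (1/2)^j"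
   proof
    fix j
    have "\<bar>\<integral>x. (s x - ?s j x) * \<psi> n x \<partial>N\<bar> \<le> sqrt (\<integral>x. (s x - ?s j x)\<^sup>2 \<partial>N) * sqrt (\<integral>x. (\<psi> n x)\<^sup>2 \<partial>N)"
     by (rule integral_Cauchy_Schwarz[OF ssd sq])
    also have "(\<integral>x. (\<psi> n x)\<^sup>2 \<partial>N) = 1" using orth[of n n] by (simp add: power2_eq_square)
    also have "sqrt (\<integral>x. (s x - ?s j x)\<^sup>2 \<partial>N) \<le> sqrt ((1/4)^j)" by (intro real_sqrt_le_mono sj)
    also have "\<dots> = (1/2)^j" by (rule sqrt_quarter_power)
    finally show "norm (\<integral>x. (s x - ?s j x) * \<psi> n x \<partial>N) \<le> (1/2)^j" by simp
   qed
   show "(\<lambda>j. (1/2)^j :: real) \<longlonglongrightarrow> 0" by (simp add: LIMSEQ_realpow_zero)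
  qed
  moreover have "(\<integral>x. (s x - ?s j x) * \<psi> n x \<partial>N) = coef s n - coef (?s j) n" for j
   using square_integrable_mult[OF s_sq sq] square_integrable_mult[OF psum_sq sq]
   by (simp add: coef_def left_diff_distrib)
  moreover have "\<forall>\<^sub>F j in sequentially. coef s n - coef (?s j) n = coef s n - ?b n"
   using eventually_gt_at_top[of n]
  proof eventually_elim
   case (elim j)
   then have "n < r j" using strict_mono_imp_increasing[OF mono, of j] by linarith
   then show ?case by (simp add: coef_psum)
  qed
  ultimately have "(\<lambda>j::nat. coef s n - ?b n) \<longlonglongrightarrow> 0"
   by (auto elim: Lim_transform_eventually)
  then show ?thesis by (simp add: LIMSEQ_const_iff)
 qed
 have "AE x in N. f x - s x = 0"
 proof (rule complete)
  show "square_integrable_on N (\<lambda>x. f x - s x)" by (intro square_integrable_diff f s_sq)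
  show "(\<integral>x. (f x - s x) * \<psi> n x \<partial>N) = 0" for n
   using square_integrable_mult[OF s_sq sq] square_integrable_mult[OF f sq] cs[of n]
   by (simp add: coef_def left_diff_distrib)
 qed
 then have fs: "AE x in N. f x = s x" by simp
 have "(\<integral>x. (f x - ?s j x)\<^sup>2 \<partial>N) \<le> (1/4)^j" for j
 proof -
  have fm: "f \<in> borel_measurable N" using f by (simp add: square_integrable_on_def)
  have "(\<integral>x. (f x - ?s j x)\<^sup>2 \<partial>N) = (\<integral>x. (s x - ?s j x)\<^sup>2 \<partial>N)"
  proof (rule integral_cong_AE)
   show "AE x in N. (f x - ?s j x)\<^sup>2 = (s x - ?s j x)\<^sup>2" using fs by eventually_elim simp
  qed (use meas[of j] fm in auto)
  then show ?thesis using sj[of j] by simp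
 qed
 then show ?thesis using mono by (intro exI[of _ r]) simp
qed

text \<open>The Bessel remainder tends to \<open>0\<close> along the subsequence, which suffices
  because the partial sums of squares increase.\<close>

lemma parseval_remainder:
 assumes f: "square_integrable_on N f"
 shows "(\<integral>x. (f x)\<^sup>2 \<partial>N) = (\<Sum>n. (coef f n)\<^sup>2)"
proof (rule antisym)
 obtain r where r: "strict_mono (r :: nat \<Rightarrow> nat)"
  "\<And>j. (\<integral>x. (f x - psum (coef f) (r j) x)\<^sup>2 \<partial>N) \<le> (1/4)^j"
  using psum_subseq_limit[OF f] by blast
 have "(\<integral>x. (f x)\<^sup>2 \<partial>N) \<le> (\<Sum>n. (coef f n)\<^sup>2) + (1/4)^j" for j
 proof -
  have "(\<Sum>n<r j. (coef f n)\<^sup>2) \<le> (\<Sum>n. (coef f n)\<^sup>2)"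
   by (intro sum_le_suminf bessel(2)[OF f]) auto
  then show ?thesis using r(2)[of j] integral_remainder_square[OF f, of "r j"] by linarith
 qed
 moreover have "(\<lambda>j. (\<Sum>n. (coef f n)\<^sup>2) + (1/4)^j) \<longlonglongrightarrow> (\<Sum>n. (coef f n)\<^sup>2) + 0"
  by (intro tendsto_intros LIMSEQ_realpow_zero) auto
 ultimately show "(\<integral>x. (f x)\<^sup>2 \<partial>N) \<le> (\<Sum>n. (coef f n)\<^sup>2)"
  by (intro LIMSEQ_le_const[of _ "(\<Sum>n. (coef f n)\<^sup>2)"]) auto
qed (rule bessel(3)[OF f])

lemma coef_mult_summable:
 assumes f: "square_integrable_on N f" and g: "square_integrable_on N g"
 shows "summable (\<lambda>n. \<bar>coef f n * coef g n\<bar>)"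
proof (rule summable_comparison_test'[of "\<lambda>n. (coef f n)\<^sup>2 + (coef g n)\<^sup>2" 0])
 show "summable (\<lambda>n. (coef f n)\<^sup>2 + (coef g n)\<^sup>2)" by (intro summable_add bessel f g)
 fix n :: nat
 have "2 * (\<bar>coef f n\<bar> * \<bar>coef g n\<bar>) \<le> \<bar>coef f n\<bar>\<^sup>2 + \<bar>coef g n\<bar>\<^sup>2"
  using sum_squares_bound[of "\<bar>coef f n\<bar>" "\<bar>coef g n\<bar>"] by (simp add: mult_ac)
 moreover have "0 \<le> \<bar>coef f n\<bar> * \<bar>coef g n\<bar>" by simp
 ultimately show "norm \<bar>coef f n * coef g n\<bar> \<le> (coef f n)\<^sup>2 + (coef g n)\<^sup>2"
  unfolding abs_mult power2_abs real_norm_def abs_abs by linarith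
qed

text \<open>Polarisation: the norm identity for \<open>f + g\<close> minus those for
  \<open>f\<close> and \<open>g\<close>. The factors \<open>1 *\<close> in the proof match the form
  of \<open>square_integrable_lincomb\<close>.\<close>

lemma parseval:
 assumes f: "square_integrable_on N f" and g: "square_integrable_on N g"
 shows "(\<lambda>n. coef f n * coef g n) sums (\<integral>x. f x * g x \<partial>N)"
proof -
 have i: "integrable N (\<lambda>x. f x * g x)" by (rule square_integrable_mult[OF f g])
 have ii: "integrable N (\<lambda>x. (f x)\<^sup>2)" "integrable N (\<lambda>x. (g x)\<^sup>2)" using f g by (auto simp: square_integrable_on_def)
 have fg: "square_integrable_on N (\<lambda>x. 1 * f x + 1 * g x)" by (rule square_integrable_lincomb[OF f g])
 have c: "coef (\<lambda>x. 1 * f x + 1 * g x) n = coef f n + coef g n" for n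
  using square_integrable_mult[OF f sq] square_integrable_mult[OF g sq]
  by (simp add: coef_def distrib_right)
 have s: "summable (\<lambda>n. coef f n * coef g n)" using coef_mult_summable[OF f g] by (rule summable_rabs_cancel)
 have "(\<integral>x. (1 * f x + 1 * g x)\<^sup>2 \<partial>N) = (\<Sum>n. (coef f n + coef g n)\<^sup>2)"
  using parseval_remainder[OF fg] unfolding c .
 also have "(\<lambda>n. (coef f n + coef g n)\<^sup>2) = (\<lambda>n. (coef f n)\<^sup>2 + (coef g n)\<^sup>2 + 2 * (coef f n * coef g n))"
  by (simp add: power2_eq_square algebra_simps)
 also have "(\<Sum>n. (coef f n)\<^sup>2 + (coef g n)\<^sup>2 + 2 * (coef f n * coef g n)) =
   (\<Sum>n. (coef f n)\<^sup>2) + (\<Sum>n. (coef g n)\<^sup>2) + 2 * (\<Sum>n. coef f n * coef g n)"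
  by (rule sums_unique[symmetric]) (intro sums_add sums_mult summable_sums bessel f g s)
 also have "(\<integral>x. (1 * f x + 1 * g x)\<^sup>2 \<partial>N) = (\<integral>x. (f x)\<^sup>2 \<partial>N) + (\<integral>x. (g x)\<^sup>2 \<partial>N) + 2 * (\<integral>x. f x * g x \<partial>N)"
 proof -
  have "(\<integral>x. (1 * f x + 1 * g x)\<^sup>2 \<partial>N) = (\<integral>x. (f x)\<^sup>2 + (g x)\<^sup>2 + 2 * (f x * g x) \<partial>N)"
   by (intro Bochner_Integration.integral_cong) (auto simp: power2_eq_square algebra_simps)
  then show ?thesis using i ii by simp
 qed
 finally have "(\<integral>x. f x * g x \<partial>N) = (\<Sum>n. coef f n * coef g n)"
  using parseval_remainder[OF f] parseval_remainder[OF g] by simp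
 then show ?thesis using s by (simp add: summable_sums)
qed

text \<open>Cauchy--Schwarz for finite sums combined with Bessel. Applied to \<open>g x\<close> and
  \<open>f\<close>, it controls spectral series uniformly over all \<open>f\<close> of bounded
  norm.\<close>

lemma coef_mult_sum_le:
 assumes f: "square_integrable_on N f" and g: "square_integrable_on N g"
 shows "(\<Sum>n. \<bar>coef f n * coef g n\<bar>) \<le> sqrt (\<integral>x. (f x)\<^sup>2 \<partial>N) * sqrt (\<integral>x. (g x)\<^sup>2 \<partial>N)"
proof (rule suminf_le_const[OF coef_mult_summable[OF f g]])
 fix k
 have "(\<Sum>n<k. \<bar>coef f n * coef g n\<bar>) \<le> L2_set (coef f) {..<k} * L2_set (coef g) {..<k}"
  unfolding abs_mult by (rule L2_set_mult_ineq)
 also have "\<dots> \<le> sqrt (\<integral>x. (f x)\<^sup>2 \<partial>N) * sqrt (\<integral>x. (g x)\<^sup>2 \<partial>N)"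
  unfolding L2_set_def by (intro mult_mono real_sqrt_le_mono bessel f g) (auto intro: sum_nonneg)
 finally show "(\<Sum>n<k. \<bar>coef f n * coef g n\<bar>) \<le> sqrt (\<integral>x. (f x)\<^sup>2 \<partial>N) * sqrt (\<integral>x. (g x)\<^sup>2 \<partial>N)" .
qed

end

section \<open>Fourier inversion\<close>

lemma integral_cos_Icc:
 assumes "a \<le> b" "t \<noteq> (0::real)"
 shows "(\<integral>y. cos (t * y) * indicator {a..b} y \<partial>lborel) = (sin (t * b) - sin (t * a)) / t"
proof -
 have "(\<integral>y. cos (t * y) * indicator {a..b} y \<partial>lborel) = sin (t * b) / t - sin (t * a) / t"
  by (rule integral_FTC_Icc_real) (use assms in \<open>auto intro!: derivative_eq_intros\<close>)
 then show ?thesis by (simp add: diff_divide_distrib)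
qed

lemma integrable_const_Icc: "integrable lborel (\<lambda>y. c * indicator {a..b::real} y :: real)"
 by (intro integrable_mult_right integrable_real_indicator) (auto simp: emeasure_lborel_Icc_eq)

context real_distribution
begin

text \<open>\<open>q\<close> is the candidate density. A real characteristic function is even, so
  only the cosine part of the inversion integral survives.\<close>

context
 fixes \<phi> :: "real \<Rightarrow> real" and q :: "real \<Rightarrow> real"
 assumes \<phi>: "\<And>t. char M t = complex_of_real (\<phi> t)" "integrable lborel \<phi>"
  and q: "\<And>y. q y = (1 / (2 * pi)) * (\<integral>t. cos (t * y) * \<phi> t \<partial>lborel)"
begin

lemma inversion_continuous: "continuous_on UNIV q"
 unfolding continuous_on_eq_continuous_at[OF open_UNIV]
proof (safe, unfold continuous_at_sequentially, safe)
 fix x :: real and X assume X: "X \<longlonglongrightarrow> x"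
 have "(\<lambda>n. \<integral>t. cos (t * X n) * \<phi> t \<partial>lborel) \<longlonglongrightarrow> (\<integral>t. cos (t * x) * \<phi> t \<partial>lborel)"
 proof (rule integral_dominated_convergence[where w="\<lambda>t. \<bar>\<phi> t\<bar>"])
  have "\<phi> \<in> borel_measurable lborel" using \<phi>(2) by auto
  then show "(\<lambda>t. cos (t * x) * \<phi> t) \<in> borel_measurable lborel" "\<And>n. (\<lambda>t. cos (t * X n) * \<phi> t) \<in> borel_measurable lborel"
   by measurable
  show "AE t in lborel. (\<lambda>n. cos (t * X n) * \<phi> t) \<longlonglongrightarrow> cos (t * x) * \<phi> t"
   by (intro AE_I2 tendsto_intros X)
 qed (use \<phi>(2) in \<open>auto simp: abs_mult intro!: mult_left_le_one_le\<close>)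
 then show "(q \<circ> X) \<longlonglongrightarrow> q x" unfolding comp_def q by (intro tendsto_intros)
qed

text \<open>Levy's inversion formula is a limit of truncated integrals whose integrand is bounded by
  \<open>(b - a) * \<bar>\<phi> t\<bar>\<close>. Integrability of \<open>\<phi>\<close> removes the
  truncation, and Fubini moves the integral over \<open>[a, b]\<close> outside.\<close>

lemma inversion_interval_nonatoms:
 assumes ab: "a \<le> b" "measure M {a} = 0" "measure M {b} = 0"
 shows "measure M {a<..b} = (\<integral>y. q y * indicator {a..b} y \<partial>lborel)"
proof -
 have [measurable]: "\<phi> \<in> borel_measurable borel" using \<phi>(2) by auto
 let ?h = "\<lambda>t. (iexp (-(t * a)) - iexp (-(t * b))) / (\<i> * t) * char M t"
 \<comment> \<open>For nonzero \<open>t\<close> this is the integral of \<open>cos (t * y)\<close>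
   over \<open>[a, b]\<close>. At \<open>t = 0\<close> both \<open>s\<close> and \<open>?h\<close>
   are \<open>0\<close> by the convention for division, which is harmless at a single point.\<close>
 define s where "s t = (sin (t * b) - sin (t * a)) / t" for t
 have Re_h: "Re (?h t) = s t * \<phi> t" for t
 proof (cases "t = 0")
  case False
  have "iexp (-(t * a)) - iexp (-(t * b)) = (\<i> * t) * Complex (s t) ((cos (t * b) - cos (t * a)) / t)"
   using False by (simp add: complex_eq_iff s_def Re_exp Im_exp)
  then have "?h t = Complex (s t) ((cos (t * b) - cos (t * a)) / t) * complex_of_real (\<phi> t)"
   using False by (simp add: \<phi>(1))
  then show ?thesis by simp
 qed (simp add: s_def)
 have bnd: "norm (?h t) \<le> (b - a) * \<bar>\<phi> t\<bar>" for t
 proof (cases "t = 0")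
  case False
  have "cmod ((iexp (t * (-a)) - iexp (t * (-b))) / (\<i> * t)) \<le> -a - (-b)"
   by (rule Levy_Inversion_aux2) (use ab False in auto)
  then show ?thesis unfolding norm_mult by (intro mult_mono) (auto simp: \<phi>(1) ab)
 qed (use ab in simp)
 have hm: "?h \<in> borel_measurable borel" by measurable
 have int: "integrable lborel (\<lambda>t. indicator {-T<..<T} t *\<^sub>R ?h t)" for T :: real
 proof (rule Bochner_Integration.integrable_bound[where f="\<lambda>t. (b - a) * \<bar>\<phi> t\<bar>"])
  show "AE x in lborel. norm (indicator {- T<..<T} x *\<^sub>R ?h x) \<le> norm ((b - a) * \<bar>\<phi> x\<bar>)"
   using bnd ab by (auto simp: indicator_def simp del: norm_mult)
 qed (use \<phi>(2) hm in auto)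
 have "(\<lambda>T. Re (1 / (2 * pi) * (CLBINT t=-real T..real T. ?h t))) \<longlonglongrightarrow> Re (measure M {a<..b})"
  using tendsto_Re[OF Levy_Inversion[OF ab]] by (simp only: of_int_minus of_int_of_nat_eq)
 also have "(\<lambda>T. Re (1 / (2 * pi) * (CLBINT t=-real T..real T. ?h t))) = (\<lambda>T. 1 / (2 * pi) * (\<integral>t. indicator {-real T<..<real T} t * (s t * \<phi> t) \<partial>lborel))"
 proof
  fix T :: nat
  have "(CLBINT t=-real T..real T. ?h t) = (\<integral>t. indicator {-real T<..<real T} t *\<^sub>R ?h t \<partial>lborel)"
   by (simp add: interval_lebesgue_integral_def set_lebesgue_integral_def)
  moreover have "Re (\<integral>t. indicator {-real T<..<real T} t *\<^sub>R ?h t \<partial>lborel) = (\<integral>t. Re (indicator {-real T<..<real T} t *\<^sub>R ?h t) \<partial>lborel)"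
   by (rule integral_Re[OF int, symmetric])
  moreover have "Re (indicator {-real T<..<real T} t *\<^sub>R ?h t) = indicator {-real T<..<real T} t * (s t * \<phi> t)" for t
   unfolding scaleR_complex.sel Re_h by simp
  ultimately have "Re (CLBINT t=-real T..real T. ?h t) = (\<integral>t. indicator {-real T<..<real T} t * (s t * \<phi> t) \<partial>lborel)"
   by (simp only:)
  then show "Re (1 / (2 * pi) * (CLBINT t=-real T..real T. ?h t)) = 1 / (2 * pi) * (\<integral>t. indicator {-real T<..<real T} t * (s t * \<phi> t) \<partial>lborel)"
   by (simp only: times_complex.sel Re_complex_of_real Im_complex_of_real)
 qed
 finally have 1: "(\<lambda>T::nat. 1 / (2 * pi) * (\<integral>t. indicator {-real T<..<real T} t * (s t * \<phi> t) \<partial>lborel)) \<longlonglongrightarrow> measure M {a<..b}"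
  by simp
 have sm: "s \<in> borel_measurable borel" unfolding s_def[abs_def] by measurable
 have sb: "\<bar>s t * \<phi> t\<bar> \<le> (b - a) * \<bar>\<phi> t\<bar>" for t
  using bnd[of t] abs_Re_le_cmod[of "?h t"] unfolding Re_h by linarith
 have 2: "(\<lambda>T::nat. 1 / (2 * pi) * (\<integral>t. indicator {-real T<..<real T} t * (s t * \<phi> t) \<partial>lborel)) \<longlonglongrightarrow> 1 / (2 * pi) * (\<integral>t. s t * \<phi> t \<partial>lborel)"
 proof (intro tendsto_intros integral_dominated_convergence[where w="\<lambda>t. (b - a) * \<bar>\<phi> t\<bar>"])
  show "AE t in lborel. (\<lambda>T::nat. indicator {-real T<..<real T} t * (s t * \<phi> t)) \<longlonglongrightarrow> s t * \<phi> t"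
  proof (intro AE_I2)
   fix t :: real
   obtain n :: nat where n: "\<bar>t\<bar> < real n" using reals_Archimedean2 by blast
   have "\<forall>\<^sub>F T::nat in sequentially. indicator {-real T<..<real T} t * (s t * \<phi> t) = s t * \<phi> t"
    using eventually_ge_at_top[of n] by eventually_elim (use n in \<open>auto simp: indicator_def\<close>)
   then show "(\<lambda>T::nat. indicator {-real T<..<real T} t * (s t * \<phi> t)) \<longlonglongrightarrow> s t * \<phi> t"
    by (rule tendsto_eventually)
  qed
  show "AE t in lborel. norm (indicator {-real T<..<real T} t * (s t * \<phi> t)) \<le> (b - a) * \<bar>\<phi> t\<bar>" for T
   using sb order_trans[OF abs_ge_zero sb] by (auto simp: indicator_def)
 qed (use sm \<phi>(2) in auto)
 have 3: "(\<integral>t. s t * \<phi> t \<partial>lborel) = (\<integral>t. (\<integral>y. (cos (t * y) * indicator {a..b} y) * \<phi> t \<partial>lborel) \<partial>lborel)"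
 proof (rule integral_cong_AE)
  show "AE t in lborel. s t * \<phi> t = (\<integral>y. (cos (t * y) * indicator {a..b} y) * \<phi> t \<partial>lborel)"
   by (rule AE_mp[OF AE_lborel_singleton[of 0]]) (simp add: integral_cos_Icc ab s_def)
  show "(\<lambda>t. \<integral>y. (cos (t * y) * indicator {a..b} y) * \<phi> t \<partial>lborel) \<in> borel_measurable lborel"
   by measurable
 qed (use sm in auto)
 have 4: "\<dots> = (\<integral>y. (\<integral>t. (cos (t * y) * indicator {a..b} y) * \<phi> t \<partial>lborel) \<partial>lborel)"
 proof (rule lborel_pair.Fubini_integral[symmetric])
  show "integrable (lborel \<Otimes>\<^sub>M lborel) (\<lambda>(t, y). (cos (t * y) * indicator {a..b} y) * \<phi> t)"
  proof (rule Bochner_Integration.integrable_bound[where f="\<lambda>(t, y). \<phi> t * indicator {a..b} y"])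
   show "integrable (lborel \<Otimes>\<^sub>M lborel) (\<lambda>(t, y). \<phi> t * (indicator {a..b} y :: real))"
   proof (rule lborel_pair.Fubini_integrable)
    show "integrable lborel (\<lambda>t. \<integral>y. norm (case (t, y) of (t, y) \<Rightarrow> \<phi> t * (indicator {a..b} y :: real)) \<partial>lborel)"
     using \<phi>(2) by (simp add: abs_mult ab)
    show "AE t in lborel. integrable lborel (\<lambda>y. case (t, y) of (t, y) \<Rightarrow> \<phi> t * (indicator {a..b} y :: real))"
     using integrable_const_Icc by (intro AE_I2) (simp only: prod.case)
   qed measurable
   show "AE x in lborel \<Otimes>\<^sub>M lborel. norm (case x of (t, y) \<Rightarrow> (cos (t * y) * indicator {a..b} y) * \<phi> t) \<le> norm (case x of (t, y) \<Rightarrow> \<phi> t * (indicator {a..b} y :: real))"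
    by (auto simp: abs_mult indicator_def intro!: AE_I2 mult_left_le_one_le)
  qed measurable
 qed
 have "1 / (2 * pi) * (\<integral>t. s t * \<phi> t \<partial>lborel) = (\<integral>y. q y * indicator {a..b} y \<partial>lborel)"
  unfolding 3 4
  by (subst integral_mult_right_zero[symmetric], intro Bochner_Integration.integral_cong refl)
   (auto simp: q indicator_def)
 with LIMSEQ_unique[OF 1 2] show ?thesis by simp
qed

lemma inversion_bounded: "\<bar>q y\<bar> \<le> (1 / (2 * pi)) * (\<integral>t. \<bar>\<phi> t\<bar> \<partial>lborel)"
proof -
 have "\<bar>\<integral>t. cos (t * y) * \<phi> t \<partial>lborel\<bar> \<le> (\<integral>t. \<bar>\<phi> t\<bar> \<partial>lborel)"
 proof (rule integral_abs_bound_integral)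
  show "integrable lborel (\<lambda>t. cos (t * y) * \<phi> t)"
   by (rule Bochner_Integration.integrable_bound[OF \<phi>(2)])
    (use \<phi>(2) in \<open>auto simp: abs_mult intro!: mult_left_le_one_le\<close>)
 qed (use \<phi>(2) in \<open>auto simp: abs_mult intro!: mult_left_le_one_le\<close>)
 then show ?thesis by (simp add: q abs_mult divide_right_mono)
qed

lemma q_measurable: "q \<in> borel_measurable borel"
 by (rule borel_measurable_continuous_onI[OF inversion_continuous])

lemma q_integrable_Icc: "integrable lborel (\<lambda>y. q y * indicator {a..b} y)"
 supply [measurable] = q_measurable
proof (rule Bochner_Integration.integrable_bound)
 show "integrable lborel (\<lambda>y. (1 / (2 * pi)) * (\<integral>t. \<bar>\<phi> t\<bar> \<partial>lborel) * indicator {a..b} y)" by (rule integrable_const_Icc)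
 show "AE x in lborel. norm (q x * indicator {a..b} x) \<le> norm ((1 / (2 * pi)) * (\<integral>t. \<bar>\<phi> t\<bar> \<partial>lborel) * indicator {a..b} x)"
  using inversion_bounded by (intro AE_I2) (auto simp: indicator_def intro: order_trans[OF _ abs_ge_self])
qed simp

lemma nonatom_between: "x < y \<Longrightarrow> \<exists>z. x < z \<and> z < y \<and> measure M {z} = 0" for x y :: real
 using open_minus_countable[OF countable_support, of "{x<..<y}"] by auto

lemma q_bound: obtains C where "C \<ge> 0" "\<And>y. \<bar>q y\<bar> \<le> C"
 using inversion_bounded order_trans[OF abs_ge_zero inversion_bounded] by blast

text \<open>The interval formula holds for nonatomic endpoints, which are dense. Squeezing such
  endpoints around \<open>z\<close> bounds the mass of \<open>z\<close> by the length of the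
  interval times the bound on \<open>q\<close>.\<close>

lemma no_atoms: "measure M {z} = 0"
proof (rule ccontr)
 obtain C where C: "C \<ge> 0" "\<And>y. \<bar>q y\<bar> \<le> C" by (rule q_bound) blast
 assume "measure M {z} \<noteq> 0"
 then have pos: "measure M {z} > 0" by (simp add: less_le)
 \<comment> \<open>The interval is shorter than \<open>2 * e\<close>, and the factor
   \<open>4\<close> makes \<open>(C + 1) * (2 * e)\<close> half of the supposed mass. The summand
   \<open>1\<close> avoids division by zero.\<close>
 define e where "e = measure M {z} / (4 * (C + 1))"
 have e: "e > 0" unfolding e_def using pos C(1) by (intro divide_pos_pos mult_pos_pos) auto
 have e2: "(C + 1) * (2 * e) = measure M {z} / 2" unfolding e_def using C(1) by (simp add: divide_simps)
 obtain a where a: "z - e < a" "a < z" "measure M {a} = 0" using nonatom_between[of "z - e" z] e by auto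
 obtain b where b: "z < b" "b < z + e" "measure M {b} = 0" using nonatom_between[of z "z + e"] e by auto
 have "measure M {z} \<le> measure M {a<..b}" using a b by (intro finite_measure_mono) auto
 also have "\<dots> = (\<integral>y. q y * indicator {a..b} y \<partial>lborel)" using a b by (intro inversion_interval_nonatoms) auto
 also have "\<dots> \<le> (\<integral>y. C * indicator {a..b} y \<partial>lborel)"
 proof (rule integral_mono[OF q_integrable_Icc])
  show "q x * indicator {a..b} x \<le> C * indicator {a..b} x" for x
   using C(2)[of x] by (auto simp: indicator_def)
 qed (rule integrable_const_Icc)
 also have "\<dots> = C * (b - a)" using a b by simp
 also have "\<dots> \<le> (C + 1) * (2 * e)" using a b C(1) by (intro mult_mono) auto
 finally show False unfolding e2 using pos by simp
qed

text \<open>Otherwise continuity makes \<open>q\<close> negative on a whole interval, whose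
  probability would then be negative.\<close>

lemma inversion_nonneg: "0 \<le> q y"
proof (rule ccontr)
 assume neg: "\<not> 0 \<le> q y"
 have "isCont q y" using inversion_continuous by (simp add: continuous_on_eq_continuous_at)
 then have "\<forall>\<^sub>F x in nhds y. q x < q y / 2"
  using neg by (intro order_tendstoD(2)[of q "q y"]) (auto simp: isCont_def tendsto_at_iff_tendsto_nhds)
 then obtain d where d: "d > 0" "\<And>x. dist x y < d \<Longrightarrow> q x < q y / 2"
  unfolding eventually_nhds_metric by blast
 have qi: "q x \<le> q y / 2" if "x \<in> {y..y + d/2}" for x using d(1) that by (intro less_imp_le d(2)) (auto simp: dist_real_def)
 have "measure M {y<..y + d/2} = (\<integral>x. q x * indicator {y..y + d/2} x \<partial>lborel)"
  using d by (intro inversion_interval_nonatoms no_atoms) auto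
 also have "\<dots> \<le> (\<integral>x. q y / 2 * indicator {y..y + d/2} x \<partial>lborel)"
 proof (rule integral_mono[OF q_integrable_Icc])
  show "q x * indicator {y..y + d/2} x \<le> q y / 2 * indicator {y..y + d/2} x" for x
   using qi[of x] by (auto simp: indicator_def)
 qed (rule integrable_const_Icc)
 also have "\<dots> < 0" using neg d(1) by (simp add: mult_neg_pos)
 finally show False by (simp add: not_less)
qed

lemma inversion_density: "M = density lborel (\<lambda>y. ennreal (q y))"
 supply [measurable] = q_measurable
proof (rule measure_eqI_lessThan)
 fix x :: real
 have Ioc: "emeasure M {a<..b} = emeasure (density lborel (\<lambda>y. ennreal (q y))) {a<..b}" if "a \<le> b" for a b
 proof -
  have "emeasure M {a<..b} = ennreal (\<integral>y. q y * indicator {a..b} y \<partial>lborel)"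
   using that by (simp add: emeasure_eq_measure inversion_interval_nonatoms no_atoms)
  also have "\<dots> = (\<integral>\<^sup>+y. ennreal (q y * indicator {a..b} y) \<partial>lborel)"
   by (rule nn_integral_eq_integral[symmetric]) (auto intro: q_integrable_Icc simp: inversion_nonneg)
  also have "\<dots> = (\<integral>\<^sup>+y. ennreal (q y) * indicator {a<..b} y \<partial>lborel)"
   by (rule nn_integral_cong_AE, rule AE_mp[OF AE_lborel_singleton[of a]]) (auto simp: indicator_def)
  finally show ?thesis by (simp add: emeasure_density)
 qed
 have u: "{x<..} = (\<Union>n::nat. {x<..x + n})"
 proof safe
  fix y :: real assume "y > x"
  moreover obtain n :: nat where "y - x \<le> n" using real_arch_simple by blast
  ultimately show "y \<in> (\<Union>n::nat. {x<..x + n})" by (auto intro!: exI[of _ n])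
 qed auto
 have inc: "incseq (\<lambda>n::nat. {x<..x + n})" by (auto simp: incseq_def)
 have "emeasure M {x<..} = (SUP n::nat. emeasure M {x<..x + n})"
  unfolding u by (rule SUP_emeasure_incseq[symmetric]) (use inc in auto)
 also have "\<dots> = (SUP n::nat. emeasure (density lborel (\<lambda>y. ennreal (q y))) {x<..x + n})"
  by (simp add: Ioc)
 also have "\<dots> = emeasure (density lborel (\<lambda>y. ennreal (q y))) {x<..}"
  unfolding u by (rule SUP_emeasure_incseq) (use inc in auto)
 finally show "emeasure M {x<..} = emeasure (density lborel (\<lambda>y. ennreal (q y))) {x<..}" .
 show "emeasure M {x<..} < \<infinity>" by (simp add: emeasure_eq_measure)
qed auto

end
end

section \<open>Potential kernels\<close>

text \<open>The potential density of the stable process discounted at rate \<open>\<beta>\<close>,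
  as Fourier inversion of its transform
  \<open>1 / (\<beta> + \<bar>\<theta>\<bar> powr \<alpha>)\<close>, which is integrable for
  \<open>1 < \<alpha>\<close>.\<close>

definition pot :: "real \<Rightarrow> real \<Rightarrow> real \<Rightarrow> real" where
 "pot \<alpha> \<beta> z = (1 / (2 * pi)) * (\<integral>\<theta>. cos (\<theta> * z) * (1 / (\<beta> + \<bar>\<theta>\<bar> powr \<alpha>)) \<partial>lborel)"

text \<open>The limit of \<open>pot \<alpha> \<beta> 0 - pot \<alpha> \<beta> z\<close> as
  \<open>\<beta>\<close> tends to \<open>0\<close>: a compensated potential that stays finite
  although \<open>pot \<alpha> \<beta> 0\<close> diverges. It is the function called
  \<open>a\<close> in the overview.\<close>

definition pot0 :: "real \<Rightarrow> real \<Rightarrow> real" where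
 "pot0 \<alpha> z = (1 / (2 * pi)) * (\<integral>\<theta>. (1 - cos (\<theta> * z)) / \<bar>\<theta>\<bar> powr \<alpha> \<partial>lborel)"

text \<open>One integrable majorant, up to constants, for both symbols: bounded near
  \<open>0\<close>, with their common decay at infinity.\<close>

definition powr_dom :: "real \<Rightarrow> real \<Rightarrow> real" where
 "powr_dom \<alpha> \<theta> = (if \<bar>\<theta>\<bar> \<le> 1 then 1 else \<bar>\<theta>\<bar> powr (- \<alpha>))"

lemma powr_dom_measurable[measurable]: "powr_dom \<alpha> \<in> borel_measurable borel"
 unfolding powr_dom_def[abs_def] by measurable

lemma powr_dom_nonneg: "0 \<le> powr_dom \<alpha> \<theta>" by (simp add: powr_dom_def)

lemma powr_dom_integrable:
 assumes \<alpha>: "1 < \<alpha>"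
 shows "integrable lborel (powr_dom \<alpha>)"
proof -
 have tail: "(\<integral>\<^sup>+x. ennreal (x powr (-\<alpha>)) * indicator {1..} x \<partial>lborel) = ennreal (0 - (1 powr (1-\<alpha>)) / (1-\<alpha>))"
 proof (rule nn_integral_FTC_atLeast[where F="\<lambda>x. x powr (1-\<alpha>) / (1-\<alpha>)"])
  fix x :: real assume "1 \<le> x"
  then show "DERIV (\<lambda>x. x powr (1-\<alpha>) / (1-\<alpha>)) x :> x powr (-\<alpha>)"
   using \<alpha> by (auto intro!: derivative_eq_intros simp: divide_simps)
 next
  have "((\<lambda>x. x powr (1-\<alpha>)) \<longlongrightarrow> 0) at_top"
   using \<alpha> by (intro tendsto_neg_powr filterlim_ident) auto
  then show "((\<lambda>x. x powr (1-\<alpha>) / (1-\<alpha>)) \<longlongrightarrow> 0) at_top"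
   using \<alpha> by (intro tendsto_divide_zero)
 qed auto
 have iR: "integrable lborel (\<lambda>x. x powr (-\<alpha>) * indicator {1..} x)"
 proof (rule integrableI_bounded)
  have "(\<integral>\<^sup>+x. ennreal (norm (x powr (-\<alpha>) * indicator {1..} x)) \<partial>lborel) = (\<integral>\<^sup>+x. ennreal (x powr (-\<alpha>)) * indicator {1..} x \<partial>lborel)"
   by (intro nn_integral_cong) (auto simp: indicator_def)
  then show "(\<integral>\<^sup>+x. ennreal (norm (x powr (-\<alpha>) * indicator {1..} x)) \<partial>lborel) < \<infinity>" using tail by simp
 qed auto
 have iL: "integrable lborel (\<lambda>x. (0 + (-1) * x) powr (-\<alpha>) * indicator {1..} (0 + (-1) * x))"
  by (rule lborel_integrable_real_affine[OF iR]) auto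
 have iC: "integrable lborel (\<lambda>x. 1 * indicator {-1..1::real} x :: real)" by (rule integrable_const_Icc)
 have "integrable lborel (\<lambda>x. x powr (-\<alpha>) * indicator {1..} x + (0 + (-1) * x) powr (-\<alpha>) * indicator {1..} (0 + (-1) * x) + 1 * indicator {-1..1::real} x)"
  by (intro Bochner_Integration.integrable_add iR iL iC)
 then show ?thesis
  by (rule Bochner_Integration.integrable_bound) (auto simp: powr_dom_def indicator_def)
qed

context
 fixes \<alpha> :: real
 assumes \<alpha>: "1 < \<alpha>" "\<alpha> < 2"
begin

lemma resolvent_symbol_le:
 assumes "0 < \<beta>" shows "1 / (\<beta> + \<bar>\<theta>\<bar> powr \<alpha>) \<le> (1 + 1 / \<beta>) * powr_dom \<alpha> \<theta>"
proof (cases "\<bar>\<theta>\<bar> \<le> 1")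
 case True
 have "1 / (\<beta> + \<bar>\<theta>\<bar> powr \<alpha>) \<le> 1 / \<beta>" using assms by (intro divide_left_mono mult_pos_pos add_pos_nonneg) auto
 then show ?thesis using True by (simp add: powr_dom_def)
next
 case False
 then have "1 / (\<beta> + \<bar>\<theta>\<bar> powr \<alpha>) \<le> 1 / (\<bar>\<theta>\<bar> powr \<alpha>)" using assms by (intro divide_left_mono mult_pos_pos add_pos_nonneg) auto
 also have "\<dots> \<le> (1 + 1 / \<beta>) * (1 / (\<bar>\<theta>\<bar> powr \<alpha>))" using assms by (simp only: times_divide_eq_right mult_1_right) (intro divide_right_mono, auto)
 finally show ?thesis using False by (simp add: powr_dom_def powr_minus_divide)
qed

lemma resolvent_symbol_integrable:
 assumes "0 < \<beta>" shows "integrable lborel (\<lambda>\<theta>. 1 / (\<beta> + \<bar>\<theta>\<bar> powr \<alpha>))"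
proof (rule Bochner_Integration.integrable_bound[OF integrable_mult_right[OF powr_dom_integrable[OF \<alpha>(1)]]])
 show "AE \<theta> in lborel. norm (1 / (\<beta> + \<bar>\<theta>\<bar> powr \<alpha>)) \<le> norm ((1 + 1 / \<beta>) * powr_dom \<alpha> \<theta>)"
  using resolvent_symbol_le[OF assms] assms
  by (intro AE_I2) (auto simp: powr_dom_nonneg abs_mult intro: order_trans[OF _ abs_ge_self])
qed auto

lemma cos_symbol_integrable:
 assumes "0 < \<beta>" shows "integrable lborel (\<lambda>\<theta>. cos (\<theta> * z) * (1 / (\<beta> + \<bar>\<theta>\<bar> powr \<alpha>)))"
 by (rule Bochner_Integration.integrable_bound[OF resolvent_symbol_integrable[OF assms]])
  (auto simp: abs_mult intro!: AE_I2 divide_right_mono)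

text \<open>Near \<open>0\<close> the quadratic bound for \<open>1 - cos\<close> beats the
  singularity because \<open>\<alpha> < 2\<close>; away from \<open>0\<close> the numerator is
  bounded.\<close>

lemma one_minus_cos_symbol_le: "(1 - cos (\<theta> * z)) / \<bar>\<theta>\<bar> powr \<alpha> \<le> (2 + z\<^sup>2) * powr_dom \<alpha> \<theta>"
proof (cases "\<bar>\<theta>\<bar> \<le> 1")
 case True
 show ?thesis
 proof (cases "\<theta> = 0")
  case False
  have "1 - cos (\<theta> * z) = 2 * (sin (\<theta> * z / 2))\<^sup>2" using cos_double_sin[of "\<theta> * z / 2"] by simp
  also have "(sin (\<theta> * z / 2))\<^sup>2 \<le> (\<theta> * z / 2)\<^sup>2"
   using abs_sin_x_le_abs_x[of "\<theta> * z / 2"] by (simp only: abs_le_square_iff)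
  finally have "1 - cos (\<theta> * z) \<le> 2 * (\<theta> * z / 2)\<^sup>2" by simp
  moreover have "2 * (\<theta> * z / 2)\<^sup>2 = \<theta>\<^sup>2 * z\<^sup>2 / 2" by (simp add: power_mult_distrib power_divide)
  moreover have "0 \<le> \<theta>\<^sup>2 * z\<^sup>2" by simp
  ultimately have 1: "1 - cos (\<theta> * z) \<le> \<theta>\<^sup>2 * z\<^sup>2" by linarith
  have "\<theta>\<^sup>2 = \<bar>\<theta>\<bar> powr 2" using False by (simp add: powr_numeral)
  also have "\<dots> \<le> \<bar>\<theta>\<bar> powr \<alpha>" using False True \<alpha> by (intro powr_mono') auto
  finally have "\<theta>\<^sup>2 * z\<^sup>2 \<le> z\<^sup>2 * \<bar>\<theta>\<bar> powr \<alpha>" by (subst mult.commute) (rule mult_left_mono, auto)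
  also have "\<dots> \<le> (2 + z\<^sup>2) * \<bar>\<theta>\<bar> powr \<alpha>" by (intro mult_right_mono) auto
  finally have "1 - cos (\<theta> * z) \<le> (2 + z\<^sup>2) * \<bar>\<theta>\<bar> powr \<alpha>" using 1 by linarith
  then show ?thesis using False True by (simp add: powr_dom_def divide_le_eq)
 qed (simp add: powr_dom_nonneg)
next
 case False
 have "1 - cos (\<theta> * z) \<le> 2 + z\<^sup>2" using cos_ge_minus_one[of "\<theta> * z"] zero_le_power2[of z] by linarith
 then have "(1 - cos (\<theta> * z)) / \<bar>\<theta>\<bar> powr \<alpha> \<le> (2 + z\<^sup>2) / \<bar>\<theta>\<bar> powr \<alpha>" by (intro divide_right_mono) auto
 then show ?thesis using False by (simp add: powr_dom_def powr_minus_divide)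
qed

lemma one_minus_cos_symbol_integrable: "integrable lborel (\<lambda>\<theta>. (1 - cos (\<theta> * z)) / \<bar>\<theta>\<bar> powr \<alpha>)"
proof (rule Bochner_Integration.integrable_bound[OF integrable_mult_right[OF powr_dom_integrable[OF \<alpha>(1)]]])
 show "AE \<theta> in lborel. norm ((1 - cos (\<theta> * z)) / \<bar>\<theta>\<bar> powr \<alpha>) \<le> norm ((2 + z\<^sup>2) * powr_dom \<alpha> \<theta>)"
  using one_minus_cos_symbol_le by (intro AE_I2) (auto simp: powr_dom_nonneg abs_mult)
qed auto

lemma pot_minus: "pot \<alpha> \<beta> (- z) = pot \<alpha> \<beta> z" by (simp add: pot_def)

lemma pot_abs_le: assumes "0 < \<beta>" shows "\<bar>pot \<alpha> \<beta> z\<bar> \<le> pot \<alpha> \<beta> 0"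
proof -
 have "\<bar>\<integral>\<theta>. cos (\<theta> * z) * (1 / (\<beta> + \<bar>\<theta>\<bar> powr \<alpha>)) \<partial>lborel\<bar> \<le> (\<integral>\<theta>. 1 / (\<beta> + \<bar>\<theta>\<bar> powr \<alpha>) \<partial>lborel)"
  by (rule integral_abs_bound_integral[OF cos_symbol_integrable[OF assms] resolvent_symbol_integrable[OF assms]])
   (use assms in \<open>auto simp: abs_mult intro!: divide_right_mono\<close>)
 then show ?thesis by (simp add: pot_def abs_mult divide_right_mono)
qed

lemma pot_isCont: assumes "0 < \<beta>" shows "isCont (pot \<alpha> \<beta>) z"
proof (unfold continuous_at_sequentially, safe)
 fix X assume X: "X \<longlonglongrightarrow> z"
 have "(\<lambda>n. \<integral>\<theta>. cos (\<theta> * X n) * (1 / (\<beta> + \<bar>\<theta>\<bar> powr \<alpha>)) \<partial>lborel) \<longlonglongrightarrow> (\<integral>\<theta>. cos (\<theta> * z) * (1 / (\<beta> + \<bar>\<theta>\<bar> powr \<alpha>)) \<partial>lborel)"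
 proof (rule integral_dominated_convergence[OF _ _ resolvent_symbol_integrable[OF assms]])
  show "AE \<theta> in lborel. (\<lambda>n. cos (\<theta> * X n) * (1 / (\<beta> + \<bar>\<theta>\<bar> powr \<alpha>))) \<longlonglongrightarrow> cos (\<theta> * z) * (1 / (\<beta> + \<bar>\<theta>\<bar> powr \<alpha>))"
   by (intro AE_I2 tendsto_intros X)
  show "AE \<theta> in lborel. norm (cos (\<theta> * X n) * (1 / (\<beta> + \<bar>\<theta>\<bar> powr \<alpha>))) \<le> 1 / (\<beta> + \<bar>\<theta>\<bar> powr \<alpha>)" for n
   using assms by (auto simp: abs_mult intro!: AE_I2 divide_right_mono)
 qed auto
 then show "(pot \<alpha> \<beta> \<circ> X) \<longlonglongrightarrow> pot \<alpha> \<beta> z" unfolding comp_def pot_def by (intro tendsto_intros)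
qed

lemma pot_measurable: assumes "0 < \<beta>" shows "pot \<alpha> \<beta> \<in> borel_measurable borel"
 by (intro borel_measurable_continuous_onI continuous_at_imp_continuous_on ballI pot_isCont assms)

lemma pot_diff:
 assumes "0 < \<beta>"
 shows "pot \<alpha> \<beta> 0 - pot \<alpha> \<beta> z = (1 / (2 * pi)) * (\<integral>\<theta>. (1 - cos (\<theta> * z)) / (\<beta> + \<bar>\<theta>\<bar> powr \<alpha>) \<partial>lborel)"
proof -
 have "(\<integral>\<theta>. (1 - cos (\<theta> * z)) / (\<beta> + \<bar>\<theta>\<bar> powr \<alpha>) \<partial>lborel) =
  (\<integral>\<theta>. 1 / (\<beta> + \<bar>\<theta>\<bar> powr \<alpha>) - cos (\<theta> * z) * (1 / (\<beta> + \<bar>\<theta>\<bar> powr \<alpha>)) \<partial>lborel)"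
  by (simp add: diff_divide_distrib)
 also have "\<dots> = (\<integral>\<theta>. 1 / (\<beta> + \<bar>\<theta>\<bar> powr \<alpha>) \<partial>lborel) - (\<integral>\<theta>. cos (\<theta> * z) * (1 / (\<beta> + \<bar>\<theta>\<bar> powr \<alpha>)) \<partial>lborel)"
  by (rule Bochner_Integration.integral_diff[OF resolvent_symbol_integrable[OF assms] cos_symbol_integrable[OF assms]])
 finally show ?thesis by (simp add: pot_def diff_divide_distrib)
qed

lemma symbol_quotient_le:
 assumes "0 < \<beta>" shows "(1 - cos (\<theta> * z)) / (\<beta> + \<bar>\<theta>\<bar> powr \<alpha>) \<le> (1 - cos (\<theta> * z)) / \<bar>\<theta>\<bar> powr \<alpha>"
 using assms by (cases "\<theta> = 0") (auto intro!: divide_left_mono mult_pos_pos add_pos_nonneg)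

lemma pot_diff_nonneg: assumes "0 < \<beta>" shows "0 \<le> pot \<alpha> \<beta> 0 - pot \<alpha> \<beta> z"
 using pot_abs_le[OF assms, of z] by linarith

lemma pot_diff_le: assumes "0 < \<beta>" shows "pot \<alpha> \<beta> 0 - pot \<alpha> \<beta> z \<le> pot0 \<alpha> z"
proof -
 have "(\<integral>\<theta>. (1 - cos (\<theta> * z)) / (\<beta> + \<bar>\<theta>\<bar> powr \<alpha>) \<partial>lborel) \<le> (\<integral>\<theta>. (1 - cos (\<theta> * z)) / \<bar>\<theta>\<bar> powr \<alpha> \<partial>lborel)"
 proof (rule integral_mono[OF _ one_minus_cos_symbol_integrable])
  show "integrable lborel (\<lambda>\<theta>. (1 - cos (\<theta> * z)) / (\<beta> + \<bar>\<theta>\<bar> powr \<alpha>))"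
   by (rule Bochner_Integration.integrable_bound[OF one_minus_cos_symbol_integrable[of z]])
    (use symbol_quotient_le[OF assms] assms in \<open>auto intro!: AE_I2\<close>)
 qed (rule symbol_quotient_le[OF assms])
 then show ?thesis unfolding pot_diff[OF assms] pot0_def by (intro mult_left_mono) auto
qed

text \<open>Discounts run along \<open>1 / (k + 1)\<close>, which is positive and decreasing, so
  that sequential and monotone limit theorems apply.\<close>

lemma pot_diff_tendsto:
 "(\<lambda>k. pot \<alpha> (1 / (real k + 1)) 0 - pot \<alpha> (1 / (real k + 1)) z) \<longlonglongrightarrow> pot0 \<alpha> z"
proof -
 have "(\<lambda>k. \<integral>\<theta>. (1 - cos (\<theta> * z)) / (1 / (real k + 1) + \<bar>\<theta>\<bar> powr \<alpha>) \<partial>lborel) \<longlonglongrightarrow> (\<integral>\<theta>. (1 - cos (\<theta> * z)) / \<bar>\<theta>\<bar> powr \<alpha> \<partial>lborel)"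
 proof (rule integral_dominated_convergence[OF _ _ one_minus_cos_symbol_integrable[of z]])
  show "AE \<theta> in lborel. (\<lambda>k. (1 - cos (\<theta> * z)) / (1 / (real k + 1) + \<bar>\<theta>\<bar> powr \<alpha>)) \<longlonglongrightarrow> (1 - cos (\<theta> * z)) / \<bar>\<theta>\<bar> powr \<alpha>"
  proof (rule AE_mp[OF AE_lborel_singleton[of 0]], intro AE_I2 impI)
   fix \<theta> :: real assume "\<theta> \<noteq> 0"
   moreover have "(\<lambda>k. 1 / (real k + 1)) \<longlonglongrightarrow> 0"
    using LIMSEQ_inverse_real_of_nat by (simp add: inverse_eq_divide add.commute)
   ultimately have "(\<lambda>k. (1 - cos (\<theta> * z)) / (1 / (real k + 1) + \<bar>\<theta>\<bar> powr \<alpha>)) \<longlonglongrightarrow> (1 - cos (\<theta> * z)) / (0 + \<bar>\<theta>\<bar> powr \<alpha>)"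
    by (intro tendsto_intros) auto
   then show "(\<lambda>k. (1 - cos (\<theta> * z)) / (1 / (real k + 1) + \<bar>\<theta>\<bar> powr \<alpha>)) \<longlonglongrightarrow> (1 - cos (\<theta> * z)) / \<bar>\<theta>\<bar> powr \<alpha>" by simp
  qed
  show "AE \<theta> in lborel. norm ((1 - cos (\<theta> * z)) / (1 / (real k + 1) + \<bar>\<theta>\<bar> powr \<alpha>)) \<le> (1 - cos (\<theta> * z)) / \<bar>\<theta>\<bar> powr \<alpha>" for k
   using symbol_quotient_le[of "1 / (real k + 1)"] by (intro AE_I2) (auto simp: add_nonneg_nonneg)
 qed auto
 moreover have "pot \<alpha> (1 / (real k + 1)) 0 - pot \<alpha> (1 / (real k + 1)) z =
   (1 / (2 * pi)) * (\<integral>\<theta>. (1 - cos (\<theta> * z)) / (1 / (real k + 1) + \<bar>\<theta>\<bar> powr \<alpha>) \<partial>lborel)" for k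
  by (rule pot_diff) simp
 ultimately show ?thesis unfolding pot0_def by (simp only:) (intro tendsto_intros)
qed

text \<open>On \<open>\<bar>\<theta>\<bar> \<le> \<tau>\<close> with
  \<open>\<tau> powr \<alpha> = \<beta>\<close> the denominator is at most
  \<open>2 * \<beta>\<close>. The exponent \<open>1 / \<alpha> - 1\<close> is negative, so the bound
  forces divergence as \<open>\<beta>\<close> vanishes; this is where recurrence appears.\<close>

lemma pot_zero_ge:
 assumes "0 < \<beta>" shows "(1 / (2 * pi)) * \<beta> powr (1 / \<alpha> - 1) \<le> pot \<alpha> \<beta> 0"
proof -
 define \<tau> where "\<tau> = \<beta> powr (1 / \<alpha>)"
 have \<tau>: "\<tau> > 0" "\<tau> powr \<alpha> = \<beta>" using assms \<alpha> by (auto simp: \<tau>_def powr_powr)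
 have "\<beta> powr (1 / \<alpha> - 1) = (1 / (2 * \<beta>)) * (\<tau> - (- \<tau>))"
  using assms by (simp add: \<tau>_def powr_diff)
 also have "\<dots> = (\<integral>\<theta>. 1 / (2 * \<beta>) * indicator {-\<tau>..\<tau>} \<theta> \<partial>lborel)" using \<tau> by simp
 also have "\<dots> \<le> (\<integral>\<theta>. 1 / (\<beta> + \<bar>\<theta>\<bar> powr \<alpha>) \<partial>lborel)"
 proof (rule integral_mono[OF integrable_const_Icc resolvent_symbol_integrable[OF assms]])
  fix \<theta> :: real
  show "1 / (2 * \<beta>) * indicator {-\<tau>..\<tau>} \<theta> \<le> 1 / (\<beta> + \<bar>\<theta>\<bar> powr \<alpha>)"
  proof (cases "\<theta> \<in> {-\<tau>..\<tau>}")
   case True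
   then have "\<bar>\<theta>\<bar> powr \<alpha> \<le> \<tau> powr \<alpha>" using \<alpha> by (intro powr_mono2) auto
   then have "1 / (2 * \<beta>) \<le> 1 / (\<beta> + \<bar>\<theta>\<bar> powr \<alpha>)"
    using assms \<tau>(2) by (intro divide_left_mono mult_pos_pos add_pos_nonneg) auto
   then show ?thesis using True by simp
  qed (use assms in simp)
 qed
 finally show ?thesis unfolding pot_def by (simp add: divide_right_mono)
qed

lemma pot_zero_pos: assumes "0 < \<beta>" shows "0 < pot \<alpha> \<beta> 0"
 using pot_zero_ge[OF assms] assms by (intro less_le_trans[OF _ pot_zero_ge[OF assms]]) simp

lemma pot_zero_at_top: "filterlim (\<lambda>k. pot \<alpha> (1 / (real k + 1)) 0) at_top sequentially"
proof (rule filterlim_at_top_mono)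
 have "filterlim (\<lambda>k. (real k + 1) powr (1 - 1 / \<alpha>)) at_top sequentially"
 proof -
  have "filterlim (\<lambda>k. real k + 1) at_top sequentially"
   by (rule filterlim_at_top_mono[OF filterlim_real_sequentially]) auto
  then have "filterlim (\<lambda>k. ln (real k + 1)) at_top sequentially"
   by (rule filterlim_compose[OF ln_at_top])
  then have "filterlim (\<lambda>k. (1 - 1 / \<alpha>) * ln (real k + 1)) at_top sequentially"
   using \<alpha> by (intro filterlim_tendsto_pos_mult_at_top[OF tendsto_const]) auto
  then have "filterlim (\<lambda>k. exp ((1 - 1 / \<alpha>) * ln (real k + 1))) at_top sequentially"
   by (rule filterlim_compose[OF exp_at_top])
  then show ?thesis by (simp add: powr_def)
 qed
 then show "filterlim (\<lambda>k. (1 / (2 * pi)) * (real k + 1) powr (1 - 1 / \<alpha>)) at_top sequentially"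
  by (intro filterlim_tendsto_pos_mult_at_top[OF tendsto_const]) auto
 show "\<forall>\<^sub>F k in sequentially. (1 / (2 * pi)) * (real k + 1) powr (1 - 1 / \<alpha>) \<le> pot \<alpha> (1 / (real k + 1)) 0"
 proof (intro always_eventually allI)
  fix k :: nat
  have "(1 / (real k + 1)) powr (1 / \<alpha> - 1) = (real k + 1) powr (1 - 1 / \<alpha>)"
   by (simp add: powr_divide powr_diff)
  then show "(1 / (2 * pi)) * (real k + 1) powr (1 - 1 / \<alpha>) \<le> pot \<alpha> (1 / (real k + 1)) 0"
   using pot_zero_ge[of "1 / (real k + 1)"] by simp
 qed
qed

text \<open>The difference of numerator and denominator converges while the denominator diverges.
  The ratio will turn out to be the Laplace transform of the passage time from \<open>z\<close> to
  \<open>0\<close>, so the limit \<open>1\<close> means that \<open>0\<close> is reached almost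
  surely.\<close>

lemma pot_ratio_tendsto: "(\<lambda>k. pot \<alpha> (1 / (real k + 1)) z / pot \<alpha> (1 / (real k + 1)) 0) \<longlonglongrightarrow> 1"
proof -
 have "(\<lambda>k. (pot \<alpha> (1 / (real k + 1)) 0 - pot \<alpha> (1 / (real k + 1)) z) / pot \<alpha> (1 / (real k + 1)) 0) \<longlonglongrightarrow> 0"
  by (rule tendsto_divide_0[OF pot_diff_tendsto]) (rule filterlim_at_top_imp_at_infinity[OF pot_zero_at_top])
 then have "(\<lambda>k. 1 - (pot \<alpha> (1 / (real k + 1)) 0 - pot \<alpha> (1 / (real k + 1)) z) / pot \<alpha> (1 / (real k + 1)) 0) \<longlonglongrightarrow> 1 - 0"
  by (intro tendsto_intros)
 moreover have "1 - (pot \<alpha> (1 / (real k + 1)) 0 - pot \<alpha> (1 / (real k + 1)) z) / pot \<alpha> (1 / (real k + 1)) 0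
   = pot \<alpha> (1 / (real k + 1)) z / pot \<alpha> (1 / (real k + 1)) 0" for k
  using pot_zero_pos[of "1 / (real k + 1)"] by (simp add: diff_divide_distrib)
 ultimately show ?thesis by simp
qed

lemma pot0_zero: "pot0 \<alpha> 0 = 0" by (simp add: pot0_def)

text \<open>Substituting \<open>z * \<theta>\<close> for the frequency pulls out
  \<open>\<bar>z\<bar> powr (\<alpha> - 1)\<close>.\<close>

lemma pot0_scaling: "pot0 \<alpha> z = pot0 \<alpha> 1 * \<bar>z\<bar> powr (\<alpha> - 1)"
proof (cases "z = 0")
 case False
 let ?f = "\<lambda>\<theta>. (1 - cos \<theta>) / \<bar>\<theta>\<bar> powr \<alpha>"
 have "(\<integral>\<theta>. ?f \<theta> \<partial>lborel) = \<bar>z\<bar> * (\<integral>\<theta>. ?f (0 + z * \<theta>) \<partial>lborel)"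
  using lborel_integral_real_affine[OF False, of ?f 0] by simp
 also have "(\<integral>\<theta>. ?f (0 + z * \<theta>) \<partial>lborel) = (\<integral>\<theta>. \<bar>z\<bar> powr (-\<alpha>) * ((1 - cos (\<theta> * z)) / \<bar>\<theta>\<bar> powr \<alpha>) \<partial>lborel)"
  by (intro Bochner_Integration.integral_cong) (auto simp: abs_mult powr_mult powr_minus_divide mult.commute)
 also have "\<dots> = \<bar>z\<bar> powr (-\<alpha>) * (\<integral>\<theta>. (1 - cos (\<theta> * z)) / \<bar>\<theta>\<bar> powr \<alpha> \<partial>lborel)"
  by (rule integral_mult_right_zero)
 finally have "(\<integral>\<theta>. ?f \<theta> \<partial>lborel) = (\<bar>z\<bar> * \<bar>z\<bar> powr (-\<alpha>)) * (\<integral>\<theta>. (1 - cos (\<theta> * z)) / \<bar>\<theta>\<bar> powr \<alpha> \<partial>lborel)" by simp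
 moreover have "\<bar>z\<bar> * \<bar>z\<bar> powr (-\<alpha>) = 1 / \<bar>z\<bar> powr (\<alpha> - 1)"
  using False by (simp add: powr_minus_divide powr_diff)
 ultimately show ?thesis using False by (simp add: pot0_def)
qed (simp add: pot0_zero)

lemma pot0_one_pos: "0 < pot0 \<alpha> 1"
proof -
 let ?f = "\<lambda>\<theta>::real. (1 - cos \<theta>) / \<bar>\<theta>\<bar> powr \<alpha>"
 have i: "integrable lborel ?f" using one_minus_cos_symbol_integrable[of 1] by simp
 have nn: "0 \<le> ?f \<theta>" for \<theta> by simp
 have "integral\<^sup>L lborel ?f \<noteq> 0"
 proof
  assume "integral\<^sup>L lborel ?f = 0"
  then have "AE \<theta> in lborel. ?f \<theta> = 0"
   using integral_nonneg_eq_0_iff_AE[OF i] nn by simp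
  then have "AE \<theta> in lborel. \<theta> \<notin> {0<..<1::real}"
  proof (rule AE_mp, intro AE_I2 impI notI)
   fix \<theta> :: real assume 0: "?f \<theta> = 0" "\<theta> \<in> {0<..<1}"
   then have "cos \<theta> = 1" by simp
   moreover have "cos \<theta> < cos 0" using 0(2) pi_gt3 by (intro cos_monotone_0_pi) auto
   ultimately show False by simp
  qed
  then have "emeasure lborel {0<..<1::real} = 0"
   by (subst (asm) AE_iff_measurable[of "{0<..<1}"]) auto
  then show False by simp
 qed
 then show ?thesis using Bochner_Integration.integral_nonneg[of lborel ?f] nn by (simp add: pot0_def less_le)
qed

section \<open>The Green function of the process killed at 0\<close>

definition grn :: "real \<Rightarrow> real \<Rightarrow> real" where
 "grn x y = pot0 \<alpha> x + pot0 \<alpha> y - pot0 \<alpha> (x - y)"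

lemma pot0_nonneg: "0 \<le> pot0 \<alpha> z"
 by (subst pot0_scaling) (use pot0_one_pos in simp)

text \<open>After division by \<open>a + b\<close> both terms lie in the unit interval, where
  \<open>x \<le> x powr \<gamma>\<close>.\<close>

lemma powr_subadditive:
 fixes a b \<gamma> :: real assumes "0 \<le> a" "0 \<le> b" "0 < \<gamma>" "\<gamma> \<le> 1"
 shows "(a + b) powr \<gamma> \<le> a powr \<gamma> + b powr \<gamma>"
proof (cases "a + b = 0")
 case False
 then have p: "a + b > 0" using assms by simp
 have *: "x / (a + b) \<le> (x / (a + b)) powr \<gamma>" if "0 \<le> x" "x \<le> a + b" for x
 proof -
  have "(x / (a + b)) powr 1 \<le> (x / (a + b)) powr \<gamma>" using that p assms by (intro powr_mono') auto
  then show ?thesis using that p by simp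
 qed
 have "1 = a / (a + b) + b / (a + b)" using p by (simp flip: add_divide_distrib)
 also have "\<dots> \<le> (a / (a + b)) powr \<gamma> + (b / (a + b)) powr \<gamma>" using assms by (intro add_mono *) auto
 also have "\<dots> = (a powr \<gamma> + b powr \<gamma>) / (a + b) powr \<gamma>"
  using assms p by (simp add: powr_divide add_divide_distrib)
 finally show ?thesis using p by (simp add: le_divide_eq)
qed (use assms in auto)

lemma pot0_subadditive: "pot0 \<alpha> (x + y) \<le> pot0 \<alpha> x + pot0 \<alpha> y"
proof -
 have "\<bar>x + y\<bar> powr (\<alpha> - 1) \<le> (\<bar>x\<bar> + \<bar>y\<bar>) powr (\<alpha> - 1)" using \<alpha> by (intro powr_mono2) auto
 also have "\<dots> \<le> \<bar>x\<bar> powr (\<alpha> - 1) + \<bar>y\<bar> powr (\<alpha> - 1)" using \<alpha> by (intro powr_subadditive) auto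
 finally have "pot0 \<alpha> 1 * \<bar>x + y\<bar> powr (\<alpha> - 1) \<le> pot0 \<alpha> 1 * (\<bar>x\<bar> powr (\<alpha> - 1) + \<bar>y\<bar> powr (\<alpha> - 1))"
  using pot0_one_pos by (intro mult_left_mono) auto
 then show ?thesis by (subst (1 2 3) pot0_scaling) (simp add: distrib_left)
qed

lemma pot0_minus: "pot0 \<alpha> (- z) = pot0 \<alpha> z" by (simp add: pot0_def)

lemma pot0_diff_commute: "pot0 \<alpha> (x - y) = pot0 \<alpha> (y - x)" using pot0_minus[of "x - y"] by simp

lemma grn_sym: "grn x y = grn y x" by (simp add: grn_def pot0_diff_commute)

lemma grn_nonneg: "0 \<le> grn x y"
 using pot0_subadditive[of x "- y"] by (simp add: grn_def pot0_minus)

lemma grn_le_left: "grn x y \<le> 2 * pot0 \<alpha> x"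
 using pot0_subadditive[of x "y - x"] by (simp add: grn_def pot0_diff_commute[of x y])

lemma grn_le_right: "grn x y \<le> 2 * pot0 \<alpha> y"
 using grn_le_left[of y x] by (simp add: grn_sym)

text \<open>The inequality behind subadditivity is strict for two positive terms, since
  \<open>\<alpha> - 1 < 1\<close>. Positivity makes the leading spectral coefficient
  \<open>c 0 x\<close> nonzero.\<close>

lemma grn_pos: assumes "x \<noteq> 0" "y \<noteq> 0" shows "0 < grn x y"
proof -
 let ?\<gamma> = "\<alpha> - 1"
 have p: "\<bar>x\<bar> + \<bar>y\<bar> > 0" using assms by simp
 have *: "z / (\<bar>x\<bar> + \<bar>y\<bar>) < (z / (\<bar>x\<bar> + \<bar>y\<bar>)) powr ?\<gamma>" if "0 < z" "z < \<bar>x\<bar> + \<bar>y\<bar>" for z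
 proof -
  have "(z / (\<bar>x\<bar> + \<bar>y\<bar>)) powr 1 < (z / (\<bar>x\<bar> + \<bar>y\<bar>)) powr ?\<gamma>" using that p \<alpha> by (intro powr_less_mono') auto
  then show ?thesis using that p by simp
 qed
 have "1 = \<bar>x\<bar> / (\<bar>x\<bar> + \<bar>y\<bar>) + \<bar>y\<bar> / (\<bar>x\<bar> + \<bar>y\<bar>)" using p by (simp flip: add_divide_distrib)
 also have "\<dots> < (\<bar>x\<bar> / (\<bar>x\<bar> + \<bar>y\<bar>)) powr ?\<gamma> + (\<bar>y\<bar> / (\<bar>x\<bar> + \<bar>y\<bar>)) powr ?\<gamma>" using assms by (intro add_strict_mono *) auto
 also have "\<dots> = (\<bar>x\<bar> powr ?\<gamma> + \<bar>y\<bar> powr ?\<gamma>) / (\<bar>x\<bar> + \<bar>y\<bar>) powr ?\<gamma>"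
  using p by (simp add: powr_divide add_divide_distrib)
 finally have "(\<bar>x\<bar> + \<bar>y\<bar>) powr ?\<gamma> < \<bar>x\<bar> powr ?\<gamma> + \<bar>y\<bar> powr ?\<gamma>" using p by (simp add: less_divide_eq)
 moreover have "\<bar>x - y\<bar> powr ?\<gamma> \<le> (\<bar>x\<bar> + \<bar>y\<bar>) powr ?\<gamma>" using \<alpha> by (intro powr_mono2) auto
 ultimately have "pot0 \<alpha> 1 * \<bar>x - y\<bar> powr ?\<gamma> < pot0 \<alpha> 1 * (\<bar>x\<bar> powr ?\<gamma> + \<bar>y\<bar> powr ?\<gamma>)"
  using pot0_one_pos by (intro mult_strict_left_mono) auto
 then have "pot0 \<alpha> (x - y) < pot0 \<alpha> x + pot0 \<alpha> y" by (subst (1 2 3) pot0_scaling) (simp add: distrib_left)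
 then show ?thesis by (simp add: grn_def)
qed

lemma pot0_measurable: "pot0 \<alpha> \<in> borel_measurable borel"
proof -
 have "pot0 \<alpha> = (\<lambda>z. pot0 \<alpha> 1 * \<bar>z\<bar> powr (\<alpha> - 1))" using pot0_scaling by (rule ext)
 moreover have "(\<lambda>z. pot0 \<alpha> 1 * \<bar>z\<bar> powr (\<alpha> - 1)) \<in> borel_measurable borel" by measurable
 ultimately show ?thesis by simp
qed

lemma grn_measurable: "(\<lambda>(x, y). grn x y) \<in> borel_measurable (borel \<Otimes>\<^sub>M borel)"
 supply [measurable] = pot0_measurable
 unfolding grn_def by measurable

end

section \<open>The Markov property on path space\<close>

abbreviation path_space :: "(real \<Rightarrow> real) measure" where
 "path_space \<equiv> PiM UNIV (\<lambda>_. borel)"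

text \<open>Imposed on the whole time line: paths of the process are continued by \<open>0\<close>
  to negative times, which removes boundary cases at time \<open>0\<close>.\<close>

definition cadlag :: "(real \<Rightarrow> real) \<Rightarrow> bool" where
 "cadlag w \<longleftrightarrow> (\<forall>t. continuous (at_right t) w) \<and> (\<forall>t. \<exists>l. (w \<longlongrightarrow> l) (at_left t))"

definition stopped :: "real \<Rightarrow> (real \<Rightarrow> real) \<Rightarrow> real \<Rightarrow> real" where
 "stopped r w = (\<lambda>s. w (min s r))"

text \<open>The cut-off \<open>max 0\<close> makes the restarted path vanish at negative times, as
  the paths of \<open>X\<close> do, so that both can have the same law on all of
  \<open>path_space\<close>.\<close>

definition restart :: "real \<Rightarrow> (real \<Rightarrow> real) \<Rightarrow> real \<Rightarrow> real" where
 "restart r w = (\<lambda>s. w (r + max 0 s) - w r)"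

lemma stopped_measurable[measurable]: "stopped r \<in> measurable path_space path_space"
 unfolding stopped_def[abs_def] by (rule measurable_PiM_single') auto

lemma restart_measurable[measurable]: "restart r \<in> measurable path_space path_space"
 unfolding restart_def[abs_def] by (rule measurable_PiM_single') auto

lemma borel_measurable_sum_components:
 assumes "S \<subseteq> I"
 shows "(\<lambda>d. sum d S) \<in> borel_measurable (PiM I (\<lambda>_. borel :: real measure))"
proof -
 have "(\<lambda>d. d i) \<in> borel_measurable (PiM I (\<lambda>_. borel :: real measure))" if "i \<in> S" for i
  using that assms by (intro measurable_component_singleton) auto
 then show ?thesis using borel_measurable_sum[of S "\<lambda>i d. d i" "PiM I (\<lambda>_. borel :: real measure)"] by simp
qed

lemma sets_sum_components:
 assumes "finite J" "\<And>s. s \<in> J \<Longrightarrow> A s \<in> sets (borel :: real measure)" "\<And>s. s \<in> J \<Longrightarrow> S s \<subseteq> I"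
 shows "{d \<in> space (PiM I (\<lambda>_. borel)). \<forall>s\<in>J. (\<Sum>i\<in>S s. d i) \<in> A s} \<in> sets (PiM I (\<lambda>_. borel))"
proof (rule sets.sets_Collect_finite_All[OF _ assms(1)])
 fix s assume "s \<in> J"
 from measurable_sets[OF borel_measurable_sum_components[OF assms(3)[OF this]] assms(2)[OF this]]
 show "{d \<in> space (PiM I (\<lambda>_. borel)). (\<Sum>i\<in>S s. d i) \<in> A s} \<in> sets (PiM I (\<lambda>_. borel))"
  by (simp add: vimage_def Int_def conj_commute)
qed

text \<open>\<open>j\<close> locates each time in a common grid, so that path values become
  telescoping sums of grid increments. The grid point \<open>0\<close> anchors these sums.\<close>

lemma sorted_times:
 fixes T :: "real set"
 assumes "finite T" "0 \<in> T" "\<And>t. t \<in> T \<Longrightarrow> 0 \<le> t"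
 obtains ts j where "sorted ts" "\<forall>t\<in>set ts. 0 \<le> t" "ts ! 0 = 0" "\<And>t. t \<in> T \<Longrightarrow> j t < length ts \<and> ts ! j t = t"
  "\<And>s t. s \<in> T \<Longrightarrow> t \<in> T \<Longrightarrow> s \<le> t \<Longrightarrow> j s \<le> j t"
proof -
 define ts where "ts = sorted_list_of_set T"
 have ts: "sorted ts" "set ts = T" unfolding ts_def using assms(1) by simp_all
 have "\<forall>t\<in>T. \<exists>i<length ts. ts ! i = t" using ts(2) by (metis in_set_conv_nth)
 then obtain j where j: "\<forall>t\<in>T. j t < length ts \<and> ts ! j t = t" by (metis bchoice)
 have mono: "j s \<le> j t" if "s \<in> T" "t \<in> T" "s \<le> t" for s t
  using that j sorted_nth_mono[OF ts(1), of "j t" "j s"] by (metis le_cases order_antisym)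
 have "0 < length ts" using ts(2) assms(2) by auto
 then have "ts ! 0 \<in> T" "ts ! 0 \<le> ts ! j 0" using ts assms(2) j sorted_nth_mono[OF ts(1), of 0 "j 0"] by auto
 then have "ts ! 0 = 0" using assms(2,3) j by (metis order_antisym)
 then show ?thesis using ts assms(3) j mono by (intro that[of ts j]) auto
qed

text \<open>Here path regularity and the value at time \<open>0\<close> hold for every outcome, and
  every real number is a valid time index. \<open>stable_motion_version\<close> produces such a
  version from the process of the theorem.\<close>

locale stable_motion = prob_space M for M :: "'w measure" +
 fixes \<alpha> :: real and X :: "real \<Rightarrow> 'w \<Rightarrow> real"
 assumes \<alpha>: "1 < \<alpha>" "\<alpha> < 2"
  and X_meas[measurable]: "\<And>t. X t \<in> borel_measurable M"
  and X_cadlag: "\<And>w. cadlag (\<lambda>t. X t w)"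
  and X_neg: "\<And>t w. t \<le> 0 \<Longrightarrow> X t w = 0"
  and X_indep: "\<And>ts. sorted ts \<Longrightarrow> (\<forall>t\<in>set ts. 0 \<le> t) \<Longrightarrow>
   indep_vars (\<lambda>_. borel) (\<lambda>i w. X (ts ! Suc i) w - X (ts ! i) w) {i. Suc i < length ts}"
  and X_char: "\<And>s t \<theta>. 0 \<le> s \<Longrightarrow> s \<le> t \<Longrightarrow>
   char (distr M borel (\<lambda>w. X t w - X s w)) \<theta> = complex_of_real (exp (- (t - s) * \<bar>\<theta>\<bar> powr \<alpha>))"
begin

definition traj :: "'w \<Rightarrow> real \<Rightarrow> real" where "traj w t = X t w"

lemma traj_measurable[measurable]: "traj \<in> measurable M path_space"
proof -
 have "traj = (\<lambda>w t. X t w)" by (intro ext) (simp add: traj_def)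
 moreover have "(\<lambda>w t. X t w) \<in> measurable M path_space" by (rule measurable_PiM_single') auto
 ultimately show ?thesis by simp
qed

lemma increment_law_eq:
 assumes "0 \<le> s" "s \<le> t" "0 \<le> s'" "s' \<le> t'" "t - s = t' - s'"
 shows "distr M borel (\<lambda>w. X t w - X s w) = distr M borel (\<lambda>w. X t' w - X s' w)"
proof (rule Levy_uniqueness)
 show "char (distr M borel (\<lambda>w. X t w - X s w)) = char (distr M borel (\<lambda>w. X t' w - X s' w))"
  using assms by (intro ext) (simp add: X_char)
qed (auto intro!: real_distribution_distr)

text \<open>Independence makes the joint law a product of marginals, and each marginal depends only
  on the length of its time step.\<close>

lemma increments_law_eq:
 assumes ts: "sorted ts" "\<forall>t\<in>set ts. 0 \<le> t" and r: "0 \<le> r"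
 defines "I \<equiv> {i. Suc i < length ts}"
 shows "distr M (PiM I (\<lambda>_. borel)) (\<lambda>w. \<lambda>i\<in>I. X (r + ts ! Suc i) w - X (r + ts ! i) w)
   = distr M (PiM I (\<lambda>_. borel)) (\<lambda>w. \<lambda>i\<in>I. X (ts ! Suc i) w - X (ts ! i) w)"
proof (cases "I = {}")
 case False
 let ?D = "\<lambda>r i w. X (r + ts ! Suc i) w - X (r + ts ! i) w"
 have law: "distr M (PiM I (\<lambda>_. borel)) (\<lambda>w. \<lambda>i\<in>I. ?D r i w) = PiM I (\<lambda>i. distr M borel (?D r i))"
  if "0 \<le> r" for r
 proof (subst indep_vars_iff_distr_eq_PiM[symmetric, OF False])
  let ?us = "map (\<lambda>t. r + t) ts"
  have "sorted ?us" using ts(1) by (simp add: sorted_wrt_map)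
  then have "indep_vars (\<lambda>_. borel) (\<lambda>i w. X (?us ! Suc i) w - X (?us ! i) w) {i. Suc i < length ?us}"
   by (rule X_indep) (use ts(2) that in auto)
  then have "indep_vars (\<lambda>_. borel) (\<lambda>i w. X (?us ! Suc i) w - X (?us ! i) w) I" by (simp add: I_def)
  also have "?this \<longleftrightarrow> indep_vars (\<lambda>_. borel) (?D r) I" by (intro indep_vars_cong refl) (auto simp: I_def)
  finally show "indep_vars (\<lambda>_. borel) (?D r) I" .
 qed auto
 have "PiM I (\<lambda>i. distr M borel (?D r i)) = PiM I (\<lambda>i. distr M borel (?D 0 i))"
 proof (rule PiM_cong[OF refl])
  fix i assume "i \<in> I"
  then have i: "Suc i < length ts" by (simp add: I_def)
  then have "ts ! i \<le> ts ! Suc i" "0 \<le> ts ! i" "0 \<le> ts ! Suc i"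
   using ts by (auto simp: sorted_iff_nth_mono)
  then show "distr M borel (?D r i) = distr M borel (?D 0 i)"
   using r by (intro increment_law_eq) auto
 qed
 then show ?thesis using law[OF r] law[of 0] by simp
qed (simp add: PiM_empty restrict_def)

text \<open>Laws on path space agree once they agree on cylinders. Cylinder events concern partial
  sums of grid increments, whose joint law does not see the shift by \<open>r\<close>.\<close>

lemma restart_law:
 assumes r: "0 \<le> r"
 shows "distr M path_space (\<lambda>w. restart r (traj w)) = distr M path_space traj"
proof (rule measure_eqI_PiM_infinite)
 fix A :: "real \<Rightarrow> real set" and J :: "real set"
 assume J: "finite J" and A: "\<And>i. i \<in> J \<Longrightarrow> A i \<in> sets borel"
 let ?T = "insert 0 (max 0 ` J)"
 have T: "finite ?T" "0 \<in> ?T" "\<And>t. t \<in> ?T \<Longrightarrow> 0 \<le> t" using J by auto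
 obtain ts j' where ts: "sorted ts" and nn: "\<forall>t\<in>set ts. 0 \<le> t" and ts0: "ts ! 0 = 0"
  and j': "\<And>t. t \<in> ?T \<Longrightarrow> j' t < length ts \<and> ts ! j' t = t" by (rule sorted_times[OF T]) (assumption, rule that)
 define I where "I = {i. Suc i < length ts}"
 define j where "j s = j' (max 0 s)" for s
 have j: "j s < length ts" "ts ! j s = max 0 s" if "s \<in> J" for s using j' that by (auto simp: j_def)
 let ?E = "{d \<in> space (PiM I (\<lambda>_. borel)). \<forall>s\<in>J. (\<Sum>i<j s. d i) \<in> A s}"
 have E: "?E \<in> sets (PiM I (\<lambda>_. borel :: real measure))"
  by (rule sets_sum_components[OF J A]) (use j(1) in \<open>force simp: I_def\<close>)+
 have rep: "emeasure M {w\<in>space M. \<forall>s\<in>J. X (q + max 0 s) w - X q w \<in> A s}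
  = emeasure (distr M (PiM I (\<lambda>_. borel)) (\<lambda>w. \<lambda>i\<in>I. X (q + ts ! Suc i) w - X (q + ts ! i) w)) ?E" for q
 proof (subst emeasure_distr[OF _ E])
  have "(\<Sum>i<j s. (\<lambda>i\<in>I. X (q + ts ! Suc i) w - X (q + ts ! i) w) i) = X (q + max 0 s) w - X q w" if "s \<in> J" for s w
  proof -
   have "(\<Sum>i<j s. (\<lambda>i\<in>I. X (q + ts ! Suc i) w - X (q + ts ! i) w) i) = (\<Sum>i<j s. X (q + ts ! Suc i) w - X (q + ts ! i) w)"
    using j(1)[OF that] by (intro sum.cong) (auto simp: I_def)
   then show ?thesis
    using sum_lessThan_telescope[of "\<lambda>i. X (q + ts ! i) w" "j s"] j(2)[OF that] ts0 by simp
  qed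
  then show "emeasure M {w\<in>space M. \<forall>s\<in>J. X (q + max 0 s) w - X q w \<in> A s} =
   emeasure M ((\<lambda>w. \<lambda>i\<in>I. X (q + ts ! Suc i) w - X (q + ts ! i) w) -` ?E \<inter> space M)"
   by (intro arg_cong[where f="emeasure M"]) (auto simp: space_PiM)
 qed auto
 have sh: "emeasure (distr M path_space (\<lambda>w. restart q (traj w))) (prod_emb UNIV (\<lambda>_. borel) J (Pi\<^sub>E J A))
   = emeasure M {w\<in>space M. \<forall>s\<in>J. X (q + max 0 s) w - X q w \<in> A s}" for q
 proof (subst emeasure_distr)
  show "prod_emb UNIV (\<lambda>_. borel) J (Pi\<^sub>E J A) \<in> sets path_space" using J A by (intro sets_PiM_I) auto
  show "emeasure M ((\<lambda>w. restart q (traj w)) -` prod_emb UNIV (\<lambda>_. borel) J (Pi\<^sub>E J A) \<inter> space M) =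
   emeasure M {w\<in>space M. \<forall>s\<in>J. X (q + max 0 s) w - X q w \<in> A s}"
   by (intro arg_cong[where f="emeasure M"]) (auto simp: prod_emb_def restart_def traj_def PiE_iff)
 qed measurable
 \<comment> \<open>The original path is its own restart at time \<open>0\<close>, so
   \<open>rep\<close> and \<open>sh\<close> cover both laws.\<close>
 have p0: "traj = (\<lambda>w. restart 0 (traj w))"
  by (intro ext) (auto simp: traj_def restart_def max_def X_neg)
 have "emeasure (distr M path_space (\<lambda>w. restart r (traj w))) (prod_emb UNIV (\<lambda>_. borel) J (Pi\<^sub>E J A))
  = emeasure (distr M path_space (\<lambda>w. restart 0 (traj w))) (prod_emb UNIV (\<lambda>_. borel) J (Pi\<^sub>E J A))"
  unfolding sh rep using increments_law_eq[OF ts nn r] by (simp add: I_def)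
 then show "emeasure (distr M path_space (\<lambda>w. restart r (traj w))) (prod_emb UNIV (\<lambda>_. borel) J (Pi\<^sub>E J A))
  = emeasure (distr M path_space traj) (prod_emb UNIV (\<lambda>_. borel) J (Pi\<^sub>E J A))"
  using p0 by simp
next
 show "finite_measure (distr M path_space (\<lambda>w. restart r (traj w)))"
  by (intro prob_space.finite_measure prob_space_distr) measurable
qed auto

text \<open>The time \<open>r\<close> is made a grid point, of index \<open>p\<close>. Values up to
  \<open>r\<close> are sums of increments before \<open>p\<close>, later displacements are sums of
  increments from \<open>p\<close> on, and disjoint groups of independent increments are
  independent.\<close>

lemma stopped_restart_indep_cylinder:
 assumes r: "0 \<le> r" and J: "finite J" "finite K"
  and A: "\<And>s. s \<in> J \<Longrightarrow> A s \<in> sets borel" and B: "\<And>s. s \<in> K \<Longrightarrow> B s \<in> sets borel"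
 shows "prob ({w\<in>space M. \<forall>s\<in>J. X (min s r) w \<in> A s} \<inter> {w\<in>space M. \<forall>s\<in>K. X (r + max 0 s) w - X r w \<in> B s})
  = prob {w\<in>space M. \<forall>s\<in>J. X (min s r) w \<in> A s} * prob {w\<in>space M. \<forall>s\<in>K. X (r + max 0 s) w - X r w \<in> B s}"
proof -
 let ?f = "\<lambda>s. max 0 (min s r)" and ?g = "\<lambda>s. r + max 0 s"
 let ?T = "{0, r} \<union> ?f ` J \<union> ?g ` K"
 have T: "finite ?T" "0 \<in> ?T" "\<And>t. t \<in> ?T \<Longrightarrow> 0 \<le> t" using J r by auto
 obtain ts i where ts: "sorted ts" and nn: "\<forall>t\<in>set ts. 0 \<le> t" and ts0: "ts ! 0 = 0"
  and i: "\<And>t. t \<in> ?T \<Longrightarrow> i t < length ts \<and> ts ! i t = t" "\<And>s t. s \<in> ?T \<Longrightarrow> t \<in> ?T \<Longrightarrow> s \<le> t \<Longrightarrow> i s \<le> i t"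
  by (rule sorted_times[OF T]) (assumption, rule that)
 define p where "p = i r"
 have p: "p < length ts" "ts ! p = r" unfolding p_def using i(1)[of r] by auto
 define j where "j s = i (?f s)" for s
 define k where "k s = i (?g s)" for s
 have j: "j s \<le> p" "ts ! j s = ?f s" if "s \<in> J" for s unfolding j_def p_def using that r i(1)[of "?f s"] i(2)[of "?f s" r] by auto
 have k: "p \<le> k s" "k s < length ts" "ts ! k s = ?g s" if "s \<in> K" for s
  unfolding k_def p_def using that i(1)[of "?g s"] i(2)[of r "?g s"] by auto
 define D where "D i w = X (ts ! Suc i) w - X (ts ! i) w" for i w
 let ?I1 = "{..<p}" and ?I2 = "{i. p \<le> i \<and> Suc i < length ts}"
 have "indep_vars (\<lambda>_. borel) D {i. Suc i < length ts}"
  unfolding D_def[abs_def] by (rule X_indep[OF ts nn])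
 then have ind: "indep_var (PiM ?I1 (\<lambda>_. borel)) (\<lambda>w. restrict (\<lambda>i. D i w) ?I1) (PiM ?I2 (\<lambda>_. borel)) (\<lambda>w. restrict (\<lambda>i. D i w) ?I2)"
  by (rule indep_var_restrict) (use p in auto)
 let ?E1 = "{d \<in> space (PiM ?I1 (\<lambda>_. borel)). \<forall>s\<in>J. (\<Sum>i<j s. d i) \<in> A s}"
 let ?E2 = "{d \<in> space (PiM ?I2 (\<lambda>_. borel)). \<forall>s\<in>K. (\<Sum>i\<in>{p..<k s}. d i) \<in> B s}"
 have E1: "?E1 \<in> sets (PiM ?I1 (\<lambda>_. borel :: real measure))"
  by (rule sets_sum_components[OF J(1) A]) (use j(1) in force)+
 have E2: "?E2 \<in> sets (PiM ?I2 (\<lambda>_. borel :: real measure))"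
  by (rule sets_sum_components[OF J(2) B]) (use k(2) in force)+
 have s1: "(\<Sum>i<j s. restrict (\<lambda>i. D i w) ?I1 i) = X (min s r) w" if "s \<in> J" for s w
 proof -
  have "(\<Sum>i<j s. restrict (\<lambda>i. D i w) ?I1 i) = (\<Sum>i<j s. X (ts ! Suc i) w - X (ts ! i) w)"
   using j(1)[OF that] by (intro sum.cong) (auto simp: D_def)
  also have "\<dots> = X (?f s) w - X 0 w"
   using sum_lessThan_telescope[of "\<lambda>i. X (ts ! i) w" "j s"] j(2)[OF that] ts0 by simp
  also have "\<dots> = X (min s r) w"
  proof (cases "min s r \<le> 0")
   case True
   then have "max 0 (min s r) = 0" by (rule max_absorb1)
   then show ?thesis using X_neg[OF True] X_neg[of 0 w] by simp
  next
   case False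
   then have "max 0 (min s r) = min s r" by (intro max_absorb2) linarith
   then show ?thesis using X_neg[of 0 w] by simp
  qed
  finally show ?thesis .
 qed
 have s2: "(\<Sum>i\<in>{p..<k s}. restrict (\<lambda>i. D i w) ?I2 i) = X (?g s) w - X r w" if "s \<in> K" for s w
 proof -
  have "(\<Sum>i\<in>{p..<k s}. restrict (\<lambda>i. D i w) ?I2 i) = (\<Sum>i\<in>{p..<k s}. X (ts ! Suc i) w - X (ts ! i) w)"
   using k(2)[OF that] by (intro sum.cong) (auto simp: D_def)
  also have "\<dots> = X (?g s) w - X r w"
   using sum_Suc_diff'[OF k(1)[OF that], of "\<lambda>i. X (ts ! i) w"] k(3)[OF that] p(2) by simp
  finally show ?thesis .
 qed
 have v1: "(\<lambda>w. restrict (\<lambda>i. D i w) ?I1) -` ?E1 \<inter> space M = {w\<in>space M. \<forall>s\<in>J. X (min s r) w \<in> A s}"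
  using s1 by (auto simp: space_PiM)
 have v2: "(\<lambda>w. restrict (\<lambda>i. D i w) ?I2) -` ?E2 \<inter> space M = {w\<in>space M. \<forall>s\<in>K. X (?g s) w - X r w \<in> B s}"
  using s2 by (auto simp: space_PiM)
 have v: "(\<lambda>x. (restrict (\<lambda>i. D i x) ?I1, restrict (\<lambda>i. D i x) ?I2)) -` (?E1 \<times> ?E2) \<inter> space M
  = ((\<lambda>w. restrict (\<lambda>i. D i w) ?I1) -` ?E1 \<inter> space M) \<inter> ((\<lambda>w. restrict (\<lambda>i. D i w) ?I2) -` ?E2 \<inter> space M)"
  by blast
 show ?thesis using indep_varD[OF ind E1 E2] unfolding v v1 v2 .
qed

text \<open>Cylinders form a generator stable under intersection, so independence extends from them
  to the full sigma-algebras.\<close>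

lemma stopped_restart_indep:
 assumes r: "0 \<le> r"
 shows "indep_var path_space (\<lambda>w. stopped r (traj w)) path_space (\<lambda>w. restart r (traj w))"
proof -
 let ?P = "\<lambda>w. stopped r (traj w)" and ?S = "\<lambda>w. restart r (traj w)"
 let ?G = "prod_algebra (UNIV :: real set) (\<lambda>_. borel :: real measure)"
 have gen: "sigma_sets (space M) {Z -` A \<inter> space M | A. A \<in> sets path_space} = sigma_sets (space M) {Z -` A \<inter> space M | A. A \<in> ?G}"
  for Z :: "'w \<Rightarrow> real \<Rightarrow> real"
 proof -
  have eq: "{Z -` A \<inter> space M | A. A \<in> sets path_space} = sigma_sets (space M) {Z -` A \<inter> space M | A. A \<in> ?G}"
   unfolding sets_PiM by (rule sigma_sets_vimage_commute) auto
  show ?thesis unfolding eq by (rule sigma_sets_sigma_sets_eq) auto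
 qed
 have st: "Int_stable {Z -` A \<inter> space M | A. A \<in> ?G}" for Z :: "'w \<Rightarrow> real \<Rightarrow> real"
 proof (rule Int_stableI)
  fix a b assume "a \<in> {Z -` A \<inter> space M | A. A \<in> ?G}" "b \<in> {Z -` A \<inter> space M | A. A \<in> ?G}"
  then obtain A B where "A \<in> ?G" "B \<in> ?G" "a = Z -` A \<inter> space M" "b = Z -` B \<inter> space M" by blast
  moreover have "A \<inter> B \<in> ?G" if "A \<in> ?G" "B \<in> ?G"
   using Int_stable_prod_algebra[of UNIV "\<lambda>_::real. borel :: real measure"] that unfolding Int_stable_def by auto
  ultimately show "a \<inter> b \<in> {Z -` A \<inter> space M | A. A \<in> ?G}" by (auto intro!: exI[of _ "A \<inter> B"])
 qed
 have m: "?P \<in> measurable M path_space" "?S \<in> measurable M path_space" by measurable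
 have ms: "{Z -` A \<inter> space M | A. A \<in> ?G} \<subseteq> events" if "Z \<in> measurable M path_space" for Z
 proof safe
  fix A assume "A \<in> ?G"
  then have "A \<in> sets path_space" unfolding sets_PiM by (rule sigma_sets.Basic)
  then show "Z -` A \<inter> space M \<in> events" by (rule measurable_sets[OF that])
 qed
 have "indep_set {?P -` A \<inter> space M | A. A \<in> ?G} {?S -` A \<inter> space M | A. A \<in> ?G}"
  unfolding indep_sets2_eq
 proof (intro conjI ballI ms m)
  fix a b assume "a \<in> {?P -` A \<inter> space M | A. A \<in> ?G}" "b \<in> {?S -` A \<inter> space M | A. A \<in> ?G}"
  then obtain A B where AB: "A \<in> ?G" "B \<in> ?G" "a = ?P -` A \<inter> space M" "b = ?S -` B \<inter> space M" by blast
  have cyl: "\<exists>J E. C = prod_emb UNIV (\<lambda>_. borel) J (\<Pi>\<^sub>E j\<in>J. E j) \<and> finite J \<and> (\<forall>i\<in>J. E i \<in> sets borel)"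
   if "C \<in> ?G" for C
   using that by (rule prod_algebraE) blast
  obtain J E where J: "A = prod_emb UNIV (\<lambda>_. borel) J (\<Pi>\<^sub>E j\<in>J. E j)" "finite J" "\<And>i. i \<in> J \<Longrightarrow> E i \<in> sets borel"
   using cyl[OF AB(1)] by blast
  obtain K F where K: "B = prod_emb UNIV (\<lambda>_. borel) K (\<Pi>\<^sub>E j\<in>K. F j)" "finite K" "\<And>i. i \<in> K \<Longrightarrow> F i \<in> sets borel"
   using cyl[OF AB(2)] by blast
  have a: "a = {w\<in>space M. \<forall>s\<in>J. X (min s r) w \<in> E s}"
   by (auto simp: AB J(1) prod_emb_def stopped_def traj_def PiE_iff)
  have b: "b = {w\<in>space M. \<forall>s\<in>K. X (r + max 0 s) w - X r w \<in> F s}"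
   by (auto simp: AB K(1) prod_emb_def restart_def traj_def PiE_iff)
  show "prob (a \<inter> b) = prob a * prob b"
   unfolding a b by (rule stopped_restart_indep_cylinder[OF r J(2) K(2) J(3) K(3)])
 qed
 then have "indep_set (sigma_sets (space M) {?P -` A \<inter> space M | A. A \<in> ?G}) (sigma_sets (space M) {?S -` A \<inter> space M | A. A \<in> ?G})"
  by (rule indep_set_sigma_sets[OF _ st st])
 then show ?thesis unfolding indep_var_eq gen using m by simp
qed

text \<open>Past and future are independent, and the future has the law of the original path; so
  their joint law is a product and Fubini applies. \<open>F\<close> may couple the two paths
  arbitrarily.\<close>

theorem markov:
 assumes r: "0 \<le> r" and F[measurable]: "F \<in> borel_measurable (path_space \<Otimes>\<^sub>M path_space)"
 shows "(\<integral>\<^sup>+w. F (stopped r (traj w), restart r (traj w)) \<partial>M) = (\<integral>\<^sup>+w. (\<integral>\<^sup>+w'. F (stopped r (traj w), traj w') \<partial>M) \<partial>M)"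
proof -
 let ?P = "\<lambda>w. stopped r (traj w)" and ?S = "\<lambda>w. restart r (traj w)"
 interpret L: prob_space "distr M path_space traj" by (rule prob_space_distr) measurable
 have "(\<integral>\<^sup>+w. F (?P w, ?S w) \<partial>M) = (\<integral>\<^sup>+z. F z \<partial>distr M (path_space \<Otimes>\<^sub>M path_space) (\<lambda>w. (?P w, ?S w)))"
  by (subst nn_integral_distr) auto
 also have "distr M (path_space \<Otimes>\<^sub>M path_space) (\<lambda>w. (?P w, ?S w)) = distr M path_space ?P \<Otimes>\<^sub>M distr M path_space traj"
  using stopped_restart_indep[OF r] unfolding indep_var_distribution_eq restart_law[OF r] by simp
 also have "(\<integral>\<^sup>+z. F z \<partial>(distr M path_space ?P \<Otimes>\<^sub>M distr M path_space traj)) =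
  (\<integral>\<^sup>+a. (\<integral>\<^sup>+b. F (a, b) \<partial>distr M path_space traj) \<partial>distr M path_space ?P)"
  by (rule L.nn_integral_fst[symmetric]) simp
 also have "\<dots> = (\<integral>\<^sup>+w. (\<integral>\<^sup>+b. F (?P w, b) \<partial>distr M path_space traj) \<partial>M)"
  by (subst nn_integral_distr) auto
 also have "\<dots> = (\<integral>\<^sup>+w. (\<integral>\<^sup>+w'. F (?P w, traj w') \<partial>M) \<partial>M)"
  by (intro nn_integral_cong, subst nn_integral_distr) auto
 finally show ?thesis .
qed

end

section \<open>Entry times\<close>

text \<open>Regularised evaluation: it agrees with \<open>w s\<close> for right-continuous \<open>w\<close>, and unlike plain
 evaluation it is jointly measurable in \<open>(w, s)\<close> for the product sigma-algebra on paths.\<close>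

definition reg :: "(real \<Rightarrow> real) \<Rightarrow> real \<Rightarrow> real" where
 "reg w s = lim (\<lambda>n. w ((of_int \<lfloor>s * 2^n\<rfloor> + 1) / 2^n))"

lemma reg_measurable[measurable (raw)]:
 assumes [measurable]: "g \<in> measurable N path_space" "f \<in> borel_measurable N"
 shows "(\<lambda>z. reg (g z) (f z)) \<in> borel_measurable N"
 unfolding reg_def
proof (rule borel_measurable_lim_metric)
 fix n :: nat
 have "(\<lambda>z. (\<lambda>i z. g z ((of_int i + 1) / 2^n)) \<lfloor>f z * 2^n\<rfloor> z) \<in> borel_measurable N"
 proof (rule measurable_compose_countable[where f="\<lambda>i z. g z ((of_int i + 1) / 2^n)"])
  show "(\<lambda>z. g z ((of_int i + 1) / 2^n)) \<in> borel_measurable N" for i :: int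
   by (rule measurable_compose[OF assms(1)]) (rule measurable_component_singleton, simp)
 qed measurable
 then show "(\<lambda>z. g z ((of_int \<lfloor>f z * 2^n\<rfloor> + 1) / 2^n)) \<in> borel_measurable N" by simp
qed

text \<open>The approximating points lie strictly to the right of \<open>s\<close>, so
  right-continuity alone gives convergence of path values.\<close>

lemma dyadic_upper:
 "s < (of_int \<lfloor>s * 2^n\<rfloor> + 1) / 2^n" "(of_int \<lfloor>s * 2^n\<rfloor> + 1) / 2^n \<le> s + (1/2)^n" for s :: real
proof -
 have "s * 2^n < of_int \<lfloor>s * 2^n\<rfloor> + 1" by linarith
 then show "s < (of_int \<lfloor>s * 2^n\<rfloor> + 1) / 2^n" by (simp add: less_divide_eq)
 have "of_int \<lfloor>s * 2^n\<rfloor> + 1 \<le> s * 2^n + 1" by linarith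
 then have "(of_int \<lfloor>s * 2^n\<rfloor> + 1) / 2^n \<le> (s * 2^n + 1) / 2^n" by (intro divide_right_mono) auto
 also have "\<dots> = s + (1/2)^n" by (simp add: add_divide_distrib power_divide)
 finally show "(of_int \<lfloor>s * 2^n\<rfloor> + 1) / 2^n \<le> s + (1/2)^n" .
qed

lemma dyadic_upper_tendsto: "(\<lambda>n. (of_int \<lfloor>s * 2^n\<rfloor> + 1) / 2^n) \<longlonglongrightarrow> (s::real)"
proof (rule tendsto_sandwich[of "\<lambda>_. s" _ _ "\<lambda>n. s + (1/2)^n"])
 have "(\<lambda>n. s + (1/2)^n) \<longlonglongrightarrow> s + 0" by (intro tendsto_intros LIMSEQ_realpow_zero) auto
 then show "(\<lambda>n. s + (1/2)^n) \<longlonglongrightarrow> s" by simp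
qed (use dyadic_upper in \<open>auto intro!: always_eventually less_imp_le\<close>)

lemma dyadic_upper_at_right: "filterlim (\<lambda>n. (of_int \<lfloor>s * 2^n\<rfloor> + 1) / 2^n) (at_right (s::real)) sequentially"
 unfolding filterlim_at using dyadic_upper_tendsto dyadic_upper(1)[of s]
 by (intro conjI always_eventually allI) (auto simp: less_imp_neq[THEN not_sym])

lemma right_continuous_dyadic:
 fixes w :: "real \<Rightarrow> real"
 assumes "continuous (at_right s) w"
 shows "(\<lambda>n. w ((of_int \<lfloor>s * 2^n\<rfloor> + 1) / 2^n)) \<longlonglongrightarrow> w s"
 using assms unfolding continuous_within by (rule filterlim_compose[OF _ dyadic_upper_at_right])

lemma reg_eq: "continuous (at_right s) w \<Longrightarrow> reg w s = w s"
 unfolding reg_def by (intro limI right_continuous_dyadic)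

text \<open>Rational times make this a countable union and hence measurable. As the time bound is
  strict and the neighbourhood open, the event is that the entry time is strictly below
  \<open>s\<close>.\<close>

definition hit :: "nat \<Rightarrow> real \<Rightarrow> real \<Rightarrow> (real \<Rightarrow> real) \<Rightarrow> bool" where
 "hit m x s w \<longleftrightarrow> (\<exists>r::rat. 0 \<le> real_of_rat r \<and> real_of_rat r < s \<and> \<bar>x + w (real_of_rat r)\<bar> < 1 / (real m + 1))"

text \<open>Killing happens when \<open>x + w\<close> comes arbitrarily close to \<open>0\<close>, not when it vanishes: unlike the
 hitting time, this is measurable without completion. Almost surely both times coincide.\<close>

definition alive :: "real \<Rightarrow> real \<Rightarrow> (real \<Rightarrow> real) \<Rightarrow> bool" where
 "alive x s w \<longleftrightarrow> (\<exists>m. \<not> hit m x s w)"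

lemma hit_measurable[measurable (raw)]:
 assumes [measurable]: "f \<in> borel_measurable N" "g \<in> borel_measurable N" "h \<in> measurable N path_space"
 shows "Measurable.pred N (\<lambda>z. hit m (f z) (g z) (h z))"
proof -
 have [measurable]: "(\<lambda>z. h z q) \<in> borel_measurable N" for q
  by (rule measurable_compose[OF assms(3)]) (rule measurable_component_singleton, simp)
 show ?thesis unfolding hit_def by measurable
qed

lemma alive_measurable[measurable (raw)]:
 assumes [measurable]: "f \<in> borel_measurable N" "g \<in> borel_measurable N" "h \<in> measurable N path_space"
 shows "Measurable.pred N (\<lambda>z. alive (f z) (g z) (h z))"
 unfolding alive_def by measurable

text \<open>An open condition at \<open>u\<close> persists on a right neighbourhood of
  \<open>u\<close>, which contains rationals below \<open>s\<close>.\<close>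

lemma hit_iff:
 assumes rc: "\<And>t. continuous (at_right t) w"
 shows "hit m x s w \<longleftrightarrow> (\<exists>u\<ge>0. u < s \<and> \<bar>x + w u\<bar> < 1 / (real m + 1))"
proof
 assume "\<exists>u\<ge>0. u < s \<and> \<bar>x + w u\<bar> < 1 / (real m + 1)"
 then obtain u where u: "0 \<le> u" "u < s" "\<bar>x + w u\<bar> < 1 / (real m + 1)" by blast
 have "((\<lambda>t. \<bar>x + w t\<bar>) \<longlongrightarrow> \<bar>x + w u\<bar>) (at_right u)"
  using rc[of u] unfolding continuous_within by (intro tendsto_intros)
 then have "\<forall>\<^sub>F t in at_right u. \<bar>x + w t\<bar> < 1 / (real m + 1)" by (rule order_tendstoD) (rule u)
 then obtain b where b: "b > u" "\<And>t. u < t \<Longrightarrow> t < b \<Longrightarrow> \<bar>x + w t\<bar> < 1 / (real m + 1)"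
  unfolding eventually_at_right_field by blast
 obtain r where r: "u < real_of_rat r" "real_of_rat r < min b s"
  using of_rat_dense[of u "min b s"] b(1) u(2) by auto
 have "0 \<le> real_of_rat r" using r(1) u(1) by linarith
 then show "hit m x s w" unfolding hit_def using b(2) r by (intro exI[of _ r] conjI) auto
qed (unfold hit_def, blast)

lemma hit_mono: "hit m x s w \<Longrightarrow> s \<le> s' \<Longrightarrow> hit m x s' w"
 unfolding hit_def by force

lemma hit_antimono_level: "hit m' x s w \<Longrightarrow> m \<le> m' \<Longrightarrow> hit m x s w"
proof -
 assume "hit m' x s w" "m \<le> m'"
 moreover have "1 / (real m' + 1) \<le> 1 / (real m + 1)" using \<open>m \<le> m'\<close> by (intro divide_left_mono) auto
 ultimately show "hit m x s w" unfolding hit_def by (meson less_le_trans)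
qed

text \<open>Entry before \<open>s\<close> is decided by the path up to \<open>s\<close>; this
  qualifies it as a past event in the Markov property.\<close>

lemma hit_stopped: "s \<le> r \<Longrightarrow> hit m x s (stopped r w) \<longleftrightarrow> hit m x s w"
 unfolding hit_def stopped_def by (intro ex_cong1) (auto simp: min_def)


lemma restart_rc:
 assumes rc: "\<And>t. continuous (at_right t) w"
 shows "continuous (at_right t) (restart r w)"
proof -
 have "((\<lambda>u. w (r + max 0 u)) \<longlongrightarrow> w (r + max 0 t)) (at_right t)"
 proof (cases "0 \<le> t")
  case True
  have "filterlim (\<lambda>u. r + max 0 u) (at_right (r + max 0 t)) (at_right t)"
   unfolding filterlim_at
  proof
   show "((\<lambda>u. r + max 0 u) \<longlongrightarrow> r + max 0 t) (at_right t)" by (intro tendsto_intros)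
   show "\<forall>\<^sub>F u in at_right t. r + max 0 u \<in> {r + max 0 t<..} \<and> r + max 0 u \<noteq> r + max 0 t"
    using eventually_at_right_less[of t] by eventually_elim (use True in auto)
  qed
  then show ?thesis using rc[of "r + max 0 t"] unfolding continuous_within by (rule filterlim_compose[rotated])
 next
  case False
  have "\<forall>\<^sub>F u in at_right t. u < 0"
   unfolding eventually_at_right_field by (intro exI[of _ 0]) (use False in auto)
  then have "\<forall>\<^sub>F u in at_right t. w (r + max 0 u) = w (r + max 0 t)"
   by eventually_elim (use False in \<open>simp add: max_absorb1\<close>)
  then show ?thesis by (rule tendsto_eventually)
 qed
 then show ?thesis unfolding continuous_within restart_def by (intro tendsto_diff tendsto_const)
qed

text \<open>The entry time of \<open>x + w\<close> into a neighbourhood of \<open>0\<close>, written as a Lebesgue measure to make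
 its measurability evident; it is \<open>0\<close> if there is no entry.\<close>

definition entry :: "nat \<Rightarrow> real \<Rightarrow> (real \<Rightarrow> real) \<Rightarrow> real" where
 "entry m x w = enn2real (\<integral>\<^sup>+s. indicator {s. 0 \<le> s \<and> \<not> hit m x s w} s \<partial>lborel)"

lemma entry_measurable[measurable (raw)]:
 assumes [measurable]: "f \<in> borel_measurable N" "h \<in> measurable N path_space"
 shows "(\<lambda>z. entry m (f z) (h z)) \<in> borel_measurable N"
 unfolding entry_def indicator_def by measurable

text \<open>The entry time is the infimum of the times spent in the neighbourhood. By strictness,
  absence of a hit up to \<open>s\<close> means that \<open>s\<close> is at most this infimum.
  Right-continuity places the position at the entry time in the closed neighbourhood, whether it is
  reached continuously or by a jump.\<close>

lemma entry_props:
 assumes rc: "\<And>t. continuous (at_right t) w" and h: "hit m x s w"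
 shows "0 \<le> entry m x w" "hit m x t w \<longleftrightarrow> entry m x w < t" "\<bar>x + w (entry m x w)\<bar> \<le> 1 / (real m + 1)"
proof -
 define S where "S = {u. 0 \<le> u \<and> \<bar>x + w u\<bar> < 1 / (real m + 1)}"
 define T where "T = Inf S"
 have ne: "S \<noteq> {}" using h unfolding hit_iff[OF rc] S_def by blast
 have bd: "bdd_below S" by (auto simp: S_def bdd_below_def)
 have T0: "0 \<le> T" unfolding T_def by (rule cInf_greatest[OF ne]) (simp add: S_def)
 have hT: "hit m x t w \<longleftrightarrow> T < t" for t
  unfolding hit_iff[OF rc] T_def cInf_less_iff[OF ne bd] by (auto simp: S_def)
 have "entry m x w = T"
 proof -
  have "{s. 0 \<le> s \<and> \<not> hit m x s w} = {0..T}" by (auto simp: hT)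
  then show ?thesis unfolding entry_def using T0 by simp
 qed
 moreover have "\<bar>x + w T\<bar> \<le> 1 / (real m + 1)"
 proof (rule ccontr)
  assume neg: "\<not> \<bar>x + w T\<bar> \<le> 1 / (real m + 1)"
  have "((\<lambda>t. \<bar>x + w t\<bar>) \<longlongrightarrow> \<bar>x + w T\<bar>) (at_right T)"
   using rc[of T] unfolding continuous_within by (intro tendsto_intros)
  then have "\<forall>\<^sub>F t in at_right T. \<bar>x + w t\<bar> > 1 / (real m + 1)" by (rule order_tendstoD) (use neg in simp)
  then obtain b where b: "b > T" "\<And>t. T < t \<Longrightarrow> t < b \<Longrightarrow> \<bar>x + w t\<bar> > 1 / (real m + 1)"
   unfolding eventually_at_right_field by blast
  then obtain u where u: "u \<in> S" "u < b" using cInf_less_iff[OF ne bd, of b] unfolding T_def by auto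
  have "T \<le> u" unfolding T_def by (rule cInf_lower[OF u(1) bd])
  then show False using b(2)[of u] u neg by (cases "u = T") (auto simp: S_def)
 qed
 ultimately show "0 \<le> entry m x w" "hit m x t w \<longleftrightarrow> entry m x w < t" "\<bar>x + w (entry m x w)\<bar> \<le> 1 / (real m + 1)"
  using T0 hT by auto
qed

context stable_motion
begin

abbreviation discounted :: "real \<Rightarrow> (real \<Rightarrow> ennreal) \<Rightarrow> real \<Rightarrow> 'w \<Rightarrow> real set \<Rightarrow> ennreal" where
 "discounted \<beta> f x w S \<equiv> \<integral>\<^sup>+s\<in>S. ennreal (exp (- \<beta> * s)) * f (x + X s w) \<partial>lborel"

abbreviation before :: "nat \<Rightarrow> real \<Rightarrow> 'w \<Rightarrow> real set" where "before m x w \<equiv> {s. 0 \<le> s \<and> \<not> hit m x s (traj w)}"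

abbreviation after :: "nat \<Rightarrow> real \<Rightarrow> 'w \<Rightarrow> real set" where "after m x w \<equiv> {s. 0 \<le> s \<and> hit m x s (traj w)}"

abbreviation life_span :: "real \<Rightarrow> 'w \<Rightarrow> real set" where "life_span x w \<equiv> {s. 0 \<le> s \<and> alive x s (traj w)}"

lemma X_rc: "continuous (at_right t) (\<lambda>s. X s w)" using X_cadlag by (simp add: cadlag_def)

lemma traj_rc: "continuous (at_right t) (traj w)"
proof -
 have "traj w = (\<lambda>s. X s w)" by (intro ext) (simp add: traj_def)
 then show ?thesis using X_rc by simp
qed

lemma reg_traj: "reg (traj w) s = X s w" using reg_eq[OF traj_rc] by (simp add: traj_def)

lemma X_comp_measurable[measurable (raw)]:
 assumes [measurable]: "f \<in> borel_measurable N" "g \<in> measurable N M"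
 shows "(\<lambda>z. X (f z) (g z)) \<in> borel_measurable N"
proof -
 have "(\<lambda>z. reg (traj (g z)) (f z)) \<in> borel_measurable N" by measurable
 then show ?thesis by (simp add: reg_traj)
qed

lemma reg_restart: "0 \<le> s \<Longrightarrow> reg (restart r (traj w)) s = X (r + s) w - X r w"
 using reg_eq[OF restart_rc[OF traj_rc]] by (simp add: restart_def traj_def)

lemma char_X: "0 \<le> s \<Longrightarrow> char (distr M borel (X s)) \<theta> = complex_of_real (exp (- s * \<bar>\<theta>\<bar> powr \<alpha>))"
 using X_char[of 0 s \<theta>] by (simp add: X_neg)

text \<open>Evaluate \<open>X\<close> at an independent exponential time of rate
  \<open>\<beta>\<close>: the result has characteristic function
  \<open>\<beta> / (\<beta> + \<bar>\<theta>\<bar> powr \<alpha>)\<close>, so Fourier inversion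
  yields the density \<open>\<beta> * pot \<alpha> \<beta>\<close>. Nonnegativity of
  \<open>pot\<close> has the same source.\<close>

lemma potential_density:
 assumes \<beta>: "0 < \<beta>" and f[measurable]: "f \<in> borel_measurable borel"
 shows "0 \<le> pot \<alpha> \<beta> y"
  "(\<integral>\<^sup>+w. (\<integral>\<^sup>+s\<in>{0..}. ennreal (exp (- \<beta> * s)) * f (X s w) \<partial>lborel) \<partial>M)
   = (\<integral>\<^sup>+y. f y * ennreal (pot \<alpha> \<beta> y) \<partial>lborel)"
proof -
 let ?E = "density lborel (\<lambda>s. ennreal (exponential_density \<beta> s))"
 interpret E: prob_space ?E by (rule prob_space_exponential_density[OF \<beta>])
 interpret P: pair_prob_space M ?E ..
 let ?R = "distr (M \<Otimes>\<^sub>M ?E) borel (\<lambda>(w, s). X s w)"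
 have Xm: "(\<lambda>(w, s). X s w) \<in> borel_measurable (M \<Otimes>\<^sub>M ?E)" by measurable
 interpret R: real_distribution ?R by (intro real_distribution_distr P.real_distribution_distr Xm)
 let ?\<phi> = "\<lambda>\<theta>. \<beta> * (1 / (\<beta> + \<bar>\<theta>\<bar> powr \<alpha>))"
 have char: "char ?R \<theta> = complex_of_real (?\<phi> \<theta>)" for \<theta>
 proof -
  let ?c = "\<bar>\<theta>\<bar> powr \<alpha>"
  have int: "integrable (M \<Otimes>\<^sub>M ?E) (\<lambda>(w, s). iexp (\<theta> * X s w))"
   by (rule P.integrable_const_bound[where B=1]) auto
  have "char ?R \<theta> = (\<integral>p. (case p of (w, s) \<Rightarrow> iexp (\<theta> * X s w)) \<partial>(M \<Otimes>\<^sub>M ?E))"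
   unfolding char_def by (subst integral_distr[OF Xm]) (auto simp: case_prod_unfold)
  also have "\<dots> = (\<integral>s. (\<integral>w. iexp (\<theta> * X s w) \<partial>M) \<partial>?E)"
   by (rule P.integral_snd[symmetric, OF int])
  also have "\<dots> = (\<integral>s. complex_of_real (exponential_density \<beta> s * exp (- s * ?c)) \<partial>lborel)"
  proof (subst integral_density)
   show "(\<integral>s. exponential_density \<beta> s *\<^sub>R (\<integral>w. iexp (\<theta> * X s w) \<partial>M) \<partial>lborel) =
    (\<integral>s. complex_of_real (exponential_density \<beta> s * exp (- s * ?c)) \<partial>lborel)"
   proof (intro Bochner_Integration.integral_cong refl)
    fix s :: real
    show "exponential_density \<beta> s *\<^sub>R (\<integral>w. iexp (\<theta> * X s w) \<partial>M) = complex_of_real (exponential_density \<beta> s * exp (- s * ?c))"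
    proof (cases "s < 0")
     case False
     then have "(\<integral>w. iexp (\<theta> * X s w) \<partial>M) = complex_of_real (exp (- s * ?c))"
      using char_X[of s \<theta>] integral_distr[of "X s" M borel "\<lambda>x. iexp (\<theta> * x)"] by (simp add: char_def)
     then show ?thesis by (simp add: scaleR_conv_of_real)
    qed (simp add: exponential_density_def)
   qed
  qed (use \<beta> in \<open>auto simp: exponential_density_nonneg\<close>)
  also have "\<dots> = complex_of_real (\<integral>s. exponential_density \<beta> s * exp (- s * ?c) \<partial>lborel)"
   by (rule integral_complex_of_real)
  also have "(\<integral>s. exponential_density \<beta> s * exp (- s * ?c) \<partial>lborel) = (\<integral>s. \<beta> / (\<beta> + ?c) * exponential_density (\<beta> + ?c) s \<partial>lborel)"
  proof (intro Bochner_Integration.integral_cong refl)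
   fix s :: real
   have "\<beta> + ?c \<noteq> 0" using \<beta> powr_ge_zero[of "\<bar>\<theta>\<bar>" \<alpha>] by linarith
   moreover have "exp (- s * \<beta>) * exp (- s * ?c) = exp (- s * (\<beta> + ?c))" by (simp add: exp_add[symmetric] algebra_simps)
   ultimately show "exponential_density \<beta> s * exp (- s * ?c) = \<beta> / (\<beta> + ?c) * exponential_density (\<beta> + ?c) s"
    by (simp add: exponential_density_def)
  qed
  also have "\<dots> = \<beta> / (\<beta> + ?c) * (\<integral>s. exponential_density (\<beta> + ?c) s \<partial>lborel)" by simp
  also have "(\<integral>s. exponential_density (\<beta> + ?c) s \<partial>lborel) = 1"
  proof -
   have pos: "0 < \<beta> + ?c" using \<beta> by (simp add: add_pos_nonneg)
   interpret E': prob_space "density lborel (\<lambda>s. ennreal (exponential_density (\<beta> + ?c) s))"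
    by (rule prob_space_exponential_density[OF pos])
   have "(\<integral>s. 1 \<partial>density lborel (\<lambda>s. ennreal (exponential_density (\<beta> + ?c) s))) = (1::real)"
    using E'.prob_space by simp
   then show ?thesis
    by (subst (asm) integral_density) (use pos in \<open>auto simp: exponential_density_nonneg\<close>)
  qed
  finally show ?thesis by simp
 qed
 have int: "integrable lborel ?\<phi>" by (intro integrable_mult_right resolvent_symbol_integrable \<alpha> \<beta>)
 have q: "\<beta> * pot \<alpha> \<beta> y = (1 / (2 * pi)) * (\<integral>t. cos (t * y) * ?\<phi> t \<partial>lborel)" for y
 proof -
  have "(\<integral>t. cos (t * y) * ?\<phi> t \<partial>lborel) = (\<integral>t. \<beta> * (cos (t * y) * (1 / (\<beta> + \<bar>t\<bar> powr \<alpha>))) \<partial>lborel)"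
   by (intro Bochner_Integration.integral_cong) auto
  also have "\<dots> = \<beta> * (\<integral>t. cos (t * y) * (1 / (\<beta> + \<bar>t\<bar> powr \<alpha>)) \<partial>lborel)" by (rule integral_mult_right_zero)
  finally show ?thesis unfolding pot_def by simp
 qed
 have "0 \<le> \<beta> * pot \<alpha> \<beta> y" for y by (rule R.inversion_nonneg[OF char int q])
 then show nn: "0 \<le> pot \<alpha> \<beta> y" for y using \<beta> by (simp add: zero_le_mult_iff)
 have pm[measurable]: "pot \<alpha> \<beta> \<in> borel_measurable borel" by (rule pot_measurable[OF \<alpha> \<beta>])
 have dens: "?R = density lborel (\<lambda>y. ennreal (\<beta> * pot \<alpha> \<beta> y))" by (rule R.inversion_density[OF char int q])
 have "ennreal \<beta> * (\<integral>\<^sup>+w. (\<integral>\<^sup>+s\<in>{0..}. ennreal (exp (- \<beta> * s)) * f (X s w) \<partial>lborel) \<partial>M)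
  = (\<integral>\<^sup>+w. (\<integral>\<^sup>+s. f (X s w) \<partial>?E) \<partial>M)"
 proof (subst nn_integral_cmult[symmetric], measurable, intro nn_integral_cong)
  fix w assume [simp]: "w \<in> space M"
  have [measurable]: "(\<lambda>s. X s w) \<in> borel_measurable borel" by measurable
  have "(\<integral>\<^sup>+s. f (X s w) \<partial>?E) = (\<integral>\<^sup>+s. ennreal (exponential_density \<beta> s) * f (X s w) \<partial>lborel)"
   by (rule nn_integral_density) auto
  also have "\<dots> = (\<integral>\<^sup>+s. ennreal \<beta> * (ennreal (exp (- \<beta> * s)) * f (X s w) * indicator {0..} s) \<partial>lborel)"
   using \<beta> by (intro nn_integral_cong) (auto simp: exponential_density_def ennreal_mult' mult_ac split: split_indicator)
  also have "\<dots> = ennreal \<beta> * (\<integral>\<^sup>+s\<in>{0..}. ennreal (exp (- \<beta> * s)) * f (X s w) \<partial>lborel)"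
   by (rule nn_integral_cmult) measurable
  finally show "ennreal \<beta> * (\<integral>\<^sup>+s\<in>{0..}. ennreal (exp (- \<beta> * s)) * f (X s w) \<partial>lborel) = (\<integral>\<^sup>+s. f (X s w) \<partial>?E)" by simp
 qed
 also have "\<dots> = (\<integral>\<^sup>+p. f (case p of (w, s) \<Rightarrow> X s w) \<partial>(M \<Otimes>\<^sub>M ?E))"
  by (subst E.nn_integral_fst[symmetric]) auto
 also have "\<dots> = (\<integral>\<^sup>+y. f y \<partial>?R)" by (rule nn_integral_distr[OF Xm, symmetric]) simp
 also have "\<dots> = (\<integral>\<^sup>+y. ennreal (\<beta> * pot \<alpha> \<beta> y) * f y \<partial>lborel)"
  unfolding dens by (rule nn_integral_density) auto
 also have "\<dots> = ennreal \<beta> * (\<integral>\<^sup>+y. f y * ennreal (pot \<alpha> \<beta> y) \<partial>lborel)"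
  using \<beta> nn by (subst nn_integral_cmult[symmetric]) (auto simp: ennreal_mult mult_ac intro!: nn_integral_cong)
 finally show "(\<integral>\<^sup>+w. (\<integral>\<^sup>+s\<in>{0..}. ennreal (exp (- \<beta> * s)) * f (X s w) \<partial>lborel) \<partial>M)
   = (\<integral>\<^sup>+y. f y * ennreal (pot \<alpha> \<beta> y) \<partial>lborel)"
  using \<beta> by (simp add: ennreal_mult_cancel_left)
qed

definition potV :: "real \<Rightarrow> (real \<Rightarrow> ennreal) \<Rightarrow> real \<Rightarrow> ennreal" where
 "potV \<beta> f z = (\<integral>\<^sup>+w. discounted \<beta> f z w {0..} \<partial>M)"

lemma potV_eq:
 assumes \<beta>: "0 < \<beta>" and f[measurable]: "f \<in> borel_measurable borel"
 shows "potV \<beta> f z = (\<integral>\<^sup>+y. f y * ennreal (pot \<alpha> \<beta> (y - z)) \<partial>lborel)"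
proof -
 have pm[measurable]: "pot \<alpha> \<beta> \<in> borel_measurable borel" by (rule pot_measurable[OF \<alpha> \<beta>])
 have "potV \<beta> f z = (\<integral>\<^sup>+y. f (z + y) * ennreal (pot \<alpha> \<beta> y) \<partial>lborel)"
  unfolding potV_def by (rule potential_density(2)[OF \<beta>]) measurable
 also have "\<dots> = (\<integral>\<^sup>+y. f y * ennreal (pot \<alpha> \<beta> (y - z)) \<partial>lborel)"
  by (subst (2) nn_integral_real_affine[where c=1 and t=z]) auto
 finally show ?thesis .
qed

end

lemma measurable_indicator_atLeast[measurable (raw)]:
 fixes f g :: "'a \<Rightarrow> real"
 assumes [measurable]: "g \<in> borel_measurable N" "f \<in> borel_measurable N"
 shows "(\<lambda>z. indicator {g z..} (f z) :: ennreal) \<in> borel_measurable N"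
 unfolding indicator_def atLeast_iff by measurable

context stable_motion
begin

lemma discounted_time_le:
 assumes \<beta>: "0 < \<beta>" and f: "\<And>y. f y \<le> ennreal B" and B: "0 \<le> B" and S: "S \<subseteq> {0..}"
 shows "(\<integral>\<^sup>+s\<in>S. ennreal (exp (- \<beta> * s)) * f (g s) \<partial>lborel) \<le> ennreal (B / \<beta>)"
proof -
 have E1: "(\<integral>\<^sup>+s. ennreal (exponential_density \<beta> s) \<partial>lborel) = 1"
 proof -
  interpret E: prob_space "density lborel (\<lambda>s. ennreal (exponential_density \<beta> s))" by (rule prob_space_exponential_density[OF \<beta>])
  show ?thesis using E.emeasure_space_1 by (simp add: emeasure_density)
 qed
 have "(\<integral>\<^sup>+s\<in>S. ennreal (exp (- \<beta> * s)) * f (g s) \<partial>lborel) \<le> (\<integral>\<^sup>+s. ennreal (B / \<beta>) * ennreal (exponential_density \<beta> s) \<partial>lborel)"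
 proof (rule nn_integral_mono)
  fix s :: real
  show "ennreal (exp (- \<beta> * s)) * f (g s) * indicator S s \<le> ennreal (B / \<beta>) * ennreal (exponential_density \<beta> s)"
  proof (cases "s \<in> S")
   case True
   then have "0 \<le> s" using S by auto
   have "ennreal (exp (- \<beta> * s)) * f (g s) \<le> ennreal (exp (- \<beta> * s)) * ennreal B" by (intro mult_left_mono f) auto
   also have "\<dots> = ennreal (B / \<beta>) * ennreal (exponential_density \<beta> s)"
    using \<beta> B \<open>0 \<le> s\<close> by (simp add: exponential_density_def ennreal_mult[symmetric] mult_ac)
   finally show ?thesis using True by simp
  qed simp
 qed
 also have "\<dots> = ennreal (B / \<beta>)" by (subst nn_integral_cmult) (auto simp: E1)
 finally show ?thesis .
qed

lemma X_time_measurable: "w \<in> space M \<Longrightarrow> (\<lambda>s. X s w) \<in> borel_measurable borel" by measurable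

definition enters :: "nat \<Rightarrow> real \<Rightarrow> 'w \<Rightarrow> bool" where
 "enters m x w \<longleftrightarrow> (\<exists>k::nat. hit m x (real k) (traj w))"

lemma enters_measurable[measurable]: "Measurable.pred M (enters m x)"
 unfolding enters_def[abs_def] by measurable

abbreviation ent :: "nat \<Rightarrow> real \<Rightarrow> 'w \<Rightarrow> real" where "ent m x w \<equiv> entry m x (traj w)"

lemma hit_imp_enters: assumes "hit m x s (traj w)" shows "enters m x w"
proof -
 obtain k :: nat where "s \<le> real k" using real_arch_simple by blast
 then show ?thesis unfolding enters_def using hit_mono[OF assms] by blast
qed

lemma ent_props:
 assumes "enters m x w"
 shows "0 \<le> ent m x w" "hit m x t (traj w) \<longleftrightarrow> ent m x w < t" "\<bar>x + X (ent m x w) w\<bar> \<le> 1 / (real m + 1)"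
 using assms entry_props[OF traj_rc, of m x _ w] unfolding enters_def traj_def by blast+

text \<open>An event unchanged by stopping at \<open>r\<close> is a function of the stopped path,
  and so is \<open>X r\<close>; both therefore count as past.\<close>

lemma markov_indicator:
 assumes r: "0 \<le> r" and G: "(\<lambda>(y, g). G y g) \<in> borel_measurable (borel \<Otimes>\<^sub>M path_space)"
  and Q: "Measurable.pred path_space Q" "\<And>w. Q (stopped r (traj w)) \<longleftrightarrow> Q (traj w)"
 shows "(\<integral>\<^sup>+w. indicator {w. Q (traj w)} w * G (X r w) (restart r (traj w)) \<partial>M)
  = (\<integral>\<^sup>+w. indicator {w. Q (traj w)} w * (\<integral>\<^sup>+w'. G (X r w) (traj w') \<partial>M) \<partial>M)"
proof -
 note [measurable] = Q(1)
 let ?F = "\<lambda>z. indicator {p. Q p} (fst z) * G (fst z r) (snd z)"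
 have "(\<lambda>z. (fst z r, snd z)) \<in> measurable (path_space \<Otimes>\<^sub>M path_space) (borel \<Otimes>\<^sub>M path_space)"
  by (intro measurable_Pair measurable_snd measurable_compose[OF measurable_fst measurable_component_singleton]) simp
 from measurable_compose[OF this G] have F: "?F \<in> borel_measurable (path_space \<Otimes>\<^sub>M path_space)"
  by (intro borel_measurable_times_ennreal) (unfold indicator_def, auto)
 have e: "?F (stopped r (traj w), g) = indicator {w. Q (traj w)} w * G (X r w) g" for w g
  using Q(2)[of w] by (simp add: stopped_def traj_def indicator_def)
 have "(\<integral>\<^sup>+w'. indicator {w. Q (traj w)} w * G (X r w) (traj w') \<partial>M) = indicator {w. Q (traj w)} w * (\<integral>\<^sup>+w'. G (X r w) (traj w') \<partial>M)" for w
  by (simp add: indicator_def)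
 then show ?thesis using markov[OF r F] unfolding e by simp
qed

text \<open>Shifting the time variable by \<open>r\<close> pulls out the discount
  \<open>exp (- \<beta> * r)\<close> and leaves the potential of the restarted path.\<close>

lemma markov_after:
 assumes r: "0 \<le> r" and f[measurable]: "f \<in> borel_measurable borel"
  and Q: "Measurable.pred path_space Q" "\<And>w. Q (stopped r (traj w)) \<longleftrightarrow> Q (traj w)"
 shows "(\<integral>\<^sup>+w. indicator {w. Q (traj w)} w * discounted \<beta> f x w {r..} \<partial>M)
  = (\<integral>\<^sup>+w. indicator {w. Q (traj w)} w * (ennreal (exp (- \<beta> * r)) * potV \<beta> f (x + X r w)) \<partial>M)"
proof -
 let ?G = "\<lambda>y g. \<integral>\<^sup>+s\<in>{0..}. ennreal (exp (- \<beta> * (r + s))) * f (x + y + reg g s) \<partial>lborel"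
 have G: "(\<lambda>(y, g). ?G y g) \<in> borel_measurable (borel \<Otimes>\<^sub>M path_space)" unfolding case_prod_unfold by measurable
 have L: "discounted \<beta> f x w {r..} = ?G (X r w) (restart r (traj w))" if "w \<in> space M" for w
 proof -
  note [measurable] = X_time_measurable[OF that]
  have "?G (X r w) (restart r (traj w)) = (\<integral>\<^sup>+s\<in>{0..}. ennreal (exp (- \<beta> * (r + s))) * f (x + X (r + s) w) \<partial>lborel)"
   by (intro nn_integral_cong) (auto simp: reg_restart split: split_indicator)
  also have "\<dots> = discounted \<beta> f x w {r..}"
   by (subst (2) nn_integral_real_affine[where c=1 and t=r]) (auto intro!: nn_integral_cong split: split_indicator)
  finally show ?thesis ..
 qed
 have R: "(\<integral>\<^sup>+w'. ?G y (traj w') \<partial>M) = ennreal (exp (- \<beta> * r)) * potV \<beta> f (x + y)" for y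
 proof -
  have "(\<integral>\<^sup>+w'. ?G y (traj w') \<partial>M) = (\<integral>\<^sup>+w'. ennreal (exp (- \<beta> * r)) * discounted \<beta> f (x + y) w' {0..} \<partial>M)"
  proof (rule nn_integral_cong)
   fix w' assume "w' \<in> space M"
   note [measurable] = X_time_measurable[OF this]
   have "?G y (traj w') = (\<integral>\<^sup>+s. ennreal (exp (- \<beta> * r)) * (ennreal (exp (- \<beta> * s)) * f (x + y + X s w') * indicator {0..} s) \<partial>lborel)"
    by (intro nn_integral_cong) (simp add: reg_traj distrib_left exp_add exp_diff ennreal_mult mult_ac exp_minus divide_inverse)
   also have "\<dots> = ennreal (exp (- \<beta> * r)) * discounted \<beta> f (x + y) w' {0..}"
    by (rule nn_integral_cmult) measurable
   finally show "?G y (traj w') = ennreal (exp (- \<beta> * r)) * discounted \<beta> f (x + y) w' {0..}" .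
  qed
  then show ?thesis unfolding potV_def by (simp add: nn_integral_cmult)
 qed
 have "(\<integral>\<^sup>+w. indicator {w. Q (traj w)} w * discounted \<beta> f x w {r..} \<partial>M) = (\<integral>\<^sup>+w. indicator {w. Q (traj w)} w * ?G (X r w) (restart r (traj w)) \<partial>M)"
  by (rule nn_integral_cong) (simp only: L)
 then show ?thesis unfolding markov_indicator[OF r G Q] R .
qed

text \<open>The entry time is approximated from above by dyadic times.\<close>

lemma strong_markov_entry:
 assumes \<beta>: "0 < \<beta>" and f[measurable]: "f \<in> borel_measurable borel" and fB: "\<And>y. f y \<le> ennreal B" "0 \<le> B"
  and v: "\<And>z. isCont v z" "\<And>z. potV \<beta> f z = ennreal (v z)"
 shows "(\<integral>\<^sup>+w. discounted \<beta> f x w (after m x w) \<partial>M)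
  = (\<integral>\<^sup>+w. indicator {w. enters m x w} w * (ennreal (exp (- \<beta> * ent m x w)) * potV \<beta> f (x + X (ent m x w) w)) \<partial>M)"
proof -
 let ?T = "ent m x"
 let ?I = "\<lambda>w. indicator {w. enters m x w} w :: ennreal"
 \<comment> \<open>Dyadic times strictly above the entry time and tending to it.\<close>
 define \<tau> where "\<tau> n w = (of_int \<lfloor>?T w * 2^n\<rfloor> + 1) / (2::real)^n" for n w
 have \<tau>_meas[measurable]: "\<tau> n \<in> borel_measurable M" for n unfolding \<tau>_def[abs_def] by measurable
 let ?A = "\<lambda>r w. \<integral>\<^sup>+s\<in>{r..}. ennreal (exp (- \<beta> * s)) * f (x + X s w) \<partial>lborel"
 let ?C = "\<lambda>r w. ennreal (exp (- \<beta> * r)) * potV \<beta> f (x + X r w)"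
 have v_meas[measurable]: "v \<in> borel_measurable borel"
  by (intro borel_measurable_continuous_onI continuous_at_imp_continuous_on ballI v)
 have V_meas[measurable]: "potV \<beta> f \<in> borel_measurable borel"
  using v(2) by (simp add: measurable_cong[of borel "potV \<beta> f" "\<lambda>z. ennreal (v z)"])
 \<comment> \<open>The entry time lies in \<open>[j / 2^n, (j + 1) / 2^n)\<close>. This is decided
   at time \<open>(j + 1) / 2^n\<close>, so the Markov property at that fixed time applies.\<close>
 define e where "e n j w \<longleftrightarrow> hit m x (real (Suc j) / 2^n) (traj w) \<and> \<not> hit m x (real j / 2^n) (traj w)" for n j w
 have e_meas[measurable]: "Measurable.pred M (e n j)" for n j unfolding e_def[abs_def] by measurable
 have e_iff: "e n j w \<longleftrightarrow> enters m x w \<and> j = nat \<lfloor>?T w * 2^n\<rfloor>" for n j w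
 proof (cases "enters m x w")
  case True
  have "e n j w \<longleftrightarrow> real j / 2^n \<le> ?T w \<and> ?T w < real (Suc j) / 2^n"
   unfolding e_def ent_props(2)[OF True] by auto
  also have "\<dots> \<longleftrightarrow> real_of_int (int j) \<le> ?T w * 2^n \<and> ?T w * 2^n < real_of_int (int j) + 1"
   by (simp add: divide_le_eq less_divide_eq add.commute)
  also have "\<dots> \<longleftrightarrow> \<lfloor>?T w * 2^n\<rfloor> = int j" by (rule floor_eq_iff[symmetric])
  also have "\<dots> \<longleftrightarrow> j = nat \<lfloor>?T w * 2^n\<rfloor>" using ent_props(1)[OF True] by auto
  finally show ?thesis using True by simp
 qed (use hit_imp_enters in \<open>auto simp: e_def\<close>)
 \<comment> \<open>For each \<open>w\<close> that enters, exactly one index \<open>j\<close>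
   contributes, and there the fixed time is \<open>\<tau> n w\<close>.\<close>
 have collapse: "(\<Sum>j. indicator {w. e n j w} w * c (real (Suc j) / 2^n)) = ?I w * c (\<tau> n w)" for n w and c :: "real \<Rightarrow> ennreal"
 proof (cases "enters m x w")
  case True
  let ?j = "nat \<lfloor>?T w * 2^n\<rfloor>"
  have "(\<Sum>j. indicator {w. e n j w} w * c (real (Suc j) / 2^n)) = (\<Sum>j\<in>{?j}. indicator {w. e n j w} w * c (real (Suc j) / 2^n))"
   by (rule suminf_finite) (auto simp: e_iff)
  also have "\<dots> = c (real (Suc ?j) / 2^n)" using True by (simp add: e_iff)
  also have "real (Suc ?j) / 2^n = \<tau> n w"
   using ent_props(1)[OF True] by (simp add: \<tau>_def add.commute of_nat_nat)
  finally show ?thesis using True by simp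
 qed (simp add: e_iff)
 have grid: "(\<integral>\<^sup>+w. ?I w * ?A (\<tau> n w) w \<partial>M) = (\<integral>\<^sup>+w. ?I w * ?C (\<tau> n w) w \<partial>M)" for n
 proof -
  have step: "(\<integral>\<^sup>+w. indicator {w. e n j w} w * ?A (real (Suc j) / 2^n) w \<partial>M)
   = (\<integral>\<^sup>+w. indicator {w. e n j w} w * ?C (real (Suc j) / 2^n) w \<partial>M)" for j
   unfolding e_def
  proof (rule markov_after)
   show "Measurable.pred path_space (\<lambda>p. hit m x (real (Suc j) / 2^n) p \<and> \<not> hit m x (real j / 2^n) p)" by measurable
   show "(hit m x (real (Suc j) / 2^n) (stopped (real (Suc j) / 2^n) (traj w)) \<and> \<not> hit m x (real j / 2^n) (stopped (real (Suc j) / 2^n) (traj w)))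
    \<longleftrightarrow> (hit m x (real (Suc j) / 2^n) (traj w) \<and> \<not> hit m x (real j / 2^n) (traj w))" for w
    by (subst (1 2) hit_stopped) (auto intro: divide_right_mono)
  qed auto
  have "(\<integral>\<^sup>+w. ?I w * ?A (\<tau> n w) w \<partial>M) = (\<integral>\<^sup>+w. (\<Sum>j. indicator {w. e n j w} w * ?A (real (Suc j) / 2^n) w) \<partial>M)"
   by (intro nn_integral_cong collapse[symmetric])
  also have "\<dots> = (\<Sum>j. \<integral>\<^sup>+w. indicator {w. e n j w} w * ?A (real (Suc j) / 2^n) w \<partial>M)"
   by (rule nn_integral_suminf) measurable
  also have "\<dots> = (\<Sum>j. \<integral>\<^sup>+w. indicator {w. e n j w} w * ?C (real (Suc j) / 2^n) w \<partial>M)" by (simp only: step)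
  also have "\<dots> = (\<integral>\<^sup>+w. (\<Sum>j. indicator {w. e n j w} w * ?C (real (Suc j) / 2^n) w) \<partial>M)"
   by (rule nn_integral_suminf[symmetric]) measurable
  also have "\<dots> = (\<integral>\<^sup>+w. ?I w * ?C (\<tau> n w) w \<partial>M)"
   by (intro nn_integral_cong collapse)
  finally show ?thesis .
 qed
 have potV_le: "potV \<beta> f z \<le> ennreal (B / \<beta>)" for z
 proof -
  have "potV \<beta> f z \<le> (\<integral>\<^sup>+w. ennreal (B / \<beta>) \<partial>M)"
   unfolding potV_def by (intro nn_integral_mono discounted_time_le[OF \<beta> fB]) auto
  then show ?thesis by (simp add: emeasure_space_1)
 qed
 have lim: "(\<lambda>n. \<integral>\<^sup>+w. ?I w * H (\<tau> n w) w \<partial>M) \<longlonglongrightarrow> (\<integral>\<^sup>+w. ?I w * H (?T w) w \<partial>M)"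
  if [measurable]: "\<And>n. (\<lambda>w. H (\<tau> n w) w) \<in> borel_measurable M" "(\<lambda>w. H (?T w) w) \<in> borel_measurable M"
   and le: "\<And>r w. 0 \<le> r \<Longrightarrow> H r w \<le> ennreal (B / \<beta>)"
   and conv: "\<And>w. w \<in> space M \<Longrightarrow> enters m x w \<Longrightarrow> (\<lambda>n. H (\<tau> n w) w) \<longlonglongrightarrow> H (?T w) w" for H
 proof (rule nn_integral_dominated_convergence[where w="\<lambda>_. ennreal (B / \<beta>)"])
  show "AE w in M. ?I w * H (\<tau> n w) w \<le> ennreal (B / \<beta>)" for n
  proof (intro AE_I2)
   fix w
   show "?I w * H (\<tau> n w) w \<le> ennreal (B / \<beta>)"
   proof (cases "enters m x w")
    case True
    have "0 \<le> \<tau> n w" using dyadic_upper(1)[of "?T w" n] ent_props(1)[OF True] unfolding \<tau>_def by linarith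
    then show ?thesis using le[of "\<tau> n w" w] True by simp
   qed simp
  qed
  show "AE w in M. (\<lambda>n. ?I w * H (\<tau> n w) w) \<longlonglongrightarrow> ?I w * H (?T w) w"
  proof (intro AE_I2)
   fix w assume "w \<in> space M"
   then show "(\<lambda>n. ?I w * H (\<tau> n w) w) \<longlonglongrightarrow> ?I w * H (?T w) w" using conv[of w] by (cases "enters m x w") auto
  qed
 qed (measurable, simp add: emeasure_space_1)
 have \<tau>lim: "(\<lambda>n. \<tau> n w) \<longlonglongrightarrow> ?T w" for w unfolding \<tau>_def by (rule dyadic_upper_tendsto)
 have lim1: "(\<lambda>n. \<integral>\<^sup>+w. ?I w * ?A (\<tau> n w) w \<partial>M) \<longlonglongrightarrow> (\<integral>\<^sup>+w. ?I w * ?A (?T w) w \<partial>M)"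
 proof (rule lim)
  show "?A r w \<le> ennreal (B / \<beta>)" if "0 \<le> r" for r w using that by (intro discounted_time_le[OF \<beta> fB]) auto
  fix w assume om: "w \<in> space M" and en: "enters m x w"
  note [measurable] = X_time_measurable[OF om]
  have \<tau>: "?T w < \<tau> n w" for n unfolding \<tau>_def by (rule dyadic_upper(1))
  let ?h = "\<lambda>s. ennreal (exp (- \<beta> * s)) * f (x + X s w)"
  show "(\<lambda>n. ?A (\<tau> n w) w) \<longlonglongrightarrow> ?A (?T w) w"
  proof (rule nn_integral_dominated_convergence[where w="\<lambda>s. ?h s * indicator {?T w..} s"])
   show "AE s in lborel. ?h s * indicator {\<tau> n w..} s \<le> ?h s * indicator {?T w..} s" for n
    using \<tau>[of n] by (auto split: split_indicator)
   have "?A (?T w) w \<le> ennreal (B / \<beta>)" using ent_props(1)[OF en] by (intro discounted_time_le[OF \<beta> fB]) auto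
   then show "?A (?T w) w < \<infinity>" by (rule le_less_trans) simp
   show "AE s in lborel. (\<lambda>n. ?h s * indicator {\<tau> n w..} s) \<longlonglongrightarrow> ?h s * indicator {?T w..} s"
   proof (rule AE_mp[OF AE_lborel_singleton[of "?T w"]], intro AE_I2 impI)
    fix s assume s: "s \<noteq> ?T w"
    show "(\<lambda>n. ?h s * indicator {\<tau> n w..} s) \<longlonglongrightarrow> ?h s * indicator {?T w..} s"
    proof (cases "s < ?T w")
     case True
     then have "?h s * indicator {\<tau> n w..} s = ?h s * indicator {?T w..} s" for n using \<tau>[of n] by auto
     then show ?thesis by simp
    next
     case False
     then have "\<forall>\<^sub>F n in sequentially. \<tau> n w < s" using s by (intro order_tendstoD(2)[OF \<tau>lim]) auto
     then have "\<forall>\<^sub>F n in sequentially. ?h s * indicator {\<tau> n w..} s = ?h s * indicator {?T w..} s"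
      by eventually_elim (use False in auto)
     then show ?thesis by (rule tendsto_eventually)
    qed
   qed
  qed measurable
 qed measurable
 \<comment> \<open>Right-continuity of the path and continuity of the potential \<open>v\<close> are
   combined here: positions at \<open>\<tau> n\<close> converge to the entry position, hence so do
   the potentials.\<close>
 have lim2: "(\<lambda>n. \<integral>\<^sup>+w. ?I w * ?C (\<tau> n w) w \<partial>M) \<longlonglongrightarrow> (\<integral>\<^sup>+w. ?I w * ?C (?T w) w \<partial>M)"
 proof (rule lim)
  show "?C r w \<le> ennreal (B / \<beta>)" if "0 \<le> r" for r w
  proof -
   have "ennreal (exp (- \<beta> * r)) \<le> 1" using \<beta> that by (simp add: ennreal_le_1)
   then have "?C r w \<le> 1 * ennreal (B / \<beta>)" by (intro mult_mono potV_le) auto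
   then show ?thesis by simp
  qed
  fix w
  have "(\<lambda>n. X (\<tau> n w) w) \<longlonglongrightarrow> X (?T w) w" unfolding \<tau>_def by (rule right_continuous_dyadic[OF X_rc])
  then have "(\<lambda>n. ennreal (exp (- \<beta> * \<tau> n w) * v (x + X (\<tau> n w) w))) \<longlonglongrightarrow> ennreal (exp (- \<beta> * ?T w) * v (x + X (?T w) w))"
   by (intro tendsto_ennrealI tendsto_mult isCont_tendsto_compose[OF v(1)] tendsto_intros \<tau>lim)
  then show "(\<lambda>n. ?C (\<tau> n w) w) \<longlonglongrightarrow> ?C (?T w) w" by (simp add: v(2) ennreal_mult')
 qed measurable
 have "(\<integral>\<^sup>+w. discounted \<beta> f x w (after m x w) \<partial>M)
   = (\<integral>\<^sup>+w. ?I w * ?A (?T w) w \<partial>M)"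
 proof (intro nn_integral_cong)
  fix w
  show "discounted \<beta> f x w (after m x w) = ?I w * ?A (?T w) w"
  proof (cases "enters m x w")
   case True
   have "discounted \<beta> f x w (after m x w) = ?A (?T w) w"
    by (rule nn_integral_cong_AE, rule AE_mp[OF AE_lborel_singleton[of "?T w"]])
     (use ent_props(1)[OF True] in \<open>auto simp: ent_props(2)[OF True] indicator_def intro!: AE_I2\<close>)
   then show ?thesis using True by simp
  next
   case False
   then have "(after m x w) = {}" using hit_imp_enters by blast
   then show ?thesis using False by simp
  qed
 qed
 also have "\<dots> = (\<integral>\<^sup>+w. ?I w * ?C (?T w) w \<partial>M)"
  using LIMSEQ_unique[OF lim1] lim2 unfolding grid by simp
 finally show ?thesis .
qed

end

section \<open>The Green function of the killed process\<close>

lemma isCont_real_eps: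
 fixes f :: "real \<Rightarrow> real"
 assumes "isCont f a" "0 < e"
 obtains d where "0 < d" "\<And>y. \<bar>y - a\<bar> < d \<Longrightarrow> \<bar>f y - f a\<bar> < e"
proof -
 obtain d where "0 < d" "\<forall>x'. dist x' a < d \<longrightarrow> dist (f x') (f a) < e"
  using assms unfolding continuous_at_eps_delta by auto
 then show ?thesis by (intro that[of d]) (simp_all add: dist_real_def)
qed

lemma small_reciprocal:
 fixes d :: real assumes "0 < d" obtains m where "1 / (real m + 1) < d"
proof -
 obtain n where "inverse (real (Suc n)) < d" using reals_Archimedean[OF assms] by blast
 then have "1 / (real n + 1) < d" by (simp add: inverse_eq_divide add.commute)
 then show ?thesis by (rule that)
qed

context stable_motion
begin

text \<open>The kernel is bounded and continuous, so dominated convergence gives the continuous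
  potential required in the strong Markov step.\<close>

lemma potV_convolution:
 fixes f :: "real \<Rightarrow> real"
 assumes \<beta>: "0 < \<beta>" and f: "integrable lborel f" "\<And>y. 0 \<le> f y"
 defines "v \<equiv> \<lambda>z. \<integral>y. f y * pot \<alpha> \<beta> (y - z) \<partial>lborel"
 shows "isCont v z" "potV \<beta> (\<lambda>y. ennreal (f y)) z = ennreal (v z)" "0 \<le> v z"
  "integrable lborel (\<lambda>y. f y * pot \<alpha> \<beta> (y - z))"
proof -
 have pm[measurable]: "pot \<alpha> \<beta> \<in> borel_measurable borel" by (rule pot_measurable[OF \<alpha> \<beta>])
 have fm[measurable]: "f \<in> borel_measurable borel" using f(1) by auto
 have pnn: "0 \<le> pot \<alpha> \<beta> y" for y by (rule potential_density(1)[OF \<beta>, of "\<lambda>_. 0"]) simp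
 have ple: "pot \<alpha> \<beta> y \<le> pot \<alpha> \<beta> 0" for y using pot_abs_le[OF \<alpha> \<beta>, of y] by simp
 have dom: "integrable lborel (\<lambda>y. f y * pot \<alpha> \<beta> 0)" using f(1) by simp
 show int: "integrable lborel (\<lambda>y. f y * pot \<alpha> \<beta> (y - z))" for z
  by (rule Bochner_Integration.integrable_bound[OF dom]) (use f(2) pnn ple in \<open>auto intro!: AE_I2 mult_left_mono simp: abs_mult\<close>)
 show nn: "0 \<le> v z" for z unfolding v_def using f(2) pnn by (intro Bochner_Integration.integral_nonneg mult_nonneg_nonneg) auto
 show "potV \<beta> (\<lambda>y. ennreal (f y)) z = ennreal (v z)" for z
 proof -
  have "potV \<beta> (\<lambda>y. ennreal (f y)) z = (\<integral>\<^sup>+y. ennreal (f y * pot \<alpha> \<beta> (y - z)) \<partial>lborel)"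
   using f(2) pnn by (subst potV_eq[OF \<beta>]) (auto simp: ennreal_mult)
  also have "\<dots> = ennreal (v z)" unfolding v_def
   by (rule nn_integral_eq_integral[OF int]) (use f(2) pnn in auto)
  finally show ?thesis .
 qed
 show "isCont v z"
 proof (unfold continuous_at_sequentially, safe)
  fix Z assume Z: "Z \<longlonglongrightarrow> z"
  have "(\<lambda>n. \<integral>y. f y * pot \<alpha> \<beta> (y - Z n) \<partial>lborel) \<longlonglongrightarrow> (\<integral>y. f y * pot \<alpha> \<beta> (y - z) \<partial>lborel)"
  proof (rule integral_dominated_convergence[OF _ _ dom])
   show "AE y in lborel. (\<lambda>n. f y * pot \<alpha> \<beta> (y - Z n)) \<longlonglongrightarrow> f y * pot \<alpha> \<beta> (y - z)"
    by (intro AE_I2 tendsto_mult tendsto_const isCont_tendsto_compose[OF pot_isCont[OF \<alpha> \<beta>]] tendsto_diff Z)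
  qed (use f(2) pnn ple in \<open>auto intro!: AE_I2 mult_left_mono simp: abs_mult\<close>)
  then show "(v \<circ> Z) \<longlonglongrightarrow> v z" unfolding comp_def v_def .
 qed
qed

definition killed_pot :: "real \<Rightarrow> (real \<Rightarrow> ennreal) \<Rightarrow> real \<Rightarrow> ennreal" where
 "killed_pot \<beta> f x = (\<integral>\<^sup>+w. discounted \<beta> f x w (life_span x w) \<partial>M)"

definition killed_pot_level :: "nat \<Rightarrow> real \<Rightarrow> (real \<Rightarrow> ennreal) \<Rightarrow> real \<Rightarrow> ennreal" where
 "killed_pot_level m \<beta> f x = (\<integral>\<^sup>+w. discounted \<beta> f x w (before m x w) \<partial>M)"

definition entry_lt :: "nat \<Rightarrow> real \<Rightarrow> real \<Rightarrow> real" where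
 "entry_lt m \<beta> x = (\<integral>w. indicator {w. enters m x w} w * exp (- \<beta> * ent m x w) \<partial>M)"

lemma entry_factor:
 assumes "0 < \<beta>"
 shows "0 \<le> indicator {w. enters m x w} w * exp (- \<beta> * ent m x w)" "indicator {w. enters m x w} w * exp (- \<beta> * ent m x w) \<le> 1"
 using assms ent_props(1)[of m x w] by (auto simp: indicator_def)

text \<open>Dynkin's formula: the potential splits at the entry time, and what follows is the
  discounted potential at the entry position. Since that position is within
  \<open>1 / (m + 1)\<close> of \<open>0\<close>, the last clause replaces its potential by a
  constant \<open>c\<close> at the cost of the oscillation \<open>\<delta>\<close>.\<close>

lemma killed_pot_level_eq:
 assumes \<beta>: "0 < \<beta>" and f[measurable]: "f \<in> borel_measurable borel" and fB: "\<And>y. f y \<le> ennreal B" "0 \<le> B"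
  and v: "\<And>z. isCont v z" "\<And>z. potV \<beta> f z = ennreal (v z)" "\<And>z. 0 \<le> v z"
 defines "S \<equiv> \<lambda>m x. \<integral>w. indicator {w. enters m x w} w * exp (- \<beta> * ent m x w) * v (x + X (ent m x w) w) \<partial>M"
 shows "killed_pot_level m \<beta> f x = ennreal (v x - S m x)" "S m x \<le> v x"
  "\<And>\<delta> c. (\<And>z. \<bar>z\<bar> \<le> 1 / (real m + 1) \<Longrightarrow> \<bar>v z - c\<bar> \<le> \<delta>) \<Longrightarrow> 0 \<le> \<delta> \<Longrightarrow> \<bar>S m x - c * entry_lt m \<beta> x\<bar> \<le> \<delta>"
proof -
 let ?W = "\<lambda>w. indicator {w. enters m x w} w * exp (- \<beta> * ent m x w) :: real"
 have v_meas[measurable]: "v \<in> borel_measurable borel"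
  by (intro borel_measurable_continuous_onI continuous_at_imp_continuous_on ballI v)
 have vB: "v z \<le> B / \<beta>" for z
 proof -
  have "potV \<beta> f z \<le> (\<integral>\<^sup>+w. ennreal (B / \<beta>) \<partial>M)"
   unfolding potV_def by (intro nn_integral_mono discounted_time_le[OF \<beta> fB]) auto
  then have "ennreal (v z) \<le> ennreal (B / \<beta>)" by (simp only: v(2) nn_integral_const emeasure_space_1 mult_1_right)
  moreover have "0 \<le> B / \<beta>" using fB(2) \<beta> by simp
  ultimately show ?thesis by (simp only: ennreal_le_iff)
 qed
 have i1: "integrable M ?W"
 proof (rule integrable_const_bound[where B=1])
  show "AE w in M. norm (?W w) \<le> 1"
   unfolding real_norm_def abs_of_nonneg[OF entry_factor(1)[OF \<beta>]] by (intro AE_I2 entry_factor(2)[OF \<beta>])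
 qed measurable
 have i2: "integrable M (\<lambda>w. ?W w * v (x + X (ent m x w) w))"
 proof (rule integrable_const_bound[where B="1 * (B / \<beta>)"])
  show "AE w in M. norm (?W w * v (x + X (ent m x w) w)) \<le> 1 * (B / \<beta>)"
  proof (intro AE_I2)
   fix w
   show "norm (?W w * v (x + X (ent m x w) w)) \<le> 1 * (B / \<beta>)"
    unfolding real_norm_def abs_of_nonneg[OF mult_nonneg_nonneg[OF entry_factor(1)[OF \<beta>] v(3)]]
    by (intro mult_mono entry_factor[OF \<beta>] vB v(3)) auto
  qed
 qed measurable
 have S_nn: "0 \<le> S m x" unfolding S_def
  by (intro Bochner_Integration.integral_nonneg mult_nonneg_nonneg[OF entry_factor(1)[OF \<beta>] v(3)])
 have split: "potV \<beta> f x = killed_pot_level m \<beta> f x +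
  (\<integral>\<^sup>+w. discounted \<beta> f x w (after m x w) \<partial>M)"
 proof -
  have "potV \<beta> f x = (\<integral>\<^sup>+w. discounted \<beta> f x w (before m x w) +
   discounted \<beta> f x w (after m x w) \<partial>M)"
   unfolding potV_def
  proof (intro nn_integral_cong)
   fix w assume om[measurable]: "w \<in> space M"
   note [measurable] = X_time_measurable[OF om]
   have [measurable]: "Measurable.pred borel (\<lambda>s. hit m x s (traj w))" using om by measurable
   show "discounted \<beta> f x w {0..} = discounted \<beta> f x w (before m x w) +
   discounted \<beta> f x w (after m x w)"
    by (subst nn_integral_add[symmetric]) (auto intro!: nn_integral_cong simp: indicator_def)
  qed
  also have "\<dots> = killed_pot_level m \<beta> f x +
  (\<integral>\<^sup>+w. discounted \<beta> f x w (after m x w) \<partial>M)"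
   unfolding killed_pot_level_def indicator_def by (intro nn_integral_add) measurable
  finally show ?thesis .
 qed
 have "(\<integral>\<^sup>+w. discounted \<beta> f x w (after m x w) \<partial>M)
  = (\<integral>\<^sup>+w. ennreal (?W w * v (x + X (ent m x w) w)) \<partial>M)"
  unfolding strong_markov_entry[OF \<beta> f fB v(1,2)]
  by (intro nn_integral_cong) (auto simp: v(2) ennreal_mult' indicator_def)
 also have "\<dots> = ennreal (S m x)"
  unfolding S_def by (rule nn_integral_eq_integral[OF i2]) (intro AE_I2 mult_nonneg_nonneg[OF entry_factor(1)[OF \<beta>] v(3)])
 finally have eq: "ennreal (v x) = killed_pot_level m \<beta> f x + ennreal (S m x)" using split v(2) by simp
 then have "ennreal (S m x) \<le> ennreal (v x)" by simp
 then show le: "S m x \<le> v x" using v(3) by (simp add: ennreal_le_iff)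
 show "killed_pot_level m \<beta> f x = ennreal (v x - S m x)"
 proof -
  have "ennreal (v x - S m x) = ennreal (v x) - ennreal (S m x)" by (rule ennreal_minus[OF S_nn, symmetric])
  also have "\<dots> = killed_pot_level m \<beta> f x" unfolding eq by (rule ennreal_add_diff_cancel_right) simp
  finally show ?thesis by (rule sym)
 qed
 show "\<bar>S m x - c * entry_lt m \<beta> x\<bar> \<le> \<delta>" if d: "\<And>z. \<bar>z\<bar> \<le> 1 / (real m + 1) \<Longrightarrow> \<bar>v z - c\<bar> \<le> \<delta>" "0 \<le> \<delta>" for \<delta> c
 proof -
  let ?I = "\<integral>w. ?W w * v (x + X (ent m x w) w) - c * ?W w \<partial>M"
  have e1: "S m x - c * entry_lt m \<beta> x = ?I"
   unfolding S_def entry_lt_def by (simp only: Bochner_Integration.integral_diff[OF i2 integrable_mult_right[OF i1]] integral_mult_right_zero)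
  have e2: "\<bar>?I\<bar> \<le> (\<integral>w. \<delta> \<partial>M)"
  proof (rule order_trans[OF integral_abs_bound integral_mono])
   fix w
   show "\<bar>?W w * v (x + X (ent m x w) w) - c * ?W w\<bar> \<le> \<delta>"
   proof (cases "enters m x w")
    case True
    have i1': "?W w * v (x + X (ent m x w) w) - c * ?W w = ?W w * (v (x + X (ent m x w) w) - c)" by (simp add: algebra_simps)
    have "\<bar>?W w * (v (x + X (ent m x w) w) - c)\<bar> \<le> 1 * \<delta>"
     unfolding abs_mult[of "?W w"] abs_of_nonneg[OF entry_factor(1)[OF \<beta>]]
     by (rule mult_mono[OF entry_factor(2)[OF \<beta>] d(1)[OF ent_props(3)[OF True]]]) simp_all
    then show ?thesis unfolding i1' by (simp only: mult_1_left)
   next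
    case False
    then have "?W w = 0" by simp
    then show ?thesis using d(2) by (simp only: mult_zero_left mult_zero_right diff_self abs_zero)
   qed
  next
   show "integrable M (\<lambda>w. \<bar>?W w * v (x + X (ent m x w) w) - c * ?W w\<bar>)"
    by (rule integrable_abs[OF Bochner_Integration.integrable_diff[OF i2 integrable_mult_right[OF i1]]])
   show "integrable M (\<lambda>w. \<delta>)" by (rule integrable_const)
  qed
  have e3: "(\<integral>w. \<delta> \<partial>M) = \<delta>" by (simp only: lebesgue_integral_const prob_space scaleR_one)
  show ?thesis using e2 unfolding e1 e3 .
 qed
qed

text \<open>\<open>alive\<close> means that some level has not been hit, so the sets
  \<open>before m x w\<close> increase to \<open>life_span x w\<close> and monotone convergence
  applies, first in time and then over outcomes.\<close>

lemma killed_pot_SUP: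
 assumes f[measurable]: "f \<in> borel_measurable borel"
 shows "killed_pot \<beta> f x = (SUP m. killed_pot_level m \<beta> f x)" "incseq (\<lambda>m. killed_pot_level m \<beta> f x)"
proof -
 have inc: "indicator (before m x w) s \<le> (indicator (before m' x w) s :: ennreal)"
  if "m \<le> m'" for m m' s w
  using that hit_antimono_level[of m' x s "traj w" m] by (auto simp: indicator_def)
 show inc2: "incseq (\<lambda>m. killed_pot_level m \<beta> f x)"
  unfolding killed_pot_level_def incseq_def by (intro allI impI nn_integral_mono mult_left_mono inc) auto
 have sup: "(SUP m. ennreal (exp (- \<beta> * s)) * f (x + X s w) * indicator (before m x w) s)
  = ennreal (exp (- \<beta> * s)) * f (x + X s w) * indicator (life_span x w) s" for s w
 proof -
  have "(SUP m. indicator (before m x w) s) = (indicator (life_span x w) s :: ennreal)"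
   by (rule antisym) (auto intro!: SUP_least SUP_upper2 simp: alive_def indicator_def split: if_splits)
  then show ?thesis by (simp add: SUP_mult_left_ennreal[symmetric])
 qed
 have "(SUP m. killed_pot_level m \<beta> f x) = (\<integral>\<^sup>+w. (SUP m. \<integral>\<^sup>+s\<in>(before m x w). ennreal (exp (- \<beta> * s)) * f (x + X s w) \<partial>lborel) \<partial>M)"
  unfolding killed_pot_level_def
 proof (rule nn_integral_monotone_convergence_SUP[symmetric])
  show "incseq (\<lambda>m w. \<integral>\<^sup>+s\<in>(before m x w). ennreal (exp (- \<beta> * s)) * f (x + X s w) \<partial>lborel)"
   by (intro incseq_SucI le_funI nn_integral_mono mult_left_mono inc) auto
 qed (unfold indicator_def, measurable)
 also have "\<dots> = killed_pot \<beta> f x"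
  unfolding killed_pot_def
 proof (intro nn_integral_cong)
  fix w assume om[measurable]: "w \<in> space M"
  note [measurable] = X_time_measurable[OF om]
  have [measurable]: "Measurable.pred borel (\<lambda>s. hit m x s (traj w))" for m using om by measurable
  show "(SUP m. \<integral>\<^sup>+s\<in>(before m x w). ennreal (exp (- \<beta> * s)) * f (x + X s w) \<partial>lborel)
   = discounted \<beta> f x w (life_span x w)"
   unfolding sup[symmetric]
  proof (rule nn_integral_monotone_convergence_SUP[symmetric])
   show "incseq (\<lambda>m s. ennreal (exp (- \<beta> * s)) * f (x + X s w) * indicator (before m x w) s)"
    by (intro incseq_SucI le_funI mult_left_mono inc) auto
  qed measurable
 qed
 finally show "killed_pot \<beta> f x = (SUP m. killed_pot_level m \<beta> f x)" by simp
qed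

text \<open>Dynkin's formula is tested with the uniform density on the neighbourhood itself. Nothing
  is collected before entry, so the potential at \<open>x\<close> is the discounted mean of its
  values at entry. The former is close to \<open>pot \<alpha> \<beta> x\<close>, the latter are
  close to \<open>pot \<alpha> \<beta> 0\<close>.\<close>

lemma entry_lt_tendsto:
 assumes \<beta>: "0 < \<beta>"
 shows "(\<lambda>m. entry_lt m \<beta> x) \<longlonglongrightarrow> pot \<alpha> \<beta> x / pot \<alpha> \<beta> 0"
proof -
 let ?u = "pot \<alpha> \<beta>"
 have u0: "0 < ?u 0" by (rule pot_zero_pos[OF \<alpha> \<beta>])
 have "(\<lambda>m. ?u 0 * entry_lt m \<beta> x) \<longlonglongrightarrow> ?u x"
 proof (rule LIMSEQ_I)
  fix e :: real assume e: "0 < e"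
  obtain d1 where d1: "d1 > 0" "\<And>y. \<bar>y - (- x)\<bar> < d1 \<Longrightarrow> \<bar>?u y - ?u (- x)\<bar> < e / 3"
   by (rule isCont_real_eps[OF pot_isCont[OF \<alpha> \<beta>, of "- x"], of "e / 3"]) (use e in simp, rule that)
  obtain d2 where d2: "d2 > 0" "\<And>y. \<bar>y - 0\<bar> < d2 \<Longrightarrow> \<bar>?u y - ?u 0\<bar> < e / 3"
   by (rule isCont_real_eps[OF pot_isCont[OF \<alpha> \<beta>, of 0], of "e / 3"]) (use e in simp, rule that)
  \<comment> \<open>Half of \<open>d2\<close>, because the averaging variable and the entry position
    each contribute up to \<open>1 / (m + 1)\<close>.\<close>
  obtain m0 where m0: "1 / (real m0 + 1) < min d1 (d2 / 2)"
   by (rule small_reciprocal[of "min d1 (d2 / 2)"]) (use d1(1) d2(1) in simp, rule that)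
  have main: "\<bar>?u 0 * entry_lt m \<beta> x - ?u x\<bar> < e" if "m0 \<le> m" for m
  proof -
   let ?\<epsilon> = "1 / (real m + 1)"
   have \<epsilon>: "0 < ?\<epsilon>" "?\<epsilon> < d1" "2 * ?\<epsilon> < d2"
   proof -
    have "?\<epsilon> \<le> 1 / (real m0 + 1)" using that by (intro divide_left_mono) auto
    then show "?\<epsilon> < d1" "2 * ?\<epsilon> < d2" using m0 by auto
   qed simp
   define f where "f y = (1 / (2 * ?\<epsilon>)) * indicator {- ?\<epsilon><..<?\<epsilon>} y" for y :: real
   define v where "v z = (\<integral>y. f y * ?u (y - z) \<partial>lborel)" for z
   have fi: "integrable lborel f" unfolding f_def
    by (intro integrable_mult_right integrable_real_indicator) auto
   have f1: "(\<integral>y. f y \<partial>lborel) = 1" using \<epsilon>(1) unfolding f_def by simp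
   have f0: "0 \<le> f y" for y using \<epsilon>(1) by (simp add: f_def)
   have v_eq: "v = (\<lambda>z. \<integral>y. f y * ?u (y - z) \<partial>lborel)" by (rule ext) (rule v_def)
   have pv: "isCont v z" "potV \<beta> (\<lambda>y. ennreal (f y)) z = ennreal (v z)" "0 \<le> v z" "integrable lborel (\<lambda>y. f y * ?u (y - z))" for z
    unfolding v_eq by (rule potV_convolution[OF \<beta> fi f0])+
   have avg: "\<bar>v z - c\<bar> \<le> \<delta>" if z: "\<And>y. \<bar>y\<bar> < ?\<epsilon> \<Longrightarrow> \<bar>?u (y - z) - c\<bar> \<le> \<delta>" for z c \<delta>
   proof -
    have "v z - c = (\<integral>y. f y * ?u (y - z) - f y * c \<partial>lborel)"
     unfolding v_def using pv(4) fi f1 by (subst Bochner_Integration.integral_diff) auto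
    also have "\<bar>\<dots>\<bar> \<le> (\<integral>y. f y * \<delta> \<partial>lborel)"
    proof (rule integral_abs_bound_integral)
     fix y
     show "\<bar>f y * ?u (y - z) - f y * c\<bar> \<le> f y * \<delta>"
     proof (cases "\<bar>y\<bar> < ?\<epsilon>")
      case True
      then show ?thesis using z[OF True] f0[of y] by (simp add: right_diff_distrib[symmetric] abs_mult mult_left_mono)
     next
      case False
      then have "f y = 0" by (auto simp: f_def indicator_def abs_less_iff)
      then show ?thesis by simp
     qed
    qed (use pv(4) fi in auto)
    finally show ?thesis using f1 by simp
   qed
   have a1: "\<bar>v x - ?u x\<bar> \<le> e / 3"
   proof (rule avg)
    show "\<bar>?u (y - x) - ?u x\<bar> \<le> e / 3" if "\<bar>y\<bar> < ?\<epsilon>" for y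
     using d1(2)[of "y - x"] pot_minus[OF \<alpha>, of \<beta> x] that \<epsilon>(2) by simp
   qed
   have a2: "\<bar>v z - ?u 0\<bar> \<le> e / 3" if "\<bar>z\<bar> \<le> ?\<epsilon>" for z
   proof (rule avg)
    show "\<bar>?u (y - z) - ?u 0\<bar> \<le> e / 3" if y: "\<bar>y\<bar> < ?\<epsilon>" for y
    proof (rule less_imp_le, rule d2(2))
     have "\<bar>y - z\<bar> \<le> \<bar>y\<bar> + \<bar>z\<bar>" by (rule abs_triangle_ineq4)
     then show "\<bar>y - z - 0\<bar> < d2" using y \<open>\<bar>z\<bar> \<le> ?\<epsilon>\<close> \<epsilon>(3) by linarith
    qed
   qed
   have fB: "ennreal (f y) \<le> ennreal (1 / (2 * ?\<epsilon>))" for y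
    using \<epsilon>(1) by (intro ennreal_leI) (auto simp: f_def indicator_def)
   have fm[measurable]: "(\<lambda>y. ennreal (f y)) \<in> borel_measurable borel" using fi by auto
   have B0: "0 \<le> 1 / (2 * ?\<epsilon>)" using \<epsilon>(1) by simp
   note kl = killed_pot_level_eq[OF \<beta> fm fB B0 pv(1,2,3), where m=m and x=x]
   \<comment> \<open>Being in the open interval at time \<open>s\<close> means a hit before every
     later time. Together with no hit before \<open>s\<close> this forces \<open>s\<close> to be the
     entry time, a single instant.\<close>
   have "killed_pot_level m \<beta> (\<lambda>y. ennreal (f y)) x = 0"
   proof -
    have "(\<integral>\<^sup>+s\<in>(before m x w). ennreal (exp (- \<beta> * s)) * ennreal (f (x + X s w)) \<partial>lborel) = 0" for w
    proof -
     have "(\<integral>\<^sup>+s\<in>(before m x w). ennreal (exp (- \<beta> * s)) * ennreal (f (x + X s w)) \<partial>lborel) = (\<integral>\<^sup>+s. 0 \<partial>(lborel :: real measure))"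
     proof (rule nn_integral_cong_AE, use AE_lborel_singleton[of "ent m x w"] in eventually_elim)
      fix s assume s: "s \<noteq> ent m x w"
      have "0 \<le> s \<Longrightarrow> \<not> hit m x s (traj w) \<Longrightarrow> f (x + X s w) = 0"
      proof (rule ccontr)
       assume a: "0 \<le> s" "\<not> hit m x s (traj w)" "f (x + X s w) \<noteq> 0"
       then have "\<bar>x + traj w s\<bar> < ?\<epsilon>" by (auto simp: f_def indicator_def traj_def abs_less_iff split: if_splits)
       then have h: "hit m x t (traj w)" if "s < t" for t unfolding hit_iff[OF traj_rc] using that a(1) by blast
       then have en: "enters m x w" using hit_imp_enters[of m x "s + 1"] by simp
       have lt: "ent m x w < t" if "s < t" for t using h[OF that] ent_props(2)[OF en] by simp
       have "ent m x w \<le> s" by (rule dense_ge) (rule less_imp_le[OF lt])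
       moreover have "s \<le> ent m x w" using a(2) ent_props(2)[OF en] by simp
       ultimately show False using s by simp
      qed
      then show "ennreal (exp (- \<beta> * s)) * ennreal (f (x + X s w)) * indicator (before m x w) s = 0"
       by (auto simp: indicator_def)
     qed
     then show ?thesis by simp
    qed
    then show ?thesis unfolding killed_pot_level_def by simp
   qed
   then have "v x = (\<integral>w. indicator {w. enters m x w} w * exp (- \<beta> * ent m x w) * v (x + X (ent m x w) w) \<partial>M)"
    (is "v x = ?S") using kl(1,2) by simp
   moreover have "\<bar>?S - ?u 0 * entry_lt m \<beta> x\<bar> \<le> e / 3" by (rule kl(3)[OF a2]) (use e in simp_all)
   ultimately have "\<bar>v x - ?u 0 * entry_lt m \<beta> x\<bar> \<le> e / 3" by simp
   then show ?thesis using a1 e by linarith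
  qed
  then show "\<exists>no. \<forall>n\<ge>no. norm (?u 0 * entry_lt n \<beta> x - ?u x) < e" by (intro exI[of _ m0]) auto
 qed
 then have "(\<lambda>m. ?u 0 * entry_lt m \<beta> x / ?u 0) \<longlonglongrightarrow> ?u x / ?u 0" using u0 by (intro tendsto_intros) auto
 then show ?thesis using u0 by simp
qed

text \<open>First passage decomposition at \<open>0\<close>, obtained by letting the level grow: the
  quotient is the Laplace transform of the passage time, and \<open>v 0\<close> is the potential
  collected afterwards.\<close>

lemma killed_pot_eq:
 assumes \<beta>: "0 < \<beta>" and f[measurable]: "f \<in> borel_measurable borel" and fB: "\<And>y. f y \<le> ennreal B" "0 \<le> B"
  and v: "\<And>z. isCont v z" "\<And>z. potV \<beta> f z = ennreal (v z)" "\<And>z. 0 \<le> v z"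
 shows "killed_pot \<beta> f x = ennreal (v x - v 0 * (pot \<alpha> \<beta> x / pot \<alpha> \<beta> 0))"
proof -
 define S where "S m = (\<integral>w. indicator {w. enters m x w} w * exp (- \<beta> * ent m x w) * v (x + X (ent m x w) w) \<partial>M)" for m
 note kl = killed_pot_level_eq[OF \<beta> f fB v, where x=x, folded S_def]
 have "(\<lambda>m. S m - v 0 * entry_lt m \<beta> x) \<longlonglongrightarrow> 0"
 proof (rule LIMSEQ_I)
  fix e :: real assume e: "0 < e"
  obtain d where d: "d > 0" "\<And>y. \<bar>y - 0\<bar> < d \<Longrightarrow> \<bar>v y - v 0\<bar> < e / 2"
   by (rule isCont_real_eps[OF v(1)[of 0], of "e / 2"]) (use e in simp, rule that)
  obtain m0 where m0: "1 / (real m0 + 1) < d"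
   by (rule small_reciprocal[OF d(1)]) (rule that)
  have "\<bar>S m - v 0 * entry_lt m \<beta> x\<bar> \<le> e / 2" if "m0 \<le> m" for m
  proof (rule kl(3))
   have "1 / (real m + 1) \<le> 1 / (real m0 + 1)" using that by (intro divide_left_mono) auto
   then show "\<bar>v z - v 0\<bar> \<le> e / 2" if "\<bar>z\<bar> \<le> 1 / (real m + 1)" for z
    using that m0 by (intro less_imp_le d(2)) auto
  qed (use e in simp)
  then show "\<exists>no. \<forall>n\<ge>no. norm (S n - v 0 * entry_lt n \<beta> x - 0) < e" using e by (intro exI[of _ m0]) force
 qed
 moreover have "(\<lambda>m. v 0 * entry_lt m \<beta> x) \<longlonglongrightarrow> v 0 * (pot \<alpha> \<beta> x / pot \<alpha> \<beta> 0)"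
  by (intro tendsto_mult tendsto_const entry_lt_tendsto \<beta>)
 ultimately have "(\<lambda>m. (S m - v 0 * entry_lt m \<beta> x) + v 0 * entry_lt m \<beta> x) \<longlonglongrightarrow> 0 + v 0 * (pot \<alpha> \<beta> x / pot \<alpha> \<beta> 0)"
  by (rule tendsto_add)
 then have "(\<lambda>m. ennreal (v x - S m)) \<longlonglongrightarrow> ennreal (v x - v 0 * (pot \<alpha> \<beta> x / pot \<alpha> \<beta> 0))"
  by (intro tendsto_ennrealI tendsto_diff tendsto_const) simp
 then have "(\<lambda>m. killed_pot_level m \<beta> f x) \<longlonglongrightarrow> ennreal (v x - v 0 * (pot \<alpha> \<beta> x / pot \<alpha> \<beta> 0))"
  unfolding kl(1) .
 moreover have "(\<lambda>m. killed_pot_level m \<beta> f x) \<longlonglongrightarrow> killed_pot \<beta> f x"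
  unfolding killed_pot_SUP(1)[OF f] by (rule LIMSEQ_SUP[OF killed_pot_SUP(2)[OF f]])
 ultimately show ?thesis by (rule LIMSEQ_unique[symmetric])
qed

lemma alive_mono: "alive x s w \<Longrightarrow> s' \<le> s \<Longrightarrow> alive x s' w"
 unfolding alive_def using hit_mono by blast

text \<open>Survival forever contributes its probability divided by \<open>\<beta>\<close> to the
  killed potential of \<open>1\<close>, and that potential is \<open>1 / \<beta>\<close> times one
  minus the passage transform. As \<open>\<beta>\<close> vanishes, recurrence sends the resulting
  bound to \<open>0\<close>.\<close>

lemma AE_dies: "AE w in M. \<exists>s. \<not> alive x s (traj w)"
proof -
 let ?N = "{w\<in>space M. \<forall>k::nat. alive x (real k) (traj w)}"
 have N: "?N \<in> events" by measurable
 have all: "alive x s (traj w)" if "w \<in> ?N" for w s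
 proof -
  obtain k :: nat where "s \<le> real k" using real_arch_simple by blast
  then show ?thesis using that alive_mono by blast
 qed
 have le: "prob ?N \<le> 1 - pot \<alpha> \<beta> x / pot \<alpha> \<beta> 0" if \<beta>: "0 < \<beta>" for \<beta>
 proof -
  have E1: "(\<integral>\<^sup>+s\<in>{0..}. ennreal (exp (- \<beta> * s)) * 1 \<partial>lborel) = ennreal (1 / \<beta>)"
  proof -
   interpret E: prob_space "density lborel (\<lambda>s. ennreal (exponential_density \<beta> s))" by (rule prob_space_exponential_density[OF \<beta>])
   have 1: "(\<integral>\<^sup>+s. ennreal (exponential_density \<beta> s) \<partial>lborel) = 1" using E.emeasure_space_1 by (simp add: emeasure_density)
   have "(\<integral>\<^sup>+s\<in>{0..}. ennreal (exp (- \<beta> * s)) * 1 \<partial>lborel) = (\<integral>\<^sup>+s. ennreal (1 / \<beta>) * ennreal (exponential_density \<beta> s) \<partial>lborel)"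
    using \<beta> by (intro nn_integral_cong) (auto simp: exponential_density_def ennreal_mult[symmetric] mult_ac indicator_def)
   then show ?thesis using 1 by (simp add: nn_integral_cmult)
  qed
  have v: "potV \<beta> (\<lambda>_. 1) z = ennreal (1 / \<beta>)" for z
   unfolding potV_def E1 by (simp add: emeasure_space_1)
  have "killed_pot \<beta> (\<lambda>_. 1) x = ennreal (1 / \<beta> - 1 / \<beta> * (pot \<alpha> \<beta> x / pot \<alpha> \<beta> 0))"
   by (rule killed_pot_eq[where B=1 and v="\<lambda>_. 1 / \<beta>"]) (use \<beta> v in auto)
  moreover have "ennreal (1 / \<beta>) * emeasure M ?N \<le> killed_pot \<beta> (\<lambda>_. 1) x"
  proof -
   have "ennreal (1 / \<beta>) * emeasure M ?N = (\<integral>\<^sup>+w. ennreal (1 / \<beta>) * indicator ?N w \<partial>M)"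
    using N by (simp add: nn_integral_cmult_indicator)
   also have "\<dots> \<le> killed_pot \<beta> (\<lambda>_. 1) x"
    unfolding killed_pot_def
   proof (rule nn_integral_mono)
    fix w
    show "ennreal (1 / \<beta>) * indicator ?N w \<le> (\<integral>\<^sup>+s\<in>(life_span x w). ennreal (exp (- \<beta> * s)) * 1 \<partial>lborel)"
    proof (cases "w \<in> ?N")
     case True
     then have "(life_span x w) = {0..}" using all[OF True] by auto
     then show ?thesis using E1 True by simp
    qed simp
   qed
   finally show ?thesis .
  qed
  ultimately have "ennreal (1 / \<beta> * prob ?N) \<le> ennreal (1 / \<beta> - 1 / \<beta> * (pot \<alpha> \<beta> x / pot \<alpha> \<beta> 0))"
  proof -
   assume a: "killed_pot \<beta> (\<lambda>_. 1) x = ennreal (1 / \<beta> - 1 / \<beta> * (pot \<alpha> \<beta> x / pot \<alpha> \<beta> 0))"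
    and b: "ennreal (1 / \<beta>) * emeasure M ?N \<le> killed_pot \<beta> (\<lambda>_. 1) x"
   have "ennreal (1 / \<beta> * prob ?N) = ennreal (1 / \<beta>) * emeasure M ?N"
    unfolding emeasure_eq_measure by (rule ennreal_mult) (use \<beta> in auto)
   with a b show ?thesis by (simp only:)
  qed
  moreover have "0 \<le> 1 / \<beta> - 1 / \<beta> * (pot \<alpha> \<beta> x / pot \<alpha> \<beta> 0)"
   using \<beta> pot_abs_le[OF \<alpha> \<beta>, of x] pot_zero_pos[OF \<alpha> \<beta>] by (simp add: field_simps)
  ultimately have "1 / \<beta> * prob ?N \<le> 1 / \<beta> * (1 - pot \<alpha> \<beta> x / pot \<alpha> \<beta> 0)"
   by (simp add: ennreal_le_iff right_diff_distrib)
  then show ?thesis using \<beta> by (simp only: mult_le_cancel_left_pos zero_less_divide_1_iff)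
 qed
 have "(\<lambda>k. 1 - pot \<alpha> (1 / (real k + 1)) x / pot \<alpha> (1 / (real k + 1)) 0) \<longlonglongrightarrow> 1 - 1"
  by (intro tendsto_diff tendsto_const pot_ratio_tendsto \<alpha>)
 then have "prob ?N \<le> 1 - 1"
  by (rule LIMSEQ_le_const) (use le in \<open>auto intro!: exI[of _ 0]\<close>)
 then have "prob ?N = 0" using measure_nonneg[of M ?N] by linarith
 then have "?N \<in> null_sets M" using N by (simp add: null_sets_def emeasure_eq_measure)
 then have "AE w in M. w \<notin> ?N" by (rule AE_not_in)
 then show ?thesis by (rule AE_mp) (auto intro!: AE_I2)
qed

end

section \<open>The Green operator as a limit of discounted killed potentials\<close>

context stable_motion
begin

lemma grn_measurable_snd[measurable]: "(\<lambda>y. grn \<alpha> x y) \<in> borel_measurable borel"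
 unfolding grn_def[OF \<alpha>] supply [measurable] = pot0_measurable[OF \<alpha>] by measurable

lemma killed_pot_pair:
 assumes f[measurable]: "f \<in> borel_measurable borel"
 shows "killed_pot \<beta> f x = (\<integral>\<^sup>+p. ennreal (exp (- \<beta> * snd p)) * f (x + X (snd p) (fst p)) * indicator {p. 0 \<le> snd p \<and> alive x (snd p) (traj (fst p))} p \<partial>(M \<Otimes>\<^sub>M lborel))"
proof -
 have m: "(\<lambda>p. ennreal (exp (- \<beta> * snd p)) * f (x + X (snd p) (fst p)) * indicator {p. 0 \<le> snd p \<and> alive x (snd p) (traj (fst p))} p) \<in> borel_measurable (M \<Otimes>\<^sub>M lborel)"
  unfolding indicator_def mem_Collect_eq by measurable
 show ?thesis unfolding killed_pot_def
  by (subst lborel.nn_integral_fst[OF m, symmetric]) (auto simp: indicator_def intro!: nn_integral_cong)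
qed

lemma killed_pot_discount_SUP:
 assumes f[measurable]: "f \<in> borel_measurable borel"
 shows "killed_pot 0 f x = (SUP k. killed_pot (1 / (real k + 1)) f x)" "incseq (\<lambda>k. killed_pot (1 / (real k + 1)) f x)"
proof -
 let ?F = "\<lambda>k p. ennreal (exp (- (1 / (real k + 1)) * snd p)) * f (x + X (snd p) (fst p)) * indicator {p. 0 \<le> snd p \<and> alive x (snd p) (traj (fst p))} p"
 have m: "?F k \<in> borel_measurable (M \<Otimes>\<^sub>M lborel)" for k unfolding indicator_def mem_Collect_eq by measurable
 have inc: "ennreal (exp (- (1 / (real k + 1)) * s)) \<le> ennreal (exp (- (1 / (real k' + 1)) * s))" if "k \<le> k'" "0 \<le> s" for k k' s
 proof -
  have "1 / (real k' + 1) \<le> 1 / (real k + 1)" using that by (intro divide_left_mono) auto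
  then have "1 / (real k' + 1) * s \<le> 1 / (real k + 1) * s" using that(2) by (rule mult_right_mono)
  then show ?thesis by (intro ennreal_leI) simp
 qed
 have incF: "incseq ?F"
 proof (unfold incseq_def le_fun_def, intro allI impI)
  fix k k' :: nat and p assume kk: "k \<le> k'"
  show "?F k p \<le> ?F k' p"
  proof (cases "0 \<le> snd p")
   case True
   show ?thesis by (rule mult_right_mono[OF mult_right_mono[OF inc[OF kk True]]]) auto
  qed simp
 qed
 show "incseq (\<lambda>k. killed_pot (1 / (real k + 1)) f x)"
  unfolding killed_pot_pair[OF f] using incF by (auto simp: incseq_def le_fun_def intro!: nn_integral_mono)
 have lim: "(SUP k. ennreal (exp (- (1 / (real k + 1)) * s))) = 1" if s: "0 \<le> s" for s
 proof -
  have "(\<lambda>k. 1 / (real k + 1)) \<longlonglongrightarrow> 0"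
   using LIMSEQ_inverse_real_of_nat by (simp add: inverse_eq_divide add.commute)
  then have "(\<lambda>k. ennreal (exp (- (1 / (real k + 1)) * s))) \<longlonglongrightarrow> ennreal (exp (- 0 * s))"
   by (intro tendsto_ennrealI tendsto_exp tendsto_mult tendsto_minus tendsto_const)
  moreover have "(\<lambda>k. ennreal (exp (- (1 / (real k + 1)) * s))) \<longlonglongrightarrow> (SUP k. ennreal (exp (- (1 / (real k + 1)) * s)))"
   by (rule LIMSEQ_SUP) (use inc[OF _ s] in \<open>auto simp: incseq_def\<close>)
  ultimately show ?thesis using LIMSEQ_unique by fastforce
 qed
 have "(SUP k. killed_pot (1 / (real k + 1)) f x) = (\<integral>\<^sup>+p. (SUP k. ?F k p) \<partial>(M \<Otimes>\<^sub>M lborel))"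
  unfolding killed_pot_pair[OF f] by (rule nn_integral_monotone_convergence_SUP[symmetric, OF incF m])
 also have "\<dots> = killed_pot 0 f x"
 proof (subst killed_pot_pair[OF f], rule nn_integral_cong)
  fix p
  have "(SUP k. ?F k p) = (SUP k. ennreal (exp (- (1 / (real k + 1)) * snd p))) * f (x + X (snd p) (fst p)) * indicator {p. 0 \<le> snd p \<and> alive x (snd p) (traj (fst p))} p"
   by (simp only: SUP_mult_right_ennreal)
  then show "(SUP k. ?F k p) = ennreal (exp (- 0 * snd p)) * f (x + X (snd p) (fst p)) * indicator {p. 0 \<le> snd p \<and> alive x (snd p) (traj (fst p))} p"
   using lim[of "snd p"] by (cases "0 \<le> snd p") (auto simp: indicator_def)
 qed
 finally show "killed_pot 0 f x = (SUP k. killed_pot (1 / (real k + 1)) f x)" by simp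
qed

lemma pot0_mono: "\<bar>y\<bar> \<le> \<bar>z\<bar> \<Longrightarrow> pot0 \<alpha> y \<le> pot0 \<alpha> z"
 by (subst (1 2) pot0_scaling[OF \<alpha>]) (use \<alpha> pot0_one_pos[OF \<alpha>] in \<open>auto intro!: mult_left_mono powr_mono2\<close>)

text \<open>The potentials in \<open>killed_pot_eq\<close> diverge as the discount vanishes. Written
  through the differences \<open>pot \<alpha> \<beta> 0 - pot \<alpha> \<beta> z\<close>, the
  divergent parts cancel and the rest is dominated by \<open>pot0\<close>; compact support of
  \<open>f\<close> makes that bound integrable.\<close>

lemma green_bounded:
 fixes f :: "real \<Rightarrow> real"
 assumes f[measurable]: "f \<in> borel_measurable borel" and f0: "\<And>y. 0 \<le> f y" and fB: "\<And>y. f y \<le> B" and supp: "\<And>y. R < \<bar>y\<bar> \<Longrightarrow> f y = 0" and R: "0 \<le> R"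
 shows "killed_pot 0 (\<lambda>y. ennreal (f y)) x = (\<integral>\<^sup>+y. ennreal (f y) * ennreal (grn \<alpha> x y) \<partial>lborel)"
proof -
 have B0: "0 \<le> B" using f0[of 0] fB[of 0] by linarith
 have fle: "\<bar>f y\<bar> \<le> B * indicator {-R..R} y" for y
  using f0[of y] fB[of y] supp[of y] by (auto simp: indicator_def)
 have fi: "integrable lborel f"
  by (rule Bochner_Integration.integrable_bound[OF integrable_const_Icc[of B "-R" R]])
   (use fle B0 in \<open>auto intro!: AE_I2\<close>)
 have fm: "(\<lambda>y. ennreal (f y)) \<in> borel_measurable borel" by measurable
 have fB': "ennreal (f y) \<le> ennreal B" for y by (intro ennreal_leI fB)
 define b where "b k = 1 / (real k + 1)" for k :: nat
 have b: "0 < b k" for k by (simp add: b_def)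
 let ?v = "\<lambda>k z. \<integral>y. f y * pot \<alpha> (b k) (y - z) \<partial>lborel"
 let ?\<rho> = "\<lambda>k. pot \<alpha> (b k) x / pot \<alpha> (b k) 0"
 let ?I = "\<lambda>k y. f y * (pot \<alpha> (b k) (y - x) - pot \<alpha> (b k) y * ?\<rho> k)"
 have u0: "0 < pot \<alpha> (b k) 0" for k by (rule pot_zero_pos[OF \<alpha> b])
 have kp: "killed_pot (b k) (\<lambda>y. ennreal (f y)) x = ennreal (\<integral>y. ?I k y \<partial>lborel)" for k
 proof -
  have "killed_pot (b k) (\<lambda>y. ennreal (f y)) x = ennreal (?v k x - ?v k 0 * ?\<rho> k)"
   by (rule killed_pot_eq[OF b fm fB' B0]) (rule potV_convolution[OF b fi f0])+
  also have "?v k x - ?v k 0 * ?\<rho> k = (\<integral>y. f y * pot \<alpha> (b k) (y - x) - f y * pot \<alpha> (b k) (y - 0) * ?\<rho> k \<partial>lborel)"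
   using potV_convolution(4)[OF b fi f0, of k x] potV_convolution(4)[OF b fi f0, of k 0]
   by (subst Bochner_Integration.integral_diff) auto
  also have "\<dots> = (\<integral>y. ?I k y \<partial>lborel)"
   by (intro Bochner_Integration.integral_cong) (auto simp: algebra_simps)
  finally show ?thesis .
 qed
 let ?a = "\<lambda>k z. pot \<alpha> (b k) 0 - pot \<alpha> (b k) z"
 \<comment> \<open>\<open>?a k\<close> is the compensated potential. The ratio in front of the last
   one tends to \<open>1\<close>, so the bracket tends to \<open>grn\<close>.\<close>
 have I: "?I k y = f y * (?a k y - ?a k (y - x) + (pot \<alpha> (b k) y / pot \<alpha> (b k) 0) * ?a k x)" for k y
  using u0[of k] by (simp add: field_simps)
 have pa: "0 \<le> ?a k z" "?a k z \<le> pot0 \<alpha> z" for k z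
  using pot_diff_nonneg[OF \<alpha> b, of k z] pot_diff_le[OF \<alpha> b, of k z] by auto
 have lim: "(\<lambda>k. \<integral>y. ?I k y \<partial>lborel) \<longlonglongrightarrow> (\<integral>y. f y * grn \<alpha> x y \<partial>lborel)"
 proof (rule integral_dominated_convergence[where w="\<lambda>y. B * (3 * pot0 \<alpha> (R + \<bar>x\<bar>)) * indicator {-R..R} y"])
  have [measurable]: "pot \<alpha> (b k) \<in> borel_measurable borel" for k by (rule pot_measurable[OF \<alpha> b])
  show "(\<lambda>y. ?I k y) \<in> borel_measurable lborel" for k by measurable
  show "AE y in lborel. (\<lambda>k. ?I k y) \<longlonglongrightarrow> f y * grn \<alpha> x y"
  proof (intro AE_I2)
   fix y
   have "(\<lambda>k. f y * (?a k y - ?a k (y - x) + (pot \<alpha> (b k) y / pot \<alpha> (b k) 0) * ?a k x)) \<longlonglongrightarrow> f y * (pot0 \<alpha> y - pot0 \<alpha> (y - x) + 1 * pot0 \<alpha> x)"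
    unfolding b_def by (intro tendsto_mult tendsto_const tendsto_add tendsto_diff pot_diff_tendsto[OF \<alpha>] pot_ratio_tendsto[OF \<alpha>])
   then show "(\<lambda>k. ?I k y) \<longlonglongrightarrow> f y * grn \<alpha> x y"
    unfolding I grn_def[OF \<alpha>] by (simp add: pot0_diff_commute[OF \<alpha>, of x y] add.commute add_diff_eq)
  qed
  show "AE y in lborel. norm (?I k y) \<le> B * (3 * pot0 \<alpha> (R + \<bar>x\<bar>)) * indicator {-R..R} y" for k
  proof (intro AE_I2)
   fix y
   show "norm (?I k y) \<le> B * (3 * pot0 \<alpha> (R + \<bar>x\<bar>)) * indicator {-R..R} y"
   proof (cases "\<bar>y\<bar> \<le> R")
    case True
    let ?K = "pot0 \<alpha> (R + \<bar>x\<bar>)"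
    have K: "?a k y \<le> ?K" "?a k (y - x) \<le> ?K" "?a k x \<le> ?K"
     by (rule order_trans[OF pa(2) pot0_mono], use True R in linarith)+
    have K0: "0 \<le> ?K" by (rule pot0_nonneg[OF \<alpha>])
    have r: "\<bar>pot \<alpha> (b k) y / pot \<alpha> (b k) 0\<bar> \<le> 1"
     using pot_abs_le[OF \<alpha> b, of k y] u0[of k] by (simp add: abs_divide divide_le_eq)
    have "\<bar>(pot \<alpha> (b k) y / pot \<alpha> (b k) 0) * ?a k x\<bar> \<le> 1 * ?K"
     unfolding abs_mult using r K(3) pa(1)[of k x] K0 by (intro mult_mono) auto
    then have "\<bar>?a k y - ?a k (y - x) + (pot \<alpha> (b k) y / pot \<alpha> (b k) 0) * ?a k x\<bar> \<le> 3 * ?K"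
     using K pa(1)[of k y] pa(1)[of k "y - x"] K0 unfolding abs_le_iff by linarith
    then have "\<bar>f y * (?a k y - ?a k (y - x) + (pot \<alpha> (b k) y / pot \<alpha> (b k) 0) * ?a k x)\<bar> \<le> B * (3 * ?K)"
     using f0[of y] fB[of y] B0 unfolding abs_mult[of "f y"] by (intro mult_mono) auto
    moreover have "indicator {-R..R} y = (1::real)" using True by (auto simp: indicator_def)
    ultimately show ?thesis unfolding I real_norm_def by (simp only: mult_1_right)
   next
    case False
    then have "f y = 0" by (intro supp) simp
    moreover have "0 \<le> B * (3 * pot0 \<alpha> (R + \<bar>x\<bar>)) * indicator {-R..R} y"
     using B0 pot0_nonneg[OF \<alpha>] by (intro mult_nonneg_nonneg) auto
    ultimately show ?thesis by (simp only: mult_zero_left norm_zero)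
   qed
  qed
  show "integrable lborel (\<lambda>y. B * (3 * pot0 \<alpha> (R + \<bar>x\<bar>)) * indicator {-R..R} y)" by (rule integrable_const_Icc)
 qed measurable
 have gi: "integrable lborel (\<lambda>y. f y * grn \<alpha> x y)"
 proof (rule Bochner_Integration.integrable_bound[OF integrable_const_Icc[of "B * (2 * pot0 \<alpha> x)" "-R" R]])
  show "AE y in lborel. norm (f y * grn \<alpha> x y) \<le> norm (B * (2 * pot0 \<alpha> x) * indicator {-R..R} y)"
  proof (intro AE_I2)
   fix y
   have "norm (f y * grn \<alpha> x y) = f y * grn \<alpha> x y" using f0 grn_nonneg[OF \<alpha>] by simp
   also have "\<dots> \<le> (B * indicator {-R..R} y) * (2 * pot0 \<alpha> x)"
    using fle[of y] f0[of y] grn_nonneg[OF \<alpha>, of x y] grn_le_left[OF \<alpha>, of x y] B0 by (intro mult_mono) auto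
   also have "\<dots> = norm (B * (2 * pot0 \<alpha> x) * indicator {-R..R} y)"
    using B0 pot0_nonneg[OF \<alpha>, of x] by (simp add: abs_mult)
   finally show "norm (f y * grn \<alpha> x y) \<le> norm (B * (2 * pot0 \<alpha> x) * indicator {-R..R} y)" .
  qed
 qed measurable
 have "(\<lambda>k. killed_pot (b k) (\<lambda>y. ennreal (f y)) x) \<longlonglongrightarrow> ennreal (\<integral>y. f y * grn \<alpha> x y \<partial>lborel)"
  unfolding kp by (intro tendsto_ennrealI lim)
 moreover have "(\<lambda>k. killed_pot (b k) (\<lambda>y. ennreal (f y)) x) \<longlonglongrightarrow> killed_pot 0 (\<lambda>y. ennreal (f y)) x"
  unfolding killed_pot_discount_SUP(1)[OF fm] b_def by (rule LIMSEQ_SUP[OF killed_pot_discount_SUP(2)[OF fm]])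
 ultimately have "killed_pot 0 (\<lambda>y. ennreal (f y)) x = ennreal (\<integral>y. f y * grn \<alpha> x y \<partial>lborel)"
  by (rule LIMSEQ_unique[symmetric])
 also have "\<dots> = (\<integral>\<^sup>+y. ennreal (f y * grn \<alpha> x y) \<partial>lborel)"
  by (rule nn_integral_eq_integral[OF gi, symmetric]) (use f0 grn_nonneg[OF \<alpha>] in auto)
 finally show ?thesis using f0 grn_nonneg[OF \<alpha>] by (simp add: ennreal_mult)
qed

text \<open>Both sides are integrals of \<open>f\<close> against a measure. The two measures agree
  on compact intervals, which form an intersection-stable generator, and are finite there because
  \<open>grn\<close> is bounded in its second argument.\<close>

theorem green:
 assumes f[measurable]: "f \<in> borel_measurable borel"
 shows "killed_pot 0 f x = (\<integral>\<^sup>+y. f y * ennreal (grn \<alpha> x y) \<partial>lborel)"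
proof -
 let ?S = "{p. 0 \<le> snd p \<and> alive x (snd p) (traj (fst p))}"
 define U where "U = distr (density (M \<Otimes>\<^sub>M lborel) (indicator ?S)) borel (\<lambda>p. x + X (snd p) (fst p))"
 have Sm[measurable]: "(indicator ?S :: _ \<Rightarrow> ennreal) \<in> borel_measurable (M \<Otimes>\<^sub>M lborel)"
  unfolding indicator_def mem_Collect_eq by measurable
 have U: "(\<integral>\<^sup>+y. h y \<partial>U) = killed_pot 0 h x" if [measurable]: "h \<in> borel_measurable borel" for h
  unfolding U_def killed_pot_pair[OF that] by (simp add: nn_integral_distr nn_integral_density mult.commute)
 let ?D = "density lborel (\<lambda>y. ennreal (grn \<alpha> x y))"
 have eq: "emeasure U {a..b} = emeasure ?D {a..b}" for a b
 proof -
  have "emeasure U {a..b} = killed_pot 0 (\<lambda>y. ennreal (indicator {a..b} y)) x"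
   by (subst U[symmetric]) (simp_all add: ennreal_indicator U_def)
  also have "\<dots> = (\<integral>\<^sup>+y. ennreal (indicator {a..b} y) * ennreal (grn \<alpha> x y) \<partial>lborel)"
   by (rule green_bounded[where B=1 and R="max \<bar>a\<bar> \<bar>b\<bar>"]) (auto simp: indicator_def)
  also have "\<dots> = emeasure ?D {a..b}" by (simp add: emeasure_density ennreal_indicator mult.commute)
  finally show ?thesis .
 qed
 have "U = ?D"
 proof (rule measure_eqI_generator_eq[where \<Omega>=UNIV and E="range (\<lambda>(a, b). {a..b})" and A="\<lambda>n. {- real n..real n}"])
  show "Int_stable (range (\<lambda>(a, b :: real). {a..b}))" unfolding Int_stable_def by (auto simp: Int_atLeastAtMost)
  show "emeasure U S = emeasure ?D S" if "S \<in> range (\<lambda>(a, b). {a..b})" for S using that eq by auto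
  show "sets U = sigma_sets UNIV (range (\<lambda>(a, b). {a..b}))" "sets ?D = sigma_sets UNIV (range (\<lambda>(a, b). {a..b}))"
   by (simp_all add: U_def borel_eq_atLeastAtMost case_prod_unfold)
  show "(\<Union>n. {- real n..real n}) = UNIV"
  proof safe
   fix y :: real
   obtain n :: nat where "\<bar>y\<bar> \<le> real n" using real_arch_simple by blast
   then show "y \<in> (\<Union>n. {- real n..real n})" by (intro UN_I[of n]) auto
  qed simp
  show "emeasure U {- real n..real n} \<noteq> \<infinity>" for n
  proof -
   have "emeasure ?D {- real n..real n} \<le> (\<integral>\<^sup>+y. ennreal (2 * pot0 \<alpha> x) * indicator {- real n..real n} y \<partial>lborel)"
    by (subst emeasure_density) (auto intro!: nn_integral_mono mult_right_mono ennreal_leI grn_le_left[OF \<alpha>])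
   also have "\<dots> < \<infinity>" by (simp add: nn_integral_cmult ennreal_mult_less_top)
   finally show ?thesis using eq by simp
  qed
 qed auto
 then show ?thesis using U[OF f] by (simp add: nn_integral_density mult.commute)
qed

text \<open>Averaging \<open>cos\<close> over a Gaussian frequency turns the characteristic function into a tail bound.\<close>

lemma tail_le:
 assumes \<delta>: "0 < \<delta>"
 obtains C where "0 \<le> C" "\<And>h. 0 \<le> h \<Longrightarrow> prob {w\<in>space M. \<delta> < \<bar>X h w\<bar>} \<le> C * h"
proof
 let ?c = "1 / \<delta>" and ?G = std_normal_distribution
 \<comment> \<open>The factor \<open>2\<close> is the Gaussian mean of \<open>1 + y^2\<close>, which
   dominates \<open>\<bar>y\<bar> powr \<alpha>\<close>. The denominator is a lower bound for
   \<open>1 - exp (- (?c * X h w)^2 / 2)\<close> on the event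
   \<open>\<delta> < \<bar>X h w\<bar>\<close>.\<close>
 define C where "C = 2 * ?c powr \<alpha> / (1 - exp (- 1 / 2))"
 have e1: "exp (- 1 / 2) < (1::real)" by simp
 show "0 \<le> C" unfolding C_def using e1 by (intro divide_nonneg_nonneg) auto
 fix h :: real assume h: "0 \<le> h"
 interpret G: real_distribution ?G by (rule real_dist_normal_dist)
 interpret P: pair_prob_space M ?G ..
 have cosR: "(\<integral>y. cos (t * y) \<partial>R) = Re (char R t)" if "real_distribution R" for R t
 proof -
  interpret R: real_distribution R by fact
  have "Re (char R t) = (\<integral>y. Re (iexp (t * y)) \<partial>R)"
   unfolding char_def by (rule integral_Re[symmetric]) (rule R.integrable_const_bound[where B=1], auto)
  then show ?thesis by (simp add: Re_exp)
 qed
 have cosG: "exp (- t\<^sup>2 / 2) = (\<integral>y. cos (t * y) \<partial>?G)" for t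
  using cosR[OF G.real_distribution_axioms, of t] char_std_normal_distribution by simp
 have cosM: "(\<integral>w. cos (t * X h w) \<partial>M) = exp (- h * \<bar>t\<bar> powr \<alpha>)" for t
  using cosR[of "distr M borel (X h)" t] char_X[OF h, of t] by (simp add: integral_distr real_distribution_distr)
 have int: "integrable (M \<Otimes>\<^sub>M ?G) (\<lambda>(w, y). cos (?c * X h w * y))"
  by (rule P.integrable_const_bound[where B=1]) auto
 have "(\<integral>w. exp (- (?c * X h w)\<^sup>2 / 2) \<partial>M) = (\<integral>w. (\<integral>y. cos (?c * X h w * y) \<partial>?G) \<partial>M)"
  by (simp only: cosG)
 also have "\<dots> = (\<integral>y. (\<integral>w. cos (?c * X h w * y) \<partial>M) \<partial>?G)"
  by (rule P.Fubini_integral[OF int, symmetric])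
 also have "\<dots> = (\<integral>y. exp (- h * \<bar>?c * y\<bar> powr \<alpha>) \<partial>?G)"
  using cosM[of "?c * y" for y] by (simp add: mult_ac)
 finally have eq: "(\<integral>w. exp (- (?c * X h w)\<^sup>2 / 2) \<partial>M) = (\<integral>y. exp (- h * \<bar>?c * y\<bar> powr \<alpha>) \<partial>?G)" .
 have i1: "integrable ?G (\<lambda>y. 1 + y\<^sup>2)"
  using integrable_std_normal_distribution_moment[of 2] by simp
 have i2: "integrable ?G (\<lambda>y. exp (- h * \<bar>?c * y\<bar> powr \<alpha>))"
  by (rule G.integrable_const_bound[where B=1]) (use h in \<open>auto intro!: AE_I2\<close>)
 have i3: "integrable M (\<lambda>w. exp (- (?c * X h w)\<^sup>2 / 2))"
  by (rule integrable_const_bound[where B=1]) auto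
 have m2: "(\<integral>y. 1 + y\<^sup>2 \<partial>?G) = 2"
  using std_normal_distribution_even_moments[of 1] G.prob_space by simp
 have "1 - (\<integral>y. exp (- h * \<bar>?c * y\<bar> powr \<alpha>) \<partial>?G) = (\<integral>y. 1 - exp (- h * \<bar>?c * y\<bar> powr \<alpha>) \<partial>?G)"
  using i2 G.prob_space by simp
 also have "\<dots> \<le> (\<integral>y. h * ?c powr \<alpha> * (1 + y\<^sup>2) \<partial>?G)"
 proof (rule integral_mono)
  fix y :: real
  have "1 - exp (- h * \<bar>?c * y\<bar> powr \<alpha>) \<le> h * \<bar>?c * y\<bar> powr \<alpha>"
   using exp_ge_add_one_self[of "- h * \<bar>?c * y\<bar> powr \<alpha>"] by linarith
  also have "\<dots> = h * ?c powr \<alpha> * \<bar>y\<bar> powr \<alpha>" using \<delta> by (simp add: abs_mult powr_mult abs_divide powr_divide)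
  also have "\<dots> \<le> h * ?c powr \<alpha> * (1 + y\<^sup>2)"
  proof (intro mult_left_mono mult_nonneg_nonneg)
   show "\<bar>y\<bar> powr \<alpha> \<le> 1 + y\<^sup>2"
   proof (cases "\<bar>y\<bar> \<le> 1")
    case True
    then have "\<bar>y\<bar> powr \<alpha> \<le> 1 powr \<alpha>" using \<alpha> by (intro powr_mono2) auto
    then have "\<bar>y\<bar> powr \<alpha> \<le> 1" by simp
    then show ?thesis using zero_le_power2[of y] by linarith
   next
    case False
    then have "\<bar>y\<bar> powr \<alpha> \<le> \<bar>y\<bar> powr 2" using \<alpha> by (intro powr_mono) auto
    also have "\<dots> = y\<^sup>2" using False by (simp add: powr_numeral)
    finally show ?thesis by simp
   qed
  qed (use h in auto)
  finally show "1 - exp (- h * \<bar>?c * y\<bar> powr \<alpha>) \<le> h * ?c powr \<alpha> * (1 + y\<^sup>2)" .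
 qed (use i1 i2 in auto)
 also have "\<dots> = 2 * h * ?c powr \<alpha>" using m2 by simp
 finally have up: "1 - (\<integral>w. exp (- (?c * X h w)\<^sup>2 / 2) \<partial>M) \<le> 2 * h * ?c powr \<alpha>" unfolding eq .
 let ?A = "{w\<in>space M. \<delta> < \<bar>X h w\<bar>}"
 have "(1 - exp (- 1 / 2)) * prob ?A = (\<integral>w. (1 - exp (- 1 / 2)) * indicator ?A w \<partial>M)" by simp
 also have "\<dots> \<le> (\<integral>w. 1 - exp (- (?c * X h w)\<^sup>2 / 2) \<partial>M)"
 proof (rule integral_mono)
  fix w
  show "(1 - exp (- 1 / 2)) * indicator ?A w \<le> 1 - exp (- (?c * X h w)\<^sup>2 / 2)"
  proof (cases "w \<in> ?A")
   case True
   then have "1 < \<bar>?c * X h w\<bar>" using \<delta> by (simp add: abs_divide less_divide_eq)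
   then have "1\<^sup>2 \<le> (?c * X h w)\<^sup>2" by (subst abs_le_square_iff[symmetric]) simp
   then have "exp (- (?c * X h w)\<^sup>2 / 2) \<le> exp (- 1 / 2)" by simp
   then show ?thesis using True by simp
  next
   case False
   have "exp (- (?c * X h w)\<^sup>2 / 2) \<le> exp 0" by (subst exp_le_cancel_iff) simp
   then show ?thesis using False by simp
  qed
 next
  have "?A \<in> events" by measurable
  then show "integrable M (\<lambda>w. (1 - exp (- 1 / 2)) * indicator ?A w :: real)"
   by (intro integrable_mult_right integrable_real_indicator) (auto simp: emeasure_eq_measure)
 qed (use i3 in simp)
 also have "\<dots> = 1 - (\<integral>w. exp (- (?c * X h w)\<^sup>2 / 2) \<partial>M)" using i3 prob_space by simp
 finally have "(1 - exp (- 1 / 2)) * prob ?A \<le> 2 * h * ?c powr \<alpha>" using up by linarith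
 then have "prob ?A \<le> 2 * h * ?c powr \<alpha> / (1 - exp (- 1 / 2))" using e1 by (simp add: le_divide_eq mult.commute)
 then show "prob ?A \<le> C * h" unfolding C_def by (simp add: mult_ac)
qed

text \<open>Up to time \<open>T\<close> the factor \<open>exp T * exp (- s)\<close> is at least
  \<open>1\<close>, so occupation is bounded by a potential of discount \<open>1\<close>, with
  density at most \<open>pot \<alpha> 1 0\<close>. Linearity in \<open>\<epsilon>\<close> makes
  small neighbourhoods negligible later.\<close>

lemma occupation_le:
 assumes \<epsilon>: "0 < \<epsilon>"
 shows "(\<integral>\<^sup>+w. (\<integral>\<^sup>+s\<in>{0..T}. indicator {w. \<bar>x + X s w\<bar> < \<epsilon>} w \<partial>lborel) \<partial>M) \<le> ennreal (exp T * (pot \<alpha> 1 0 * (2 * \<epsilon>)))"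
proof -
 let ?f = "indicator {-\<epsilon><..<\<epsilon>} :: real \<Rightarrow> ennreal"
 have "(\<integral>\<^sup>+w. (\<integral>\<^sup>+s\<in>{0..T}. indicator {w. \<bar>x + X s w\<bar> < \<epsilon>} w \<partial>lborel) \<partial>M)
  \<le> (\<integral>\<^sup>+w. ennreal (exp T) * discounted 1 ?f x w {0..} \<partial>M)"
 proof (rule nn_integral_mono)
  fix w assume om: "w \<in> space M"
  note [measurable] = X_time_measurable[OF om]
  have "(\<integral>\<^sup>+s\<in>{0..T}. indicator {w. \<bar>x + X s w\<bar> < \<epsilon>} w \<partial>lborel) \<le> (\<integral>\<^sup>+s. ennreal (exp T) * (ennreal (exp (- 1 * s)) * ?f (x + X s w) * indicator {0..} s) \<partial>lborel)"
  proof (rule nn_integral_mono)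
   fix s
   have "1 \<le> ennreal (exp T) * ennreal (exp (- 1 * s))" if "s \<le> T"
   proof -
    have "1 \<le> exp T * exp (- 1 * s)" using that by (simp add: exp_add[symmetric])
    then have "ennreal 1 \<le> ennreal (exp T * exp (- 1 * s))" by (rule ennreal_leI)
    then show ?thesis by (simp add: ennreal_mult)
   qed
   then show "indicator {w. \<bar>x + X s w\<bar> < \<epsilon>} w * indicator {0..T} s \<le> ennreal (exp T) * (ennreal (exp (- 1 * s)) * ?f (x + X s w) * indicator {0..} s)"
    by (auto simp: indicator_def abs_less_iff)
  qed
  also have "\<dots> = ennreal (exp T) * discounted 1 ?f x w {0..}"
   by (rule nn_integral_cmult) measurable
  finally show "(\<integral>\<^sup>+s\<in>{0..T}. indicator {w. \<bar>x + X s w\<bar> < \<epsilon>} w \<partial>lborel) \<le> ennreal (exp T) * discounted 1 ?f x w {0..}" .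
 qed
 also have "\<dots> = ennreal (exp T) * potV 1 ?f x"
  unfolding potV_def by (rule nn_integral_cmult) measurable
 also have "potV 1 ?f x = (\<integral>\<^sup>+y. ?f y * ennreal (pot \<alpha> 1 (y - x)) \<partial>lborel)" by (rule potV_eq) auto
 also have "\<dots> \<le> (\<integral>\<^sup>+y. ennreal (pot \<alpha> 1 0) * ?f y \<partial>lborel)"
 proof (rule nn_integral_mono)
  fix y
  have "pot \<alpha> 1 (y - x) \<le> pot \<alpha> 1 0" using pot_abs_le[OF \<alpha>, of 1 "y - x"] by simp
  then show "?f y * ennreal (pot \<alpha> 1 (y - x)) \<le> ennreal (pot \<alpha> 1 0) * ?f y"
   by (subst mult.commute) (intro mult_right_mono ennreal_leI, auto)
 qed
 also have "\<dots> = ennreal (pot \<alpha> 1 0) * ennreal (2 * \<epsilon>)" using \<epsilon> by (simp add: nn_integral_cmult)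
 finally show ?thesis
  using \<epsilon> pot_zero_pos[OF \<alpha>, of 1] by (simp add: ennreal_mult mult_left_mono)
qed

text \<open>Given the path up to \<open>s\<close>, the next increment over time \<open>h\<close>
  exceeds \<open>\<delta>\<close> with probability at most \<open>C * h\<close>. Integration over
  \<open>s\<close> multiplies this by the occupation bound, so being near \<open>0\<close> and then
  jumping is of order \<open>h * \<epsilon>\<close>.\<close>

lemma jump_frequency_le:
 assumes h: "0 \<le> h" and \<delta>: "0 < \<delta>" and C: "0 \<le> C" "\<And>h. 0 \<le> h \<Longrightarrow> prob {w\<in>space M. \<delta> < \<bar>X h w\<bar>} \<le> C * h" and \<epsilon>: "0 < \<epsilon>"
 shows "(\<integral>\<^sup>+w. (\<integral>\<^sup>+s\<in>{0..T}. indicator {w. \<bar>x + X s w\<bar> < \<epsilon> \<and> \<delta> < \<bar>X (s + h) w - X s w\<bar>} w \<partial>lborel) \<partial>M)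
  \<le> ennreal (C * h) * ennreal (exp T * (pot \<alpha> 1 0 * (2 * \<epsilon>)))"
proof -
 let ?e = "\<lambda>s. indicator {w. \<bar>x + X s w\<bar> < \<epsilon>} :: 'w \<Rightarrow> ennreal"
 let ?J = "\<lambda>s. indicator {w. \<bar>x + X s w\<bar> < \<epsilon> \<and> \<delta> < \<bar>X (s + h) w - X s w\<bar>} :: 'w \<Rightarrow> ennreal"
 have Jm: "(\<lambda>(w, s). ?J s w * indicator {0..T} s) \<in> borel_measurable (M \<Otimes>\<^sub>M lborel)"
  unfolding indicator_def[of "Collect _"] mem_Collect_eq by measurable
 have em: "(\<lambda>(w, s). ?e s w * indicator {0..T} s) \<in> borel_measurable (M \<Otimes>\<^sub>M lborel)"
  unfolding indicator_def[of "Collect _"] mem_Collect_eq by measurable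
 have step: "(\<integral>\<^sup>+w. ?J s w \<partial>M) \<le> ennreal (C * h) * (\<integral>\<^sup>+w. ?e s w \<partial>M)" if s: "0 \<le> s" for s
 proof -
  let ?Q = "\<lambda>p. \<bar>x + p s\<bar> < \<epsilon>" and ?G = "\<lambda>y g. indicator {g. \<delta> < \<bar>g h\<bar>} g :: ennreal"
  have [measurable]: "(\<lambda>g. g t) \<in> borel_measurable path_space" for t by (rule measurable_component_singleton) simp
  have "(\<lambda>(y :: real, g). ?G y g) \<in> borel_measurable (borel \<Otimes>\<^sub>M path_space)"
   unfolding case_prod_unfold indicator_def mem_Collect_eq by measurable
  note m = markov_indicator[OF s this, of ?Q]
  have "(\<integral>\<^sup>+w. ?J s w \<partial>M) = (\<integral>\<^sup>+w. indicator {w. ?Q (traj w)} w * ?G (X s w) (restart s (traj w)) \<partial>M)"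
   using h by (intro nn_integral_cong) (auto simp: restart_def traj_def indicator_def max_absorb2)
  also have "\<dots> = (\<integral>\<^sup>+w. indicator {w. ?Q (traj w)} w * (\<integral>\<^sup>+w'. ?G (X s w) (traj w') \<partial>M) \<partial>M)"
   by (rule m) (auto simp: stopped_def)
  also have "\<dots> = (\<integral>\<^sup>+w. ?e s w * emeasure M {w\<in>space M. \<delta> < \<bar>X h w\<bar>} \<partial>M)"
  proof -
   have "(\<integral>\<^sup>+w'. ?G y (traj w') \<partial>M) = (\<integral>\<^sup>+w'. indicator {w\<in>space M. \<delta> < \<bar>X h w\<bar>} w' \<partial>M)" for y
    by (intro nn_integral_cong) (simp add: traj_def indicator_def)
   then show ?thesis by (simp add: traj_def)
  qed
  also have "\<dots> \<le> (\<integral>\<^sup>+w. ennreal (C * h) * ?e s w \<partial>M)"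
   unfolding emeasure_eq_measure by (subst mult.commute) (intro nn_integral_mono mult_right_mono ennreal_leI C(2)[OF h], simp)
  also have "\<dots> = ennreal (C * h) * (\<integral>\<^sup>+w. ?e s w \<partial>M)"
   by (rule nn_integral_cmult) (unfold indicator_def mem_Collect_eq, measurable)
  finally show ?thesis .
 qed
 interpret MS: pair_sigma_finite M lborel ..
 have "(\<integral>\<^sup>+w. (\<integral>\<^sup>+s\<in>{0..T}. ?J s w \<partial>lborel) \<partial>M) = (\<integral>\<^sup>+s. (\<integral>\<^sup>+w. ?J s w * indicator {0..T} s \<partial>M) \<partial>lborel)"
  using MS.Fubini'[OF Jm] by simp
 also have "\<dots> \<le> (\<integral>\<^sup>+s. ennreal (C * h) * (\<integral>\<^sup>+w. ?e s w * indicator {0..T} s \<partial>M) \<partial>lborel)"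
 proof (rule nn_integral_mono)
  fix s :: real
  show "(\<integral>\<^sup>+w. ?J s w * indicator {0..T} s \<partial>M) \<le> ennreal (C * h) * (\<integral>\<^sup>+w. ?e s w * indicator {0..T} s \<partial>M)"
   using step[of s] by (cases "s \<in> {0..T}") auto
 qed
 also have "\<dots> = ennreal (C * h) * (\<integral>\<^sup>+s. (\<integral>\<^sup>+w. ?e s w * indicator {0..T} s \<partial>M) \<partial>lborel)"
  by (rule nn_integral_cmult) (unfold indicator_def[of "Collect _"] mem_Collect_eq, measurable)
 also have "(\<integral>\<^sup>+s. (\<integral>\<^sup>+w. ?e s w * indicator {0..T} s \<partial>M) \<partial>lborel) = (\<integral>\<^sup>+w. (\<integral>\<^sup>+s\<in>{0..T}. ?e s w \<partial>lborel) \<partial>M)"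
  using MS.Fubini'[OF em] by simp
 also have "ennreal (C * h) * \<dots> \<le> ennreal (C * h) * ennreal (exp T * (pot \<alpha> 1 0 * (2 * \<epsilon>)))"
  by (intro mult_left_mono occupation_le \<epsilon>) simp
 finally show ?thesis .
qed

text \<open>If \<open>x + X\<close> jumped away from a zero left limit at time \<open>s\<close>, then all times in \<open>(s - h, s)\<close> would
 see a small value of \<open>x + X\<close> followed by a large increment over time \<open>h\<close>; such times are rare.\<close>

lemma AE_no_jump_from_zero_quantitative:
 assumes \<delta>: "0 < \<delta>"
 shows "AE w in M. \<forall>s>0. s \<le> T \<longrightarrow> ((\<lambda>t. x + X t w) \<longlongrightarrow> 0) (at_left s) \<longrightarrow> \<bar>x + X s w\<bar> \<le> 4 * \<delta>"
proof -
 obtain C where C: "0 \<le> C" "\<And>h. 0 \<le> h \<Longrightarrow> prob {w\<in>space M. \<delta> < \<bar>X h w\<bar>} \<le> C * h" by (rule tail_le[OF \<delta>], rule that)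
 define K where "K = C * (exp T * (pot \<alpha> 1 0 * 2))"
 \<comment> \<open>Time spent near \<open>0\<close> just before a large increment, divided by the
   window length \<open>1 / (n + 1)\<close>. Its mean is of order \<open>\<epsilon>\<close>
   uniformly in \<open>n\<close>, while a jump away from left limit \<open>0\<close> keeps it at
   least \<open>1\<close> for all large \<open>n\<close>.\<close>
 define \<phi> where "\<phi> \<epsilon> n w = ennreal (real (Suc n)) * (\<integral>\<^sup>+s\<in>{0..T}. indicator {w. \<bar>x + X s w\<bar> < \<epsilon> \<and> \<delta> < \<bar>X (s + 1 / real (Suc n)) w - X s w\<bar>} w \<partial>lborel)" for \<epsilon> n w
 have \<phi>m[measurable]: "\<phi> \<epsilon> n \<in> borel_measurable M" for \<epsilon> n
  unfolding \<phi>_def[abs_def] indicator_def[of "Collect _"] mem_Collect_eq by measurable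
 have \<phi>le: "(\<integral>\<^sup>+w. \<phi> \<epsilon> n w \<partial>M) \<le> ennreal (K * \<epsilon>)" if \<epsilon>: "0 < \<epsilon>" for \<epsilon> n
 proof -
  let ?h = "1 / real (Suc n)"
  have "(\<integral>\<^sup>+w. \<phi> \<epsilon> n w \<partial>M) = ennreal (real (Suc n)) * (\<integral>\<^sup>+w. (\<integral>\<^sup>+s\<in>{0..T}. indicator {w. \<bar>x + X s w\<bar> < \<epsilon> \<and> \<delta> < \<bar>X (s + ?h) w - X s w\<bar>} w \<partial>lborel) \<partial>M)"
   unfolding \<phi>_def indicator_def[of "Collect _"] mem_Collect_eq by (rule nn_integral_cmult) measurable
  also have "\<dots> \<le> ennreal (real (Suc n)) * (ennreal (C * ?h) * ennreal (exp T * (pot \<alpha> 1 0 * (2 * \<epsilon>))))"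
   by (intro mult_left_mono jump_frequency_le[OF _ \<delta> C \<epsilon>]) auto
  also have "\<dots> = ennreal (real (Suc n) * (C * ?h * (exp T * (pot \<alpha> 1 0 * (2 * \<epsilon>)))))"
   using C(1) \<epsilon> pot_zero_pos[OF \<alpha>, of 1] by (simp only: ennreal_mult[symmetric] mult_nonneg_nonneg of_nat_0_le_iff zero_le_divide_1_iff exp_ge_zero less_imp_le zero_le_numeral zero_less_one)
  also have "real (Suc n) * (C * ?h * (exp T * (pot \<alpha> 1 0 * (2 * \<epsilon>)))) = K * \<epsilon>"
   unfolding K_def by (simp del: of_nat_Suc add: field_simps)
  finally show ?thesis .
 qed
 define L where "L \<epsilon> = {w\<in>space M. 1 \<le> liminf (\<lambda>n. \<phi> \<epsilon> n w)}" for \<epsilon>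
 have Lm[measurable]: "L \<epsilon> \<in> events" for \<epsilon> unfolding L_def by measurable
 have Lle: "emeasure M (L \<epsilon>) \<le> ennreal (K * \<epsilon>)" if \<epsilon>: "0 < \<epsilon>" for \<epsilon>
 proof -
  have "emeasure M (L \<epsilon>) = (\<integral>\<^sup>+w. indicator (L \<epsilon>) w \<partial>M)" by simp
  also have "\<dots> \<le> (\<integral>\<^sup>+w. liminf (\<lambda>n. \<phi> \<epsilon> n w) \<partial>M)"
   by (rule nn_integral_mono) (auto simp: L_def indicator_def)
  also have "\<dots> \<le> liminf (\<lambda>n. \<integral>\<^sup>+w. \<phi> \<epsilon> n w \<partial>M)" by (rule nn_integral_liminf) measurable
  also have "\<dots> \<le> ennreal (K * \<epsilon>)"
   by (rule Liminf_le) (use \<phi>le[OF \<epsilon>] in \<open>auto intro!: always_eventually\<close>)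
  finally show ?thesis .
 qed
 \<comment> \<open>A forbidden jump puts \<open>w\<close> into \<open>L \<epsilon>\<close> for every
   such \<open>\<epsilon>\<close>, whereas Fatou bounded the probability of
   \<open>L \<epsilon>\<close> by a multiple of \<open>\<epsilon>\<close>.\<close>
 let ?Z = "\<Inter>j. L (1 / (real j + 1))"
 have "emeasure M ?Z \<le> ennreal (K * (1 / (real j + 1)))" for j
  by (rule order_trans[OF emeasure_mono Lle]) (auto intro!: INT_lower)
 moreover have "(\<lambda>j. ennreal (K * (1 / (real j + 1)))) \<longlonglongrightarrow> ennreal (K * 0)"
 proof (intro tendsto_ennrealI tendsto_mult tendsto_const)
  show "(\<lambda>j. 1 / (real j + 1)) \<longlonglongrightarrow> 0"
   using LIMSEQ_inverse_real_of_nat by (simp add: inverse_eq_divide add.commute)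
 qed
 ultimately have "emeasure M ?Z \<le> ennreal (K * 0)"
  by (intro LIMSEQ_le_const[where X="\<lambda>j. ennreal (K * (1 / (real j + 1)))"]) auto
 then have "emeasure M ?Z = 0" by simp
 then have "?Z \<in> null_sets M" by (intro null_setsI) measurable
 then have "AE w in M. w \<notin> ?Z" by (rule AE_not_in)
 then show ?thesis
 proof (rule AE_mp, intro AE_I2 impI allI)
  fix w s assume om: "w \<in> space M" and nz: "w \<notin> ?Z" and s: "0 < s" "s \<le> T" and lim: "((\<lambda>t. x + X t w) \<longlongrightarrow> 0) (at_left s)"
  show "\<bar>x + X s w\<bar> \<le> 4 * \<delta>"
  proof (rule ccontr)
   assume big: "\<not> \<bar>x + X s w\<bar> \<le> 4 * \<delta>"
   note [measurable] = X_time_measurable[OF om]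
   have "w \<in> L (1 / (real j + 1))" for j
   proof -
    let ?\<epsilon> = "1 / (real j + 1)"
    have "((\<lambda>t. \<bar>x + X t w\<bar>) \<longlongrightarrow> \<bar>0\<bar>) (at_left s)" by (intro tendsto_rabs lim)
    then have "\<forall>\<^sub>F t in at_left s. \<bar>x + X t w\<bar> < min ?\<epsilon> \<delta>" by (rule order_tendstoD) (use \<delta> in simp)
    then obtain a where a: "a < s" "\<And>t. a < t \<Longrightarrow> t < s \<Longrightarrow> \<bar>x + X t w\<bar> < min ?\<epsilon> \<delta>"
     unfolding eventually_at_left_field by blast
    have "((\<lambda>t. \<bar>x + X t w\<bar>) \<longlongrightarrow> \<bar>x + X s w\<bar>) (at_right s)"
     using X_rc[of s w] unfolding continuous_within by (intro tendsto_rabs tendsto_add tendsto_const)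
    then have "\<forall>\<^sub>F t in at_right s. \<bar>x + X t w\<bar> > 4 * \<delta>" by (rule order_tendstoD) (use big in simp)
    then obtain b where b: "s < b" "\<And>t. s < t \<Longrightarrow> t < b \<Longrightarrow> \<bar>x + X t w\<bar> > 4 * \<delta>"
     unfolding eventually_at_right_field by blast
    \<comment> \<open>Windows shorter than \<open>\<eta>\<close> keep \<open>t\<close> positive and
      within the stretch before \<open>s\<close> where the path is small, and keep
      \<open>t + h\<close> within the stretch after \<open>s\<close> where it is large.\<close>
    define \<eta> where "\<eta> = min s (min (s - a) (b - s))"
    have \<eta>: "0 < \<eta>" using s a(1) b(1) by (simp add: \<eta>_def)
    obtain n0 where n0: "1 / (real n0 + 1) < \<eta>" by (rule small_reciprocal[OF \<eta>]) (rule that)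
    have "1 \<le> \<phi> ?\<epsilon> n w" if "n0 \<le> n" for n
    proof -
     let ?h = "1 / real (Suc n)"
     have h: "0 < ?h" "?h < \<eta>"
     proof -
      have "?h \<le> 1 / (real n0 + 1)" using that by (intro divide_left_mono) auto
      then show "?h < \<eta>" using n0 by linarith
     qed simp
     then have hs: "?h < s" "?h < s - a" "?h < b - s" by (auto simp: \<eta>_def)
     have "ennreal ?h = emeasure lborel {s - ?h<..<s}" using h(1) by simp
     also have "\<dots> = (\<integral>\<^sup>+t. indicator {s - ?h<..<s} t \<partial>lborel)" by simp
     also have "\<dots> \<le> (\<integral>\<^sup>+t\<in>{0..T}. indicator {w. \<bar>x + X t w\<bar> < ?\<epsilon> \<and> \<delta> < \<bar>X (t + ?h) w - X t w\<bar>} w \<partial>lborel)"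
     proof (rule nn_integral_mono)
      fix t :: real
      show "indicator {s - ?h<..<s} t \<le> (indicator {w. \<bar>x + X t w\<bar> < ?\<epsilon> \<and> \<delta> < \<bar>X (t + ?h) w - X t w\<bar>} w * indicator {0..T} t :: ennreal)"
      proof (cases "t \<in> {s - ?h<..<s}")
       case True
       have 1: "\<bar>x + X t w\<bar> < min ?\<epsilon> \<delta>" using a(2)[of t] True hs by auto
       have 2: "4 * \<delta> < \<bar>x + X (t + ?h) w\<bar>" using b(2)[of "t + ?h"] True hs by auto
       have "\<delta> < \<bar>X (t + ?h) w - X t w\<bar>" using 1 2 \<delta> by linarith
       then show ?thesis using 1 True s hs by (simp add: indicator_def)
      qed simp
     qed
     finally have "ennreal (real (Suc n)) * ennreal ?h \<le> \<phi> ?\<epsilon> n w" unfolding \<phi>_def by (rule mult_left_mono) simp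
     moreover have "ennreal (real (Suc n)) * ennreal ?h = 1" by (simp add: ennreal_mult[symmetric] del: of_nat_Suc)
     ultimately show ?thesis by simp
    qed
    then have "\<forall>\<^sub>F n in sequentially. 1 \<le> \<phi> ?\<epsilon> n w" unfolding eventually_sequentially by blast
    then have "1 \<le> liminf (\<lambda>n. \<phi> ?\<epsilon> n w)" by (rule Liminf_bounded)
    then show ?thesis using om by (simp add: L_def)
   qed
   then show False using nz by blast
  qed
 qed
qed

lemma AE_no_jump_from_zero:
 "AE w in M. \<forall>s>0. ((\<lambda>t. x + X t w) \<longlongrightarrow> 0) (at_left s) \<longrightarrow> x + X s w = 0"
proof -
 have "AE w in M. \<forall>k j::nat. \<forall>s>0. s \<le> real k \<longrightarrow> ((\<lambda>t. x + X t w) \<longlongrightarrow> 0) (at_left s) \<longrightarrow> \<bar>x + X s w\<bar> \<le> 4 * (1 / (real j + 1))"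
  unfolding AE_all_countable by (intro allI AE_no_jump_from_zero_quantitative) simp
 then show ?thesis
 proof (rule AE_mp, intro AE_I2 impI allI)
  fix w s
  assume a: "\<forall>k j::nat. \<forall>s>0. s \<le> real k \<longrightarrow> ((\<lambda>t. x + X t w) \<longlongrightarrow> 0) (at_left s) \<longrightarrow> \<bar>x + X s w\<bar> \<le> 4 * (1 / (real j + 1))"
   and s: "0 < s" and lim: "((\<lambda>t. x + X t w) \<longlongrightarrow> 0) (at_left s)"
  obtain k :: nat where k: "s \<le> real k" using real_arch_simple by blast
  have le: "\<bar>x + X s w\<bar> \<le> 4 * (1 / (real j + 1))" for j using a k s lim by blast
  have "(\<lambda>j. 4 * (1 / (real j + 1))) \<longlonglongrightarrow> 4 * 0"
  proof (intro tendsto_mult tendsto_const)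
   show "(\<lambda>j. 1 / (real j + 1)) \<longlonglongrightarrow> 0"
    using LIMSEQ_inverse_real_of_nat by (simp add: inverse_eq_divide add.commute)
  qed
  then have "\<bar>x + X s w\<bar> \<le> 4 * 0"
   by (rule LIMSEQ_le_const) (use le in blast)
  then show "x + X s w = 0" by simp
 qed
qed

end

section \<open>Clocks and resolvents\<close>

text \<open>One-sided limits bound the path near every point; compactness leaves finitely many local
  bounds.\<close>

lemma cadlag_bounded:
 fixes w :: "real \<Rightarrow> real"
 assumes "cadlag w"
 shows "\<exists>B. \<forall>u\<in>{a..b}. \<bar>w u\<bar> \<le> B"
proof -
 have "\<exists>U B. open U \<and> t \<in> U \<and> (\<forall>u\<in>U. \<bar>w u\<bar> \<le> B)" for t
 proof -
  obtain l where l: "(w \<longlongrightarrow> l) (at_left t)" using assms unfolding cadlag_def by blast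
  have r: "(w \<longlongrightarrow> w t) (at_right t)" using assms unfolding cadlag_def continuous_within by blast
  have "\<forall>\<^sub>F u in at_left t. \<bar>w u\<bar> < \<bar>l\<bar> + 1" by (rule order_tendstoD(2)[OF tendsto_rabs[OF l]]) simp
  moreover have "\<forall>\<^sub>F u in at_right t. \<bar>w u\<bar> < \<bar>w t\<bar> + 1" by (rule order_tendstoD(2)[OF tendsto_rabs[OF r]]) simp
  ultimately have "\<forall>\<^sub>F u in at t. \<bar>w u\<bar> \<le> \<bar>l\<bar> + \<bar>w t\<bar> + 1"
   unfolding eventually_at_split by (auto elim!: eventually_mono)
  then have "\<forall>\<^sub>F u in nhds t. \<bar>w u\<bar> \<le> \<bar>l\<bar> + \<bar>w t\<bar> + 1"
   unfolding eventually_at_filter by eventually_elim auto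
  then show ?thesis unfolding eventually_nhds by blast
 qed
 then obtain U B where U: "\<And>t. open (U t)" "\<And>t. t \<in> U t" "\<And>t u. u \<in> U t \<Longrightarrow> \<bar>w u\<bar> \<le> B t" by metis
 obtain C where C: "C \<subseteq> {a..b}" "finite C" "{a..b} \<subseteq> (\<Union>t\<in>C. U t)"
  by (rule compactE_image[OF compact_Icc, of "{a..b}" U a b]) (use U in auto)
 have "\<bar>w u\<bar> \<le> (\<Sum>t\<in>C. \<bar>B t\<bar>)" if u: "u \<in> {a..b}" for u
 proof -
  obtain t where t: "t \<in> C" "u \<in> U t" using C(3) u by blast
  have "\<bar>w u\<bar> \<le> \<bar>B t\<bar>" using U(3)[OF t(2)] by linarith
  also have "\<dots> \<le> (\<Sum>t\<in>C. \<bar>B t\<bar>)" using t(1) C(2) by (intro member_le_sum) auto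
  finally show ?thesis .
 qed
 then show ?thesis by blast
qed

text \<open>\<open>d\<close> stands for the speed density along one fixed path, so that the time
  change can be treated deterministically, path by path.\<close>

locale clock =
 fixes d :: "real \<Rightarrow> real"
 assumes d_meas[measurable]: "d \<in> borel_measurable borel" and d_pos: "\<And>u. 0 < d u"
  and d_bdd: "\<And>s. \<exists>K. \<forall>u\<in>{0..s}. d u \<le> K"
begin

definition A :: "real \<Rightarrow> real" where "A s = enn2real (\<integral>\<^sup>+u\<in>{0..s}. ennreal (d u) \<partial>lborel)"

lemma A_fin: "(\<integral>\<^sup>+u\<in>{0..s}. ennreal (d u) \<partial>lborel) < \<infinity>"
proof -
 obtain K where K: "\<And>u. u \<in> {0..s} \<Longrightarrow> d u \<le> K" using d_bdd by blast
 have "(\<integral>\<^sup>+u\<in>{0..s}. ennreal (d u) \<partial>lborel) \<le> (\<integral>\<^sup>+u. ennreal K * indicator {0..s} u \<partial>lborel)"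
  by (rule nn_integral_mono) (auto simp: indicator_def intro!: ennreal_leI K)
 also have "\<dots> = ennreal K * emeasure lborel {0..s}" by (rule nn_integral_cmult_indicator) simp
 also have "\<dots> < \<infinity>" by (simp add: ennreal_mult_less_top emeasure_lborel_Icc_eq)
 finally show ?thesis .
qed

lemma ennreal_A: "ennreal (A s) = (\<integral>\<^sup>+u\<in>{0..s}. ennreal (d u) \<partial>lborel)"
 unfolding A_def using A_fin[of s] by (intro ennreal_enn2real) simp

lemma A_nonneg: "0 \<le> A s" by (simp add: A_def)

lemma A_nonpos: "s \<le> 0 \<Longrightarrow> A s = 0"
proof -
 assume s: "s \<le> 0"
 have "(\<integral>\<^sup>+u\<in>{0..s}. ennreal (d u) \<partial>lborel) = (\<integral>\<^sup>+u. 0 \<partial>(lborel :: real measure))"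
 proof (rule nn_integral_cong_AE, rule AE_mp[OF AE_lborel_singleton[of 0]], intro AE_I2 impI)
  show "ennreal (d u) * indicator {0..s} u = 0" if "u \<noteq> 0" for u using that s by (auto simp: indicator_def)
 qed
 then show ?thesis by (simp add: A_def)
qed

lemma A_diff: assumes "0 \<le> s" "s \<le> t" shows "ennreal (A t) = ennreal (A s) + (\<integral>\<^sup>+u\<in>{s..t}. ennreal (d u) \<partial>lborel)"
proof -
 have "ennreal (A t) = (\<integral>\<^sup>+u. ennreal (d u) * indicator {0..s} u + ennreal (d u) * indicator {s..t} u \<partial>lborel)"
  unfolding ennreal_A
  by (rule nn_integral_cong_AE, rule AE_mp[OF AE_lborel_singleton[of s]]) (use assms in \<open>auto simp: indicator_def\<close>)
 also have "\<dots> = ennreal (A s) + (\<integral>\<^sup>+u\<in>{s..t}. ennreal (d u) \<partial>lborel)"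
  unfolding ennreal_A by (rule nn_integral_add) measurable
 finally show ?thesis .
qed

lemma A_strict: assumes "0 \<le> s" "s < t" shows "A s < A t"
proof -
 have "(\<integral>\<^sup>+u\<in>{s..t}. ennreal (d u) \<partial>lborel) \<noteq> 0"
 proof
  assume "(\<integral>\<^sup>+u\<in>{s..t}. ennreal (d u) \<partial>lborel) = 0"
  then have "AE u in lborel. ennreal (d u) * indicator {s..t} u = 0" by (subst (asm) nn_integral_0_iff_AE) auto
  then have "AE u in lborel. u \<notin> {s..t}"
  proof eventually_elim
   case (elim u)
   moreover have "ennreal (d u) \<noteq> 0" using d_pos[of u] by (simp add: ennreal_eq_0_iff not_le)
   ultimately show ?case by (simp add: indicator_def split: if_splits)
  qed
  then have "emeasure lborel {s..t} = 0" by (subst (asm) AE_iff_measurable[of "{s..t}"]) auto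
  then show False using assms by simp
 qed
 moreover have "(\<integral>\<^sup>+u\<in>{s..t}. ennreal (d u) \<partial>lborel) < top"
 proof -
  have "(\<integral>\<^sup>+u\<in>{s..t}. ennreal (d u) \<partial>lborel) \<le> ennreal (A t)" using A_diff[of s t] assms by simp
  then show ?thesis by (rule le_less_trans) simp
 qed
 ultimately obtain i where i: "0 < i" "(\<integral>\<^sup>+u\<in>{s..t}. ennreal (d u) \<partial>lborel) = ennreal i"
  by (cases "\<integral>\<^sup>+u\<in>{s..t}. ennreal (d u) \<partial>lborel") (auto simp: less_le)
 have "ennreal (A t) = ennreal (A s + i)"
  using A_diff[of s t] assms i A_nonneg[of s] by (simp add: ennreal_plus)
 then have "A t = A s + i" using A_nonneg[of t] A_nonneg[of s] i by (subst (asm) ennreal_inj) auto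
 then show ?thesis using i by simp
qed

lemma A_mono: "s \<le> t \<Longrightarrow> A s \<le> A t"
 using A_strict[of s t] A_nonpos[of s] A_nonneg[of t] by (cases "0 \<le> s"; cases "s = t") auto

lemma A_strict_mono: "strict_mono_on {0..} A"
 by (intro strict_mono_onI A_strict) auto

lemma A_less_iff: "0 \<le> s \<Longrightarrow> 0 \<le> t \<Longrightarrow> A s < A t \<longleftrightarrow> s < t"
 using A_strict A_mono by (meson not_le)

lemma A_lipschitz: assumes "0 \<le> s" "s \<le> t" "\<And>u. u \<in> {0..t} \<Longrightarrow> d u \<le> K" shows "A t - A s \<le> K * (t - s)"
proof -
 have K0: "0 \<le> K" using assms(3)[of 0] d_pos[of 0] assms(1,2) by (auto intro: order_trans[OF less_imp_le])
 have "(\<integral>\<^sup>+u\<in>{s..t}. ennreal (d u) \<partial>lborel) \<le> (\<integral>\<^sup>+u. ennreal K * indicator {s..t} u \<partial>lborel)"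
  by (rule nn_integral_mono) (use assms in \<open>auto simp: indicator_def intro!: ennreal_leI\<close>)
 also have "\<dots> = ennreal K * emeasure lborel {s..t}" by (rule nn_integral_cmult_indicator) simp
 also have "\<dots> = ennreal (K * (t - s))" using assms K0 by (simp add: ennreal_mult)
 finally have "ennreal (A t) \<le> ennreal (A s) + ennreal (K * (t - s))"
  unfolding A_diff[OF assms(1,2)] by (rule add_left_mono)
 also have "\<dots> = ennreal (A s + K * (t - s))" using K0 assms by (intro ennreal_plus[symmetric] A_nonneg) auto
 finally have "A t \<le> A s + K * (t - s)" using K0 assms A_nonneg[of s] by (subst (asm) ennreal_le_iff) auto
 then show ?thesis by simp
qed

lemma A_continuous: "continuous_on {0..} A"
proof (unfold continuous_on_iff, intro ballI allI impI)
 fix s e :: real assume s: "s \<in> {0..}" and e: "0 < e"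
 obtain K where K: "\<And>u. u \<in> {0..s+1} \<Longrightarrow> d u \<le> K" using d_bdd by blast
 have K0: "0 < K" using K[of 0] d_pos[of 0] s by auto
 have lip: "\<bar>A t - A u\<bar> \<le> K * \<bar>t - u\<bar>" if "0 \<le> t" "0 \<le> u" "t \<le> s + 1" "u \<le> s + 1" for t u
 proof (cases "t \<le> u")
  case True
  then show ?thesis using A_lipschitz[of t u K] A_mono[OF True] K that by auto
 next
  case False
  then show ?thesis using A_lipschitz[of u t K] A_mono[of u t] K that by auto
 qed
 show "\<exists>\<delta>>0. \<forall>t\<in>{0..}. dist t s < \<delta> \<longrightarrow> dist (A t) (A s) < e"
 proof (intro exI[of _ "min 1 (e / K)"] conjI ballI impI)
  show "0 < min 1 (e / K)" using e K0 by simp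
  fix t assume t: "t \<in> {0..}" "dist t s < min 1 (e / K)"
  then have "\<bar>A t - A s\<bar> \<le> K * \<bar>t - s\<bar>" using s by (intro lip) (auto simp: dist_real_def)
  also have "\<dots> < K * (e / K)" using t(2) K0 by (intro mult_strict_left_mono) (auto simp: dist_real_def)
  finally show "dist (A t) (A s) < e" using K0 by (simp add: dist_real_def)
 qed
qed

lemma A_measurable[measurable]: "A \<in> borel_measurable borel"
 by (rule borel_measurable_mono) (simp add: mono_def A_mono)

lemma A_zero: "A 0 = 0" by (simp add: A_nonpos)

lemma time_change_integral:
 fixes \<phi> :: "real \<Rightarrow> ennreal"
 assumes "\<phi> \<in> borel_measurable borel" "0 \<le> L"
 shows "(\<integral>\<^sup>+s\<in>{0..<L}. \<phi> (A s) * d s \<partial>lborel) = (\<integral>\<^sup>+v\<in>{0..<A L}. \<phi> v \<partial>lborel)"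
 using nn_integral_time_change[of d A \<phi> L] d_pos A_nonneg A_strict_mono A_continuous A_zero assms ennreal_A
 by (simp add: less_imp_le)

lemma A_surj: assumes "0 \<le> t" "t \<le> A s" "0 \<le> s" shows "\<exists>r\<ge>0. r \<le> s \<and> A r = t"
 using IVT'[of A 0 t s] assms A_zero continuous_on_subset[OF A_continuous, of "{0..s}"] by auto

text \<open>The inverse of \<open>A\<close>, encoded as the length of a sublevel set. In this form
  it stays measurable when the path varies.\<close>

definition inv_clock :: "real \<Rightarrow> real" where
 "inv_clock t = enn2real (\<integral>\<^sup>+s. indicator {s. 0 \<le> s \<and> A s \<le> t} s \<partial>lborel)"

lemma inv_clock_A: assumes "0 \<le> s" shows "inv_clock (A s) = s"
proof -
 have "{r. 0 \<le> r \<and> A r \<le> A s} = {0..s}" using A_less_iff[of s] assms by (auto simp: not_less[symmetric])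
 then show ?thesis using assms unfolding inv_clock_def by simp
qed

text \<open>Strict growth of \<open>A\<close> turns the strict inequality in the definition of the
  time change into \<open>s < r\<close>, and the infimum of such \<open>r\<close> is
  \<open>s\<close>.\<close>

lemma Inf_clock_A:
 assumes "0 \<le> s" shows "Inf {ereal r | r. 0 < r \<and> ennreal (A s) < (\<integral>\<^sup>+u\<in>{0..r}. ennreal (d u) \<partial>lborel)} = ereal s"
proof -
 have "0 < r \<and> ennreal (A s) < (\<integral>\<^sup>+u\<in>{0..r}. ennreal (d u) \<partial>lborel) \<longleftrightarrow> s < r" for r
  using A_less_iff[OF assms, of r] assms by (cases "0 < r") (auto simp: ennreal_A[symmetric] ennreal_less_iff A_nonneg)
 then have "{ereal r | r. 0 < r \<and> ennreal (A s) < (\<integral>\<^sup>+u\<in>{0..r}. ennreal (d u) \<partial>lborel)} = {ereal r | r. s < r}"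
  by (simp only:)
 also have "Inf \<dots> = ereal s"
 proof (rule antisym)
  show "ereal s \<le> Inf {ereal r | r. s < r}" by (rule Inf_greatest) auto
  show "Inf {ereal r | r. s < r} \<le> ereal s"
  proof (rule dense_ge)
   fix y assume "ereal s < y"
   then obtain r where "ereal s < ereal r" "ereal r < y" using ereal_dense2 by blast
   then have "Inf {ereal r | r. s < r} \<le> ereal r" by (intro Inf_lower) auto
   then show "Inf {ereal r | r. s < r} \<le> y" using \<open>ereal r < y\<close> by simp
  qed
 qed
 finally show ?thesis .
qed

text \<open>The limit \<open>s\<close> is approached from the right without being attained, so the
  statement composes with right limits of paths.\<close>

lemma inv_clock_right_continuous:
 assumes s: "0 \<le> s"
 shows "filterlim inv_clock (at_right s) (at_right (A s))"
 unfolding filterlim_at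
proof
 have ev: "\<forall>\<^sub>F t in at_right (A s). s < inv_clock t \<and> inv_clock t < r" if sr: "s < r" for r
 proof -
  have "\<forall>\<^sub>F t in at_right (A s). A s < t \<and> t < A r"
   using eventually_at_right_field A_strict[OF s sr] by blast
  then show ?thesis
  proof eventually_elim
   case (elim t)
   then obtain q where q: "0 \<le> q" "q \<le> r" "A q = t" using A_surj[of t r] s sr A_nonneg[of s] by auto
   then show ?case using elim A_less_iff[OF s q(1)] A_less_iff[OF q(1), of r] s sr inv_clock_A[OF q(1)] by auto
  qed
 qed
 show "\<forall>\<^sub>F t in at_right (A s). inv_clock t \<in> {s<..} \<and> inv_clock t \<noteq> s"
  using ev[OF less_add_one] by eventually_elim auto
 show "(inv_clock \<longlongrightarrow> s) (at_right (A s))"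
 proof (rule order_tendstoI)
  show "\<forall>\<^sub>F t in at_right (A s). a < inv_clock t" if "a < s" for a
   using ev[OF less_add_one] by eventually_elim (use that in auto)
  show "\<forall>\<^sub>F t in at_right (A s). inv_clock t < a" if "s < a" for a
   using ev[OF that] by eventually_elim auto
 qed
qed

end

lemma hit_restart:
 assumes rc: "\<And>t. continuous (at_right t) w" and r: "0 \<le> r" and s: "0 \<le> s"
 shows "hit m x (r + s) w \<longleftrightarrow> hit m x r w \<or> hit m (x + w r) s (restart r w)"
 unfolding hit_iff[OF rc] hit_iff[OF restart_rc[OF rc]]
proof
 assume "\<exists>u\<ge>0. u < r + s \<and> \<bar>x + w u\<bar> < 1 / (real m + 1)"
 then obtain u where u: "0 \<le> u" "u < r + s" "\<bar>x + w u\<bar> < 1 / (real m + 1)" by blast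
 show "(\<exists>u\<ge>0. u < r \<and> \<bar>x + w u\<bar> < 1 / (real m + 1)) \<or> (\<exists>u\<ge>0. u < s \<and> \<bar>x + w r + restart r w u\<bar> < 1 / (real m + 1))"
 proof (cases "u < r")
  case False
  then have "0 \<le> u - r" "u - r < s" "\<bar>x + w r + restart r w (u - r)\<bar> < 1 / (real m + 1)"
   using u by (auto simp: restart_def max_absorb2)
  then show ?thesis by blast
 qed (use u in blast)
next
 assume "(\<exists>u\<ge>0. u < r \<and> \<bar>x + w u\<bar> < 1 / (real m + 1)) \<or> (\<exists>u\<ge>0. u < s \<and> \<bar>x + w r + restart r w u\<bar> < 1 / (real m + 1))"
 then show "\<exists>u\<ge>0. u < r + s \<and> \<bar>x + w u\<bar> < 1 / (real m + 1)"
 proof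
  assume "\<exists>u\<ge>0. u < s \<and> \<bar>x + w r + restart r w u\<bar> < 1 / (real m + 1)"
  then obtain u where "0 \<le> u" "u < s" "\<bar>x + w r + restart r w u\<bar> < 1 / (real m + 1)" by blast
  then show ?thesis using r by (intro exI[of _ "r + u"]) (auto simp: restart_def max_absorb2)
 next
  assume "\<exists>u\<ge>0. u < r \<and> \<bar>x + w u\<bar> < 1 / (real m + 1)"
  then obtain u where "0 \<le> u" "u < r" "\<bar>x + w u\<bar> < 1 / (real m + 1)" by blast
  then show ?thesis using s by (intro exI[of _ u]) auto
 qed
qed

text \<open>Survival on each piece comes with its own level; the larger one serves both, since
  neighbourhoods shrink as the level grows.\<close>

lemma alive_restart:
 assumes rc: "\<And>t. continuous (at_right t) w" and r: "0 \<le> r" and s: "0 \<le> s"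
 shows "alive x (r + s) w \<longleftrightarrow> alive x r w \<and> alive (x + w r) s (restart r w)"
proof
 assume "alive x (r + s) w"
 then show "alive x r w \<and> alive (x + w r) s (restart r w)"
  unfolding alive_def hit_restart[OF assms] by blast
next
 assume "alive x r w \<and> alive (x + w r) s (restart r w)"
 then obtain m1 m2 where m: "\<not> hit m1 x r w" "\<not> hit m2 (x + w r) s (restart r w)" unfolding alive_def by blast
 have "\<not> hit (max m1 m2) x r w" using hit_antimono_level[of "max m1 m2" x r w m1] m(1) by auto
 moreover have "\<not> hit (max m1 m2) (x + w r) s (restart r w)"
  using hit_antimono_level[of "max m1 m2" "x + w r" s "restart r w" m2] m(2) by auto
 ultimately show "alive x (r + s) w" unfolding alive_def hit_restart[OF assms] by blast
qed

lemma alive_stopped: "alive x r (stopped r w) \<longleftrightarrow> alive x r w"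
 unfolding alive_def hit_stopped[OF order_refl] ..

locale time_changed_motion = stable_motion M \<alpha> X for M :: "'w measure" and \<alpha> X +
 fixes \<sigma> :: "real \<Rightarrow> real"
 assumes sigma_cont: "continuous_on UNIV \<sigma>" and sigma_pos: "\<And>x. 0 < \<sigma> x"
begin

definition spd :: "real \<Rightarrow> real" where "spd y = \<sigma> y powr (- \<alpha>)"

lemma spd_pos: "0 < spd y" using sigma_pos[of y] by (simp add: spd_def)

lemma spd_continuous: "continuous_on UNIV spd"
proof -
 have "\<sigma> y \<noteq> 0" for y using sigma_pos[of y] by simp
 then show ?thesis unfolding spd_def[abs_def] by (intro continuous_on_powr sigma_cont continuous_on_const) auto
qed

lemma spd_measurable[measurable]: "spd \<in> borel_measurable borel"
 by (rule borel_measurable_continuous_onI[OF spd_continuous])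

lemma clock_path: assumes "w \<in> space M" shows "clock (\<lambda>u. spd (x + X u w))"
proof
 note [measurable] = X_time_measurable[OF assms]
 show "(\<lambda>u. spd (x + X u w)) \<in> borel_measurable borel" by measurable
 show "0 < spd (x + X u w)" for u by (rule spd_pos)
 fix s :: real
 obtain B where B: "\<And>u. u \<in> {0..s} \<Longrightarrow> \<bar>X u w\<bar> \<le> B" using cadlag_bounded[OF X_cadlag[of w], of 0 s] by blast
 have "compact (spd ` {x - B..x + B})"
  by (intro compact_continuous_image continuous_on_subset[OF spd_continuous]) auto
 then have "\<exists>K. \<forall>y\<in>{x - B..x + B}. \<bar>spd y\<bar> \<le> K"
  using compact_imp_bounded[of "spd ` {x - B..x + B}"] unfolding bounded_iff by auto
 then obtain K where K: "\<And>y. y \<in> {x - B..x + B} \<Longrightarrow> \<bar>spd y\<bar> \<le> K" by blast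
 have "spd (x + X u w) \<le> K" if "u \<in> {0..s}" for u
  using K[of "x + X u w"] B[OF that] by (auto simp: abs_le_iff)
 then show "\<exists>K. \<forall>u\<in>{0..s}. spd (x + X u w) \<le> K" by blast
qed

abbreviation clk :: "real \<Rightarrow> 'w \<Rightarrow> real \<Rightarrow> real" where "clk x w \<equiv> clock.A (\<lambda>u. spd (x + X u w))"

text \<open>The clock as a functional of an arbitrary path, so that it can be evaluated on restarted
  paths in the Markov property; \<open>reg\<close> keeps it jointly measurable.\<close>

definition pclk :: "real \<Rightarrow> real \<Rightarrow> (real \<Rightarrow> real) \<Rightarrow> real" where
 "pclk x s w = enn2real (\<integral>\<^sup>+u. ennreal (spd (x + reg w u)) * indicator {u. 0 \<le> u \<and> u \<le> s} u \<partial>lborel)"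

lemma pclk_measurable[measurable (raw)]:
 assumes [measurable]: "f \<in> borel_measurable N" "g \<in> borel_measurable N" "h \<in> measurable N path_space"
 shows "(\<lambda>z. pclk (f z) (g z) (h z)) \<in> borel_measurable N"
 unfolding pclk_def indicator_def mem_Collect_eq by measurable

lemma pclk_traj: "w \<in> space M \<Longrightarrow> pclk x s (traj w) = clk x w s"
 unfolding pclk_def clock.A_def[OF clock_path] reg_traj atLeastAtMost_def atLeast_def atMost_def Int_def by simp

lemma clk_measurable[measurable (raw)]:
 assumes [measurable]: "f \<in> borel_measurable N" "g \<in> borel_measurable N" "h \<in> measurable N M"
 shows "(\<lambda>z. clk (f z) (h z) (g z)) \<in> borel_measurable N"
proof -
 have "(\<lambda>z. pclk (f z) (g z) (traj (h z))) \<in> borel_measurable N" by measurable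
 then show ?thesis
  using measurable_space[OF assms(3)] by (simp add: pclk_traj cong: measurable_cong)
qed

lemma pclk_restart:
 assumes om: "w \<in> space M" and r: "0 \<le> r" and s: "0 \<le> s"
 shows "pclk (x + X r w) s (restart r (traj w)) = clk x w (r + s) - clk x w r"
proof -
 interpret c: clock "\<lambda>u. spd (x + X u w)" by (rule clock_path[OF om])
 note [measurable] = X_time_measurable[OF om]
 have "(\<integral>\<^sup>+u. ennreal (spd (x + X r w + reg (restart r (traj w)) u)) * indicator {u. 0 \<le> u \<and> u \<le> s} u \<partial>lborel)
  = (\<integral>\<^sup>+u. ennreal (spd (x + X (r + u) w)) * indicator {u. 0 \<le> u \<and> u \<le> s} u \<partial>lborel)"
  by (intro nn_integral_cong) (auto simp: reg_restart indicator_def)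
 also have "\<dots> = (\<integral>\<^sup>+u\<in>{r..r+s}. ennreal (spd (x + X u w)) \<partial>lborel)"
  by (subst (2) nn_integral_real_affine[where c=1 and t=r]) (auto intro!: nn_integral_cong simp: indicator_def)
 finally have eq: "pclk (x + X r w) s (restart r (traj w)) = enn2real (\<integral>\<^sup>+u\<in>{r..r+s}. ennreal (spd (x + X u w)) \<partial>lborel)"
  unfolding pclk_def by simp
 have d: "ennreal (c.A (r + s)) = ennreal (c.A r) + (\<integral>\<^sup>+u\<in>{r..r+s}. ennreal (spd (x + X u w)) \<partial>lborel)"
  by (rule c.A_diff) (use r s in auto)
 then have "(\<integral>\<^sup>+u\<in>{r..r+s}. ennreal (spd (x + X u w)) \<partial>lborel) = ennreal (c.A (r + s)) - ennreal (c.A r)"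
  by simp
 also have "\<dots> = ennreal (c.A (r + s) - c.A r)" by (rule ennreal_minus) (rule c.A_nonneg)
 finally show ?thesis unfolding eq using c.A_mono[of r "r + s"] s by simp
qed

text \<open>The resolvent of the killed time-changed process, written in the time of
  \<open>X\<close>: when the clock reads \<open>t\<close>, the element \<open>dt\<close> is the
  speed density times \<open>ds\<close>. \<open>law_Laplace\<close> confirms this reading.\<close>

definition res :: "real \<Rightarrow> (real \<Rightarrow> ennreal) \<Rightarrow> real \<Rightarrow> ennreal" where
 "res \<beta> f x = (\<integral>\<^sup>+w. (\<integral>\<^sup>+s\<in>(life_span x w). ennreal (exp (- \<beta> * clk x w s)) * (f (x + X s w) * ennreal (spd (x + X s w))) \<partial>lborel) \<partial>M)"

lemma res_measurable[measurable]:
 assumes [measurable]: "f \<in> borel_measurable borel"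
 shows "res \<beta> f \<in> borel_measurable borel"
 unfolding res_def[abs_def] indicator_def mem_Collect_eq by measurable

lemma res_0: assumes [measurable]: "f \<in> borel_measurable borel"
 shows "res 0 f x = (\<integral>\<^sup>+y. f y * ennreal (spd y) * ennreal (grn \<alpha> x y) \<partial>lborel)"
proof -
 have "res 0 f x = killed_pot 0 (\<lambda>y. f y * ennreal (spd y)) x"
  unfolding res_def killed_pot_def by simp
 then show ?thesis by (simp add: green)
qed

text \<open>The fundamental theorem of calculus in clock time: the integral of
  \<open>\<beta> * exp (- \<beta> * (A s - v))\<close> over \<open>[0, A s)\<close> is
  \<open>1 - exp (- \<beta> * A s)\<close>. As a sum equal to \<open>1\<close>, it can be inserted
  into any integrand with values in \<open>[0, \<infinity>]\<close>.\<close>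

lemma exp_clock_identity:
 assumes om: "w \<in> space M" and \<beta>: "0 \<le> \<beta>" and s: "0 \<le> s"
 shows "ennreal (exp (- \<beta> * clk x w s)) + ennreal \<beta> * (\<integral>\<^sup>+r\<in>{0..<s}. ennreal (exp (- \<beta> * (clk x w s - clk x w r))) * ennreal (spd (x + X r w)) \<partial>lborel) = 1"
proof -
 interpret c: clock "\<lambda>u. spd (x + X u w)" by (rule clock_path[OF om])
 show ?thesis
 proof (cases "\<beta> = 0")
  case False
  then have b: "0 < \<beta>" using \<beta> by simp
  have "(\<integral>\<^sup>+r\<in>{0..<s}. ennreal (exp (- \<beta> * (c.A s - c.A r))) * ennreal (spd (x + X r w)) \<partial>lborel)
   = (\<integral>\<^sup>+v\<in>{0..<c.A s}. ennreal (exp (- \<beta> * (c.A s - v))) \<partial>lborel)"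
   by (rule c.time_change_integral[of "\<lambda>v. ennreal (exp (- \<beta> * (c.A s - v)))"]) (use s in measurable)
  also have "\<dots> = (\<integral>\<^sup>+v. ennreal (exp (- \<beta> * (c.A s - v))) * indicator {0..c.A s} v \<partial>lborel)"
   by (rule nn_integral_cong_AE, rule AE_mp[OF AE_lborel_singleton[of "c.A s"]]) (auto simp: indicator_def)
  also have "\<dots> = ennreal (exp (- \<beta> * (c.A s - c.A s)) / \<beta> - exp (- \<beta> * (c.A s - 0)) / \<beta>)"
   by (rule nn_integral_FTC_Icc) (use b c.A_nonneg[of s] in \<open>auto intro!: derivative_eq_intros\<close>)
  finally have "(\<integral>\<^sup>+r\<in>{0..<s}. ennreal (exp (- \<beta> * (c.A s - c.A r))) * ennreal (spd (x + X r w)) \<partial>lborel) = ennreal (1 / \<beta> - exp (- \<beta> * c.A s) / \<beta>)" by simp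
  then have "ennreal \<beta> * (\<integral>\<^sup>+r\<in>{0..<s}. ennreal (exp (- \<beta> * (c.A s - c.A r))) * ennreal (spd (x + X r w)) \<partial>lborel) = ennreal (\<beta> * (1 / \<beta> - exp (- \<beta> * c.A s) / \<beta>))"
   using b by (simp only: ennreal_mult')
  also have "\<beta> * (1 / \<beta> - exp (- \<beta> * c.A s) / \<beta>) = 1 - exp (- \<beta> * c.A s)" using b by (simp add: field_simps)
  finally have e: "ennreal \<beta> * (\<integral>\<^sup>+r\<in>{0..<s}. ennreal (exp (- \<beta> * (c.A s - c.A r))) * ennreal (spd (x + X r w)) \<partial>lborel) = ennreal (1 - exp (- \<beta> * c.A s))" .
  have "exp (- \<beta> * c.A s) \<le> 1" using b c.A_nonneg[of s] by simp
  then have "ennreal (exp (- \<beta> * c.A s)) + ennreal (1 - exp (- \<beta> * c.A s)) = ennreal 1"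
   by (subst ennreal_plus[symmetric]) auto
  then show ?thesis unfolding e by simp
 qed simp
qed

definition path_res :: "real \<Rightarrow> (real \<Rightarrow> ennreal) \<Rightarrow> real \<Rightarrow> (real \<Rightarrow> real) \<Rightarrow> ennreal" where
 "path_res \<beta> f y g = (\<integral>\<^sup>+s. ennreal (exp (- \<beta> * pclk y s g)) * (f (y + reg g s) * ennreal (spd (y + reg g s))) * indicator {s. 0 \<le> s \<and> alive y s g} s \<partial>lborel)"

lemma path_res_measurable[measurable (raw)]:
 assumes [measurable]: "f \<in> borel_measurable borel" "h \<in> borel_measurable N" "k \<in> measurable N path_space"
 shows "(\<lambda>z. path_res \<beta> f (h z) (k z)) \<in> borel_measurable N"
 unfolding path_res_def indicator_def mem_Collect_eq by measurable

lemma res_path_res: "res \<beta> f x = (\<integral>\<^sup>+w. path_res \<beta> f x (traj w) \<partial>M)"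
 unfolding res_def path_res_def by (rule nn_integral_cong) (simp add: pclk_traj reg_traj)

text \<open>The constant \<open>1\<close> in the integrand of \<open>res 0\<close> is replaced by
  \<open>exp_clock_identity\<close>; the new variable \<open>r\<close> is moved outside and the
  Markov property of \<open>X\<close> is applied at the fixed time \<open>r\<close>. By additivity
  of clock and survival, what follows \<open>r\<close> is the \<open>\<beta>\<close>-resolvent at
  the position reached.\<close>

theorem resolvent_equation:
 assumes f[measurable]: "f \<in> borel_measurable borel" and \<beta>: "0 \<le> \<beta>"
 shows "res 0 f x = res \<beta> f x + ennreal \<beta> * res 0 (res \<beta> f) x"
proof -
 let ?al = "\<lambda>s w. indicator (life_span x w) s :: ennreal"
 let ?fs = "\<lambda>s w. f (x + X s w) * ennreal (spd (x + X s w))"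
 let ?W = "\<lambda>w s r. ?al s w * ?fs s w * (ennreal (exp (- \<beta> * (clk x w s - clk x w r))) * ennreal (spd (x + X r w)) * indicator {r. 0 \<le> r \<and> r < s} r)"
 let ?E = "\<lambda>r w. \<integral>\<^sup>+s. ?W w s r \<partial>lborel"
 let ?P = "\<lambda>s w. ennreal (exp (- \<beta> * clk x w s)) * ?fs s w * ?al s w"
 interpret MS: pair_sigma_finite M lborel ..
 have path: "(\<integral>\<^sup>+s. ennreal (exp (- 0 * clk x w s)) * ?fs s w * ?al s w \<partial>lborel) = (\<integral>\<^sup>+s. ?P s w \<partial>lborel) + ennreal \<beta> * (\<integral>\<^sup>+r. ?E r w \<partial>lborel)"
  and shift: "0 \<le> r \<Longrightarrow> ?E r w = indicator {w. alive x r (traj w)} w * (ennreal (spd (x + X r w)) * path_res \<beta> f (x + X r w) (restart r (traj w)))"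
  if om[measurable]: "w \<in> space M" for w r
 proof -
  interpret c: clock "\<lambda>u. spd (x + X u w)" by (rule clock_path[OF om])
  note [measurable] = X_time_measurable[OF om]
  have [measurable]: "Measurable.pred borel (\<lambda>s. alive x s (traj w))" "clk x w \<in> borel_measurable borel" by measurable
  have W: "(\<lambda>(s, r). ?W w s r) \<in> borel_measurable (lborel \<Otimes>\<^sub>M lborel)" and Pm: "(\<lambda>s. ?P s w) \<in> borel_measurable lborel"
   unfolding indicator_def mem_Collect_eq case_prod_unfold by measurable
  then have Q: "(\<lambda>s. \<integral>\<^sup>+r. ?W w s r \<partial>lborel) \<in> borel_measurable lborel" by (intro lborel.borel_measurable_nn_integral)
  have "ennreal (exp (- 0 * clk x w s)) * ?fs s w * ?al s w = ?P s w + ennreal \<beta> * (\<integral>\<^sup>+r. ?W w s r \<partial>lborel)" for s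
  proof (cases "0 \<le> s")
   case True
   have "(\<integral>\<^sup>+r. ?W w s r \<partial>lborel) = (?al s w * ?fs s w) * (\<integral>\<^sup>+r\<in>{0..<s}. ennreal (exp (- \<beta> * (clk x w s - clk x w r))) * ennreal (spd (x + X r w)) \<partial>lborel)"
    unfolding atLeastLessThan_def atLeast_def lessThan_def Int_def mem_Collect_eq
    by (rule nn_integral_cmult) (unfold indicator_def mem_Collect_eq, measurable)
   moreover have "ennreal (exp (- 0 * clk x w s)) * ?fs s w * ?al s w = (?al s w * ?fs s w) * 1" by (simp add: mult.commute)
   ultimately show ?thesis unfolding exp_clock_identity[OF om \<beta> True, symmetric, of x] by (simp only: distrib_left mult_ac)
  qed (simp add: indicator_def)
  then have "(\<integral>\<^sup>+s. ennreal (exp (- 0 * clk x w s)) * ?fs s w * ?al s w \<partial>lborel) = (\<integral>\<^sup>+s. ?P s w + ennreal \<beta> * (\<integral>\<^sup>+r. ?W w s r \<partial>lborel) \<partial>lborel)"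
   by (intro nn_integral_cong)
  also have "\<dots> = (\<integral>\<^sup>+s. ?P s w \<partial>lborel) + (\<integral>\<^sup>+s. ennreal \<beta> * (\<integral>\<^sup>+r. ?W w s r \<partial>lborel) \<partial>lborel)"
   by (rule nn_integral_add[OF Pm borel_measurable_times_ennreal[OF borel_measurable_const Q]])
  also have "(\<integral>\<^sup>+s. ennreal \<beta> * (\<integral>\<^sup>+r. ?W w s r \<partial>lborel) \<partial>lborel) = ennreal \<beta> * (\<integral>\<^sup>+s. (\<integral>\<^sup>+r. ?W w s r \<partial>lborel) \<partial>lborel)"
   by (rule nn_integral_cmult[OF Q])
  also have "(\<integral>\<^sup>+s. (\<integral>\<^sup>+r. ?W w s r \<partial>lborel) \<partial>lborel) = (\<integral>\<^sup>+r. ?E r w \<partial>lborel)"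
   by (rule lborel_pair.Fubini'[OF W, symmetric])
  finally show "(\<integral>\<^sup>+s. ennreal (exp (- 0 * clk x w s)) * ?fs s w * ?al s w \<partial>lborel) = (\<integral>\<^sup>+s. ?P s w \<partial>lborel) + ennreal \<beta> * (\<integral>\<^sup>+r. ?E r w \<partial>lborel)" .
  assume r: "0 \<le> r"
  let ?y = "x + X r w" and ?g = "restart r (traj w)"
  let ?R = "\<lambda>s. ennreal (exp (- \<beta> * pclk ?y s ?g)) * (f (?y + reg ?g s) * ennreal (spd (?y + reg ?g s))) * indicator {s. 0 \<le> s \<and> alive ?y s ?g} s"
  have "(\<lambda>s. ?W w s r) \<in> borel_measurable borel" unfolding indicator_def mem_Collect_eq by measurable
  from nn_integral_real_affine[OF this, where c=1 and t=r]
  have "?E r w = (\<integral>\<^sup>+s. ?W w (r + s) r \<partial>lborel)" by (simp only: abs_one ennreal_1 mult_1_left one_neq_zero not_False_eq_True simp_thms)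
  also have "\<dots> = (\<integral>\<^sup>+s. (indicator {w. alive x r (traj w)} w * ennreal (spd ?y)) * ?R s \<partial>lborel)"
  proof (rule nn_integral_cong_AE, rule AE_mp[OF AE_lborel_singleton[of 0]], intro AE_I2 impI)
   fix s :: real assume s0: "s \<noteq> 0"
   show "?W w (r + s) r = (indicator {w. alive x r (traj w)} w * ennreal (spd ?y)) * ?R s"
   proof (cases "0 \<le> s")
    case True
    have "alive x (r + s) (traj w) \<longleftrightarrow> alive x r (traj w) \<and> alive ?y s ?g"
     using alive_restart[OF traj_rc r True, of x w] by (simp add: traj_def)
    then show ?thesis using r True s0 by (simp add: reg_restart[OF True] pclk_restart[OF om r True] indicator_def mult_ac)
   qed (simp add: indicator_def)
  qed
  also have "\<dots> = (indicator {w. alive x r (traj w)} w * ennreal (spd ?y)) * path_res \<beta> f ?y ?g"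
  proof -
   have [simp]: "?g \<in> space path_space" by (simp add: space_PiM)
   show ?thesis unfolding path_res_def by (rule nn_integral_cmult) (unfold indicator_def mem_Collect_eq, measurable)
  qed
  finally show "?E r w = indicator {w. alive x r (traj w)} w * (ennreal (spd ?y) * path_res \<beta> f ?y ?g)" by (simp add: mult.assoc)
 qed
 have Em: "(\<lambda>(w, r). ?E r w) \<in> borel_measurable (M \<Otimes>\<^sub>M lborel)" "(\<lambda>w. \<integral>\<^sup>+r. ?E r w \<partial>lborel) \<in> borel_measurable M" "(\<lambda>w. \<integral>\<^sup>+s. ?P s w \<partial>lborel) \<in> borel_measurable M"
  unfolding indicator_def mem_Collect_eq case_prod_unfold by measurable
 have "res 0 f x = (\<integral>\<^sup>+w. (\<integral>\<^sup>+s. ?P s w \<partial>lborel) + ennreal \<beta> * (\<integral>\<^sup>+r. ?E r w \<partial>lborel) \<partial>M)"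
  unfolding res_def by (rule nn_integral_cong[OF path])
 also have "\<dots> = res \<beta> f x + ennreal \<beta> * (\<integral>\<^sup>+w. (\<integral>\<^sup>+r. ?E r w \<partial>lborel) \<partial>M)"
  unfolding res_def using Em(2,3) by (simp add: nn_integral_add nn_integral_cmult)
 also have "(\<integral>\<^sup>+w. (\<integral>\<^sup>+r. ?E r w \<partial>lborel) \<partial>M) = (\<integral>\<^sup>+r. (\<integral>\<^sup>+w. ?E r w \<partial>M) \<partial>lborel)" by (rule MS.Fubini'[OF Em(1), symmetric])
 also have "\<dots> = (\<integral>\<^sup>+r. (\<integral>\<^sup>+w. res \<beta> f (x + X r w) * ennreal (spd (x + X r w)) * ?al r w \<partial>M) \<partial>lborel)"
 proof (rule nn_integral_cong)
  fix r :: real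
  show "(\<integral>\<^sup>+w. ?E r w \<partial>M) = (\<integral>\<^sup>+w. res \<beta> f (x + X r w) * ennreal (spd (x + X r w)) * ?al r w \<partial>M)"
  proof (cases "0 \<le> r")
   case r: True
   let ?G = "\<lambda>y g. ennreal (spd (x + y)) * path_res \<beta> f (x + y) g"
   have G: "(\<lambda>(y, g). ?G y g) \<in> borel_measurable (borel \<Otimes>\<^sub>M path_space)" unfolding case_prod_unfold by measurable
   have "(\<integral>\<^sup>+w. ?E r w \<partial>M) = (\<integral>\<^sup>+w. indicator {w. alive x r (traj w)} w * ?G (X r w) (restart r (traj w)) \<partial>M)"
    by (rule nn_integral_cong[OF shift[OF _ r]])
   also have "\<dots> = (\<integral>\<^sup>+w. indicator {w. alive x r (traj w)} w * (\<integral>\<^sup>+w'. ?G (X r w) (traj w') \<partial>M) \<partial>M)"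
    by (rule markov_indicator[OF r G]) (auto simp: alive_stopped)
   also have "\<dots> = (\<integral>\<^sup>+w. res \<beta> f (x + X r w) * ennreal (spd (x + X r w)) * ?al r w \<partial>M)"
    using r by (intro nn_integral_cong) (simp add: nn_integral_cmult res_path_res indicator_def mult_ac)
   finally show ?thesis .
  qed (simp add: indicator_def)
 qed
 also have "\<dots> = (\<integral>\<^sup>+w. (\<integral>\<^sup>+r. res \<beta> f (x + X r w) * ennreal (spd (x + X r w)) * ?al r w \<partial>lborel) \<partial>M)"
  by (rule MS.Fubini') (unfold indicator_def mem_Collect_eq case_prod_unfold, measurable)
 also have "\<dots> = res 0 (res \<beta> f) x"
  unfolding res_def[of 0] by simp
 finally show ?thesis .
qed

end

section \<open>The time-changed process\<close>

text \<open>Where \<open>x + w\<close> has neither zeros nor vanishing left limits, its reciprocal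
  is again cadlag and hence bounded; this keeps the path out of some neighbourhood of
  \<open>0\<close>.\<close>

lemma cadlag_bounded_away:
 fixes w :: "real \<Rightarrow> real"
 assumes w: "cadlag w" and neg: "\<And>t. t \<le> 0 \<Longrightarrow> w t = 0" and x: "x \<noteq> 0"
  and jump: "\<And>s. 0 < s \<Longrightarrow> ((\<lambda>t. x + w t) \<longlongrightarrow> 0) (at_left s) \<Longrightarrow> x + w s = 0"
  and nz: "\<And>u. 0 \<le> u \<Longrightarrow> u \<le> s \<Longrightarrow> x + w u \<noteq> 0"
 shows "alive x s w"
proof -
 \<comment> \<open>Set to \<open>0\<close> from \<open>s\<close> on, since nothing is assumed beyond
   \<open>s\<close>; hits are only counted strictly before \<open>s\<close>.\<close>
 define w' where "w' = (\<lambda>u. if u < s then inverse (x + w u) else 0)"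
 have nz': "x + w t \<noteq> 0" if "t \<le> s" for t using nz[of t] neg[of t] x that by (cases "0 \<le> t") auto
 have "cadlag w'"
  unfolding cadlag_def
 proof (intro conjI allI)
  fix t :: real
  show "continuous (at_right t) w'"
  proof (cases "t < s")
   case True
   have "\<forall>\<^sub>F u in at_right t. inverse (x + w u) = w' u"
    unfolding eventually_at_right_field by (intro exI[of _ s]) (auto simp: True w'_def)
   moreover have "((\<lambda>u. inverse (x + w u)) \<longlongrightarrow> inverse (x + w t)) (at_right t)"
    using w nz'[of t] True unfolding cadlag_def continuous_within
    by (intro tendsto_inverse tendsto_add tendsto_const) auto
   ultimately show ?thesis unfolding continuous_within using True
    by (simp add: w'_def tendsto_cong)
  next
   case False
   have "\<forall>\<^sub>F u in at_right t. w' u = w' t"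
    using eventually_at_right_less by eventually_elim (use False in \<open>auto simp: w'_def\<close>)
   then show ?thesis unfolding continuous_within by (rule tendsto_eventually)
  qed
  show "\<exists>l. (w' \<longlongrightarrow> l) (at_left t)"
  proof (cases "t \<le> s")
   case True
   obtain l where l: "(w \<longlongrightarrow> l) (at_left t)" using w unfolding cadlag_def by blast
   then have xl: "((\<lambda>u. x + w u) \<longlongrightarrow> x + l) (at_left t)" by (intro tendsto_intros)
   have "x + l \<noteq> 0"
   proof (cases "0 < t")
    case False
    have "\<forall>\<^sub>F u in at_left t. w u = 0"
     unfolding eventually_at_left_field by (intro exI[of _ "t - 1"]) (use False neg in auto)
    then have "(w \<longlongrightarrow> 0) (at_left t)" by (rule tendsto_eventually)
    then have "l = 0" using tendsto_unique[OF _ l] by simp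
    then show ?thesis using x by simp
   qed (use jump[of t] xl nz'[OF True] in auto)
   moreover have "\<forall>\<^sub>F u in at_left t. inverse (x + w u) = w' u"
    unfolding eventually_at_left_field by (intro exI[of _ "t - 1"]) (use True in \<open>auto simp: w'_def\<close>)
   ultimately have "(w' \<longlongrightarrow> inverse (x + l)) (at_left t)"
    using tendsto_inverse[OF xl] by (simp add: tendsto_cong)
   then show ?thesis ..
  next
   case False
   then have "\<forall>\<^sub>F u in at_left t. w' u = 0"
    unfolding eventually_at_left_field by (intro exI[of _ s]) (auto simp: w'_def)
   then show ?thesis by (intro exI) (rule tendsto_eventually)
  qed
 qed
 then obtain B where B: "\<And>u. u \<in> {0..s} \<Longrightarrow> \<bar>w' u\<bar> \<le> B" using cadlag_bounded[of w' 0 s] by blast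
 obtain m :: nat where m: "B \<le> real m" using real_arch_simple by blast
 have "\<not> hit m x s w"
 proof
  have rc: "continuous (at_right t) w" for t using w by (simp add: cadlag_def)
  assume "hit m x s w"
  then obtain u where u: "0 \<le> u" "u < s" "\<bar>x + w u\<bar> < 1 / (real m + 1)" unfolding hit_iff[OF rc] by blast
  have "inverse \<bar>x + w u\<bar> \<le> real m" using B[of u] u m by (simp add: w'_def)
  moreover have "real m + 1 < inverse \<bar>x + w u\<bar>"
   using u(3) nz[OF u(1)] u(2) by (simp add: field_simps)
  ultimately show False by simp
 qed
 then show ?thesis unfolding alive_def by blast
qed

text \<open>The infimum \<open>H\<close> of the zeros is attained by right-continuity. Before
  \<open>H\<close> the path stays away from \<open>0\<close>, after \<open>H\<close> every
  neighbourhood has been entered; so approaching \<open>0\<close> and vanishing happen at the same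
  time.\<close>

lemma first_zero:
 fixes w :: "real \<Rightarrow> real"
 assumes w: "cadlag w" and neg: "\<And>t. t \<le> 0 \<Longrightarrow> w t = 0" and x: "x \<noteq> 0"
  and jump: "\<And>s. 0 < s \<Longrightarrow> ((\<lambda>t. x + w t) \<longlongrightarrow> 0) (at_left s) \<Longrightarrow> x + w s = 0"
  and dies: "\<exists>s. \<not> alive x s w"
 shows "\<exists>H>0. x + w H = 0 \<and> (\<forall>u. 0 \<le> u \<and> u < H \<longrightarrow> x + w u \<noteq> 0) \<and> (\<forall>s<H. alive x s w) \<and> (\<forall>s>H. \<not> alive x s w)"
proof -
 have rc: "continuous (at_right t) w" for t using w by (simp add: cadlag_def)
 define Z where "Z = {u. 0 \<le> u \<and> x + w u = 0}"
 define H where "H = Inf Z"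
 have bdd: "bdd_below Z" unfolding Z_def by (intro bdd_belowI[of _ 0]) auto
 have away: "alive x s w" if "\<And>u. 0 \<le> u \<Longrightarrow> u \<le> s \<Longrightarrow> x + w u \<noteq> 0" for s
  by (rule cadlag_bounded_away[OF w neg x jump that])
 obtain s where "\<not> alive x s w" using dies by blast
 then have ne: "Z \<noteq> {}" using away[of s] unfolding Z_def by blast
 have H0: "0 \<le> H" unfolding H_def using ne by (rule cInf_greatest) (simp add: Z_def)
 have before: "x + w u \<noteq> 0" if "0 \<le> u" "u < H" for u
  using cInf_lower[of u Z, OF _ bdd] that unfolding H_def Z_def by force
 have zero: "x + w H = 0"
 proof (rule ccontr)
  assume a: "x + w H \<noteq> 0"
  have "((\<lambda>u. x + w u) \<longlongrightarrow> x + w H) (at_right H)" using rc[of H] unfolding continuous_within by (intro tendsto_intros)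
  then have "\<forall>\<^sub>F u in at_right H. x + w u \<noteq> 0" using a by (rule tendsto_imp_eventually_ne)
  then obtain b where b: "H < b" "\<And>u. H < u \<Longrightarrow> u < b \<Longrightarrow> x + w u \<noteq> 0" unfolding eventually_at_right_field by blast
  then obtain u where u: "u \<in> Z" "u < b" using cInf_less_iff[OF ne bdd, of b] unfolding H_def by blast
  then have "H \<le> u" unfolding H_def by (intro cInf_lower bdd)
  then show False using u b(2)[of u] a by (cases "u = H") (auto simp: Z_def)
 qed
 have "H \<noteq> 0" using zero neg[of 0] x by auto
 then have "0 < H" using H0 by simp
 moreover have "\<forall>s<H. alive x s w" using away before by (meson le_less_trans)
 moreover have "\<not> alive x s w" if "H < s" for s
 proof -
  have "hit m x s w" for m unfolding hit_iff[OF rc] using H0 that zero by (intro exI[of _ H]) auto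
  then show ?thesis unfolding alive_def by blast
 qed
 ultimately show ?thesis using zero before by blast
qed

context time_changed_motion
begin

text \<open>Jointly measurable versions of the time change, of the time-changed position and of the
 lifetime; on good paths, that is, almost surely, they agree with the ones in the statement.\<close>

definition zeta :: "real \<Rightarrow> real \<Rightarrow> 'w \<Rightarrow> real" where
 "zeta x t w = enn2real (\<integral>\<^sup>+s. indicator {s. 0 \<le> s \<and> clk x w s \<le> t} s \<partial>lborel)"

definition pos :: "real \<Rightarrow> real \<Rightarrow> 'w \<Rightarrow> real" where "pos x t w = x + X (zeta x t w) w"

definition life :: "real \<Rightarrow> 'w \<Rightarrow> ennreal" where
 "life x w = (\<integral>\<^sup>+u. ennreal (spd (x + X u w)) * indicator {u. 0 \<le> u \<and> alive x u (traj w)} u \<partial>lborel)"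

definition alv :: "real \<Rightarrow> real \<Rightarrow> 'w \<Rightarrow> bool" where "alv x t w \<longleftrightarrow> ennreal t < life x w"

lemma pos_measurable[measurable (raw)]:
 assumes [measurable]: "f \<in> borel_measurable N" "g \<in> borel_measurable N" "h \<in> measurable N M"
 shows "(\<lambda>z. pos (f z) (g z) (h z)) \<in> borel_measurable N"
proof -
 have [measurable]: "(\<lambda>z. zeta (f z) (g z) (h z)) \<in> borel_measurable N"
  unfolding zeta_def indicator_def mem_Collect_eq by measurable
 show ?thesis unfolding pos_def by measurable
qed

lemma alv_measurable[measurable (raw)]:
 assumes [measurable]: "f \<in> borel_measurable N" "g \<in> borel_measurable N" "h \<in> measurable N M"
 shows "Measurable.pred N (\<lambda>z. alv (f z) (g z) (h z))"
proof -
 have [measurable]: "(\<lambda>z. life (f z) (h z)) \<in> borel_measurable N"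
  unfolding life_def indicator_def mem_Collect_eq by measurable
 show ?thesis unfolding alv_def by measurable
qed

definition good :: "real \<Rightarrow> 'w \<Rightarrow> bool" where
 "good x w \<longleftrightarrow> w \<in> space M \<and> (\<exists>s. \<not> alive x s (traj w)) \<and> (\<forall>s>0. ((\<lambda>t. x + X t w) \<longlongrightarrow> 0) (at_left s) \<longrightarrow> x + X s w = 0)"

lemma AE_good: "AE w in M. good x w"
 using AE_dies[of x] AE_no_jump_from_zero[of x] AE_space unfolding good_def by eventually_elim blast

lemma good_path:
 assumes g: "good x w" and x: "x \<noteq> 0"
 shows "\<exists>H>0. x + X H w = 0 \<and> (\<forall>u. 0 \<le> u \<and> u < H \<longrightarrow> x + X u w \<noteq> 0) \<and> (\<forall>s<H. alive x s (traj w)) \<and> (\<forall>s>H. \<not> alive x s (traj w))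
  \<and> life x w = ennreal (clk x w H) \<and> (\<forall>t\<ge>0. alv x t w \<longleftrightarrow> t < clk x w H) \<and> (\<forall>s\<ge>0. pos x (clk x w s) w = x + X s w)"
proof -
 have om: "w \<in> space M" using g by (simp add: good_def)
 interpret c: clock "\<lambda>u. spd (x + X u w)" by (rule clock_path[OF om])
 have tr: "traj w = (\<lambda>t. X t w)" by (intro ext) (simp add: traj_def)
 have "\<exists>H>0. x + traj w H = 0 \<and> (\<forall>u. 0 \<le> u \<and> u < H \<longrightarrow> x + traj w u \<noteq> 0) \<and> (\<forall>s<H. alive x s (traj w)) \<and> (\<forall>s>H. \<not> alive x s (traj w))"
 proof (rule first_zero)
  show "cadlag (traj w)" unfolding tr by (rule X_cadlag)
 qed (use g x in \<open>auto simp: good_def tr X_neg\<close>)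
 then obtain H where H: "0 < H" "x + X H w = 0" "\<forall>u. 0 \<le> u \<and> u < H \<longrightarrow> x + X u w \<noteq> 0"
   "\<forall>s<H. alive x s (traj w)" "\<forall>s>H. \<not> alive x s (traj w)" unfolding traj_def by blast
 have life: "life x w = ennreal (c.A H)"
  unfolding life_def c.ennreal_A
 proof (rule nn_integral_cong_AE, rule AE_mp[OF AE_lborel_singleton[of H]], intro AE_I2 impI)
  fix u assume "u \<noteq> H"
  then have "alive x u (traj w) \<longleftrightarrow> u \<le> H" using H(4,5) by (cases u H rule: linorder_cases) auto
  then show "ennreal (spd (x + X u w)) * indicator {u. 0 \<le> u \<and> alive x u (traj w)} u = ennreal (spd (x + X u w)) * indicator {0..H} u"
   by (simp add: indicator_def)
 qed
 moreover have "alv x t w \<longleftrightarrow> t < c.A H" if "0 \<le> t" for t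
  unfolding alv_def life using that by (simp add: ennreal_less_iff)
 moreover have "pos x (c.A s) w = x + X s w" if "0 \<le> s" for s
  using c.inv_clock_A[OF that] unfolding pos_def zeta_def c.inv_clock_def by simp
 ultimately show ?thesis using H by blast
qed

text \<open>Each clock reading \<open>A s\<close> is attained at exactly one time, so zeros of the
  time-changed path correspond to zeros of \<open>x + X\<close>, and the hitting time is the clock
  reading at the first of them.\<close>

lemma time_changed_good:
 assumes g: "good x w" and x: "x \<noteq> 0" and eq: "\<And>t. 0 \<le> t \<Longrightarrow> X0 t w = X t w"
 shows "\<forall>t\<ge>0. (ereal t < hitting_time0 \<alpha> \<sigma> X0 x w \<longleftrightarrow> alv x t w) \<and> (alv x t w \<longrightarrow> time_changed \<alpha> \<sigma> X0 x t w = pos x t w \<and> pos x t w \<noteq> 0)"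
proof -
 have om: "w \<in> space M" using g by (simp add: good_def)
 interpret c: clock "\<lambda>u. spd (x + X u w)" by (rule clock_path[OF om])
 obtain H where H: "0 < H" "x + X H w = 0" "\<forall>u. 0 \<le> u \<and> u < H \<longrightarrow> x + X u w \<noteq> 0"
  and alv: "\<forall>t\<ge>0. alv x t w \<longleftrightarrow> t < c.A H" and pos: "\<forall>s\<ge>0. pos x (c.A s) w = x + X s w"
  using good_path[OF g x] by blast
 have af: "additive_functional \<alpha> \<sigma> X0 x s w = (\<integral>\<^sup>+u\<in>{0..s}. ennreal (spd (x + X u w)) \<partial>lborel)" for s
  unfolding additive_functional_def spd_def by (intro nn_integral_cong) (auto simp: indicator_def eq)
 have tc: "time_changed \<alpha> \<sigma> X0 x (c.A s) w = x + X s w" if "0 \<le> s" for s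
  unfolding time_changed_def time_change_def af c.Inf_clock_A[OF that] using eq[OF that] by simp
 \<comment> \<open>Beyond the range of the clock the time change is infinite, with real value
   \<open>0\<close> by convention. The position is then \<open>x\<close>, which creates no spurious
   zero.\<close>
 have tc': "time_changed \<alpha> \<sigma> X0 x t w \<noteq> 0" if t: "0 \<le> t" and n: "\<And>s. 0 \<le> s \<Longrightarrow> t \<noteq> c.A s" for t
 proof -
  have "\<not> ennreal t < additive_functional \<alpha> \<sigma> X0 x s w" if "0 < s" for s
  proof
   assume "ennreal t < additive_functional \<alpha> \<sigma> X0 x s w"
   then have "t < c.A s" using t unfolding af c.ennreal_A[symmetric] by (simp add: ennreal_less_iff)
   then show False using c.A_surj[of t s] t that n by force
  qed
  then have "{ereal s | s. 0 < s \<and> ennreal t < additive_functional \<alpha> \<sigma> X0 x s w} = {}" by blast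
  then have "time_change \<alpha> \<sigma> X0 x t w = \<infinity>" unfolding time_change_def by (simp only: Inf_empty top_ereal_def)
  then have "time_changed \<alpha> \<sigma> X0 x t w = x + X0 0 w" unfolding time_changed_def by simp
  then show ?thesis using eq[of 0] X_neg[of 0 w] x by simp
 qed
 have "{ereal t | t. 0 < t \<and> time_changed \<alpha> \<sigma> X0 x t w = 0} = {ereal (c.A s) | s. 0 < s \<and> x + X s w = 0}"
 proof (intro equalityI subsetI)
  fix e assume "e \<in> {ereal t | t. 0 < t \<and> time_changed \<alpha> \<sigma> X0 x t w = 0}"
  then obtain t where t: "e = ereal t" "0 < t" "time_changed \<alpha> \<sigma> X0 x t w = 0" by blast
  then obtain s where s: "0 \<le> s" "t = c.A s" using tc'[of t] by fastforce
  then have "0 < s" using t(2) c.A_zero by (cases "s = 0") auto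
  then show "e \<in> {ereal (c.A s) | s. 0 < s \<and> x + X s w = 0}" using t s tc[of s] by auto
 next
  fix e assume "e \<in> {ereal (c.A s) | s. 0 < s \<and> x + X s w = 0}"
  then obtain s where s: "e = ereal (c.A s)" "0 < s" "x + X s w = 0" by blast
  then show "e \<in> {ereal t | t. 0 < t \<and> time_changed \<alpha> \<sigma> X0 x t w = 0}"
   using tc[of s] c.A_strict[of 0 s] c.A_zero by auto
 qed
 then have "hitting_time0 \<alpha> \<sigma> X0 x w = Inf {ereal (c.A s) | s. 0 < s \<and> x + X s w = 0}"
  unfolding hitting_time0_def by simp
 also have "\<dots> = ereal (c.A H)"
 proof (rule antisym)
  show "Inf {ereal (c.A s) | s. 0 < s \<and> x + X s w = 0} \<le> ereal (c.A H)" using H by (intro Inf_lower) blast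
  show "ereal (c.A H) \<le> Inf {ereal (c.A s) | s. 0 < s \<and> x + X s w = 0}"
  proof (rule Inf_greatest)
   fix e assume "e \<in> {ereal (c.A s) | s. 0 < s \<and> x + X s w = 0}"
   then obtain s where s: "e = ereal (c.A s)" "0 < s" "x + X s w = 0" by blast
   have "H \<le> s" by (rule ccontr) (use s H(3) in auto)
   then show "ereal (c.A H) \<le> e" using s c.A_mono by simp
  qed
 qed
 finally have ht: "hitting_time0 \<alpha> \<sigma> X0 x w = ereal (c.A H)" .
 show ?thesis
 proof (intro allI impI conjI)
  fix t :: real assume t: "0 \<le> t"
  show "ereal t < hitting_time0 \<alpha> \<sigma> X0 x w \<longleftrightarrow> alv x t w" using alv t ht by simp
  assume "alv x t w"
  then have tl: "t < c.A H" using alv t by simp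
  then obtain s where s: "0 \<le> s" "t = c.A s" using c.A_surj[of t H] t H(1) by force
  then have "s < H" using tl c.A_less_iff[of s H] H(1) by simp
  then show "pos x t w \<noteq> 0" using H(3) s pos by simp
  show "time_changed \<alpha> \<sigma> X0 x t w = pos x t w" using s pos tc by simp
 qed
qed


text \<open>A subprobability on the whole line, the missing mass being the killed part; restriction
  to the punctured line is postponed to the comparison with the kernels of the theorem.\<close>

definition law :: "real \<Rightarrow> real \<Rightarrow> real measure" where
 "law t x = distr (density M (\<lambda>w. indicator {w\<in>space M. alv x t w} w)) borel (pos x t)"

lemma sets_law[simp, measurable_cong]: "sets (law t x) = sets borel" by (simp add: law_def)

lemma space_law[simp]: "space (law t x) = UNIV" by (simp add: law_def)

lemma nn_integral_law:
 assumes [measurable]: "f \<in> borel_measurable borel"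
 shows "(\<integral>\<^sup>+y. f y \<partial>law t x) = (\<integral>\<^sup>+w. indicator {w. alv x t w} w * f (pos x t w) \<partial>M)"
proof -
 have "(\<integral>\<^sup>+y. f y \<partial>law t x) = (\<integral>\<^sup>+w. indicator {w\<in>space M. alv x t w} w * f (pos x t w) \<partial>M)"
  unfolding law_def by (simp add: nn_integral_distr nn_integral_density)
 also have "\<dots> = (\<integral>\<^sup>+w. indicator {w. alv x t w} w * f (pos x t w) \<partial>M)"
  by (intro nn_integral_cong) (simp add: indicator_def)
 finally show ?thesis .
qed

lemma emeasure_law:
 assumes [measurable]: "B \<in> sets borel"
 shows "emeasure (law t x) B = emeasure M {w\<in>space M. alv x t w \<and> pos x t w \<in> B}"
proof -
 have "emeasure (law t x) B = (\<integral>\<^sup>+y. indicator B y \<partial>law t x)" by simp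
 also have "\<dots> = (\<integral>\<^sup>+w. indicator {w\<in>space M. alv x t w \<and> pos x t w \<in> B} w \<partial>M)"
 proof (subst nn_integral_law)
  show "(\<integral>\<^sup>+w. indicator {w. alv x t w} w * indicator B (pos x t w) \<partial>M) = (\<integral>\<^sup>+w. indicator {w\<in>space M. alv x t w \<and> pos x t w \<in> B} w \<partial>M)"
   by (rule nn_integral_cong) (simp add: indicator_def)
 qed measurable
 also have "\<dots> = emeasure M {w\<in>space M. alv x t w \<and> pos x t w \<in> B}" by (rule nn_integral_indicator) measurable
 finally show ?thesis .
qed

lemma measure_law:
 assumes "B \<in> sets borel"
 shows "measure (law t x) B = prob {w\<in>space M. alv x t w \<and> pos x t w \<in> B}"
 using emeasure_law[OF assms] by (simp add: measure_def)

lemma finite_measure_law: "finite_measure (law t x)"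
 by (rule finite_measureI) (simp add: emeasure_law emeasure_finite)

lemma measure_law_le_1: "measure (law t x) B \<le> 1"
proof -
 interpret l: finite_measure "law t x" by (rule finite_measure_law)
 have "measure (law t x) B \<le> measure (law t x) UNIV" using l.bounded_measure[of B] by simp
 also have "\<dots> \<le> 1" by (simp add: measure_law)
 finally show ?thesis .
qed

lemma nn_integral_law_measurable[measurable (raw)]:
 assumes [measurable]: "f \<in> borel_measurable borel" "g \<in> borel_measurable N" "h \<in> borel_measurable N"
 shows "(\<lambda>z. \<integral>\<^sup>+y. f y \<partial>law (g z) (h z)) \<in> borel_measurable N"
 unfolding nn_integral_law[OF assms(1)] indicator_def mem_Collect_eq by measurable

lemma measure_law_measurable[measurable (raw)]:
 assumes [measurable]: "B \<in> sets borel" "g \<in> borel_measurable N" "h \<in> borel_measurable N"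
 shows "(\<lambda>z. measure (law (g z) (h z)) B) \<in> borel_measurable N"
proof -
 have "measure (law t x) B = enn2real (\<integral>\<^sup>+y. indicator B y \<partial>law t x)" for t x by (simp add: measure_def)
 then show ?thesis by (simp only:) measurable
qed

lemma integral_law:
 fixes f :: "real \<Rightarrow> real"
 assumes [measurable]: "f \<in> borel_measurable borel"
 shows "(\<integral>y. f y \<partial>law t x) = (\<integral>w. indicator {w. alv x t w} w * f (pos x t w) \<partial>M)"
proof -
 have "(\<integral>y. f y \<partial>law t x) = (\<integral>w. indicator {w\<in>space M. alv x t w} w * f (pos x t w) \<partial>M)"
 proof -
  have "density M (\<lambda>w. indicator {w\<in>space M. alv x t w} w) = density M (\<lambda>w. ennreal (indicator {w\<in>space M. alv x t w} w))"
   by (intro density_cong) (auto simp: indicator_def)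
  then show ?thesis unfolding law_def by (simp add: integral_distr integral_density)
 qed
 also have "\<dots> = (\<integral>w. indicator {w. alv x t w} w * f (pos x t w) \<partial>M)"
  by (intro Bochner_Integration.integral_cong) (auto simp: indicator_def)
 finally show ?thesis .
qed

lemma law_zero: assumes "x \<noteq> 0" "0 \<le> t" shows "emeasure (law t x) {0} = 0"
proof -
 have "AE w in M. \<not> (alv x t w \<and> pos x t w \<in> {0})"
  using AE_good[of x] by eventually_elim (use time_changed_good[where ?X0.0=X, OF _ assms(1)] assms(2) in auto)
 then show ?thesis by (subst emeasure_law) (auto intro!: emeasure_eq_0_AE)
qed

text \<open>Fubini brings the time integral inside, and the change of variables
  \<open>t = A s\<close> on each good path turns it into the integral defining \<open>res\<close>.
  Survival in clock time and survival in the time of \<open>X\<close> both end at the first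
  zero.\<close>

lemma law_Laplace:
 assumes x: "x \<noteq> 0" and f[measurable]: "f \<in> borel_measurable borel"
 shows "(\<integral>\<^sup>+t\<in>{0..}. ennreal (exp (- \<beta> * t)) * (\<integral>\<^sup>+y. f y \<partial>law t x) \<partial>lborel) = res \<beta> f x"
proof -
 interpret MS: pair_sigma_finite M lborel ..
 let ?h = "\<lambda>t w. ennreal (exp (- \<beta> * t)) * (indicator {w. 0 \<le> t \<and> alv x t w} w * f (pos x t w))"
 have hm: "(\<lambda>(w, t). ?h t w) \<in> borel_measurable (M \<Otimes>\<^sub>M lborel)"
  unfolding indicator_def mem_Collect_eq case_prod_unfold by measurable
 have "(\<integral>\<^sup>+t\<in>{0..}. ennreal (exp (- \<beta> * t)) * (\<integral>\<^sup>+y. f y \<partial>law t x) \<partial>lborel) = (\<integral>\<^sup>+t. (\<integral>\<^sup>+w. ?h t w \<partial>M) \<partial>lborel)"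
 proof (rule nn_integral_cong)
  fix t :: real
  have m: "(\<lambda>w. indicator {w. 0 \<le> t \<and> alv x t w} w * f (pos x t w)) \<in> borel_measurable M"
   unfolding indicator_def mem_Collect_eq by measurable
  show "ennreal (exp (- \<beta> * t)) * (\<integral>\<^sup>+y. f y \<partial>law t x) * indicator {0..} t = (\<integral>\<^sup>+w. ?h t w \<partial>M)"
   unfolding nn_integral_cmult[OF m] nn_integral_law[OF f] by (cases "0 \<le> t") (auto simp: indicator_def)
 qed
 also have "\<dots> = (\<integral>\<^sup>+w. (\<integral>\<^sup>+t. ?h t w \<partial>lborel) \<partial>M)" by (rule MS.Fubini'[OF hm])
 also have "\<dots> = res \<beta> f x"
  unfolding res_def
 proof (rule nn_integral_cong_AE)
  show "AE w in M. (\<integral>\<^sup>+t. ?h t w \<partial>lborel) = (\<integral>\<^sup>+s\<in>(life_span x w). ennreal (exp (- \<beta> * clk x w s)) * (f (x + X s w) * ennreal (spd (x + X s w))) \<partial>lborel)"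
   using AE_good[of x]
  proof eventually_elim
   case (elim w)
   then have om[measurable]: "w \<in> space M" by (simp add: good_def)
   interpret c: clock "\<lambda>u. spd (x + X u w)" by (rule clock_path[OF om])
   obtain H where H: "0 < H" "\<forall>s<H. alive x s (traj w)" "\<forall>s>H. \<not> alive x s (traj w)"
    and alv: "\<forall>t\<ge>0. alv x t w \<longleftrightarrow> t < c.A H" and pos: "\<forall>s\<ge>0. pos x (c.A s) w = x + X s w"
    using good_path[OF elim x] by blast
   let ?\<phi> = "\<lambda>t. ennreal (exp (- \<beta> * t)) * f (pos x t w)"
   have "(\<integral>\<^sup>+t. ?h t w \<partial>lborel) = (\<integral>\<^sup>+t\<in>{0..<c.A H}. ?\<phi> t \<partial>lborel)"
    by (intro nn_integral_cong) (use alv in \<open>auto simp: indicator_def\<close>)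
   also have "\<dots> = (\<integral>\<^sup>+s\<in>{0..<H}. ?\<phi> (c.A s) * ennreal (spd (x + X s w)) \<partial>lborel)"
    by (rule c.time_change_integral[symmetric]) (measurable, simp add: H(1) less_imp_le)
   also have "\<dots> = (\<integral>\<^sup>+s\<in>(life_span x w). ennreal (exp (- \<beta> * c.A s)) * (f (x + X s w) * ennreal (spd (x + X s w))) \<partial>lborel)"
   proof (rule nn_integral_cong_AE, rule AE_mp[OF AE_lborel_singleton[of H]], intro AE_I2 impI)
    fix s assume "s \<noteq> H"
    then have "s < H \<longleftrightarrow> alive x s (traj w)" using H(2,3) by (cases s H rule: linorder_cases) auto
    then show "?\<phi> (c.A s) * ennreal (spd (x + X s w)) * indicator {0..<H} s = ennreal (exp (- \<beta> * c.A s)) * (f (x + X s w) * ennreal (spd (x + X s w))) * indicator (life_span x w) s"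
     using pos by (auto simp: indicator_def mult_ac)
   qed
   finally show ?case .
  qed
 qed
 finally show ?thesis .
qed

text \<open>The survival interval \<open>[0, A H)\<close> is open on the right and the inverse clock
  is approached from the right, so the integrand converges on each good path.\<close>

lemma law_right_continuous:
 fixes f :: "real \<Rightarrow> real"
 assumes x: "x \<noteq> 0" and t: "0 \<le> t" and f: "continuous_on UNIV f" and B: "\<And>y. \<bar>f y\<bar> \<le> B"
 shows "continuous (at_right t) (\<lambda>t. \<integral>y. f y \<partial>law t x)"
proof -
 have [measurable]: "f \<in> borel_measurable borel" by (rule borel_measurable_continuous_onI[OF f])
 show ?thesis
  unfolding continuous_within
 proof (rule tendsto_at_right_sequentially[of t "t + 1"])
  fix S :: "nat \<Rightarrow> real"
  assume S: "\<And>n. t < S n" "S \<longlonglongrightarrow> t"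
  have St: "filterlim S (at_right t) sequentially"
   unfolding filterlim_at using S by (auto intro!: always_eventually simp: less_imp_neq[THEN not_sym])
  show "(\<lambda>n. \<integral>y. f y \<partial>law (S n) x) \<longlonglongrightarrow> (\<integral>y. f y \<partial>law t x)"
   unfolding integral_law[OF \<open>f \<in> borel_measurable borel\<close>]
  proof (rule integral_dominated_convergence[where w="\<lambda>_. B"])
   show "(\<lambda>w. indicator {w. alv x t w} w * f (pos x t w)) \<in> borel_measurable M"
    unfolding indicator_def mem_Collect_eq by measurable
   show "(\<lambda>w. indicator {w. alv x (S n) w} w * f (pos x (S n) w)) \<in> borel_measurable M" for n
    unfolding indicator_def mem_Collect_eq by measurable
   have "0 \<le> B" using B[of 0] by linarith
   then show "AE w in M. norm (indicator {w. alv x (S n) w} w * f (pos x (S n) w)) \<le> B" for n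
    using B by (auto simp: indicator_def)
   show "AE w in M. (\<lambda>n. indicator {w. alv x (S n) w} w * f (pos x (S n) w)) \<longlonglongrightarrow> indicator {w. alv x t w} w * f (pos x t w)"
    using AE_good[of x]
   proof eventually_elim
    case (elim w)
    then have om: "w \<in> space M" by (simp add: good_def)
    interpret c: clock "\<lambda>u. spd (x + X u w)" by (rule clock_path[OF om])
    obtain H where H: "0 < H"
     and alv: "\<forall>t\<ge>0. alv x t w \<longleftrightarrow> t < c.A H" and pos: "\<forall>s\<ge>0. pos x (c.A s) w = x + X s w"
     using good_path[OF elim x] by blast
    show ?case
    proof (cases "t < c.A H")
     case True
     obtain s where s: "0 \<le> s" "t = c.A s" using c.A_surj[of t H] t H True by force
     have "\<forall>\<^sub>F n in sequentially. S n < c.A H" using S(2) True by (rule order_tendstoD)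
     then have ev: "\<forall>\<^sub>F n in sequentially. f (pos x (S n) w) = indicator {w. alv x (S n) w} w * f (pos x (S n) w)"
     proof eventually_elim
      case (elim n)
      then have "alv x (S n) w" using alv S(1)[of n] t by simp
      then show ?case by simp
     qed
     have "filterlim c.inv_clock (at_right s) (at_right t)" unfolding s(2) by (rule c.inv_clock_right_continuous[OF s(1)])
     then have "filterlim (\<lambda>n. c.inv_clock (S n)) (at_right s) sequentially" using St by (rule filterlim_compose)
     then have "(\<lambda>n. X (c.inv_clock (S n)) w) \<longlonglongrightarrow> X s w"
      using X_rc[of s w, unfolded continuous_within] by (rule filterlim_compose[rotated])
     then have "(\<lambda>n. x + X (c.inv_clock (S n)) w) \<longlonglongrightarrow> x + X s w" by (intro tendsto_intros)
     then have "(\<lambda>n. pos x (S n) w) \<longlonglongrightarrow> pos x t w"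
      using pos s unfolding pos_def zeta_def c.inv_clock_def by simp
     then have "(\<lambda>n. f (pos x (S n) w)) \<longlonglongrightarrow> f (pos x t w)"
      using f by (intro isCont_tendsto_compose[of _ f]) (auto simp: continuous_on_eq_continuous_at)
     then have "(\<lambda>n. indicator {w. alv x (S n) w} w * f (pos x (S n) w)) \<longlonglongrightarrow> f (pos x t w)"
      by (rule Lim_transform_eventually[OF _ ev])
     then show ?thesis using alv t True by simp
    next
     case False
     then have "\<not> alv x (S n) w" for n using alv S(1)[of n] t by auto
     then show ?thesis using False alv t by simp
    qed
   qed
  qed simp
 qed simp
qed

lemma law_0: assumes x: "x \<noteq> 0" and B: "B \<in> sets borel" shows "measure (law 0 x) B = indicator B x"
proof -
 have "AE w in M. alv x 0 w \<and> pos x 0 w = x"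
  using AE_good[of x]
 proof eventually_elim
  case (elim w)
  then have om: "w \<in> space M" by (simp add: good_def)
  interpret c: clock "\<lambda>u. spd (x + X u w)" by (rule clock_path[OF om])
  obtain H where H: "0 < H"
   and alv: "\<forall>t\<ge>0. alv x t w \<longleftrightarrow> t < c.A H" and pos: "\<forall>s\<ge>0. pos x (c.A s) w = x + X s w"
   using good_path[OF elim x] by blast
  show ?case using alv pos[rule_format, of 0] c.A_strict[of 0 H] H c.A_zero X_neg[of 0 w] by simp
 qed
 then have "AE w in M. (alv x 0 w \<and> pos x 0 w \<in> B) \<longleftrightarrow> x \<in> B" by eventually_elim auto
 then have "prob {w\<in>space M. alv x 0 w \<and> pos x 0 w \<in> B} = prob {w\<in>space M. x \<in> B}"
  by (intro prob_eq_AE) (use B in \<open>auto intro: measurable_sets\<close>)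
 then show ?thesis using B prob_space by (cases "x \<in> B") (auto simp: measure_law)
qed

end

text \<open>The events of the theorem need not be measurable for \<open>M\<close>. Being almost
  surely equal to measurable ones, they are measurable for the completion, with the same
  probability.\<close>

lemma measure_completion_AE_eq:
 assumes "AE x in M. P x \<longleftrightarrow> Q x" and Q: "{x\<in>space M. Q x} \<in> sets M"
 shows "measure (completion M) {x\<in>space (completion M). P x} = measure M {x\<in>space M. Q x}"
proof -
 have ae: "AE x in completion M. x \<in> {x\<in>space M. Q x} \<longleftrightarrow> x \<in> {x\<in>space M. P x}"
  by (rule AE_completion) (use assms(1) in eventually_elim, auto)
 have P: "{x\<in>space M. P x} \<in> sets (completion M)"
  by (rule completion.in_sets_AE[OF ae]) (use Q in auto)
 have "measure (completion M) {x\<in>space M. P x} = measure (completion M) {x\<in>space M. Q x}"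
  using ae P Q by (intro measure_eq_AE) auto
 then show ?thesis using Q by simp
qed

text \<open>\<open>measure_of\<close> depends only on the values of the set function on the
  sigma-algebra; agreement with a genuine measure there provides countable additivity.\<close>

lemma measure_of_borel0:
 assumes "sets N = sets borel0" and "\<And>A. A \<in> sets borel0 \<Longrightarrow> emeasure N A = m A"
 shows "measure_of (- {0}) (sets borel0) m = N"
proof -
 have sp: "space N = - {0}" using sets_eq_imp_space_eq[OF assms(1)] by (simp add: space_restrict_space)
 have sub: "sets borel0 \<subseteq> Pow (- {0})" using sets.space_closed[of N] sp assms(1) by simp
 have "measure_of (- {0}) (sets borel0) m = measure_of (- {0}) (sets borel0) (emeasure N)"
 proof (rule measure_of_eq[OF sub])
  fix A assume "A \<in> sigma_sets (- {0}) (sets borel0)"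
  then have "A \<in> sets borel0" using sets.sigma_sets_eq[of N] sp assms(1) by simp
  then show "m A = emeasure N A" using assms(2) by simp
 qed
 also have "\<dots> = N" using measure_of_of_measure[of N] sp assms(1) by simp
 finally show ?thesis .
qed

lemma borel0_borel: "A \<in> sets borel0 \<Longrightarrow> A \<in> sets borel \<and> A \<subseteq> - {0}"
 by (auto simp: sets_restrict_space)

context time_changed_motion
begin

text \<open>\<open>X0\<close> is the process of the theorem and \<open>X\<close> its regular
  version; they agree at all nonnegative times outside a null set.\<close>

context
 fixes X0 :: "real \<Rightarrow> 'w \<Rightarrow> real"
 assumes X0: "AE w in M. \<forall>t\<ge>0. X0 t w = X t w"
begin

lemma killed_transition_law:
 assumes x: "x \<noteq> 0" and t: "0 \<le> t" and B: "B \<in> sets borel"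
 shows "killed_transition \<alpha> \<sigma> M X0 t x B = measure (law t x) B"
proof -
 have "AE w in M. (time_changed \<alpha> \<sigma> X0 x t w \<in> B \<and> ereal t < hitting_time0 \<alpha> \<sigma> X0 x w) \<longleftrightarrow> (alv x t w \<and> pos x t w \<in> B)"
  using X0 AE_good[of x]
 proof eventually_elim
  case (elim w)
  then show ?case using time_changed_good[OF elim(2) x, of X0] t by auto
 qed
 then show ?thesis
  unfolding killed_transition_def measure_law[OF B] by (rule measure_completion_AE_eq) (use B in measurable)
qed

lemma survival_prob_law:
 assumes "x \<noteq> 0" "0 \<le> t"
 shows "survival_prob \<alpha> \<sigma> M X0 t x = measure (law t x) UNIV"
 using killed_transition_law[OF assms, of UNIV] by (simp add: survival_prob_def killed_transition_def)

lemma conditional_prob_law: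
 assumes x: "x \<noteq> 0" and t: "0 \<le> t" and B: "B \<in> sets borel"
 shows "conditional_prob \<alpha> \<sigma> M X0 t x B = measure (law t x) B / measure (law t x) UNIV"
 using killed_transition_law[OF x t B] survival_prob_law[OF x t]
 by (simp add: conditional_prob_def cond_prob_def survival_prob_def killed_transition_def)

lemma killed_kernel_law:
 assumes x: "x \<noteq> 0" and t: "0 \<le> t"
 shows "killed_kernel \<alpha> \<sigma> M X0 t x = restrict_space (law t x) (- {0})"
 unfolding killed_kernel_def
proof (rule measure_of_borel0)
 fix A assume A: "A \<in> sets borel0"
 interpret l: finite_measure "law t x" by (rule finite_measure_law)
 have "emeasure (restrict_space (law t x) (- {0})) A = emeasure (law t x) A"
  using borel0_borel[OF A] by (intro emeasure_restrict_space) auto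
 then show "emeasure (restrict_space (law t x) (- {0})) A = ennreal (killed_transition \<alpha> \<sigma> M X0 t x A)"
  using killed_transition_law[OF x t] borel0_borel[OF A] by (simp add: l.emeasure_eq_measure)
qed (simp add: sets_restrict_space)

lemma conditional_law_law:
 assumes x: "x \<noteq> 0" and t: "0 \<le> t"
 shows "conditional_law \<alpha> \<sigma> M X0 t x = restrict_space (density (law t x) (\<lambda>_. ennreal (1 / measure (law t x) UNIV))) (- {0})"
 unfolding conditional_law_def
proof (rule measure_of_borel0)
 fix A assume A: "A \<in> sets borel0"
 interpret l: finite_measure "law t x" by (rule finite_measure_law)
 let ?D = "density (law t x) (\<lambda>_. ennreal (1 / measure (law t x) UNIV))"
 have "emeasure (restrict_space ?D (- {0})) A = emeasure ?D A"
  using borel0_borel[OF A] by (intro emeasure_restrict_space) auto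
 also have "\<dots> = ennreal (1 / measure (law t x) UNIV) * emeasure (law t x) A"
  using borel0_borel[OF A] by (simp add: emeasure_density nn_integral_cmult_indicator)
 also have "\<dots> = ennreal (conditional_prob \<alpha> \<sigma> M X0 t x A)"
  using conditional_prob_law[OF x t] borel0_borel[OF A]
  by (simp add: l.emeasure_eq_measure ennreal_mult'[symmetric])
 finally show "emeasure (restrict_space ?D (- {0})) A = ennreal (conditional_prob \<alpha> \<sigma> M X0 t x A)" .
qed (simp add: sets_restrict_space)

end

end

section \<open>Spectral expansion of the killed semigroup\<close>

lemma integral_exp_half_line:
 fixes a :: real assumes a: "0 < a"
 shows "has_bochner_integral lborel (\<lambda>t. indicator {0..} t * exp (- a * t)) (1 / a)"
proof (rule has_bochner_integral_nn_integral)
 have "((\<lambda>t. - (exp (- a * t) / a)) \<longlongrightarrow> - (0 / a)) at_top"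
  using a by (intro tendsto_intros filterlim_compose[OF exp_at_bot] filterlim_tendsto_neg_mult_at_bot[OF tendsto_const] filterlim_ident) auto
 then have "(\<integral>\<^sup>+t. ennreal (exp (- a * t)) * indicator {0..} t \<partial>lborel) = ennreal (- (0 / a) - - (exp (- a * 0) / a))"
  by (intro nn_integral_FTC_atLeast) (use a in \<open>auto intro!: derivative_eq_intros\<close>)
 then show "(\<integral>\<^sup>+t. ennreal (indicator {0..} t * exp (- a * t)) \<partial>lborel) = ennreal (1 / a)"
  by (simp add: ennreal_mult' mult.commute ennreal_indicator[symmetric] del: ennreal_indicator)
qed (use a in auto)

lemma integral_enn2real:
 assumes [measurable]: "u \<in> borel_measurable N" and fin: "(\<integral>\<^sup>+x. u x \<partial>N) < \<infinity>"
 shows "integrable N (\<lambda>x. enn2real (u x))" "(\<integral>x. enn2real (u x) \<partial>N) = enn2real (\<integral>\<^sup>+x. u x \<partial>N)"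
proof -
 have "AE x in N. u x \<noteq> \<infinity>" by (rule nn_integral_PInf_AE) (use fin in auto)
 then have eq: "(\<integral>\<^sup>+x. ennreal (enn2real (u x)) \<partial>N) = (\<integral>\<^sup>+x. u x \<partial>N)"
  by (intro nn_integral_cong_AE) (auto simp: less_top)
 show "integrable N (\<lambda>x. enn2real (u x))" by (rule integrableI_nonneg) (use eq fin in auto)
 show "(\<integral>x. enn2real (u x) \<partial>N) = enn2real (\<integral>\<^sup>+x. u x \<partial>N)"
  using eq by (subst integral_eq_nn_integral) auto
qed

text \<open>Measure and basis live on the whole line, where \<open>{0}\<close> is a null set. The
  eigenvalue equation keeps an exceptional set that may depend on \<open>t\<close>.\<close>

locale killed_spectrum = time_changed_motion M \<alpha> X \<sigma> + mu: orthonormal_basis "speed_measure \<alpha> \<sigma>" \<psi>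
 for M :: "'w measure" and \<alpha> X \<sigma> \<psi> +
 fixes lam :: "nat \<Rightarrow> real"
 assumes pot0_finite: "(\<integral>\<^sup>+y. ennreal (pot0 \<alpha> y) \<partial>speed_measure \<alpha> \<sigma>) < \<infinity>"
  and eigen: "\<And>n t. 0 \<le> t \<Longrightarrow> AE x in speed_measure \<alpha> \<sigma>. (\<integral>y. \<psi> n y \<partial>law t x) = exp (- lam n * t) * \<psi> n x"
  and lam0: "0 < lam 0" and lam01: "lam 0 < lam 1" and lam_mono: "incseq lam"
  and ground_pos: "\<And>x. x \<noteq> 0 \<Longrightarrow> 0 < \<psi> 0 x"
begin

abbreviation \<mu> :: "real measure" where "\<mu> \<equiv> speed_measure \<alpha> \<sigma>"

abbreviation g :: "real \<Rightarrow> real \<Rightarrow> real" where "g \<equiv> grn \<alpha>"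

lemma mu_eq: "\<mu> = density lborel (\<lambda>y. ennreal (spd y))" by (simp add: speed_measure_def spd_def)

lemma sets_mu[simp, measurable_cong]: "sets \<mu> = sets borel" by (simp add: speed_measure_def)

lemma space_mu[simp]: "space \<mu> = UNIV" by (simp add: speed_measure_def)

lemma nn_integral_mu:
 assumes [measurable]: "f \<in> borel_measurable borel"
 shows "(\<integral>\<^sup>+y. f y \<partial>\<mu>) = (\<integral>\<^sup>+y. f y * ennreal (spd y) \<partial>lborel)"
 unfolding mu_eq by (simp add: nn_integral_density mult.commute)

lemma psi_measurable[measurable]: "\<psi> n \<in> borel_measurable borel"
 using mu.sq[of n] by (simp add: square_integrable_on_def measurable_cong_sets[OF sets_mu refl])

lemma lam_pos: "0 < lam n" using lam0 lam_mono[THEN incseqD, of 0 n] by simp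

lemma lam_ge1: "0 < n \<Longrightarrow> lam 1 \<le> lam n" using lam_mono[THEN incseqD, of 1 n] by simp

lemma AE_mu_nonzero: "AE x in \<mu>. x \<noteq> 0"
proof -
 have "AE x in lborel. x \<noteq> (0::real)" by (rule AE_lborel_singleton)
 then show ?thesis unfolding mu_eq by (subst AE_density) auto
qed

lemma res_0_mu: "f \<in> borel_measurable borel \<Longrightarrow> res 0 f x = (\<integral>\<^sup>+y. f y * ennreal (g x y) \<partial>\<mu>)"
 by (simp add: res_0 nn_integral_mu mult.assoc mult.left_commute mult.commute)

lemmas [measurable] = pot0_measurable[OF \<alpha>]

lemma g_measurable_pair[measurable (raw)]:
 assumes [measurable]: "f \<in> borel_measurable N" "h \<in> borel_measurable N"
 shows "(\<lambda>z. g (f z) (h z)) \<in> borel_measurable N"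
 using measurable_compose[OF measurable_Pair[OF assms] grn_measurable[OF \<alpha>]] by simp

lemma pot0_integrable: "integrable \<mu> (pot0 \<alpha>)"
 by (rule integrableI_bounded) (use pot0_finite in \<open>simp_all add: pot0_nonneg[OF \<alpha>]\<close>)

definition \<kappa> :: real where "\<kappa> = (\<integral>y. pot0 \<alpha> y \<partial>\<mu>)"

lemma kappa_nonneg: "0 \<le> \<kappa>" unfolding \<kappa>_def by (simp add: pot0_nonneg[OF \<alpha>])

lemma g_nonneg: "0 \<le> g x y" by (rule grn_nonneg[OF \<alpha>])

text \<open>The square of a minimum is at most the product: one factor \<open>g x y\<close> is
  bounded through \<open>x\<close>, the other through \<open>y\<close>.\<close>

lemma g_sq: "square_integrable_on \<mu> (g x)" and g_norm: "(\<integral>y. (g x y)\<^sup>2 \<partial>\<mu>) \<le> 4 * pot0 \<alpha> x * \<kappa>"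
proof -
 have le: "(g x y)\<^sup>2 \<le> 4 * pot0 \<alpha> x * pot0 \<alpha> y" for y
  using mult_mono[OF grn_le_left[OF \<alpha>, of x y] grn_le_right[OF \<alpha>, of x y]] g_nonneg[of x y] pot0_nonneg[OF \<alpha>, of x]
  by (simp add: power2_eq_square)
 have i: "integrable \<mu> (\<lambda>y. (g x y)\<^sup>2)"
  by (rule Bochner_Integration.integrable_bound[where f="\<lambda>y. 4 * pot0 \<alpha> x * pot0 \<alpha> y"])
   (use le pot0_nonneg[OF \<alpha>] in \<open>auto intro!: integrable_mult_right pot0_integrable simp: abs_mult\<close>)
 then show "square_integrable_on \<mu> (g x)" unfolding square_integrable_on_def by simp
 have "(\<integral>y. (g x y)\<^sup>2 \<partial>\<mu>) \<le> (\<integral>y. 4 * pot0 \<alpha> x * pot0 \<alpha> y \<partial>\<mu>)"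
  by (rule integral_mono[OF i]) (use le in \<open>auto intro!: integrable_mult_right pot0_integrable\<close>)
 then show "(\<integral>y. (g x y)\<^sup>2 \<partial>\<mu>) \<le> 4 * pot0 \<alpha> x * \<kappa>" by (simp add: \<kappa>_def)
qed

lemma g_integrable: "square_integrable_on \<mu> f \<Longrightarrow> integrable \<mu> (\<lambda>y. g x y * f y)"
 by (rule square_integrable_mult[OF g_sq])

lemma bounded_sq: "f \<in> borel_measurable borel \<Longrightarrow> (\<And>y. \<bar>f y\<bar> \<le> B) \<Longrightarrow> square_integrable_on \<mu> f"
 by (rule square_integrable_bounded[OF mu.finite_measure_axioms, of f B]) auto

definition c :: "nat \<Rightarrow> real \<Rightarrow> real" where "c n x = (\<integral>y. g x y * \<psi> n y \<partial>\<mu>)"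

lemma coef_g: "mu.coef (g x) n = c n x" by (simp add: mu.coef_def c_def)

lemma c_measurable[measurable]: "c n \<in> borel_measurable borel"
 unfolding c_def[abs_def] by measurable

lemma coef_g_summable: "square_integrable_on \<mu> f \<Longrightarrow> summable (\<lambda>n. \<bar>c n x * mu.coef f n\<bar>)"
 using mu.coef_mult_summable[OF g_sq, of f x] by (simp add: coef_g)

lemma coef_g_sum_le: "square_integrable_on \<mu> f \<Longrightarrow> (\<Sum>n. \<bar>c n x * mu.coef f n\<bar>) \<le> sqrt (4 * pot0 \<alpha> x * \<kappa>) * sqrt (\<integral>y. (f y)\<^sup>2 \<partial>\<mu>)"
proof -
 assume f: "square_integrable_on \<mu> f"
 have "(\<Sum>n. \<bar>c n x * mu.coef f n\<bar>) \<le> sqrt (\<integral>y. (g x y)\<^sup>2 \<partial>\<mu>) * sqrt (\<integral>y. (f y)\<^sup>2 \<partial>\<mu>)"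
  using mu.coef_mult_sum_le[OF g_sq f, of x] unfolding coef_g .
 moreover have "sqrt (\<integral>y. (g x y)\<^sup>2 \<partial>\<mu>) * sqrt (\<integral>y. (f y)\<^sup>2 \<partial>\<mu>) \<le> sqrt (4 * pot0 \<alpha> x * \<kappa>) * sqrt (\<integral>y. (f y)\<^sup>2 \<partial>\<mu>)"
  by (rule mult_right_mono[OF real_sqrt_le_mono[OF g_norm]]) simp
 ultimately show ?thesis by (rule order_trans)
qed


lemma killed_integral_0:
 assumes f[measurable]: "f \<in> borel_measurable borel" and x: "x \<noteq> 0"
 shows "(\<integral>\<^sup>+t\<in>{0..}. (\<integral>\<^sup>+y. f y \<partial>law t x) \<partial>lborel) = (\<integral>\<^sup>+y. f y * ennreal (g x y) \<partial>\<mu>)"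
 using law_Laplace[OF x f, of 0] res_0_mu[OF f] by simp

text \<open>The eigenvalue equation is integrated over time. Fubini for null sets exchanges its
  exceptional sets, so that for almost every \<open>x\<close> it holds at almost every
  \<open>t\<close>. As \<open>\<psi> n\<close> may change sign, positive and negative parts are
  integrated separately; their time integrals are finite because \<open>g x\<close> and
  \<open>\<psi> n\<close> are square integrable.\<close>

lemma green_eigen: "AE x in \<mu>. c n x = \<psi> n x / lam n"
proof -
 interpret P: pair_sigma_finite \<mu> lborel ..
 let ?f = "\<lambda>s y. ennreal (s * \<psi> n y)"
 \<comment> \<open>The sign \<open>s\<close> is \<open>1\<close> or \<open>-1\<close>, and
   \<open>ennreal\<close> truncates at \<open>0\<close>: the two choices give the positive and the
   negative part of \<open>\<psi> n\<close>.\<close>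
 define q where "q s t x = (\<integral>\<^sup>+y. ?f s y \<partial>law t x)" for s t x
 have q_m[measurable]: "(\<lambda>z. q s (a z) (b z)) \<in> borel_measurable N" if "a \<in> borel_measurable N" "b \<in> borel_measurable N" for s a b and N :: "'c measure"
  unfolding q_def using that by measurable
 have fin: "(\<integral>\<^sup>+t. q s t x * indicator {0..} t \<partial>lborel) = (\<integral>\<^sup>+y. ennreal (s * \<psi> n y * g x y) \<partial>\<mu>)" "(\<integral>\<^sup>+t. q s t x * indicator {0..} t \<partial>lborel) < \<infinity>" "AE t in lborel. 0 \<le> t \<longrightarrow> q s t x < \<infinity>" if "x \<noteq> 0" and s: "\<bar>s\<bar> = 1" for s x
 proof -
  have "(\<integral>\<^sup>+t. q s t x * indicator {0..} t \<partial>lborel) = (\<integral>\<^sup>+y. ennreal (s * \<psi> n y) * ennreal (g x y) \<partial>\<mu>)"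
   unfolding q_def by (rule killed_integral_0) (use that in measurable)
  then show eq: "(\<integral>\<^sup>+t. q s t x * indicator {0..} t \<partial>lborel) = (\<integral>\<^sup>+y. ennreal (s * \<psi> n y * g x y) \<partial>\<mu>)"
   by (simp add: ennreal_mult''[OF g_nonneg])
  have le: "s * \<psi> n y * g x y \<le> norm (g x y * \<psi> n y)" for y
  proof -
   have "s * \<psi> n y * g x y \<le> \<bar>s * \<psi> n y * g x y\<bar>" by (rule abs_ge_self)
   then show ?thesis using s by (simp add: abs_mult mult.commute)
  qed
  have "(\<integral>\<^sup>+y. ennreal (s * \<psi> n y * g x y) \<partial>\<mu>) \<le> (\<integral>\<^sup>+y. ennreal (norm (g x y * \<psi> n y)) \<partial>\<mu>)"
   by (intro nn_integral_mono ennreal_leI le)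
  also have "\<dots> < \<infinity>" using g_integrable[OF mu.sq, of x n] by (simp add: integrable_iff_bounded)
  finally show f: "(\<integral>\<^sup>+t. q s t x * indicator {0..} t \<partial>lborel) < \<infinity>" unfolding eq .
  then have "AE t in lborel. q s t x * indicator {0..} t \<noteq> \<infinity>" by (intro nn_integral_PInf_AE) auto
  then show "AE t in lborel. 0 \<le> t \<longrightarrow> q s t x < \<infinity>" by eventually_elim (auto simp: indicator_def less_top)
 qed
 let ?E = "\<lambda>x t. 0 \<le> t \<longrightarrow> enn2real (q 1 t x) - enn2real (q (-1) t x) = exp (- lam n * t) * \<psi> n x"
 have fin_swap: "AE t in lborel. AE x in \<mu>. 0 \<le> t \<longrightarrow> q s t x < \<infinity>" if s: "\<bar>s\<bar> = 1" for s
 proof (subst P.AE_commute[symmetric])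
  show "{z \<in> space (\<mu> \<Otimes>\<^sub>M lborel). 0 \<le> snd z \<longrightarrow> q s (snd z) (fst z) < \<infinity>} \<in> sets (\<mu> \<Otimes>\<^sub>M lborel)" by measurable
  show "AE x in \<mu>. AE t in lborel. 0 \<le> t \<longrightarrow> q s t x < \<infinity>"
   using AE_mu_nonzero by eventually_elim (rule fin(3)[OF _ s])
 qed
 have "AE t in lborel. AE x in \<mu>. ?E x t"
  using fin_swap[of 1, simplified] fin_swap[of "-1", simplified]
 proof eventually_elim
  case (elim t)
  show ?case
  proof (cases "0 \<le> t")
   case True
   have q1: "AE x in \<mu>. q 1 t x < \<infinity>" and q2: "AE x in \<mu>. q (-1) t x < \<infinity>" using elim True by simp_all
   have "AE x in \<mu>. enn2real (q 1 t x) - enn2real (q (-1) t x) = exp (- lam n * t) * \<psi> n x"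
    using q1 q2 eigen[OF True, of n]
   proof eventually_elim
    case (elim x)
    have "integrable (law t x) (\<psi> n)"
     unfolding real_integrable_def using elim(1,2) by (auto simp: q_def less_top)
    then show ?case using elim(3) unfolding real_lebesgue_integral_def[OF \<open>integrable (law t x) (\<psi> n)\<close>] q_def by simp
   qed
   then show ?thesis by simp
  qed simp
 qed
 then have "AE x in \<mu>. AE t in lborel. ?E x t"
  by (subst P.AE_commute) measurable
 then show ?thesis
  using AE_mu_nonzero
 proof eventually_elim
  case (elim x)
  let ?Q = "\<lambda>s t. enn2real (q s t x * indicator {0..} t)"
  have Q: "integrable lborel (?Q s)" "(\<integral>t. ?Q s t \<partial>lborel) = enn2real (\<integral>\<^sup>+y. ennreal (s * \<psi> n y * g x y) \<partial>\<mu>)" if "\<bar>s\<bar> = 1" for s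
   using integral_enn2real[of "\<lambda>t. q s t x * indicator {0..} t" lborel] fin(1,2)[OF elim(2) that] by simp_all
  have "c n x = (\<integral>y. \<psi> n y * g x y \<partial>\<mu>)" unfolding c_def by (simp add: mult.commute)
  also have "\<dots> = (\<integral>t. ?Q 1 t \<partial>lborel) - (\<integral>t. ?Q (-1) t \<partial>lborel)"
   using Q(2)[of 1] Q(2)[of "-1"] g_integrable[OF mu.sq, of x n]
   by (subst real_lebesgue_integral_def) (auto simp: mult.commute)
  also have "\<dots> = (\<integral>t. ?Q 1 t - ?Q (-1) t \<partial>lborel)"
   using Q(1) by simp
  also have "\<dots> = (\<integral>t. indicator {0..} t * exp (- lam n * t) * \<psi> n x \<partial>lborel)"
   by (rule integral_cong_AE) (use elim(1) in \<open>auto simp: indicator_def enn2real_mult\<close>)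
  also have "\<dots> = \<psi> n x / lam n"
   using integral_exp_half_line[OF lam_pos, of n] by (simp add: has_bochner_integral_iff)
  finally show ?case .
 qed
qed

end

text \<open>Rays are limits of continuous ramps, Dynkin's lemma passes from rays to Borel sets, and
  bounded functions are limits of simple ones. Closure under uniformly bounded pointwise limits is
  what dominated convergence supplies in the application.\<close>

lemma bounded_borel_induct:
 fixes P :: "(real \<Rightarrow> real) \<Rightarrow> bool"
 assumes cont: "\<And>f. continuous_on UNIV f \<Longrightarrow> (\<And>y. 0 \<le> f y) \<Longrightarrow> (\<And>y. f y \<le> 1) \<Longrightarrow> P f"
  and lin: "\<And>a f h. P f \<Longrightarrow> P h \<Longrightarrow> P (\<lambda>y. f y + a * h y)"
  and lim: "\<And>u f B. (\<And>k::nat. P (u k)) \<Longrightarrow> (\<And>k y. \<bar>u k y\<bar> \<le> B) \<Longrightarrow> (\<And>y. (\<lambda>k. u k y) \<longlonglongrightarrow> f y) \<Longrightarrow> P f"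
  and f: "f \<in> borel_measurable borel" and B: "\<And>y. \<bar>f y\<bar> \<le> B"
 shows "P f"
proof -
 have one: "P (\<lambda>_. 1)" by (rule cont) auto
 have zero: "P (\<lambda>_. 0)" by (rule cont) auto
 have sum: "P (\<lambda>y. \<Sum>i\<in>I. a i * u i y)" if "finite I" "\<And>i. i \<in> I \<Longrightarrow> P (u i)" for I :: "'i set" and a and u :: "'i \<Rightarrow> real \<Rightarrow> real"
  using that
 proof (induction I)
  case (insert i I)
  have "P (\<lambda>y. (\<Sum>i\<in>I. a i * u i y) + a i * u i y)" by (rule lin) (use insert in auto)
  then show ?case using insert(1,2) by (simp add: add.commute)
 qed (use zero in simp)
 have ray: "P (indicator {..<b})" for b
 proof (rule lim[of "\<lambda>k y. max 0 (min 1 (real k * (b - y)))" 1])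
  show "P (\<lambda>y. max 0 (min 1 (real k * (b - y))))" for k by (rule cont) (auto intro!: continuous_intros)
  show "(\<lambda>k. max 0 (min 1 (real k * (b - y)))) \<longlonglongrightarrow> indicator {..<b} y" for y
  proof (cases "y < b")
   case True
   obtain n :: nat where n: "1 / (b - y) \<le> real n" using real_arch_simple by blast
   have "\<forall>\<^sub>F k in sequentially. max 0 (min 1 (real k * (b - y))) = indicator {..<b} y"
    using eventually_ge_at_top[of n]
   proof eventually_elim
    case (elim k)
    then have "1 / (b - y) \<le> real k" using n by simp
    then have "1 \<le> real k * (b - y)" using True by (simp add: field_simps)
    then show ?case using True by simp
   qed
   then show ?thesis by (rule tendsto_eventually)
  next
   case False
   then have "real k * (b - y) \<le> 0" for k by (simp add: mult_le_0_iff)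
   then have "max 0 (min 1 (real k * (b - y))) = 0" for k by (simp add: min_le_iff_disj)
   then show ?thesis using False by simp
  qed
 qed auto
 have ind: "P (indicator A)" if A: "A \<in> sets borel" for A :: "real set"
 proof -
  have "{..<a} \<inter> {..<b} = {..<min a b}" for a b :: real by auto
  then have "Int_stable (range lessThan :: real set set)" unfolding Int_stable_def by auto
  moreover have "range lessThan \<subseteq> Pow (UNIV :: real set)" by simp
  moreover have "A \<in> sigma_sets UNIV (range lessThan)"
   using A unfolding borel_Iio by (simp add: sets_measure_of)
  ultimately show ?thesis
  proof (induction rule: sigma_sets_induct_disjoint)
   case (basic A)
   then show ?case using ray by auto
  next
   case empty
   show ?case using zero by (simp add: indicator_def)
  next
   case (compl A)
   have "P (\<lambda>y. 1 + (-1) * indicator A y)" by (rule lin[OF one compl(2)])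
   moreover have "(\<lambda>y. 1 + (-1) * indicator A y) = (indicator (UNIV - A) :: real \<Rightarrow> real)"
    by (intro ext) (auto simp: indicator_def)
   ultimately show ?case by simp
  next
   case (union A)
   show ?case
   proof (rule lim[of "\<lambda>k y. \<Sum>i<k. 1 * indicator (A i) y" 1])
    show "P (\<lambda>y. \<Sum>i<k. 1 * indicator (A i) y)" for k
     by (rule sum[of "{..<k}" "\<lambda>i. indicator (A i)" "\<lambda>_. 1"]) (use union in auto)
    have eq: "(\<Sum>i<k. 1 * indicator (A i) y) = (indicator (\<Union>i<k. A i) y :: real)" for k y
     using union(1) by (subst indicator_UN_disjoint) (auto simp: disjoint_family_on_def)
    show "\<bar>\<Sum>i<k. 1 * indicator (A i) y\<bar> \<le> (1::real)" for k y unfolding eq by simp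
    show "(\<lambda>k. \<Sum>i<k. 1 * indicator (A i) y) \<longlonglongrightarrow> (indicator (\<Union>i. A i) y :: real)" for y
     unfolding eq by (rule LIMSEQ_indicator_UN)
   qed
  qed
 qed
 obtain u where u: "\<And>k. simple_function borel (u k)" "\<And>y. (\<lambda>k. u k y) \<longlonglongrightarrow> f y" "\<And>k y. dist (u k y) 0 \<le> 2 * dist (f y) 0"
  using borel_measurable_implies_sequence_metric[OF f, of 0] by auto
 show ?thesis
 proof (rule lim[of u "2 * B"])
  show "(\<lambda>k. u k y) \<longlonglongrightarrow> f y" for y by (rule u(2))
  show "\<bar>u k y\<bar> \<le> 2 * B" for k y using u(3)[of k y] B[of y] by simp
  show "P (u k)" for k
  proof -
   have "P (\<lambda>y. \<Sum>z\<in>range (u k). z * indicator (u k -` {z}) y)"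
    by (rule sum[of "range (u k)" "\<lambda>z. indicator (u k -` {z})" "\<lambda>z. z"]) (use u(1)[of k] in \<open>auto intro!: ind simp: simple_function_def\<close>)
   moreover have "(\<lambda>y. \<Sum>z\<in>range (u k). z * indicator (u k -` {z}) y) = u k"
   proof
    fix y
    have "u k y = (\<Sum>z\<in>u k ` space borel. indicator (u k -` {z} \<inter> space borel) y *\<^sub>R z)"
     by (rule simple_function_indicator_representation_banach[OF u(1)]) simp
    also have "\<dots> = (\<Sum>z\<in>range (u k). z * indicator (u k -` {z}) y)" by (simp add: mult.commute)
    finally show "(\<Sum>z\<in>range (u k). z * indicator (u k -` {z}) y) = u k y" ..
   qed
   ultimately show ?thesis by (rule back_subst[of P])
  qed
 qed
qed

text \<open>Everything rests on \<open>lam n * exp (- lam n * t) \<le> 1 / t\<close>, which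
  dominates the series away from \<open>t = 0\<close> by a multiple of the absolutely summable
  \<open>a\<close>. The Laplace transform is taken termwise, where the factor
  \<open>lam n / (lam n + \<beta>)\<close> is at most \<open>1\<close>.\<close>

lemma dirichlet_series:
 fixes a lam :: "nat \<Rightarrow> real"
 assumes a: "summable (\<lambda>n. \<bar>a n\<bar>)" and lam: "\<And>n. 0 < lam n"
 defines "S \<equiv> \<lambda>t. \<Sum>n. lam n * exp (- lam n * t) * a n"
 shows dirichlet_series_summable: "0 < t \<Longrightarrow> summable (\<lambda>n. \<bar>lam n * exp (- lam n * t) * a n\<bar>)"
  and dirichlet_series_continuous: "0 < t \<Longrightarrow> isCont S t"
  and dirichlet_series_laplace: "0 \<le> \<beta> \<Longrightarrow> has_bochner_integral lborel (\<lambda>t. indicator {0<..} t * (exp (- \<beta> * t) * S t)) (\<Sum>n. a n * lam n / (lam n + \<beta>))"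
proof -
 have le: "\<bar>lam n * exp (- lam n * t) * a n\<bar> \<le> \<bar>a n\<bar> / d" if "0 < d" "d \<le> t" for n t d
 proof -
  have "lam n * d \<le> lam n * t" using that lam[of n] by simp
  also have "\<dots> \<le> exp (lam n * t)" using exp_ge_add_one_self[of "lam n * t"] by linarith
  finally have "lam n * exp (- lam n * t) \<le> 1 / d" using that by (simp add: exp_minus field_simps)
  then have "(lam n * exp (- lam n * t)) * \<bar>a n\<bar> \<le> (1 / d) * \<bar>a n\<bar>" by (rule mult_right_mono) simp
  then show ?thesis using lam[of n] by (simp add: abs_mult)
 qed
 show sm: "summable (\<lambda>n. \<bar>lam n * exp (- lam n * t) * a n\<bar>)" if "0 < t" for t
  by (rule summable_comparison_test'[OF summable_divide[OF a, of t], of 0]) (use le[OF that order_refl] in simp)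
 show "isCont S t" if t: "0 < t"
 proof -
  have "uniform_limit {t/2..} (\<lambda>N t. \<Sum>n<N. lam n * exp (- lam n * t) * a n) S sequentially"
   unfolding S_def by (rule Weierstrass_m_test[OF _ summable_divide[OF a, of "t/2"]]) (use le[of "t/2"] t in simp)
  then have "continuous_on {t/2..} S"
   by (rule uniform_limit_theorem[rotated]) (auto intro!: continuous_intros always_eventually)
  then show ?thesis using t by (intro continuous_on_interior[of "{t/2..}"]) auto
 qed
 show "has_bochner_integral lborel (\<lambda>t. indicator {0<..} t * (exp (- \<beta> * t) * S t)) (\<Sum>n. a n * lam n / (lam n + \<beta>))" if \<beta>: "0 \<le> \<beta>"
 proof -
  let ?f = "\<lambda>n t. indicator {0<..} t * (exp (- \<beta> * t) * (lam n * exp (- lam n * t) * a n))"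
  have pos: "0 < lam n + \<beta>" for n using lam[of n] \<beta> by simp
  have f: "has_bochner_integral lborel (\<lambda>t. indicator {0<..} t * (exp (- \<beta> * t) * (lam n * exp (- lam n * t) * z))) (lam n * z / (lam n + \<beta>))" for n z
  proof -
   have "has_bochner_integral lborel (\<lambda>t. (indicator {0..} t * exp (- (lam n + \<beta>) * t)) * (lam n * z)) (1 / (lam n + \<beta>) * (lam n * z))"
    by (intro has_bochner_integral_mult_left integral_exp_half_line pos)
   then have "has_bochner_integral lborel (\<lambda>t. (indicator {0..} t * exp (- (lam n + \<beta>) * t)) * (lam n * z)) (lam n * z / (lam n + \<beta>))" by simp
   then show ?thesis
   proof (subst has_bochner_integral_cong_AE)
    show "AE t in lborel. indicator {0<..} t * (exp (- \<beta> * t) * (lam n * exp (- lam n * t) * z)) = indicator {0..} t * exp (- (lam n + \<beta>) * t) * (lam n * z)"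
    proof (rule AE_mp[OF AE_lborel_singleton[of 0]], intro AE_I2 impI)
     fix t :: real assume "t \<noteq> 0"
     have "exp (- (lam n + \<beta>) * t) = exp (- \<beta> * t) * exp (- lam n * t)" by (simp add: exp_add[symmetric] algebra_simps)
     then show "indicator {0<..} t * (exp (- \<beta> * t) * (lam n * exp (- lam n * t) * z)) = indicator {0..} t * exp (- (lam n + \<beta>) * t) * (lam n * z)"
      using \<open>t \<noteq> 0\<close> by (auto simp: indicator_def)
    qed
   qed auto
  qed
  have n: "norm (?f n t) = indicator {0<..} t * (exp (- \<beta> * t) * (lam n * exp (- lam n * t) * \<bar>a n\<bar>))" for n t
   using lam[of n] by (simp add: abs_mult)
  have i: "integrable lborel (?f n)" for n using f[of n "a n"] by (simp add: has_bochner_integral_iff)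
  have ae: "AE t in lborel. summable (\<lambda>n. norm (?f n t))"
  proof (intro AE_I2)
   fix t :: real
   show "summable (\<lambda>n. norm (?f n t))"
   proof (cases "0 < t")
    case True
    have "summable (\<lambda>n. exp (- \<beta> * t) * \<bar>lam n * exp (- lam n * t) * a n\<bar>)" by (intro summable_mult sm True)
    then show ?thesis unfolding n using True by (simp add: abs_mult abs_of_pos[OF lam])
   qed simp
  qed
  have "(\<integral>t. norm (?f n t) \<partial>lborel) = lam n * \<bar>a n\<bar> / (lam n + \<beta>)" for n
   unfolding n using f[of n "\<bar>a n\<bar>"] by (simp add: has_bochner_integral_iff)
  moreover have "summable (\<lambda>n. lam n * \<bar>a n\<bar> / (lam n + \<beta>))"
  proof (rule summable_comparison_test'[OF a, of 0])
   fix n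
   have "lam n * \<bar>a n\<bar> \<le> \<bar>a n\<bar> * (lam n + \<beta>)" using \<beta> by (simp add: algebra_simps)
   then show "norm (lam n * \<bar>a n\<bar> / (lam n + \<beta>)) \<le> \<bar>a n\<bar>" using lam[of n] pos[of n] by (simp add: divide_le_eq)
  qed
  ultimately have s: "summable (\<lambda>n. \<integral>t. norm (?f n t) \<partial>lborel)" by simp
  have sumf: "(\<Sum>n. ?f n t) = indicator {0<..} t * (exp (- \<beta> * t) * S t)" for t
  proof (cases "0 < t")
   case True
   then show ?thesis unfolding S_def using suminf_mult[OF summable_rabs_cancel[OF sm[OF True]], of "exp (- \<beta> * t)"] by simp
  qed simp
  have "has_bochner_integral lborel (\<lambda>t. \<Sum>n. ?f n t) (\<Sum>n. (\<integral>t. ?f n t \<partial>lborel))"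
   unfolding has_bochner_integral_iff using integrable_suminf[OF i ae s] integral_suminf[OF i ae s] by blast
  moreover have "(\<integral>t. ?f n t \<partial>lborel) = a n * lam n / (lam n + \<beta>)" for n
   using f[of n "a n"] by (simp add: has_bochner_integral_iff mult.commute)
  ultimately show ?thesis unfolding sumf by simp
 qed
qed

section \<open>The resolvent and the semigroup as series, valid at every nonzero point\<close>

context killed_spectrum
begin

lemma g_sym: "g x y = g y x" by (rule grn_sym[OF \<alpha>])

lemma g_bound:
 assumes [measurable]: "f \<in> borel_measurable borel" and "\<And>y. \<bar>f y\<bar> \<le> B"
 shows "integrable \<mu> (\<lambda>y. g x y * f y)" "\<bar>\<integral>y. g x y * f y \<partial>\<mu>\<bar> \<le> 2 * \<kappa> * B"
proof -
 show i: "integrable \<mu> (\<lambda>y. g x y * f y)" by (rule g_integrable[OF bounded_sq]) (use assms in auto)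
 have "\<bar>\<integral>y. g x y * f y \<partial>\<mu>\<bar> \<le> (\<integral>y. \<bar>g x y * f y\<bar> \<partial>\<mu>)" by (rule integral_abs_bound)
 also have "\<dots> \<le> (\<integral>y. 2 * pot0 \<alpha> y * B \<partial>\<mu>)"
 proof (rule integral_mono)
  show "\<bar>g x y * f y\<bar> \<le> 2 * pot0 \<alpha> y * B" for y
   using mult_mono[OF grn_le_right[OF \<alpha>, of x y] assms(2)[of y]] g_nonneg[of x y] pot0_nonneg[OF \<alpha>, of y]
   by (simp add: abs_mult)
 qed (use i in \<open>auto intro!: integrable_mult_left integrable_mult_right pot0_integrable\<close>)
 also have "\<dots> = 2 * \<kappa> * B" by (simp add: \<kappa>_def)
 finally show "\<bar>\<integral>y. g x y * f y \<partial>\<mu>\<bar> \<le> 2 * \<kappa> * B" .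
qed

text \<open>Symmetry of \<open>g\<close> and Fubini move the Green operator onto
  \<open>\<psi> n\<close>, where it acts as division by \<open>lam n\<close>.\<close>

lemma coef_green:
 assumes f[measurable]: "f \<in> borel_measurable borel" and B: "\<And>y. \<bar>f y\<bar> \<le> B"
 shows "mu.coef (\<lambda>x. \<integral>y. g x y * f y \<partial>\<mu>) n = mu.coef f n / lam n"
proof -
 interpret P: pair_sigma_finite \<mu> \<mu> ..
 have pi: "integrable \<mu> (\<psi> n)" by (rule square_integrable_on_imp_integrable[OF mu.finite_measure_axioms mu.sq])
 have int: "integrable (\<mu> \<Otimes>\<^sub>M \<mu>) (\<lambda>(x, y). g x y * f y * \<psi> n x)"
 proof (rule P.Fubini_integrable)
  show "(\<lambda>(x, y). g x y * f y * \<psi> n x) \<in> borel_measurable (\<mu> \<Otimes>\<^sub>M \<mu>)" by measurable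
  show "AE x in \<mu>. integrable \<mu> (\<lambda>y. case (x, y) of (x, y) \<Rightarrow> g x y * f y * \<psi> n x)"
   using g_bound(1)[OF f B] by simp
  have "(\<lambda>x. \<integral>y. norm (g x y * f y * \<psi> n x) \<partial>\<mu>) = (\<lambda>x. (\<integral>y. g x y * \<bar>f y\<bar> \<partial>\<mu>) * \<bar>\<psi> n x\<bar>)"
   by (intro ext) (simp add: abs_mult g_nonneg)
  moreover have "integrable \<mu> (\<lambda>x. (\<integral>y. g x y * \<bar>f y\<bar> \<partial>\<mu>) * \<bar>\<psi> n x\<bar>)"
  proof (rule Bochner_Integration.integrable_bound[where f="\<lambda>x. 2 * \<kappa> * B * \<bar>\<psi> n x\<bar>"])
   show "AE x in \<mu>. norm ((\<integral>y. g x y * \<bar>f y\<bar> \<partial>\<mu>) * \<bar>\<psi> n x\<bar>) \<le> norm (2 * \<kappa> * B * \<bar>\<psi> n x\<bar>)"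
   proof (intro AE_I2)
    fix x
    have "\<bar>\<integral>y. g x y * \<bar>f y\<bar> \<partial>\<mu>\<bar> \<le> 2 * \<kappa> * B" by (rule g_bound(2)) (use B in auto)
    then have "\<bar>\<integral>y. g x y * \<bar>f y\<bar> \<partial>\<mu>\<bar> * \<bar>\<psi> n x\<bar> \<le> 2 * \<kappa> * B * \<bar>\<psi> n x\<bar>" by (rule mult_right_mono) simp
    then have "norm ((\<integral>y. g x y * \<bar>f y\<bar> \<partial>\<mu>) * \<bar>\<psi> n x\<bar>) \<le> 2 * \<kappa> * B * \<bar>\<psi> n x\<bar>" by (simp add: abs_mult)
    also have "\<dots> \<le> norm (2 * \<kappa> * B * \<bar>\<psi> n x\<bar>)" unfolding real_norm_def by (rule abs_ge_self)
    finally show "norm ((\<integral>y. g x y * \<bar>f y\<bar> \<partial>\<mu>) * \<bar>\<psi> n x\<bar>) \<le> norm (2 * \<kappa> * B * \<bar>\<psi> n x\<bar>)" .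
   qed
  qed (use pi in auto)
  ultimately show "integrable \<mu> (\<lambda>x. \<integral>y. norm (case (x, y) of (x, y) \<Rightarrow> g x y * f y * \<psi> n x) \<partial>\<mu>)" by simp
 qed
 have "mu.coef (\<lambda>x. \<integral>y. g x y * f y \<partial>\<mu>) n = (\<integral>x. (\<integral>y. g x y * f y * \<psi> n x \<partial>\<mu>) \<partial>\<mu>)"
  unfolding mu.coef_def using g_bound(1)[OF f B] by (intro Bochner_Integration.integral_cong) auto
 also have "\<dots> = (\<integral>y. (\<integral>x. g x y * f y * \<psi> n x \<partial>\<mu>) \<partial>\<mu>)" using P.Fubini_integral[OF int] by simp
 also have "\<dots> = (\<integral>y. f y * c n y \<partial>\<mu>)"
 proof (rule Bochner_Integration.integral_cong[OF refl])
  fix y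
  have "(\<integral>x. g x y * f y * \<psi> n x \<partial>\<mu>) = (\<integral>x. f y * (g y x * \<psi> n x) \<partial>\<mu>)"
   by (intro Bochner_Integration.integral_cong) (auto simp: g_sym[of y] mult_ac)
  then show "(\<integral>x. g x y * f y * \<psi> n x \<partial>\<mu>) = f y * c n y" by (simp add: c_def)
 qed
 also have "\<dots> = (\<integral>y. f y * \<psi> n y / lam n \<partial>\<mu>)"
  by (rule integral_cong_AE) (use green_eigen[of n] in auto)
 also have "\<dots> = mu.coef f n / lam n" by (simp add: mu.coef_def)
 finally show ?thesis .
qed

definition rs :: "real \<Rightarrow> (real \<Rightarrow> real) \<Rightarrow> real \<Rightarrow> real" where
 "rs \<beta> f x = enn2real (res \<beta> (\<lambda>y. ennreal (f y)) x)"

context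
 fixes f :: "real \<Rightarrow> real" and B :: real
 assumes f[measurable]: "f \<in> borel_measurable borel" and f0: "\<And>y. 0 \<le> f y" and fB: "\<And>y. f y \<le> B"
begin

lemma f_abs: "\<bar>f y\<bar> \<le> B" using f0[of y] fB[of y] by simp

lemma res_0_real: "res 0 (\<lambda>y. ennreal (f y)) x = ennreal (\<integral>y. g x y * f y \<partial>\<mu>)"
proof -
 have "res 0 (\<lambda>y. ennreal (f y)) x = (\<integral>\<^sup>+y. ennreal (g x y * f y) \<partial>\<mu>)"
  by (subst res_0_mu) (simp_all add: ennreal_mult g_nonneg f0 mult.commute)
 also have "\<dots> = ennreal (\<integral>y. g x y * f y \<partial>\<mu>)"
  by (rule nn_integral_eq_integral) (use g_bound(1)[OF f f_abs] g_nonneg f0 in auto)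
 finally show ?thesis .
qed

lemma green_f: "0 \<le> (\<integral>y. g x y * f y \<partial>\<mu>)" "(\<integral>y. g x y * f y \<partial>\<mu>) \<le> 2 * \<kappa> * B"
 using g_bound(2)[OF f f_abs, of x] by (auto intro!: integral_nonneg_AE simp: g_nonneg f0)

lemma res_le: assumes "0 \<le> \<beta>" shows "res \<beta> (\<lambda>y. ennreal (f y)) x \<le> ennreal (\<integral>y. g x y * f y \<partial>\<mu>)"
 using resolvent_equation[of "\<lambda>y. ennreal (f y)" \<beta> x] assms unfolding res_0_real by simp

lemma rs_props:
 assumes \<beta>: "0 \<le> \<beta>"
 shows ennreal_rs: "ennreal (rs \<beta> f x) = res \<beta> (\<lambda>y. ennreal (f y)) x"
  and rs_nonneg: "0 \<le> rs \<beta> f x" and rs_le: "rs \<beta> f x \<le> 2 * \<kappa> * B"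
proof -
 have le: "res \<beta> (\<lambda>y. ennreal (f y)) x \<le> ennreal (2 * \<kappa> * B)"
  using res_le[OF \<beta>, of x] ennreal_leI[OF green_f(2)[of x]] by (rule order_trans)
 then show "ennreal (rs \<beta> f x) = res \<beta> (\<lambda>y. ennreal (f y)) x"
  unfolding rs_def by (intro ennreal_enn2real) (rule le_less_trans[OF _ ennreal_less_top])
 show "0 \<le> rs \<beta> f x" by (simp add: rs_def)
 have "0 \<le> 2 * \<kappa> * B" using green_f[of x] by linarith
 then show "rs \<beta> f x \<le> 2 * \<kappa> * B" unfolding rs_def using le by (metis enn2real_leI)
qed

lemma rs_measurable[measurable]: "rs \<beta> f \<in> borel_measurable borel"
 unfolding rs_def[abs_def] by measurable

end

lemma rs_resolvent:
 assumes f[measurable]: "f \<in> borel_measurable borel" and f0: "\<And>y. 0 \<le> f y" and fB: "\<And>y. f y \<le> B" and \<beta>: "0 \<le> \<beta>"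
 shows "(\<integral>y. g x y * f y \<partial>\<mu>) = rs \<beta> f x + \<beta> * (\<integral>y. g x y * rs \<beta> f y \<partial>\<mu>)"
proof -
 note r = rs_props[OF f f0 fB \<beta>]
 have m: "rs \<beta> f \<in> borel_measurable borel" by (rule rs_measurable[OF f f0 fB])
 have "ennreal (\<integral>y. g x y * f y \<partial>\<mu>) = res \<beta> (\<lambda>y. ennreal (f y)) x + ennreal \<beta> * res 0 (res \<beta> (\<lambda>y. ennreal (f y))) x"
  unfolding res_0_real[OF f f0 fB, symmetric] by (rule resolvent_equation[OF _ \<beta>]) measurable
 also have "res \<beta> (\<lambda>y. ennreal (f y)) = (\<lambda>y. ennreal (rs \<beta> f y))" using r(1) by (intro ext) simp
 also have "res 0 (\<lambda>y. ennreal (rs \<beta> f y)) x = ennreal (\<integral>y. g x y * rs \<beta> f y \<partial>\<mu>)"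
  by (rule res_0_real[OF m r(2,3)])
 also have "ennreal (rs \<beta> f x) + ennreal \<beta> * ennreal (\<integral>y. g x y * rs \<beta> f y \<partial>\<mu>) = ennreal (rs \<beta> f x + \<beta> * (\<integral>y. g x y * rs \<beta> f y \<partial>\<mu>))"
  using \<beta> r(2) green_f(1)[OF m r(2,3)] by (simp add: ennreal_mult ennreal_plus)
 finally show ?thesis
  using green_f(1)[OF f f0 fB] \<beta> r(2) green_f(1)[OF m r(2,3)] by (subst (asm) ennreal_inj) auto
qed

text \<open>Coefficients in the resolvent equation give those of \<open>rs \<beta> f\<close> as
  \<open>mu.coef f n / (lam n + \<beta>)\<close>. Put back into the same equation at a fixed
  \<open>x\<close>, with both Green integrals expanded by Parseval against \<open>g x\<close>, they
  yield a series for the value at that very point.\<close>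

lemma rs_sums:
 assumes f[measurable]: "f \<in> borel_measurable borel" and f0: "\<And>y. 0 \<le> f y" and fB: "\<And>y. f y \<le> B" and \<beta>: "0 \<le> \<beta>"
 shows "(\<lambda>n. (c n x * mu.coef f n) * lam n / (lam n + \<beta>)) sums rs \<beta> f x"
proof -
 note r = rs_props[OF f f0 fB \<beta>]
 have m[measurable]: "rs \<beta> f \<in> borel_measurable borel" by (rule rs_measurable[OF f f0 fB])
 have rB: "\<bar>rs \<beta> f y\<bar> \<le> 2 * \<kappa> * B" for y using r(2,3)[of y] by simp
 have fA: "\<bar>f y\<bar> \<le> B" for y by (rule f_abs[OF f f0 fB])
 note rsq = bounded_sq[OF m rB] and fsq = bounded_sq[OF f fA]
 have coef_r: "mu.coef (rs \<beta> f) n = mu.coef f n / (lam n + \<beta>)" for n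
 proof -
  have "(\<lambda>x. \<integral>y. g x y * f y \<partial>\<mu>) = (\<lambda>x. rs \<beta> f x + \<beta> * (\<integral>y. g x y * rs \<beta> f y \<partial>\<mu>))"
   by (intro ext rs_resolvent[OF f f0 fB \<beta>])
  then have "mu.coef f n / lam n = mu.coef (\<lambda>x. rs \<beta> f x + \<beta> * (\<integral>y. g x y * rs \<beta> f y \<partial>\<mu>)) n"
   using coef_green[OF f fA, of n] by simp
  also have "\<dots> = (\<integral>x. rs \<beta> f x * \<psi> n x + \<beta> * ((\<integral>y. g x y * rs \<beta> f y \<partial>\<mu>) * \<psi> n x) \<partial>\<mu>)"
   unfolding mu.coef_def by (simp add: algebra_simps)
  also have "\<dots> = mu.coef (rs \<beta> f) n + \<beta> * mu.coef (\<lambda>x. \<integral>y. g x y * rs \<beta> f y \<partial>\<mu>) n"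
  proof -
   have "square_integrable_on \<mu> (\<lambda>x. \<integral>y. g x y * rs \<beta> f y \<partial>\<mu>)"
    by (rule bounded_sq[OF _ g_bound(2)[OF m rB]]) measurable
   then have "integrable \<mu> (\<lambda>x. (\<integral>y. g x y * rs \<beta> f y \<partial>\<mu>) * \<psi> n x)" by (rule square_integrable_mult[OF _ mu.sq])
   moreover have "integrable \<mu> (\<lambda>x. rs \<beta> f x * \<psi> n x)" by (rule square_integrable_mult[OF rsq mu.sq])
   ultimately show ?thesis unfolding mu.coef_def by simp
  qed
  also have "\<dots> = mu.coef (rs \<beta> f) n + \<beta> * (mu.coef (rs \<beta> f) n / lam n)" by (simp only: coef_green[OF m rB])
  finally have "mu.coef f n / lam n = mu.coef (rs \<beta> f) n * ((lam n + \<beta>) / lam n)"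
   using lam_pos[of n] by (simp add: field_simps)
  then show ?thesis using lam_pos[of n] \<beta> by (simp add: field_simps)
 qed
 have "(\<lambda>n. c n x * mu.coef f n - \<beta> * (c n x * mu.coef (rs \<beta> f) n)) sums ((\<integral>y. g x y * f y \<partial>\<mu>) - \<beta> * (\<integral>y. g x y * rs \<beta> f y \<partial>\<mu>))"
  using mu.parseval[OF g_sq[of x] fsq] mu.parseval[OF g_sq[of x] rsq] unfolding coef_g by (intro sums_diff sums_mult)
 also have "(\<integral>y. g x y * f y \<partial>\<mu>) - \<beta> * (\<integral>y. g x y * rs \<beta> f y \<partial>\<mu>) = rs \<beta> f x"
  using rs_resolvent[OF f f0 fB \<beta>, of x] by simp
 also have "(\<lambda>n. c n x * mu.coef f n - \<beta> * (c n x * mu.coef (rs \<beta> f) n)) = (\<lambda>n. (c n x * mu.coef f n) * lam n / (lam n + \<beta>))"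
 proof
  fix n
  have "lam n + \<beta> \<noteq> 0" using lam_pos[of n] \<beta> by simp
  then show "c n x * mu.coef f n - \<beta> * (c n x * mu.coef (rs \<beta> f) n) = (c n x * mu.coef f n) * lam n / (lam n + \<beta>)"
   unfolding coef_r by (simp add: field_simps)
 qed
 finally show ?thesis .
qed

end

context killed_spectrum
begin

text \<open>Written with \<open>lam n * c n x\<close> in place of \<open>\<psi> n x\<close>: the two
  agree almost everywhere, but \<open>c n x\<close> has a determined value at every point.\<close>

definition ser :: "real \<Rightarrow> real \<Rightarrow> (real \<Rightarrow> real) \<Rightarrow> real" where
 "ser x t f = (\<Sum>n. lam n * exp (- lam n * t) * (c n x * mu.coef f n))"

lemma ser_summable:
 assumes "square_integrable_on \<mu> f" "0 < t"
 shows "summable (\<lambda>n. \<bar>lam n * exp (- lam n * t) * (c n x * mu.coef f n)\<bar>)"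
 by (rule dirichlet_series_summable[OF coef_g_summable[OF assms(1)] lam_pos assms(2)])

lemma lam_exp_le: assumes "0 < t" shows "lam n * exp (- lam n * t) \<le> 1 / t"
proof -
 have "lam n * t \<le> exp (lam n * t)" using exp_ge_add_one_self[of "lam n * t"] by linarith
 then show ?thesis using assms by (simp add: exp_minus field_simps)
qed

lemma ser_partial_le:
 assumes f: "square_integrable_on \<mu> f" and t: "0 < t"
 shows "\<bar>\<Sum>n<N. lam n * exp (- lam n * t) * (c n x * mu.coef f n)\<bar> \<le> 1 / t * (sqrt (4 * pot0 \<alpha> x * \<kappa>) * sqrt (\<integral>y. (f y)\<^sup>2 \<partial>\<mu>))"
proof -
 have "\<bar>\<Sum>n<N. lam n * exp (- lam n * t) * (c n x * mu.coef f n)\<bar> \<le> (\<Sum>n<N. \<bar>lam n * exp (- lam n * t) * (c n x * mu.coef f n)\<bar>)"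
  by (rule sum_abs)
 also have "\<dots> \<le> (\<Sum>n<N. 1 / t * \<bar>c n x * mu.coef f n\<bar>)"
 proof (rule sum_mono)
  fix n
  have "lam n * exp (- lam n * t) * \<bar>c n x * mu.coef f n\<bar> \<le> 1 / t * \<bar>c n x * mu.coef f n\<bar>"
   by (rule mult_right_mono[OF lam_exp_le[OF t]]) simp
  then show "\<bar>lam n * exp (- lam n * t) * (c n x * mu.coef f n)\<bar> \<le> 1 / t * \<bar>c n x * mu.coef f n\<bar>"
   by (simp add: abs_mult abs_of_pos[OF lam_pos])
 qed
 also have "\<dots> = 1 / t * (\<Sum>n<N. \<bar>c n x * mu.coef f n\<bar>)" by (simp only: sum_distrib_left)
 also have "\<dots> \<le> 1 / t * (\<Sum>n. \<bar>c n x * mu.coef f n\<bar>)"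
  by (intro mult_left_mono sum_le_suminf coef_g_summable[OF f]) (use t in auto)
 also have "\<dots> \<le> 1 / t * (sqrt (4 * pot0 \<alpha> x * \<kappa>) * sqrt (\<integral>y. (f y)\<^sup>2 \<partial>\<mu>))"
  by (intro mult_left_mono coef_g_sum_le[OF f]) (use t in auto)
 finally show ?thesis .
qed

lemma ser_sums:
 assumes "square_integrable_on \<mu> f" "0 < t"
 shows "(\<lambda>n. lam n * exp (- lam n * t) * (c n x * mu.coef f n)) sums ser x t f"
 unfolding ser_def by (rule summable_sums[OF summable_rabs_cancel[OF ser_summable[OF assms]]])

lemma ser_le:
 assumes "square_integrable_on \<mu> f" "0 < t"
 shows "\<bar>ser x t f\<bar> \<le> 1 / t * (sqrt (4 * pot0 \<alpha> x * \<kappa>) * sqrt (\<integral>y. (f y)\<^sup>2 \<partial>\<mu>))"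
proof (rule LIMSEQ_le_const2)
 show "(\<lambda>N. \<bar>\<Sum>n<N. lam n * exp (- lam n * t) * (c n x * mu.coef f n)\<bar>) \<longlonglongrightarrow> \<bar>ser x t f\<bar>"
  using ser_sums[OF assms, of x] unfolding sums_def by (rule tendsto_rabs)
qed (use ser_partial_le[OF assms] in blast)

lemma coef_lincomb:
 assumes "square_integrable_on \<mu> f" "square_integrable_on \<mu> h"
 shows "mu.coef (\<lambda>y. f y + a * h y) n = mu.coef f n + a * mu.coef h n"
proof -
 have "(\<integral>y. (f y + a * h y) * \<psi> n y \<partial>\<mu>) = (\<integral>y. f y * \<psi> n y + a * (h y * \<psi> n y) \<partial>\<mu>)" by (simp add: algebra_simps)
 then show ?thesis unfolding mu.coef_def using assms[THEN square_integrable_mult[OF _ mu.sq]] by simp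
qed

lemma ser_lincomb:
 assumes f: "square_integrable_on \<mu> f" and h: "square_integrable_on \<mu> h" and t: "0 < t"
 shows "ser x t (\<lambda>y. f y + a * h y) = ser x t f + a * ser x t h"
proof -
 have "(\<lambda>n. lam n * exp (- lam n * t) * (c n x * mu.coef f n) + a * (lam n * exp (- lam n * t) * (c n x * mu.coef h n))) sums (ser x t f + a * ser x t h)"
  by (intro sums_add sums_mult ser_sums f h t)
 moreover have "(\<lambda>n. lam n * exp (- lam n * t) * (c n x * mu.coef f n) + a * (lam n * exp (- lam n * t) * (c n x * mu.coef h n)))
   = (\<lambda>n. lam n * exp (- lam n * t) * (c n x * mu.coef (\<lambda>y. f y + a * h y) n))"
  unfolding coef_lincomb[OF f h] by (simp add: algebra_simps)
 ultimately show ?thesis unfolding ser_def by (simp add: sums_iff)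
qed

text \<open>Both sides are right-continuous in \<open>t\<close> and have Laplace transform
  \<open>rs \<beta> f x\<close>: the law by \<open>law_Laplace\<close>, the series by
  \<open>dirichlet_series_laplace\<close> together with \<open>rs_sums\<close>. Continuity of
  \<open>f\<close> provides right-continuity of the law side.\<close>

lemma law_eq_ser_continuous:
 assumes x: "x \<noteq> 0" and t: "0 < t" and fc: "continuous_on UNIV f" and f0: "\<And>y. 0 \<le> f y" and f1: "\<And>y. f y \<le> 1"
 shows "(\<integral>y. f y \<partial>law t x) = ser x t f"
proof -
 have f[measurable]: "f \<in> borel_measurable borel" by (rule borel_measurable_continuous_onI[OF fc])
 have fA: "\<bar>f y\<bar> \<le> 1" for y using f0[of y] f1[of y] by simp
 note fsq = bounded_sq[OF f fA]
 define p where "p t = (\<integral>y. f y \<partial>law t x)" for t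
 have fi: "integrable (law t x) f" for t
 proof -
  interpret l: finite_measure "law t x" by (rule finite_measure_law)
  show ?thesis by (rule l.integrable_const_bound[of _ 1]) (use fA in auto)
 qed
 have p0: "0 \<le> p t" for t unfolding p_def by (rule integral_nonneg_AE) (simp add: f0)
 have p_enn: "ennreal (p t) = (\<integral>\<^sup>+y. ennreal (f y) \<partial>law t x)" for t
  unfolding p_def by (rule nn_integral_eq_integral[symmetric]) (use fi f0 in auto)
 have pm[measurable]: "p \<in> borel_measurable borel"
 proof -
  have "p = (\<lambda>t. enn2real (\<integral>\<^sup>+y. ennreal (f y) \<partial>law t x))" using p0 by (intro ext) (simp add: p_enn[symmetric])
  moreover have "(\<lambda>t. enn2real (\<integral>\<^sup>+y. ennreal (f y) \<partial>law t x)) \<in> borel_measurable borel" by measurable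
  ultimately show ?thesis by simp
 qed
 have P: "has_bochner_integral lborel (\<lambda>t. indicator {0<..} t * (exp (- \<beta> * t) * p t)) (rs \<beta> f x)" if \<beta>: "0 \<le> \<beta>" for \<beta>
 proof (rule has_bochner_integral_nn_integral)
  have "(\<integral>\<^sup>+t. ennreal (indicator {0<..} t * (exp (- \<beta> * t) * p t)) \<partial>lborel) = (\<integral>\<^sup>+t\<in>{0..}. ennreal (exp (- \<beta> * t)) * (\<integral>\<^sup>+y. ennreal (f y) \<partial>law t x) \<partial>lborel)"
  proof (rule nn_integral_cong_AE, rule AE_mp[OF AE_lborel_singleton[of 0]], intro AE_I2 impI)
   fix t :: real assume "t \<noteq> 0"
   then show "ennreal (indicator {0<..} t * (exp (- \<beta> * t) * p t)) = ennreal (exp (- \<beta> * t)) * (\<integral>\<^sup>+y. ennreal (f y) \<partial>law t x) * indicator {0..} t"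
    unfolding p_enn[symmetric] using p0 by (auto simp: indicator_def ennreal_mult)
  qed
  also have "\<dots> = res \<beta> (\<lambda>y. ennreal (f y)) x" by (rule law_Laplace[OF x]) measurable
  finally show "(\<integral>\<^sup>+t. ennreal (indicator {0<..} t * (exp (- \<beta> * t) * p t)) \<partial>lborel) = ennreal (rs \<beta> f x)"
   using ennreal_rs[OF f f0 f1 \<beta>] by simp
 qed (use p0 rs_nonneg[OF f f0 f1 \<beta>] in auto)
 have S: "has_bochner_integral lborel (\<lambda>t. indicator {0<..} t * (exp (- \<beta> * t) * ser x t f)) (rs \<beta> f x)" if \<beta>: "0 \<le> \<beta>" for \<beta>
  using dirichlet_series_laplace[where lam=lam, OF coef_g_summable[OF fsq, of x] lam_pos \<beta>] rs_sums[OF f f0 f1 \<beta>, of x]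
  unfolding ser_def by (simp only: sums_iff)
 define F where "F t = p t - ser x t f" for t
 have D: "has_bochner_integral lborel (\<lambda>t. indicator {0<..} t * (exp (- \<beta> * t) * F t)) 0" if \<beta>: "0 \<le> \<beta>" for \<beta>
 proof -
  have "has_bochner_integral lborel (\<lambda>t. indicator {0<..} t * (exp (- \<beta> * t) * p t) - indicator {0<..} t * (exp (- \<beta> * t) * ser x t f)) (rs \<beta> f x - rs \<beta> f x)"
   by (intro has_bochner_integral_diff P S \<beta>)
  then show ?thesis unfolding F_def by (simp add: algebra_simps)
 qed
 have "F t = 0"
 proof (rule laplace_uniqueness[OF _ _ _ t])
  show "integrable lborel (\<lambda>t. indicator {0<..} t * F t)" using D[of 0] by (simp add: has_bochner_integral_iff)
  show "(\<integral>t. indicator {0<..} t * (exp (- real k * t) * F t) \<partial>lborel) = 0" for k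
   using D[of "real k"] by (simp add: has_bochner_integral_iff)
  have "isCont (\<lambda>t. ser x t f) t"
   unfolding ser_def by (rule dirichlet_series_continuous[OF coef_g_summable[OF fsq] lam_pos t])
  then have "continuous (at_right t) (\<lambda>t. ser x t f)" by (rule continuous_at_imp_continuous_at_within)
  moreover have "continuous (at_right t) p" unfolding p_def[abs_def] by (rule law_right_continuous[OF x _ fc fA]) (use t in simp)
  ultimately show "continuous (at_right t) F" unfolding F_def[abs_def] by (rule continuous_diff[rotated])
 qed
 then show ?thesis unfolding F_def p_def by simp
qed

text \<open>Extension from continuous functions by \<open>bounded_borel_induct\<close>. The series
  passes to bounded limits because \<open>ser_le\<close> controls it by the L2 norm.\<close>

theorem law_eq_ser:
 assumes x: "x \<noteq> 0" and t: "0 < t" and f: "f \<in> borel_measurable borel" and B: "\<And>y. \<bar>f y\<bar> \<le> B"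
 shows "(\<integral>y. f y \<partial>law t x) = ser x t f"
proof -
 interpret l: finite_measure "law t x" by (rule finite_measure_law)
 have li: "integrable (law t x) h" if "h \<in> borel_measurable borel" "\<And>y. \<bar>h y\<bar> \<le> C" for h and C :: real
  by (rule l.integrable_const_bound[of _ C]) (use that in auto)
 define P where "P h \<longleftrightarrow> h \<in> borel_measurable borel \<and> (\<exists>C. \<forall>y. \<bar>h y\<bar> \<le> C) \<and> (\<integral>y. h y \<partial>law t x) = ser x t h" for h
 have "P f"
 proof (rule bounded_borel_induct[OF _ _ _ f B])
  fix h :: "real \<Rightarrow> real" assume h: "continuous_on UNIV h" "\<And>y. 0 \<le> h y" "\<And>y. h y \<le> 1"
  then have "\<exists>C. \<forall>y. \<bar>h y\<bar> \<le> C" by (intro exI[of _ 1]) (simp add: abs_le_iff order_trans[OF _ h(2)])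
  then show "P h" unfolding P_def
   using borel_measurable_continuous_onI[OF h(1)] law_eq_ser_continuous[OF x t h] by blast
 next
  fix a :: real and h k :: "real \<Rightarrow> real" assume hk: "P h" "P k"
  then obtain C D where C: "\<And>y. \<bar>h y\<bar> \<le> C" and D: "\<And>y. \<bar>k y\<bar> \<le> D" unfolding P_def by blast
  have m[measurable]: "h \<in> borel_measurable borel" "k \<in> borel_measurable borel" using hk by (simp_all add: P_def)
  have "\<bar>h y + a * k y\<bar> \<le> C + \<bar>a\<bar> * D" for y
   using abs_triangle_ineq[of "h y" "a * k y"] C[of y] mult_left_mono[OF D[of y], of "\<bar>a\<bar>"] by (simp add: abs_mult)
  then have "\<exists>C. \<forall>y. \<bar>h y + a * k y\<bar> \<le> C" by blast
  moreover have "(\<integral>y. h y + a * k y \<partial>law t x) = ser x t (\<lambda>y. h y + a * k y)"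
   using ser_lincomb[OF bounded_sq[OF m(1) C] bounded_sq[OF m(2) D] t, of x a] li[OF m(1) C] li[OF m(2) D] hk by (simp add: P_def)
  ultimately show "P (\<lambda>y. h y + a * k y)" unfolding P_def by (intro conjI) auto
 next
  fix u :: "nat \<Rightarrow> real \<Rightarrow> real" and h C
  assume u: "\<And>k. P (u k)" "\<And>k y. \<bar>u k y\<bar> \<le> C" "\<And>y. (\<lambda>k. u k y) \<longlonglongrightarrow> h y"
  have um[measurable]: "u k \<in> borel_measurable borel" for k using u(1) by (simp add: P_def)
  have hm[measurable]: "h \<in> borel_measurable borel" by (rule borel_measurable_LIMSEQ_real[OF u(3) um])
  have hC: "\<bar>h y\<bar> \<le> C" for y by (rule LIMSEQ_le_const2[OF tendsto_rabs[OF u(3)]]) (use u(2) in blast)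
  have "(\<lambda>k. \<integral>y. u k y \<partial>law t x) \<longlonglongrightarrow> (\<integral>y. h y \<partial>law t x)"
   by (rule integral_dominated_convergence[where w="\<lambda>_. C"]) (use u in auto)
  moreover have "(\<lambda>k. \<integral>y. u k y \<partial>law t x) \<longlonglongrightarrow> ser x t h"
  proof -
   have d: "square_integrable_on \<mu> (\<lambda>y. u k y + (-1) * h y)" for k
   proof (rule bounded_sq[where B="2 * C"])
    show "\<bar>u k y + (-1) * h y\<bar> \<le> 2 * C" for y using u(2)[of k y] hC[of y] by simp
   qed measurable
   have "(\<lambda>k. \<integral>y. (u k y + (-1) * h y)\<^sup>2 \<partial>\<mu>) \<longlonglongrightarrow> (\<integral>y. 0 \<partial>\<mu>)"
   proof (rule integral_dominated_convergence[where w="\<lambda>_. (2 * C)\<^sup>2"])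
    show "AE y in \<mu>. norm ((u k y + (-1) * h y)\<^sup>2) \<le> (2 * C)\<^sup>2" for k
    proof (intro AE_I2)
     fix y
     have "\<bar>u k y + (-1) * h y\<bar> \<le> \<bar>2 * C\<bar>" using u(2)[of k y] hC[of y] by simp
     then have "(u k y + (-1) * h y)\<^sup>2 \<le> (2 * C)\<^sup>2" by (rule abs_le_square_iff[THEN iffD1])
     then show "norm ((u k y + (-1) * h y)\<^sup>2) \<le> (2 * C)\<^sup>2" by simp
    qed
    show "AE y in \<mu>. (\<lambda>k. (u k y + (-1) * h y)\<^sup>2) \<longlonglongrightarrow> 0"
    proof (intro AE_I2)
     fix y
     have "(\<lambda>k. (u k y + (-1) * h y)\<^sup>2) \<longlonglongrightarrow> (h y + (-1) * h y)\<^sup>2" by (intro tendsto_intros u(3))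
     then show "(\<lambda>k. (u k y + (-1) * h y)\<^sup>2) \<longlonglongrightarrow> 0" by simp
    qed
   qed auto
   then have "(\<lambda>k. 1 / t * (sqrt (4 * pot0 \<alpha> x * \<kappa>) * sqrt (\<integral>y. (u k y + (-1) * h y)\<^sup>2 \<partial>\<mu>))) \<longlonglongrightarrow> 1 / t * (sqrt (4 * pot0 \<alpha> x * \<kappa>) * sqrt (\<integral>y. 0 \<partial>\<mu>))"
    by (intro tendsto_intros)
   then have z: "(\<lambda>k. 1 / t * (sqrt (4 * pot0 \<alpha> x * \<kappa>) * sqrt (\<integral>y. (u k y + (-1) * h y)\<^sup>2 \<partial>\<mu>))) \<longlonglongrightarrow> 0" by simp
   have "(\<lambda>k. ser x t (\<lambda>y. u k y + (-1) * h y)) \<longlonglongrightarrow> 0"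
    by (rule Lim_null_comparison[OF _ z]) (use ser_le[OF d t] in auto)
   moreover have "ser x t (\<lambda>y. u k y + (-1) * h y) = (\<integral>y. u k y \<partial>law t x) - ser x t h" for k
    using ser_lincomb[OF bounded_sq[OF um u(2)] bounded_sq[OF hm hC] t, where x=x and a="-1"] u(1)[of k] by (simp add: P_def)
   ultimately show ?thesis by (simp add: LIM_zero_iff)
  qed
  ultimately have "(\<integral>y. h y \<partial>law t x) = ser x t h" by (rule LIMSEQ_unique)
  then show "P h" unfolding P_def using hC by auto
 qed
 then show ?thesis by (simp add: P_def)
qed

end

section \<open>Convergence to the ground state\<close>

lemma (in prob_space) integral_pos_AE:
 fixes f :: "'a \<Rightarrow> real"
 assumes i: "integrable M f" and pos: "AE x in M. 0 < f x"
 shows "0 < (\<integral>x. f x \<partial>M)"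
proof -
 have "(\<integral>x. f x \<partial>M) \<noteq> 0"
 proof
  assume "(\<integral>x. f x \<partial>M) = 0"
  then have "AE x in M. f x = 0" using i pos by (subst integral_nonneg_eq_0_iff_AE[symmetric]) (auto elim: eventually_mono)
  then have "AE x in M. False" using pos by eventually_elim simp
  then show False by simp
 qed
 moreover have "0 \<le> (\<integral>x. f x \<partial>M)" by (rule integral_nonneg_AE) (use pos in eventually_elim, simp)
 ultimately show ?thesis by simp
qed

context killed_spectrum
begin

definition Z :: real where "Z = (\<integral>y. \<psi> 0 y \<partial>\<mu>)"

lemma psi_integrable: "integrable \<mu> (\<psi> n)"
 by (rule square_integrable_on_imp_integrable[OF mu.finite_measure_axioms mu.sq])

lemma AE_ground_pos: "AE y in \<mu>. 0 < \<psi> 0 y"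
 using AE_mu_nonzero by eventually_elim (rule ground_pos)

lemma Z_pos: "0 < Z" unfolding Z_def by (rule mu.integral_pos_AE[OF psi_integrable AE_ground_pos])

lemma c0_pos: assumes x: "x \<noteq> 0" shows "0 < c 0 x"
 unfolding c_def
proof (rule mu.integral_pos_AE[OF g_integrable[OF mu.sq]])
 show "AE y in \<mu>. 0 < g x y * \<psi> 0 y"
  using AE_mu_nonzero by eventually_elim (use x ground_pos grn_pos[OF \<alpha>] in auto)
qed

lemma coef_0_le: assumes [measurable]: "f \<in> borel_measurable borel" and f1: "\<And>y. \<bar>f y\<bar> \<le> 1" shows "\<bar>mu.coef f 0\<bar> \<le> Z"
proof -
 have "\<bar>mu.coef f 0\<bar> \<le> (\<integral>y. \<bar>f y * \<psi> 0 y\<bar> \<partial>\<mu>)" unfolding mu.coef_def by (rule integral_abs_bound)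
 also have "\<dots> \<le> (\<integral>y. \<psi> 0 y \<partial>\<mu>)"
 proof (rule integral_mono_AE)
  show "AE y in \<mu>. \<bar>f y * \<psi> 0 y\<bar> \<le> \<psi> 0 y"
   using AE_ground_pos
  proof eventually_elim
   case (elim y)
   then show ?case using mult_right_mono[OF f1[of y], of "\<psi> 0 y"] by (simp add: abs_mult)
  qed
  show "integrable \<mu> (\<lambda>y. \<bar>f y * \<psi> 0 y\<bar>)"
   by (intro integrable_abs square_integrable_mult[OF _ mu.sq] bounded_sq[OF _ f1]) measurable
 qed (rule psi_integrable)
 finally show ?thesis unfolding Z_def .
qed

lemma coef_1: "mu.coef (\<lambda>_. 1) 0 = Z" by (simp add: mu.coef_def Z_def)

text \<open>One unit of time pays for the factor \<open>lam n\<close>, since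
  \<open>lam n * exp (- lam n) \<le> 1\<close>; the remaining time \<open>t - 1\<close> decays at
  rate at least \<open>lam 1\<close>. Hence \<open>1 \<le> t\<close> and the constant
  \<open>exp (lam 1)\<close>. What is left is summed by Cauchy--Schwarz, uniformly in
  \<open>f\<close>.\<close>

lemma ground_state_asymptotics:
 assumes x: "x \<noteq> 0" and t: "1 \<le> t" and f[measurable]: "f \<in> borel_measurable borel" and f1: "\<And>y. \<bar>f y\<bar> \<le> 1"
 shows "\<bar>(\<integral>y. f y \<partial>law t x) - lam 0 * exp (- lam 0 * t) * (c 0 x * mu.coef f 0)\<bar> \<le> exp (lam 1) * sqrt (4 * pot0 \<alpha> x * \<kappa>) * exp (- lam 1 * t)"
proof -
 have t0: "0 < t" using t by simp
 note fsq = bounded_sq[OF f f1]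
 let ?T = "\<lambda>n. lam n * exp (- lam n * t) * (c n x * mu.coef f n)"
 let ?K = "exp (lam 1) * exp (- lam 1 * t)"
 have sT: "summable (\<lambda>n. \<bar>?T n\<bar>)" by (rule ser_summable[OF fsq t0])
 have sa: "summable (\<lambda>n. \<bar>c n x * mu.coef f n\<bar>)" by (rule coef_g_summable[OF fsq])
 have le: "\<bar>?T (Suc n)\<bar> \<le> ?K * \<bar>c (Suc n) x * mu.coef f (Suc n)\<bar>" for n
 proof -
  let ?l = "lam (Suc n)"
  have "?l * exp (- ?l * 1) \<le> 1 / 1" by (rule lam_exp_le) simp
  moreover have "exp (- ?l * (t - 1)) \<le> exp (- lam 1 * (t - 1))"
   using mult_right_mono[OF lam_ge1[of "Suc n"], of "t - 1"] t by simp
  ultimately have "(?l * exp (- ?l * 1)) * exp (- ?l * (t - 1)) \<le> 1 * exp (- lam 1 * (t - 1))"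
   using lam_pos[of "Suc n"] by (intro mult_mono) auto
  also have "(?l * exp (- ?l * 1)) * exp (- ?l * (t - 1)) = ?l * exp (- ?l * t)"
   by (simp add: exp_add[symmetric] algebra_simps)
  also have "1 * exp (- lam 1 * (t - 1)) = ?K" by (simp add: exp_add[symmetric] algebra_simps)
  finally have "?l * exp (- ?l * t) * \<bar>c (Suc n) x * mu.coef f (Suc n)\<bar> \<le> ?K * \<bar>c (Suc n) x * mu.coef f (Suc n)\<bar>"
   by (rule mult_right_mono) simp
  then show ?thesis by (simp add: abs_mult abs_of_pos[OF lam_pos])
 qed
 have "(\<integral>y. f y \<partial>law t x) - ?T 0 = (\<Sum>n. ?T (Suc n))"
  unfolding law_eq_ser[OF x t0 f f1] ser_def by (rule suminf_split_head[OF summable_rabs_cancel[OF sT], symmetric])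
 moreover have "\<bar>\<Sum>n. ?T (Suc n)\<bar> \<le> (\<Sum>n. \<bar>?T (Suc n)\<bar>)"
  by (rule summable_rabs) (use sT in \<open>subst summable_Suc_iff\<close>)
 moreover have "(\<Sum>n. \<bar>?T (Suc n)\<bar>) \<le> (\<Sum>n. ?K * \<bar>c (Suc n) x * mu.coef f (Suc n)\<bar>)"
  by (intro suminf_le le summable_mult) (use sT sa in \<open>subst summable_Suc_iff, simp\<close>)+
 moreover have "(\<Sum>n. ?K * \<bar>c (Suc n) x * mu.coef f (Suc n)\<bar>) = ?K * (\<Sum>n. \<bar>c (Suc n) x * mu.coef f (Suc n)\<bar>)"
  by (rule suminf_mult) (use sa in \<open>subst summable_Suc_iff\<close>)
 moreover have "(\<Sum>n. \<bar>c (Suc n) x * mu.coef f (Suc n)\<bar>) \<le> (\<Sum>n. \<bar>c n x * mu.coef f n\<bar>)"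
  using suminf_split_head[OF sa] by simp
 moreover have "(\<Sum>n. \<bar>c n x * mu.coef f n\<bar>) \<le> sqrt (4 * pot0 \<alpha> x * \<kappa>) * sqrt (\<integral>y. (f y)\<^sup>2 \<partial>\<mu>)"
  by (rule coef_g_sum_le[OF fsq])
 moreover have "sqrt (4 * pot0 \<alpha> x * \<kappa>) * sqrt (\<integral>y. (f y)\<^sup>2 \<partial>\<mu>) \<le> sqrt (4 * pot0 \<alpha> x * \<kappa>) * 1"
 proof (rule mult_left_mono)
  have "(\<integral>y. (f y)\<^sup>2 \<partial>\<mu>) \<le> (\<integral>y. 1 \<partial>\<mu>)"
   by (rule integral_mono) (use fsq f1 in \<open>auto simp: square_integrable_on_def abs_square_le_1\<close>)
  then show "sqrt (\<integral>y. (f y)\<^sup>2 \<partial>\<mu>) \<le> 1" using mu.prob_space by simp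
 qed (use pot0_nonneg[OF \<alpha>] kappa_nonneg in simp)
 ultimately have "\<bar>(\<integral>y. f y \<partial>law t x) - ?T 0\<bar> \<le> ?K * (\<Sum>n. \<bar>c (Suc n) x * mu.coef f (Suc n)\<bar>)"
  and "(\<Sum>n. \<bar>c (Suc n) x * mu.coef f (Suc n)\<bar>) \<le> sqrt (4 * pot0 \<alpha> x * \<kappa>)" by linarith+
 then have "\<bar>(\<integral>y. f y \<partial>law t x) - ?T 0\<bar> \<le> ?K * sqrt (4 * pot0 \<alpha> x * \<kappa>)"
  by (meson mult_left_mono order_trans less_imp_le mult_pos_pos exp_gt_zero)
 then show ?thesis by (simp add: mult_ac)
qed

text \<open>Numerator and denominator share the leading exponential, which cancels; each relative
  error carries the factor \<open>exp (- (lam 1 - lam 0) * t)\<close>. At small times, where the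
  denominator is not yet controlled, the trivial bound \<open>2\<close> is absorbed into the
  constant.\<close>

theorem conditional_law_bound:
 assumes x: "x \<noteq> 0"
 shows "\<exists>C>0. \<forall>t\<ge>0. \<forall>f. f \<in> borel_measurable borel \<longrightarrow> (\<forall>y. \<bar>f y\<bar> \<le> 1) \<longrightarrow>
  \<bar>(\<integral>y. f y \<partial>law t x) / measure (law t x) UNIV - mu.coef f 0 / Z\<bar> \<le> C * exp (- (lam 1 - lam 0) * t)"
proof -
 define E where "E = exp (lam 1) * sqrt (4 * pot0 \<alpha> x * \<kappa>)"
 define D where "D = lam 0 * c 0 x * Z"
 define \<delta> where "\<delta> = lam 1 - lam 0"
 have E0: "0 \<le> E" unfolding E_def using pot0_nonneg[OF \<alpha>] kappa_nonneg by simp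
 have D0: "0 < D" unfolding D_def using lam0 c0_pos[OF x] Z_pos by simp
 have d0: "0 < \<delta>" unfolding \<delta>_def using lam01 by simp
 have "((\<lambda>t. E * exp (- \<delta> * t)) \<longlongrightarrow> E * 0) at_top"
  using d0 by (intro tendsto_intros filterlim_compose[OF exp_at_bot] filterlim_tendsto_neg_mult_at_bot[OF tendsto_const] filterlim_ident) auto
 then have "\<forall>\<^sub>F t in at_top. E * exp (- \<delta> * t) < D / 2" by (rule order_tendstoD) (use D0 in simp)
 then obtain t1 where t1: "\<And>t. t1 \<le> t \<Longrightarrow> E * exp (- \<delta> * t) < D / 2" unfolding eventually_at_top_linorder by blast
 \<comment> \<open>From \<open>t0\<close> on the error is at most half of the leading term, so the
   denominator is at least the other half. The two summands of \<open>C\<close> serve large and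
   small times.\<close>
 define t0 where "t0 = max 1 t1"
 define C where "C = 4 * E / D + 2 * exp (\<delta> * t0)"
 have Cpos: "0 < C" unfolding C_def using E0 D0 by (intro add_nonneg_pos) auto
 show ?thesis
 proof (intro exI[of _ C] conjI allI impI Cpos)
  fix t :: real and f :: "real \<Rightarrow> real"
  assume t: "0 \<le> t" and f[measurable]: "f \<in> borel_measurable borel" and "\<forall>y. \<bar>f y\<bar> \<le> 1"
  then have f1: "\<bar>f y\<bar> \<le> 1" for y by blast
  interpret l: finite_measure "law t x" by (rule finite_measure_law)
  define a where "a = (\<integral>y. f y \<partial>law t x)"
  define s where "s = measure (law t x) UNIV"
  define b where "b = mu.coef f 0"
  have bZ: "\<bar>b\<bar> \<le> Z" unfolding b_def by (rule coef_0_le[OF f f1])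
  have s: "s = (\<integral>y. 1 \<partial>law t x)" unfolding s_def by simp
  have s0: "0 \<le> s" unfolding s_def by simp
  have as: "\<bar>a\<bar> \<le> s"
  proof -
   have "\<bar>a\<bar> \<le> (\<integral>y. \<bar>f y\<bar> \<partial>law t x)" unfolding a_def by (rule integral_abs_bound)
   also have "\<dots> \<le> (\<integral>y. 1 \<partial>law t x)"
    by (rule integral_mono) (use f1 in \<open>auto intro!: l.integrable_const_bound[of _ 1]\<close>)
   finally show ?thesis unfolding s .
  qed
  have "\<bar>a / s - b / Z\<bar> \<le> C * exp (- \<delta> * t)" if "t < t0"
  proof -
   \<comment> \<open>Positivity of \<open>s\<close> has not been established at these times; if
     \<open>s = 0\<close>, the quotient is \<open>0\<close> by convention.\<close>
   have "\<bar>a / s\<bar> \<le> 1"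
    unfolding abs_divide abs_of_nonneg[OF s0] divide_le_eq_1 using as s0 by linarith
   moreover have "\<bar>b / Z\<bar> \<le> 1"
    unfolding abs_divide abs_of_pos[OF Z_pos] divide_le_eq_1 using bZ Z_pos by linarith
   ultimately have "\<bar>a / s - b / Z\<bar> \<le> 2" by linarith
   also have "2 \<le> 2 * exp (\<delta> * t0) * exp (- \<delta> * t)"
   proof -
    have "0 \<le> \<delta> * t0 + - \<delta> * t" using that d0 by (simp add: mult_left_mono)
    then have "1 \<le> exp (\<delta> * t0 + - \<delta> * t)" by simp
    then show ?thesis unfolding exp_add by simp
   qed
   also have "\<dots> \<le> C * exp (- \<delta> * t)" unfolding C_def using E0 D0 by (intro mult_right_mono) auto
   finally show ?thesis .
  qed
  moreover have "\<bar>a / s - b / Z\<bar> \<le> C * exp (- \<delta> * t)" if "t0 \<le> t"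
  proof -
   have t1': "1 \<le> t" "t1 \<le> t" using that by (simp_all add: t0_def)
   define k where "k = lam 0 * exp (- lam 0 * t) * c 0 x"
   define e where "e = E * exp (- lam 1 * t)"
   have k0: "0 < k" unfolding k_def using lam0 c0_pos[OF x] by simp
   have e0: "0 \<le> e" unfolding e_def using E0 by simp
   have kZ: "k * Z = D * exp (- lam 0 * t)" unfolding k_def D_def by simp
   have e_eq: "e = E * exp (- \<delta> * t) * exp (- lam 0 * t)"
    unfolding e_def \<delta>_def by (simp add: exp_add[symmetric] algebra_simps)
   have ek: "e \<le> k * Z / 2"
    using mult_right_mono[OF less_imp_le[OF t1[OF t1'(2)]], of "exp (- lam 0 * t)"] unfolding e_eq kZ by simp
   have A: "\<bar>a - k * b\<bar> \<le> e"
    using ground_state_asymptotics[OF x t1'(1) f f1] unfolding a_def k_def b_def e_def E_def by (simp add: mult.assoc)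
   have S: "\<bar>s - k * Z\<bar> \<le> e"
    using ground_state_asymptotics[OF x t1'(1), of "\<lambda>_. 1"] unfolding s k_def e_def E_def coef_1 by (simp add: mult.assoc)
   have sk: "k * Z / 2 \<le> s" using S ek by linarith
   have kZ0: "0 < k * Z" using k0 Z_pos by simp
   then have spos: "0 < s" using sk by linarith
   have "a / s - b / Z = ((a - k * b) * Z - b * (s - k * Z)) / (s * Z)" using spos Z_pos by (simp add: field_simps)
   then have E1: "\<bar>a / s - b / Z\<bar> = \<bar>(a - k * b) * Z - b * (s - k * Z)\<bar> / \<bar>s * Z\<bar>" by (simp only: abs_divide)
   have E2: "\<bar>s * Z\<bar> = s * Z" using spos Z_pos by simp
   have E3: "\<bar>(a - k * b) * Z - b * (s - k * Z)\<bar> \<le> e * Z + Z * e"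
   proof -
    have "\<bar>(a - k * b) * Z\<bar> \<le> e * Z" using mult_right_mono[OF A, of Z] Z_pos by (simp add: abs_mult)
    moreover have "\<bar>b * (s - k * Z)\<bar> \<le> Z * e" unfolding abs_mult using bZ S Z_pos by (intro mult_mono) auto
    ultimately show ?thesis by linarith
   qed
   have "\<bar>a / s - b / Z\<bar> \<le> (e * Z + Z * e) / (s * Z)"
    unfolding E1 E2 by (rule divide_right_mono[OF E3]) (use spos Z_pos in simp)
   also have "\<dots> = 2 * e / s" using Z_pos by (simp add: field_simps)
   also have "\<dots> \<le> 2 * e / (k * Z / 2)" using sk e0 kZ0 by (intro divide_left_mono) (auto simp: spos)
   also have "\<dots> = 4 * E / D * exp (- \<delta> * t)" unfolding kZ e_eq by simp
   also have "\<dots> \<le> C * exp (- \<delta> * t)" unfolding C_def by (intro mult_right_mono) auto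
   finally show ?thesis .
  qed
  ultimately have "\<bar>a / s - b / Z\<bar> \<le> C * exp (- \<delta> * t)" by linarith
  then show "\<bar>(\<integral>y. f y \<partial>law t x) / measure (law t x) UNIV - mu.coef f 0 / Z\<bar> \<le> C * exp (- (lam 1 - lam 0) * t)"
   unfolding a_def s_def b_def \<delta>_def .
 qed
qed

text \<open>For positive \<open>t\<close>, expand the transition probability in its series, replace
  \<open>c n\<close> by \<open>\<psi> n / lam n\<close> almost everywhere, and integrate against
  \<open>\<psi> 0\<close>: orthogonality keeps the term \<open>n = 0\<close>. The partial sums are
  dominated by a multiple of \<open>sqrt (pot0 \<alpha> x)\<close>, whose square is integrable for
  \<open>\<mu>\<close>.\<close>

lemma ground_state_invariant:
 assumes t: "0 \<le> t" and B[measurable]: "B \<in> sets borel"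
 shows "(\<integral>x. measure (law t x) B * \<psi> 0 x \<partial>\<mu>) = exp (- lam 0 * t) * (\<integral>x. indicator B x * \<psi> 0 x \<partial>\<mu>)"
proof (cases "t = 0")
 case True
 have "(\<integral>x. measure (law t x) B * \<psi> 0 x \<partial>\<mu>) = (\<integral>x. indicator B x * \<psi> 0 x \<partial>\<mu>)"
  by (rule integral_cong_AE) (use AE_mu_nonzero in \<open>auto simp: True law_0\<close>)
 then show ?thesis using True by simp
next
 case False
 then have t0: "0 < t" using t by simp
 let ?f = "indicator B :: real \<Rightarrow> real"
 have f: "?f \<in> borel_measurable borel" by measurable
 have f1: "\<bar>?f y\<bar> \<le> 1" for y by simp
 note fsq = bounded_sq[OF f f1]
 let ?S = "\<lambda>N x. \<Sum>n<N. lam n * exp (- lam n * t) * (c n x * mu.coef ?f n)"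
 let ?w = "\<lambda>x. 1 / t * (sqrt (4 * pot0 \<alpha> x * \<kappa>) * sqrt (\<integral>y. (?f y)\<^sup>2 \<partial>\<mu>))"
 have wsq: "square_integrable_on \<mu> (\<lambda>x. \<bar>?w x\<bar>)"
 proof -
  have "(\<lambda>x. (?w x)\<^sup>2) = (\<lambda>x. pot0 \<alpha> x * ((1 / t)\<^sup>2 * 4 * \<kappa> * (\<integral>y. (?f y)\<^sup>2 \<partial>\<mu>)))"
   using pot0_nonneg[OF \<alpha>] kappa_nonneg by (intro ext) (simp add: power_mult_distrib power_divide)
  then have "integrable \<mu> (\<lambda>x. (?w x)\<^sup>2)" using pot0_integrable by simp
  moreover have "(\<lambda>x. \<bar>?w x\<bar>) \<in> borel_measurable \<mu>" by measurable
  ultimately show ?thesis unfolding square_integrable_on_def power2_abs by blast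
 qed
 have psq: "square_integrable_on \<mu> (\<lambda>x. \<bar>\<psi> 0 x\<bar>)" using mu.sq[of 0] unfolding square_integrable_on_def by simp
 have "(\<lambda>N. \<integral>x. ?S N x * \<psi> 0 x \<partial>\<mu>) \<longlonglongrightarrow> (\<integral>x. measure (law t x) B * \<psi> 0 x \<partial>\<mu>)"
 proof (rule integral_dominated_convergence[where w="\<lambda>x. \<bar>?w x\<bar> * \<bar>\<psi> 0 x\<bar>"])
  show "integrable \<mu> (\<lambda>x. \<bar>?w x\<bar> * \<bar>\<psi> 0 x\<bar>)" by (rule square_integrable_mult[OF wsq psq])
  show "AE x in \<mu>. norm (?S N x * \<psi> 0 x) \<le> \<bar>?w x\<bar> * \<bar>\<psi> 0 x\<bar>" for N
  proof (intro AE_I2)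
   fix x
   have "\<bar>?S N x\<bar> \<le> \<bar>?w x\<bar>" using ser_partial_le[OF fsq t0, of x N] by (rule order_trans) (rule abs_ge_self)
   then show "norm (?S N x * \<psi> 0 x) \<le> \<bar>?w x\<bar> * \<bar>\<psi> 0 x\<bar>"
    unfolding real_norm_def abs_mult[of "?S N x"] by (rule mult_right_mono) simp
  qed
  show "AE x in \<mu>. (\<lambda>N. ?S N x * \<psi> 0 x) \<longlonglongrightarrow> measure (law t x) B * \<psi> 0 x"
   using AE_mu_nonzero
  proof eventually_elim
   case (elim x)
   have "measure (law t x) B = ser x t ?f" using law_eq_ser[OF elim t0 f f1] by simp
   moreover have "(\<lambda>N. ?S N x) \<longlonglongrightarrow> ser x t ?f" using ser_sums[OF fsq t0, of x] unfolding sums_def .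
   ultimately show ?case by (intro tendsto_mult tendsto_const) simp
  qed
 qed measurable
 moreover have "(\<integral>x. ?S N x * \<psi> 0 x \<partial>\<mu>) = exp (- lam 0 * t) * mu.coef ?f 0" if "0 < N" for N
 proof -
  have "(\<integral>x. ?S N x * \<psi> 0 x \<partial>\<mu>) = (\<integral>x. (\<Sum>n<N. exp (- lam n * t) * mu.coef ?f n * (\<psi> n x * \<psi> 0 x)) \<partial>\<mu>)"
  proof (rule integral_cong_AE)
   have "AE x in \<mu>. \<forall>n. c n x = \<psi> n x / lam n" unfolding AE_all_countable by (intro allI green_eigen)
   then show "AE x in \<mu>. ?S N x * \<psi> 0 x = (\<Sum>n<N. exp (- lam n * t) * mu.coef ?f n * (\<psi> n x * \<psi> 0 x))"
   proof eventually_elim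
    case (elim x)
    have "lam n * exp (- lam n * t) * (c n x * mu.coef ?f n) * \<psi> 0 x = exp (- lam n * t) * mu.coef ?f n * (\<psi> n x * \<psi> 0 x)" for n
     using elim lam_pos[of n] by simp
    then show ?case unfolding sum_distrib_right by (simp only:)
   qed
  qed measurable
  also have "\<dots> = (\<Sum>n<N. exp (- lam n * t) * mu.coef ?f n * (\<integral>x. \<psi> n x * \<psi> 0 x \<partial>\<mu>))"
   using square_integrable_mult[OF mu.sq mu.sq] by (subst Bochner_Integration.integral_sum) auto
  also have "\<dots> = (\<Sum>n<N. if n = 0 then exp (- lam 0 * t) * mu.coef ?f 0 else 0)"
   by (intro sum.cong) (auto simp: mu.orth)
  also have "\<dots> = exp (- lam 0 * t) * mu.coef ?f 0" using that by (simp add: sum.delta)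
  finally show ?thesis .
 qed
 then have "(\<lambda>N. \<integral>x. ?S N x * \<psi> 0 x \<partial>\<mu>) \<longlonglongrightarrow> exp (- lam 0 * t) * mu.coef ?f 0"
  by (intro tendsto_eventually) (rule eventually_sequentiallyI[of 1], simp)
 ultimately have "(\<integral>x. measure (law t x) B * \<psi> 0 x \<partial>\<mu>) = exp (- lam 0 * t) * mu.coef ?f 0" by (rule LIMSEQ_unique)
 then show ?thesis by (simp add: mu.coef_def)
qed

end

section \<open>Quasi-stationary distributions\<close>

context killed_spectrum
begin

text \<open>Iterating the equation \<open>h = s * G h\<close> trades the growth of \<open>h\<close> for a constant.\<close>

lemma green_fixed_point_bounded:
 assumes h[measurable]: "h \<in> borel_measurable borel" and h0: "\<And>y. 0 \<le> h y" and hi: "integrable \<mu> h"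
  and hC: "\<And>y. h y \<le> C * pot0 \<alpha> y" and s: "0 < s" and fix_eq: "\<And>y. h y = s * (\<integral>x. g y x * h x \<partial>\<mu>)"
 shows "\<exists>A. \<forall>y. h y \<le> A"
proof -
 note p0 = pot0_nonneg[OF \<alpha>]
 \<comment> \<open>The far part of \<open>pot0\<close>, cut at level \<open>R\<close>. Since
   \<open>pot0\<close> is integrable, \<open>R\<close> can be chosen so high that
   \<open>2 * s\<close> times its integral is at most \<open>1 / 2\<close>, the contraction factor
   of the iteration.\<close>
 let ?J = "\<lambda>R x. indicator {x. R < pot0 \<alpha> x} x * pot0 \<alpha> x"
 have Ji: "integrable \<mu> (?J R)" for R
  by (rule Bochner_Integration.integrable_bound[OF pot0_integrable]) (auto simp: indicator_def p0)
 have "(\<lambda>n::nat. \<integral>x. ?J (real n) x \<partial>\<mu>) \<longlonglongrightarrow> (\<integral>x. 0 \<partial>\<mu>)"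
 proof (rule integral_dominated_convergence[where w="pot0 \<alpha>"])
  show "AE x in \<mu>. (\<lambda>n. ?J (real n) x) \<longlonglongrightarrow> 0"
  proof (intro AE_I2)
   fix x
   obtain m :: nat where m: "pot0 \<alpha> x \<le> real m" using real_arch_simple by blast
   show "(\<lambda>n. ?J (real n) x) \<longlonglongrightarrow> 0"
    by (rule tendsto_eventually, rule eventually_sequentiallyI[of m]) (use m in \<open>auto simp: indicator_def\<close>)
  qed
 qed (auto simp: indicator_def p0 intro: pot0_integrable)
 then have "(\<lambda>n::nat. 2 * s * (\<integral>x. ?J (real n) x \<partial>\<mu>)) \<longlonglongrightarrow> 2 * s * 0" by (intro tendsto_intros) simp
 then have "\<forall>\<^sub>F n in sequentially. 2 * s * (\<integral>x. ?J (real n) x \<partial>\<mu>) < 1 / 2" by (rule order_tendstoD) simp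
 then obtain n :: nat where n: "2 * s * (\<integral>x. ?J (real n) x \<partial>\<mu>) < 1 / 2" unfolding eventually_sequentially by blast
 define R where "R = real n"
 define e where "e = (\<integral>x. ?J R x \<partial>\<mu>)"
 have e: "2 * s * e \<le> 1 / 2" using n unfolding e_def R_def by simp
 define H where "H = (\<integral>x. h x \<partial>\<mu>)"
 define A where "A = 2 * s * R * H"
 have A0: "0 \<le> A" unfolding A_def H_def R_def using s h0 by (simp add: integral_nonneg_AE)
 \<comment> \<open>Where \<open>pot0\<close> is at most \<open>R\<close>, the kernel is at most
   \<open>2 * R\<close> and the total mass \<open>H\<close> suffices. Beyond that, the kernel is
   bounded through \<open>x\<close> on the constant part of the bound and through \<open>y\<close>
   on the growing part, so that the small far integral appears in both.\<close>
 have step: "h y \<le> (A + a / 2) + b / 2 * pot0 \<alpha> y" if ab: "0 \<le> a" "0 \<le> b" "\<And>x. h x \<le> a + b * pot0 \<alpha> x" for a b y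
 proof -
  let ?m = "\<lambda>x. 2 * R * h x + (2 * a + 2 * b * pot0 \<alpha> y) * ?J R x"
  have le: "g y x * h x \<le> ?m x" for x
  proof (cases "R < pot0 \<alpha> x")
   case True
   have "g y x * h x \<le> g y x * (a + b * pot0 \<alpha> x)" by (rule mult_left_mono[OF ab(3) g_nonneg])
   also have "\<dots> = g y x * a + g y x * (b * pot0 \<alpha> x)" by (simp add: distrib_left)
   also have "\<dots> \<le> 2 * pot0 \<alpha> x * a + 2 * pot0 \<alpha> y * (b * pot0 \<alpha> x)"
    using ab p0 by (intro add_mono mult_right_mono grn_le_right[OF \<alpha>] grn_le_left[OF \<alpha>]) auto
   also have "\<dots> = (2 * a + 2 * b * pot0 \<alpha> y) * ?J R x" using True by (simp add: algebra_simps)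
   also have "\<dots> \<le> ?m x" using h0[of x] by (simp add: R_def)
   finally show ?thesis .
  next
   case False
   then have "g y x \<le> 2 * R" using grn_le_right[OF \<alpha>, of y x] by linarith
   then show ?thesis using mult_right_mono[OF _ h0[of x]] False by simp
  qed
  have mi: "integrable \<mu> ?m" by (intro Bochner_Integration.integrable_add integrable_mult_right hi Ji)
  have gi: "integrable \<mu> (\<lambda>x. g y x * h x)"
   by (rule Bochner_Integration.integrable_bound[OF mi]) (use le g_nonneg h0 in \<open>auto intro!: AE_I2 order_trans[OF _ abs_ge_self] simp: abs_mult\<close>)
  have "(\<integral>x. g y x * h x \<partial>\<mu>) \<le> (\<integral>x. ?m x \<partial>\<mu>)" by (rule integral_mono[OF gi mi le])
  also have "\<dots> = 2 * R * H + (2 * a + 2 * b * pot0 \<alpha> y) * e"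
   unfolding H_def e_def using hi Ji by simp
  finally have "h y \<le> s * (2 * R * H + (2 * a + 2 * b * pot0 \<alpha> y) * e)"
   unfolding fix_eq[of y] using s by (intro mult_left_mono) auto
  also have "\<dots> = A + (a + b * pot0 \<alpha> y) * (2 * s * e)" unfolding A_def by (simp add: algebra_simps)
  also have "\<dots> \<le> A + (a + b * pot0 \<alpha> y) * (1 / 2)"
   using ab p0 e by (intro add_left_mono mult_left_mono) auto
  finally show ?thesis by (simp add: algebra_simps)
 qed
 have C0: "0 \<le> C * pot0 \<alpha> 1" using hC[of 1] h0[of 1] by simp
 then have C0: "0 \<le> C" using pot0_one_pos[OF \<alpha>] by (simp add: zero_le_mult_iff)
 \<comment> \<open>The constant \<open>2 * A\<close> reproduces itself, as
   \<open>A + 2 * A / 2 = 2 * A\<close>, while the coefficient of \<open>pot0\<close>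
   halves.\<close>
 have it: "\<forall>y. h y \<le> 2 * A + C * (1/2)^k * pot0 \<alpha> y" for k
 proof (induction k)
  case 0
  show ?case using A0 by (auto intro!: order_trans[OF hC])
 next
  case (Suc k)
  have "h y \<le> (A + 2 * A / 2) + C * (1/2)^k / 2 * pot0 \<alpha> y" for y
   by (rule step) (use A0 C0 Suc in auto)
  then show ?case by simp
 qed
 have "h y \<le> 2 * A" for y
 proof (rule LIMSEQ_le_const)
  have "(\<lambda>k. 2 * A + C * (1/2)^k * pot0 \<alpha> y) \<longlonglongrightarrow> 2 * A + C * 0 * pot0 \<alpha> y"
   by (intro tendsto_intros LIMSEQ_realpow_zero) auto
  then show "(\<lambda>k. 2 * A + C * (1/2)^k * pot0 \<alpha> y) \<longlonglongrightarrow> 2 * A" by simp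
 qed (use it in blast)
 then show ?thesis by blast
qed

text \<open>Quasi-stationarity says that the law at time \<open>t\<close> maps \<open>\<eta>\<close>
  to \<open>S t\<close> times \<open>\<eta>\<close>. Integrated over time, the Green operator maps
  \<open>\<eta>\<close> to \<open>sb\<close> times \<open>\<eta>\<close>, where \<open>sb\<close> is
  the mean lifetime, finite by the bound on \<open>g\<close>. The Green operator has a kernel with
  respect to \<open>\<mu>\<close>, which gives the density, with \<open>s = 1 / sb\<close>.\<close>

lemma quasi_stationary_density:
 assumes "prob_space \<eta>" and sets_eta[measurable_cong]: "sets \<eta> = sets borel" and nz: "AE x in \<eta>. x \<noteq> 0"
  and qs: "\<And>t B. 0 \<le> t \<Longrightarrow> B \<in> sets borel \<Longrightarrow>
   (\<integral>x. measure (law t x) B \<partial>\<eta>) / (\<integral>x. measure (law t x) UNIV \<partial>\<eta>) = measure \<eta> B"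
 shows "\<exists>s>0. (\<lambda>y. s * (\<integral>x. g x y \<partial>\<eta>)) \<in> borel_measurable borel \<and> \<eta> = density \<mu> (\<lambda>y. ennreal (s * (\<integral>x. g x y \<partial>\<eta>)))"
proof -
 interpret E: prob_space \<eta> by fact
 interpret EL: pair_sigma_finite \<eta> lborel ..
 interpret EM: pair_sigma_finite \<eta> \<mu> ..
 have space_eta[simp]: "space \<eta> = UNIV" using sets_eq_imp_space_eq[OF sets_eta] by simp
 define S where "S t = (\<integral>\<^sup>+x. emeasure (law t x) UNIV \<partial>\<eta>)" for t
 have em[measurable]: "(\<lambda>z. emeasure (law (a z) (b z)) B) \<in> borel_measurable N"
  if "B \<in> sets borel" "a \<in> borel_measurable N" "b \<in> borel_measurable N" for B a b and N :: "'c measure"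
  using nn_integral_law_measurable[OF borel_measurable_indicator[OF that(1)] that(2,3)] that(1) by simp
 have real: "(\<integral>\<^sup>+x. emeasure (law t x) B \<partial>\<eta>) = ennreal (\<integral>x. measure (law t x) B \<partial>\<eta>)" if B: "B \<in> sets borel" for t B
 proof -
  have "integrable \<eta> (\<lambda>x. measure (law t x) B)"
   by (rule E.integrable_const_bound[of _ 1]) (use measure_law_le_1 B in auto)
  then have "(\<integral>\<^sup>+x. ennreal (measure (law t x) B) \<partial>\<eta>) = ennreal (\<integral>x. measure (law t x) B \<partial>\<eta>)"
   by (rule nn_integral_eq_integral) simp
  then show ?thesis using finite_measure.emeasure_eq_measure[OF finite_measure_law] by simp
 qed
 have realU: "(\<integral>\<^sup>+x. emeasure (law t x) UNIV \<partial>\<eta>) = ennreal (\<integral>x. measure (law t x) UNIV \<partial>\<eta>)" for t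
  by (rule real) simp
 have eqn: "(\<integral>\<^sup>+x. emeasure (law t x) B \<partial>\<eta>) = S t * emeasure \<eta> B" and Spos: "S t \<noteq> 0"
  if t: "0 \<le> t" and B: "B \<in> sets borel" for t B
 proof -
  let ?s = "\<integral>x. measure (law t x) UNIV \<partial>\<eta>"
  \<comment> \<open>Division by zero would give \<open>0\<close> instead of \<open>1\<close>, so the
    normalised equation itself rules out a vanishing survival probability.\<close>
  have "?s / ?s = 1" using qs[OF t, of UNIV] E.prob_space by simp
  then have s0: "?s \<noteq> 0" by auto
  have s1: "0 \<le> ?s" by (rule integral_nonneg_AE) simp
  show "S t \<noteq> 0" unfolding S_def realU using s0 s1 by simp
  have "(\<integral>x. measure (law t x) B \<partial>\<eta>) = ?s * measure \<eta> B" using qs[OF t B] s0 by (simp add: field_simps)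
  then show "(\<integral>\<^sup>+x. emeasure (law t x) B \<partial>\<eta>) = S t * emeasure \<eta> B"
   unfolding S_def real[OF B] realU E.emeasure_eq_measure using s1 by (simp add: ennreal_mult)
 qed
 define sb where "sb = (\<integral>\<^sup>+t\<in>{0..}. S t \<partial>lborel)"
 have Sm[measurable]: "S \<in> borel_measurable borel" unfolding S_def[abs_def] by measurable
 let ?k = "\<lambda>y. \<integral>\<^sup>+x. ennreal (g x y) \<partial>\<eta>"
 have K: "sb * emeasure \<eta> B = (\<integral>\<^sup>+y. indicator B y * ?k y \<partial>\<mu>)" if B[measurable]: "B \<in> sets borel" for B
 proof -
  have "sb * emeasure \<eta> B = (\<integral>\<^sup>+t. (S t * indicator {0..} t) * emeasure \<eta> B \<partial>lborel)"
   unfolding sb_def by (rule nn_integral_multc[symmetric]) measurable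
  also have "\<dots> = (\<integral>\<^sup>+t. (\<integral>\<^sup>+x. emeasure (law t x) B * indicator {0..} t \<partial>\<eta>) \<partial>lborel)"
  proof (rule nn_integral_cong)
   fix t :: real
   show "(S t * indicator {0..} t) * emeasure \<eta> B = (\<integral>\<^sup>+x. emeasure (law t x) B * indicator {0..} t \<partial>\<eta>)"
    using eqn(1)[OF _ B, of t] by (cases "0 \<le> t") auto
  qed
  also have "\<dots> = (\<integral>\<^sup>+x. (\<integral>\<^sup>+t. emeasure (law t x) B * indicator {0..} t \<partial>lborel) \<partial>\<eta>)"
   by (rule EL.Fubini') measurable
  also have "\<dots> = (\<integral>\<^sup>+x. (\<integral>\<^sup>+y. indicator B y * ennreal (g x y) \<partial>\<mu>) \<partial>\<eta>)"
  proof (rule nn_integral_cong_AE)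
   show "AE x in \<eta>. (\<integral>\<^sup>+t. emeasure (law t x) B * indicator {0..} t \<partial>lborel) = (\<integral>\<^sup>+y. indicator B y * ennreal (g x y) \<partial>\<mu>)"
    using nz by eventually_elim (use killed_integral_0[of "indicator B"] B in simp)
  qed
  also have "\<dots> = (\<integral>\<^sup>+y. (\<integral>\<^sup>+x. indicator B y * ennreal (g x y) \<partial>\<eta>) \<partial>\<mu>)"
   by (rule EM.Fubini'[symmetric]) measurable
  also have "\<dots> = (\<integral>\<^sup>+y. indicator B y * ?k y \<partial>\<mu>)"
   by (intro nn_integral_cong nn_integral_cmult) measurable
  finally show ?thesis .
 qed
 have gi: "integrable \<eta> (\<lambda>x. g x y)" for y
  by (rule E.integrable_const_bound[of _ "2 * pot0 \<alpha> y"]) (use g_nonneg grn_le_right[OF \<alpha>] in auto)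
 have kr: "?k y = ennreal (\<integral>x. g x y \<partial>\<eta>)" for y
  by (rule nn_integral_eq_integral[OF gi]) (simp add: g_nonneg)
 have g0: "0 \<le> (\<integral>x. g x y \<partial>\<eta>)" for y by (rule integral_nonneg_AE) (simp add: g_nonneg)
 have gm[measurable]: "(\<lambda>y. \<integral>x. g x y \<partial>\<eta>) \<in> borel_measurable borel"
  by (rule E.borel_measurable_lebesgue_integral) measurable
 have sb_fin: "sb \<noteq> \<infinity>"
 proof -
  have "sb = (\<integral>\<^sup>+y. ?k y \<partial>\<mu>)" using K[of UNIV] E.emeasure_space_1 by simp
  also have "\<dots> \<le> (\<integral>\<^sup>+y. 2 * ennreal (pot0 \<alpha> y) \<partial>\<mu>)"
  proof (rule nn_integral_mono)
   fix y
   have "?k y \<le> (\<integral>\<^sup>+x. ennreal (2 * pot0 \<alpha> y) \<partial>\<eta>)" by (intro nn_integral_mono ennreal_leI grn_le_right[OF \<alpha>])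
   then show "?k y \<le> 2 * ennreal (pot0 \<alpha> y)" using E.emeasure_space_1 by (simp add: ennreal_mult pot0_nonneg[OF \<alpha>])
  qed
  also have "\<dots> < \<infinity>" using pot0_finite by (simp add: nn_integral_cmult ennreal_mult_less_top)
  finally show ?thesis by simp
 qed
 have sb_pos: "sb \<noteq> 0"
 proof
  assume "sb = 0"
  then have "AE t in lborel. S t * indicator {0..} t = 0" unfolding sb_def by (subst (asm) nn_integral_0_iff_AE) auto
  then have "AE t::real in lborel. t \<notin> {0..1}" by eventually_elim (use Spos[OF _ sets.top] in \<open>auto simp: indicator_def split: if_splits\<close>)
  then have "emeasure lborel {0..1::real} = 0" by (subst (asm) AE_iff_measurable[of "{0..1}"]) auto
  then show False by simp
 qed
 define s where "s = 1 / enn2real sb"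
 have sbr: "ennreal (enn2real sb) = sb" "0 < enn2real sb"
  using sb_fin sb_pos by (auto simp: less_top enn2real_positive_iff zero_less_iff_neq_zero)
 have s: "0 < s" unfolding s_def using sbr by simp
 have hm: "(\<lambda>y. s * (\<integral>x. g x y \<partial>\<eta>)) \<in> borel_measurable borel" by measurable
 have "\<eta> = density \<mu> (\<lambda>y. ennreal (s * (\<integral>x. g x y \<partial>\<eta>)))"
 proof (rule measure_eqI)
  fix B assume "B \<in> sets \<eta>"
  then have B[measurable]: "B \<in> sets borel" by (simp add: sets_eta)
  have "emeasure \<eta> B = ennreal s * (sb * emeasure \<eta> B)"
  proof -
   have "ennreal s * sb = ennreal s * ennreal (enn2real sb)" by (simp only: sbr(1))
   also have "\<dots> = ennreal (s * enn2real sb)" using s by (simp only: ennreal_mult')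
   also have "s * enn2real sb = 1" unfolding s_def using sbr(2) by simp
   finally have "ennreal s * sb = 1" by simp
   then show ?thesis by (simp add: mult.assoc[symmetric])
  qed
  also have "\<dots> = (\<integral>\<^sup>+y. ennreal s * (indicator B y * ?k y) \<partial>\<mu>)" unfolding K[OF B] by (rule nn_integral_cmult[symmetric]) measurable
  also have "\<dots> = (\<integral>\<^sup>+y. ennreal (s * (\<integral>x. g x y \<partial>\<eta>)) * indicator B y \<partial>\<mu>)"
   unfolding kr using s g0 by (intro nn_integral_cong) (simp add: ennreal_mult mult_ac)
  also have "\<dots> = emeasure (density \<mu> (\<lambda>y. ennreal (s * (\<integral>x. g x y \<partial>\<eta>)))) B" by (rule emeasure_density[symmetric]) auto
  finally show "emeasure \<eta> B = emeasure (density \<mu> (\<lambda>y. ennreal (s * (\<integral>x. g x y \<partial>\<eta>)))) B" .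
 qed (simp add: sets_eta)
 then show ?thesis using s hm by blast
qed

text \<open>Coefficients satisfy \<open>(1 - s / lam n) * mu.coef h n = 0\<close>. Since
  \<open>h\<close> is nonnegative with integral \<open>1\<close> and \<open>\<psi> 0\<close> is
  positive, the coefficient at \<open>0\<close> is nonzero and \<open>s = lam 0\<close>; as
  \<open>lam 0 < lam 1\<close>, all other coefficients vanish.\<close>

theorem quasi_stationary_unique:
 assumes pe: "prob_space \<eta>" and sets_eta[measurable_cong]: "sets \<eta> = sets borel" and nz: "AE x in \<eta>. x \<noteq> 0"
  and qs: "\<And>t B. 0 \<le> t \<Longrightarrow> B \<in> sets borel \<Longrightarrow>
   (\<integral>x. measure (law t x) B \<partial>\<eta>) / (\<integral>x. measure (law t x) UNIV \<partial>\<eta>) = measure \<eta> B"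
  and B: "B \<in> sets borel"
 shows "measure \<eta> B = mu.coef (indicator B) 0 / Z"
proof -
 interpret E: prob_space \<eta> by fact
 have space_eta[simp]: "space \<eta> = UNIV" using sets_eq_imp_space_eq[OF sets_eta] by simp
 obtain s where s: "0 < s" and hm0: "(\<lambda>y. s * (\<integral>x. g x y \<partial>\<eta>)) \<in> borel_measurable borel"
  and dens0: "\<eta> = density \<mu> (\<lambda>y. ennreal (s * (\<integral>x. g x y \<partial>\<eta>)))"
  using quasi_stationary_density[OF pe sets_eta nz qs] by blast
 define h where "h y = s * (\<integral>x. g x y \<partial>\<eta>)" for y
 have hm[measurable]: "h \<in> borel_measurable borel" using hm0 unfolding h_def[abs_def] .
 have dens: "\<eta> = density \<mu> (\<lambda>y. ennreal (h y))" using dens0 unfolding h_def .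
 have gi: "integrable \<eta> (\<lambda>x. g x y)" for y
  by (rule E.integrable_const_bound[of _ "2 * pot0 \<alpha> y"]) (use g_nonneg grn_le_right[OF \<alpha>] in auto)
 have h0: "0 \<le> h y" for y unfolding h_def using s by (intro mult_nonneg_nonneg integral_nonneg_AE) (auto simp: g_nonneg)
 have transfer: "(\<integral>x. f x \<partial>\<eta>) = (\<integral>x. h x * f x \<partial>\<mu>)" if [measurable]: "f \<in> borel_measurable borel" for f :: "real \<Rightarrow> real"
  by (subst dens) (simp add: integral_density h0)
 have hC: "h y \<le> 2 * s * pot0 \<alpha> y" for y
 proof -
  have "(\<integral>x. g x y \<partial>\<eta>) \<le> (\<integral>x. 2 * pot0 \<alpha> y \<partial>\<eta>)" by (rule integral_mono[OF gi]) (use grn_le_right[OF \<alpha>] in auto)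
  then have "(\<integral>x. g x y \<partial>\<eta>) \<le> 2 * pot0 \<alpha> y" using E.prob_space by simp
  then show ?thesis unfolding h_def using mult_left_mono[of "\<integral>x. g x y \<partial>\<eta>" "2 * pot0 \<alpha> y" s] s by simp
 qed
 have hi: "integrable \<mu> h"
  by (rule Bochner_Integration.integrable_bound[where f="\<lambda>y. 2 * s * pot0 \<alpha> y"])
   (use hC h0 pot0_integrable in \<open>auto intro!: AE_I2 order_trans[OF _ abs_ge_self]\<close>)
 have h1: "(\<integral>x. h x \<partial>\<mu>) = 1" using transfer[of "\<lambda>_. 1"] E.prob_space by simp
 have fix_eq: "h y = s * (\<integral>x. g y x * h x \<partial>\<mu>)" for y
  unfolding h_def[of y] by (subst transfer) (simp_all add: g_sym[of _ y] mult.commute)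
 obtain A where A: "\<And>y. h y \<le> A" using green_fixed_point_bounded[OF hm h0 hi hC s fix_eq] by blast
 have hA: "\<bar>h y\<bar> \<le> A" for y using h0[of y] A[of y] by simp
 note hsq = bounded_sq[OF hm hA]
 have co: "mu.coef h n = s * (mu.coef h n / lam n)" for n
 proof -
  have "h = (\<lambda>y. s * (\<integral>x. g y x * h x \<partial>\<mu>))" by (rule ext) (rule fix_eq)
  then have "mu.coef h n = mu.coef (\<lambda>y. s * (\<integral>x. g y x * h x \<partial>\<mu>)) n" by (rule arg_cong)
  also have "\<dots> = s * mu.coef (\<lambda>y. \<integral>x. g y x * h x \<partial>\<mu>) n" unfolding mu.coef_def by (simp add: mult.assoc)
  also have "\<dots> = s * (mu.coef h n / lam n)" by (simp only: coef_green[OF hm hA])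
  finally show ?thesis .
 qed
 have "mu.coef h 0 \<noteq> 0"
 proof
  assume z: "mu.coef h 0 = 0"
  have "integrable \<mu> (\<lambda>x. h x * \<psi> 0 x)" by (rule square_integrable_mult[OF hsq mu.sq])
  moreover have "AE x in \<mu>. 0 \<le> h x * \<psi> 0 x" using AE_ground_pos by eventually_elim (use h0 in auto)
  ultimately have "AE x in \<mu>. h x * \<psi> 0 x = 0"
   using z unfolding mu.coef_def by (subst integral_nonneg_eq_0_iff_AE[symmetric]) auto
  then have "AE x in \<mu>. h x = 0" using AE_ground_pos by eventually_elim auto
  then have "(\<integral>x. h x \<partial>\<mu>) = (\<integral>x. 0 \<partial>\<mu>)" by (intro integral_cong_AE) auto
  then show False using h1 by simp
 qed
 then have s_eq: "s = lam 0" using co[of 0] lam_pos[of 0] by (simp add: field_simps)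
 have zero: "mu.coef h n = 0" if "0 < n" for n
 proof -
  have "lam 0 < lam n" using lam_ge1[OF that] lam01 by simp
  then show ?thesis using co[of n] lam_pos[of n] unfolding s_eq by (simp add: field_simps)
 qed
 have p0sq: "square_integrable_on \<mu> (\<psi> 0)" by (rule mu.sq)
 define b where "b = mu.coef h 0"
 have "AE x in \<mu>. h x + (- b) * \<psi> 0 x = 0"
 proof (rule mu.complete)
  show "square_integrable_on \<mu> (\<lambda>x. h x + (- b) * \<psi> 0 x)"
   using square_integrable_lincomb[OF hsq p0sq, of 1 "- b"] by simp
  show "(\<integral>x. (h x + (- b) * \<psi> 0 x) * \<psi> n x \<partial>\<mu>) = 0" for n
   using coef_lincomb[OF hsq p0sq, of "- b" n] zero[of n] by (cases "n = 0") (auto simp: mu.coef_def mu.orth b_def)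
 qed
 then have h_ae: "AE x in \<mu>. h x = b * \<psi> 0 x" by eventually_elim simp
 have "1 = b * Z"
 proof -
  have "(\<integral>x. h x \<partial>\<mu>) = (\<integral>x. b * \<psi> 0 x \<partial>\<mu>)" by (rule integral_cong_AE) (use h_ae in auto)
  then show ?thesis using h1 by (simp add: Z_def)
 qed
 then have bZ: "b = 1 / Z" using Z_pos by (simp add: field_simps)
 have "measure \<eta> B = (\<integral>x. indicator B x \<partial>\<eta>)" using B by simp
 also have "\<dots> = (\<integral>x. h x * indicator B x \<partial>\<mu>)" using B by (subst transfer) auto
 also have "\<dots> = (\<integral>x. b * (indicator B x * \<psi> 0 x) \<partial>\<mu>)" by (rule integral_cong_AE) (use h_ae B in auto)
 also have "\<dots> = mu.coef (indicator B) 0 / Z" by (simp add: mu.coef_def bZ)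
 finally show ?thesis .
qed

end

section \<open>Versions of the stable process\<close>

text \<open>Independence of finitely many variables says that their joint law is the product of the
  marginals, and laws do not notice null sets.\<close>

lemma (in prob_space) indep_vars_cong_AE_finite:
 assumes iv: "indep_vars M' X I" and fin: "finite I" and Y: "\<And>i. i \<in> I \<Longrightarrow> random_variable (M' i) (Y i)"
  and ae: "\<And>i. i \<in> I \<Longrightarrow> AE w in M. X i w = Y i w"
 shows "indep_vars M' Y I"
proof (cases "I = {}")
 case True
 then show ?thesis by (simp add: indep_vars_def indep_sets_def)
next
 case False
 have X: "random_variable (M' i) (X i)" if "i \<in> I" for i using iv that unfolding indep_vars_def by blast
 have all: "AE w in M. \<forall>i\<in>I. X i w = Y i w" using ae fin by (subst AE_finite_all) auto
 have "distr M (\<Pi>\<^sub>M i\<in>I. M' i) (\<lambda>w. \<lambda>i\<in>I. Y i w) = distr M (\<Pi>\<^sub>M i\<in>I. M' i) (\<lambda>w. \<lambda>i\<in>I. X i w)"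
 proof (rule distr_cong_AE)
  show "AE w in M. (\<lambda>i\<in>I. Y i w) = (\<lambda>i\<in>I. X i w)" using all by eventually_elim (auto simp: restrict_def)
 qed (auto intro!: measurable_restrict X Y)
 also have "\<dots> = (\<Pi>\<^sub>M i\<in>I. distr M (M' i) (X i))"
  using indep_vars_iff_distr_eq_PiM'[OF False X] iv by simp
 also have "\<dots> = (\<Pi>\<^sub>M i\<in>I. distr M (M' i) (Y i))"
 proof (rule PiM_cong[OF refl])
  show "distr M (M' i) (X i) = distr M (M' i) (Y i)" if "i \<in> I" for i
   by (rule distr_cong_AE) (use ae that X Y in auto)
 qed
 finally show ?thesis using indep_vars_iff_distr_eq_PiM'[OF False Y] by simp
qed

text \<open>On a null set containing all bad paths the process is replaced by \<open>0\<close>, and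
  negative times are filled with \<open>0\<close>. Increments over nonnegative times change only on
  that null set, so their laws and independence survive.\<close>

lemma stable_motion_version:
 assumes \<alpha>: "1 < \<alpha>" "\<alpha> < 2" and st: "symmetric_stable_process \<alpha> M X"
 shows "\<exists>X'. stable_motion M \<alpha> X' \<and> (AE w in M. \<forall>t\<ge>0. X t w = X' t w)"
proof -
 interpret prob_space M using st by (simp add: symmetric_stable_process_def)
 have Xm: "X t \<in> borel_measurable M" if "0 \<le> t" for t using st that by (simp add: symmetric_stable_process_def)
 let ?P = "\<lambda>w. X 0 w = 0 \<and> (\<forall>t\<ge>0. continuous (at_right t) (\<lambda>s. X s w)) \<and> (\<forall>t>0. \<exists>l. ((\<lambda>s. X s w) \<longlongrightarrow> l) (at_left t))"
 have "AE w in M. X 0 w = 0" "AE w in M. (\<forall>t\<ge>0. continuous (at_right t) (\<lambda>s. X s w)) \<and> (\<forall>t>0. \<exists>l. ((\<lambda>s. X s w) \<longlongrightarrow> l) (at_left t))"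
  using st unfolding symmetric_stable_process_def by blast+
 then have "AE w in M. ?P w" by eventually_elim blast
 then obtain N where N: "{w\<in>space M. \<not> ?P w} \<subseteq> N" "emeasure M N = 0" "N \<in> sets M" by (rule AE_E)
 define G where "G = space M - N"
 have G[measurable]: "G \<in> sets M" unfolding G_def using N(3) by simp
 have GP: "?P w" if "w \<in> G" for w using that N(1) unfolding G_def by blast
 have AEG: "AE w in M. w \<in> G" unfolding G_def using N(2,3) AE_not_in[of N M] AE_space by (auto simp: null_sets_def)
 define X' where "X' t w = (if 0 < t \<and> w \<in> G then X t w else 0)" for t w
 have eq: "X t w = X' t w" if "w \<in> G" "0 \<le> t" for w t
  using that GP[OF that(1)] by (cases "t = 0") (auto simp: X'_def)
 have ae: "AE w in M. \<forall>t\<ge>0. X t w = X' t w" using AEG by eventually_elim (use eq in blast)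
 have X'm: "X' t \<in> borel_measurable M" for t
 proof (cases "0 < t")
  case True
  then have "X' t = (\<lambda>w. if w \<in> G then X t w else 0)" by (intro ext) (simp add: X'_def)
  then show ?thesis using Xm[of t] True by simp
 next
  case False
  then have "X' t = (\<lambda>_. 0)" by (intro ext) (simp add: X'_def)
  then show ?thesis by simp
 qed
 have "stable_motion M \<alpha> X'"
 proof
  show "1 < \<alpha>" "\<alpha> < 2" by fact+
  show "X' t \<in> borel_measurable M" for t by (rule X'm)
  show "X' t w = 0" if "t \<le> 0" for t w using that by (simp add: X'_def)
  show "cadlag (\<lambda>t. X' t w)" for w
  proof (cases "w \<in> G")
   case False
   then have "(\<lambda>t. X' t w) = (\<lambda>_. 0)" by (intro ext) (simp add: X'_def)
   then show ?thesis unfolding cadlag_def by (auto intro!: exI[of _ 0])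
  next
   case True
   note P = GP[OF True]
   show ?thesis
    unfolding cadlag_def
   proof (intro conjI allI)
    fix t :: real
    show "continuous (at_right t) (\<lambda>t. X' t w)"
    proof (cases "0 \<le> t")
     case t: True
     have "\<forall>\<^sub>F s in at_right t. X s w = X' s w"
      using eventually_at_right_less[of t] by eventually_elim (use t eq[OF True] in auto)
     moreover have "((\<lambda>s. X s w) \<longlongrightarrow> X' t w) (at_right t)"
      using P t unfolding continuous_within eq[OF True t, symmetric] by blast
     ultimately show ?thesis unfolding continuous_within by (simp add: tendsto_cong)
    next
     case False
     have "\<forall>\<^sub>F s in at_right t. X' s w = X' t w"
      unfolding eventually_at_right_field by (intro exI[of _ 0]) (use False in \<open>auto simp: X'_def\<close>)
     then show ?thesis unfolding continuous_within by (rule tendsto_eventually)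
    qed
    show "\<exists>l. ((\<lambda>t. X' t w) \<longlongrightarrow> l) (at_left t)"
    proof (cases "0 < t")
     case t: True
     then obtain l where l: "((\<lambda>s. X s w) \<longlongrightarrow> l) (at_left t)" using P by blast
     have "\<forall>\<^sub>F s in at_left t. X s w = X' s w"
      unfolding eventually_at_left_field by (intro exI[of _ 0]) (use t eq[OF True] in auto)
     then show ?thesis using l by (auto simp: tendsto_cong)
    next
     case False
     have "\<forall>\<^sub>F s in at_left t. X' s w = 0"
      unfolding eventually_at_left_field by (intro exI[of _ "t - 1"]) (use False in \<open>auto simp: X'_def\<close>)
     then show ?thesis by (intro exI) (rule tendsto_eventually)
    qed
   qed
  qed
  have inc: "AE w in M. X t w - X s w = X' t w - X' s w" if "0 \<le> s" "0 \<le> t" for s t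
   using ae by eventually_elim (use that in simp)
  show "indep_vars (\<lambda>_. borel) (\<lambda>i w. X' (ts ! Suc i) w - X' (ts ! i) w) {i. Suc i < length ts}"
   if "sorted ts" "\<forall>t\<in>set ts. 0 \<le> t" for ts
  proof (rule indep_vars_cong_AE_finite)
   show "indep_vars (\<lambda>_. borel) (\<lambda>i w. X (ts ! Suc i) w - X (ts ! i) w) {i. Suc i < length ts}"
    using st that unfolding symmetric_stable_process_def by blast
   show "finite {i. Suc i < length ts}" by (rule finite_subset[of _ "{..<length ts}"]) auto
   show "random_variable borel (\<lambda>w. X' (ts ! Suc i) w - X' (ts ! i) w)" for i using X'm by simp
   show "AE w in M. X (ts ! Suc i) w - X (ts ! i) w = X' (ts ! Suc i) w - X' (ts ! i) w" if "i \<in> {i. Suc i < length ts}" for i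
    by (rule inc) (use that \<open>\<forall>t\<in>set ts. 0 \<le> t\<close> in auto)
  qed
  show "char (distr M borel (\<lambda>w. X' t w - X' s w)) \<theta> = complex_of_real (exp (- (t - s) * \<bar>\<theta>\<bar> powr \<alpha>))"
   if "0 \<le> s" "s \<le> t" for s t \<theta>
  proof -
   have "distr M borel (\<lambda>w. X' t w - X' s w) = distr M borel (\<lambda>w. X t w - X s w)"
    by (rule distr_cong_AE) (use inc[of s t] that X'm Xm in auto)
   then show ?thesis using st that unfolding symmetric_stable_process_def by simp
  qed
 qed
 then show ?thesis using ae by blast
qed

section \<open>Passage between the punctured line and the line\<close>

lemma Omega_sets: "- {0} \<inter> space (speed_measure \<alpha> \<sigma>) \<in> sets (speed_measure \<alpha> \<sigma>)"
 by (simp add: speed_measure_def)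

lemma borel_measurable_borel0:
 fixes f :: "real \<Rightarrow> real"
 assumes "f \<in> borel_measurable borel0"
 shows "(\<lambda>y. indicator (- {0}) y * f y) \<in> borel_measurable borel"
 using assms borel_measurable_restrict_space_iff[of "- {0::real}" borel f] by simp

lemma square_integrable_on_restrict:
 "square_integrable_on (speed_measure0 \<alpha> \<sigma>) f \<longleftrightarrow> square_integrable_on (speed_measure \<alpha> \<sigma>) (\<lambda>y. indicator (- {0}) y * f y)"
proof -
 have "(\<lambda>x. indicator (- {0}) x *\<^sub>R (f x)\<^sup>2) = (\<lambda>x. (indicator (- {0}) x * f x)\<^sup>2)"
  by (intro ext) (simp add: indicator_def)
 then show ?thesis
  unfolding square_integrable_on_def speed_measure0_def borel_measurable_restrict_space_iff[OF Omega_sets]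
   integrable_restrict_space[OF Omega_sets] by simp
qed

lemma integral_speed_measure0:
 fixes f :: "real \<Rightarrow> real"
 shows "(\<integral>x. f x \<partial>speed_measure0 \<alpha> \<sigma>) = (\<integral>x. indicator (- {0}) x * f x \<partial>speed_measure \<alpha> \<sigma>)"
 unfolding speed_measure0_def integral_restrict_space[OF Omega_sets] by simp

context killed_spectrum
begin

definition nu :: "real measure" where
 "nu = restrict_space (density \<mu> (\<lambda>y. ennreal (\<psi> 0 y / Z))) (- {0})"

lemma sets_nu: "sets nu = sets borel0"
 unfolding nu_def by (simp add: sets_restrict_space)

lemma space_nu: "space nu = - {0}"
 unfolding nu_def by (simp add: space_restrict_space)

lemma integral_nu:
 fixes f :: "real \<Rightarrow> real"
 assumes f: "f \<in> borel_measurable borel0"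
 shows "(\<integral>x. f x \<partial>nu) = mu.coef (\<lambda>y. indicator (- {0}) y * f y) 0 / Z"
proof -
 have [measurable]: "(\<lambda>y. indicator (- {0}) y * f y) \<in> borel_measurable borel" by (rule borel_measurable_borel0[OF f])
 have "(\<integral>x. f x \<partial>nu) = (\<integral>y. indicator (- {0}) y * f y \<partial>density \<mu> (\<lambda>y. ennreal (\<psi> 0 y / Z)))"
  unfolding nu_def by (subst integral_restrict_space) auto
 also have "\<dots> = (\<integral>y. \<psi> 0 y / Z * (indicator (- {0}) y * f y) \<partial>\<mu>)"
  by (subst integral_density) (use AE_ground_pos Z_pos in auto)
 also have "\<dots> = (\<integral>y. (indicator (- {0}) y * f y * \<psi> 0 y) / Z \<partial>\<mu>)" by (simp add: mult.commute)
 also have "\<dots> = mu.coef (\<lambda>y. indicator (- {0}) y * f y) 0 / Z" unfolding mu.coef_def by simp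
 finally show ?thesis .
qed

lemma measure_nu: assumes A: "A \<in> sets borel0" shows "measure nu A = mu.coef (indicator A) 0 / Z"
proof -
 have "measure nu A = (\<integral>x. indicator A x \<partial>nu)" using A sets.sets_into_space[of A nu] sets_nu by (simp add: Int_absorb1)
 also have "\<dots> = mu.coef (\<lambda>y. indicator (- {0}) y * indicator A y) 0 / Z" by (rule integral_nu) (use A in simp)
 also have "(\<lambda>y. indicator (- {0}) y * indicator A y) = (indicator A :: real \<Rightarrow> real)"
  using borel0_borel[OF A] by (intro ext) (auto simp: indicator_def)
 finally show ?thesis .
qed


lemma prob_space_nu: "prob_space nu"
proof (rule prob_spaceI)
 have "emeasure nu (space nu) = emeasure (density \<mu> (\<lambda>y. ennreal (\<psi> 0 y / Z))) (- {0})"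
  unfolding space_nu by (subst nu_def) (rule emeasure_restrict_space, auto)
 also have "\<dots> = (\<integral>\<^sup>+y. ennreal (\<psi> 0 y / Z) * indicator (- {0}) y \<partial>\<mu>)" by (subst emeasure_density) auto
 also have "\<dots> = (\<integral>\<^sup>+y. ennreal (\<psi> 0 y / Z) \<partial>\<mu>)" by (rule nn_integral_cong_AE) (use AE_mu_nonzero in auto)
 also have "\<dots> = ennreal (\<integral>y. \<psi> 0 y / Z \<partial>\<mu>)"
  by (rule nn_integral_eq_integral) (use psi_integrable AE_ground_pos Z_pos in \<open>auto elim: eventually_mono\<close>)
 also have "(\<integral>y. \<psi> 0 y / Z \<partial>\<mu>) = 1" using Z_pos by (simp add: Z_def)
 finally show "emeasure nu (space nu) = 1" by simp
qed

context
 fixes X0 :: "real \<Rightarrow> 'w \<Rightarrow> real"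
 assumes X0: "AE w in M. \<forall>t\<ge>0. X0 t w = X t w"
begin

lemma AE_nonzero_borel0: "sets \<eta> = sets borel0 \<Longrightarrow> AE x in \<eta>. x \<noteq> 0"
 by (rule AE_I2) (auto dest: sets_eq_imp_space_eq simp: space_restrict_space)

lemma measurable_borel0: "f \<in> borel_measurable borel \<Longrightarrow> sets \<eta> = sets borel0 \<Longrightarrow> f \<in> borel_measurable \<eta>"
 for f :: "real \<Rightarrow> real"
 by (subst measurable_cong_sets[of \<eta> borel0 borel borel]) (auto intro: measurable_restrict_space1)

lemma integral_killed_transition:
 assumes \<eta>: "sets \<eta> = sets borel0" and t: "0 \<le> t" and A: "A \<in> sets borel"
 shows "(\<integral>x. killed_transition \<alpha> \<sigma> M X0 t x A \<partial>\<eta>) = (\<integral>x. measure (law t x) A \<partial>\<eta>)"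
 by (rule Bochner_Integration.integral_cong[OF refl])
  (use sets_eq_imp_space_eq[OF \<eta>] killed_transition_law[OF X0 _ t A] in \<open>auto simp: space_restrict_space\<close>)

lemma integral_survival_prob:
 assumes \<eta>: "sets \<eta> = sets borel0" and t: "0 \<le> t"
 shows "(\<integral>x. survival_prob \<alpha> \<sigma> M X0 t x \<partial>\<eta>) = (\<integral>x. measure (law t x) UNIV \<partial>\<eta>)"
 by (rule Bochner_Integration.integral_cong[OF refl])
  (use sets_eq_imp_space_eq[OF \<eta>] survival_prob_law[OF X0 _ t] in \<open>auto simp: space_restrict_space\<close>)

lemma integral_law_nu:
 assumes t: "0 \<le> t" and A: "A \<in> sets borel"
 shows "(\<integral>x. measure (law t x) A \<partial>nu) = exp (- lam 0 * t) * mu.coef (indicator A) 0 / Z"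
proof -
 have "(\<integral>x. measure (law t x) A \<partial>nu) = mu.coef (\<lambda>x. indicator (- {0}) x * measure (law t x) A) 0 / Z"
  by (rule integral_nu) (use A in \<open>auto intro!: measurable_restrict_space1\<close>)
 also have "mu.coef (\<lambda>x. indicator (- {0}) x * measure (law t x) A) 0 = (\<integral>x. measure (law t x) A * \<psi> 0 x \<partial>\<mu>)"
  unfolding mu.coef_def by (rule integral_cong_AE) (use AE_mu_nonzero A in auto)
 finally show ?thesis unfolding ground_state_invariant[OF t A] by (simp add: mu.coef_def)
qed

lemma quasi_stationary_nu: "quasi_stationary \<alpha> \<sigma> M X0 nu"
 unfolding quasi_stationary_def
proof (intro conjI allI impI ballI prob_space_nu sets_nu)
 fix t :: real and A assume t: "0 \<le> t" and A: "A \<in> sets borel0"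
 have A': "A \<in> sets borel" using borel0_borel[OF A] by blast
 have "mu.coef (indicator UNIV) 0 = Z" using coef_1 by (simp add: indicator_def)
 then show "(\<integral>x. killed_transition \<alpha> \<sigma> M X0 t x A \<partial>nu) / (\<integral>x. survival_prob \<alpha> \<sigma> M X0 t x \<partial>nu) = measure nu A"
  unfolding integral_killed_transition[OF sets_nu t A'] integral_survival_prob[OF sets_nu t]
   integral_law_nu[OF t A'] integral_law_nu[OF t sets.top[of borel, unfolded space_borel]] measure_nu[OF A]
  using Z_pos by simp
qed

lemma quasi_stationary_eq_nu:
 assumes q: "quasi_stationary \<alpha> \<sigma> M X0 \<eta>"
 shows "\<eta> = nu"
proof -
 have pe: "prob_space \<eta>" and se: "sets \<eta> = sets borel0"
  and eq: "\<And>t A. 0 \<le> t \<Longrightarrow> A \<in> sets borel0 \<Longrightarrow>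
   (\<integral>x. killed_transition \<alpha> \<sigma> M X0 t x A \<partial>\<eta>) / (\<integral>x. survival_prob \<alpha> \<sigma> M X0 t x \<partial>\<eta>) = measure \<eta> A"
  using q unfolding quasi_stationary_def by blast+
 interpret E: prob_space \<eta> by fact
 have spe: "space \<eta> = - {0}" using sets_eq_imp_space_eq[OF se] by (simp add: space_restrict_space)
 \<comment> \<open>\<open>\<eta>\<close> lives on the punctured line;
   \<open>quasi_stationary_unique\<close> is about measures on the line, hence the image
   measure.\<close>
 define \<eta>' where "\<eta>' = distr \<eta> borel (\<lambda>x. x)"
 have id[measurable]: "(\<lambda>x. x) \<in> borel_measurable \<eta>" by (rule measurable_borel0[OF _ se]) simp
 have me: "measure \<eta>' B = measure \<eta> (B - {0})" if "B \<in> sets borel" for B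
  unfolding \<eta>'_def using that by (subst measure_distr) (auto simp: spe Diff_eq intro: arg_cong[where f="measure \<eta>"])
 have int: "(\<integral>x. f x \<partial>\<eta>') = (\<integral>x. f x \<partial>\<eta>)" if "f \<in> borel_measurable borel" for f :: "real \<Rightarrow> real"
  unfolding \<eta>'_def using that by (subst integral_distr) auto
 have B0: "B - {0} \<in> sets borel0" if "B \<in> sets borel" for B :: "real set"
  using that by (auto simp: sets_restrict_space Diff_eq)
 have "measure \<eta>' B = mu.coef (indicator B) 0 / Z" if B: "B \<in> sets borel" for B
 proof (rule quasi_stationary_unique[OF _ _ _ _ B])
  show "prob_space \<eta>'" unfolding \<eta>'_def by (rule E.prob_space_distr) simp
  show "sets \<eta>' = sets borel" by (simp add: \<eta>'_def)
  show "AE x in \<eta>'. x \<noteq> 0" unfolding \<eta>'_def by (subst AE_distr_iff) (use AE_nonzero_borel0[OF se] in auto)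
  fix t :: real and C :: "real set" assume t: "0 \<le> t" and C[measurable]: "C \<in> sets borel"
  have C': "C - {0} \<in> sets borel" by simp
  have "(\<integral>x. measure (law t x) C \<partial>\<eta>') = (\<integral>x. measure (law t x) (C - {0}) \<partial>\<eta>)"
  proof (subst int)
   show "(\<integral>x. measure (law t x) C \<partial>\<eta>) = (\<integral>x. measure (law t x) (C - {0}) \<partial>\<eta>)"
   proof (rule Bochner_Integration.integral_cong[OF refl])
    fix x assume "x \<in> space \<eta>"
    \<comment> \<open>The laws do not charge \<open>0\<close>, so the equation for
      \<open>C - {0}\<close> on the punctured line gives the one for \<open>C\<close>.\<close>
    then have "{0} \<in> null_sets (law t x)" using law_zero[of x t] t spe by (auto simp: null_sets_def)
    then show "measure (law t x) C = measure (law t x) (C - {0})" by (subst measure_Diff_null_set) auto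
   qed
  qed measurable
  moreover have "(\<integral>x. measure (law t x) UNIV \<partial>\<eta>') = (\<integral>x. measure (law t x) UNIV \<partial>\<eta>)" by (rule int) measurable
  ultimately show "(\<integral>x. measure (law t x) C \<partial>\<eta>') / (\<integral>x. measure (law t x) UNIV \<partial>\<eta>') = measure \<eta>' C"
   using eq[OF t B0[OF C]] unfolding integral_killed_transition[OF se t C'] integral_survival_prob[OF se t] me[OF C] by simp
 qed
 then have e: "measure \<eta> (A - {0}) = mu.coef (indicator A) 0 / Z" if "A \<in> sets borel" for A using me that by simp
 interpret N: prob_space nu by (rule prob_space_nu)
 show ?thesis
 proof (rule measure_eqI)
  show "sets \<eta> = sets nu" by (simp add: se sets_nu)
  fix A assume "A \<in> sets \<eta>"
  then have A: "A \<in> sets borel0" by (simp add: se)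
  then have "A - {0} = A" "A \<in> sets borel" using borel0_borel[OF A] by auto
  then have "measure \<eta> A = measure nu A" using e[of A] measure_nu[OF A] by simp
  then show "emeasure \<eta> A = emeasure nu A" by (simp add: E.emeasure_eq_measure N.emeasure_eq_measure)
 qed
qed

lemma Yaglom_limit:
 assumes x: "x \<noteq> 0" and A: "A \<in> sets borel0"
 shows "((\<lambda>t. conditional_prob \<alpha> \<sigma> M X0 t x A) \<longlongrightarrow> measure nu A) at_top"
proof -
 have A': "A \<in> sets borel" using borel0_borel[OF A] by blast
 obtain C where C: "\<forall>t\<ge>0. \<forall>f. f \<in> borel_measurable borel \<longrightarrow> (\<forall>y. \<bar>f y\<bar> \<le> 1) \<longrightarrow>
  \<bar>(\<integral>y. f y \<partial>law t x) / measure (law t x) UNIV - mu.coef f 0 / Z\<bar> \<le> C * exp (- (lam 1 - lam 0) * t)"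
  using conditional_law_bound[OF x] by blast
 have le: "\<bar>conditional_prob \<alpha> \<sigma> M X0 t x A - measure nu A\<bar> \<le> C * exp (- (lam 1 - lam 0) * t)" if t: "0 \<le> t" for t
 proof -
  have "\<bar>(\<integral>y. indicator A y \<partial>law t x) / measure (law t x) UNIV - mu.coef (indicator A) 0 / Z\<bar> \<le> C * exp (- (lam 1 - lam 0) * t)"
   by (rule C[rule_format, OF t]) (use A' in auto)
  then show ?thesis using A' unfolding conditional_prob_law[OF X0 x t A'] measure_nu[OF A] by simp
 qed
 have "((\<lambda>t. C * exp (- (lam 1 - lam 0) * t)) \<longlongrightarrow> C * 0) at_top"
  using lam01 by (intro tendsto_intros filterlim_compose[OF exp_at_bot] filterlim_tendsto_neg_mult_at_bot[OF tendsto_const] filterlim_ident) auto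
 then have z: "((\<lambda>t. C * exp (- (lam 1 - lam 0) * t)) \<longlongrightarrow> 0) at_top" by simp
 have "((\<lambda>t. conditional_prob \<alpha> \<sigma> M X0 t x A - measure nu A) \<longlongrightarrow> 0) at_top"
  by (rule Lim_null_comparison[OF _ z]) (use eventually_ge_at_top[of 0] in eventually_elim, use le in simp)
 then show ?thesis by (simp add: LIM_zero_iff)
qed

text \<open>Test functions on the punctured line, extended by \<open>0\<close>, are Borel functions
  bounded by \<open>1\<close>; the constant of \<open>conditional_law_bound\<close> serves all of
  them at once, so the supremum inherits it.\<close>

lemma tv_norm_bound:
 assumes x: "x \<noteq> 0"
 shows "\<exists>C>0. \<forall>t\<ge>0. tv_norm_diff (conditional_law \<alpha> \<sigma> M X0 t x) nu \<le> C * exp (- (lam 1 - lam 0) * t)"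
proof -
 obtain C where "0 < C" and C: "\<forall>t\<ge>0. \<forall>f. f \<in> borel_measurable borel \<longrightarrow> (\<forall>y. \<bar>f y\<bar> \<le> 1) \<longrightarrow>
  \<bar>(\<integral>y. f y \<partial>law t x) / measure (law t x) UNIV - mu.coef f 0 / Z\<bar> \<le> C * exp (- (lam 1 - lam 0) * t)"
  using conditional_law_bound[OF x] by blast
 show ?thesis
 proof (intro exI[of _ C] conjI allI impI \<open>0 < C\<close>)
  fix t :: real assume t: "0 \<le> t"
  show "tv_norm_diff (conditional_law \<alpha> \<sigma> M X0 t x) nu \<le> C * exp (- (lam 1 - lam 0) * t)"
   unfolding tv_norm_diff_def
  proof (rule cSUP_least)
   have "(\<lambda>_. 0) \<in> {f \<in> borel_measurable nu. \<forall>x\<in>space nu. \<bar>f x\<bar> \<le> (1::real)}" by simp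
   then show "{f \<in> borel_measurable nu. \<forall>x\<in>space nu. \<bar>f x\<bar> \<le> (1::real)} \<noteq> {}" by blast
   fix f :: "real \<Rightarrow> real" assume "f \<in> {f \<in> borel_measurable nu. \<forall>x\<in>space nu. \<bar>f x\<bar> \<le> 1}"
   then have f: "f \<in> borel_measurable borel0" and f1: "\<And>y. y \<noteq> 0 \<Longrightarrow> \<bar>f y\<bar> \<le> 1"
    by (auto simp: measurable_cong_sets[OF sets_nu refl] space_nu)
   let ?f = "\<lambda>y. indicator (- {0}) y * f y"
   let ?s = "measure (law t x) UNIV"
   have fm[measurable]: "?f \<in> borel_measurable borel" by (rule borel_measurable_borel0[OF f])
   have "(\<integral>y. f y \<partial>conditional_law \<alpha> \<sigma> M X0 t x) = (\<integral>y. ?f y \<partial>density (law t x) (\<lambda>_. ennreal (1 / ?s)))"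
    unfolding conditional_law_law[OF X0 x t] by (subst integral_restrict_space) auto
   also have "\<dots> = (\<integral>y. 1 / ?s * ?f y \<partial>law t x)" by (subst integral_density) auto
   also have "\<dots> = (\<integral>y. ?f y \<partial>law t x) / ?s" by simp
   finally have i: "(\<integral>y. f y \<partial>conditional_law \<alpha> \<sigma> M X0 t x) = (\<integral>y. ?f y \<partial>law t x) / ?s" .
   show "\<bar>(\<integral>y. f y \<partial>conditional_law \<alpha> \<sigma> M X0 t x) - (\<integral>y. f y \<partial>nu)\<bar> \<le> C * exp (- (lam 1 - lam 0) * t)"
    unfolding i integral_nu[OF f]
    by (rule C[rule_format, OF t fm]) (use f1 in \<open>auto simp: indicator_def\<close>)
  qed
 qed
qed

end

end

theorem theorem1p2:
  fixes \<alpha> :: real and \<sigma> :: "real \<Rightarrow> real"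
    and M :: "'w measure" and X :: "real \<Rightarrow> 'w \<Rightarrow> real"
    and lam :: "nat \<Rightarrow> real" and \<psi> :: "nat \<Rightarrow> real \<Rightarrow> real"
  assumes alpha: "1 < \<alpha>" "\<alpha> < 2"
    and stable: "symmetric_stable_process \<alpha> M X"
    and sigma_cont: "continuous_on UNIV \<sigma>"
    and sigma_pos: "\<And>x. 0 < \<sigma> x"
    and speed_prob: "prob_space (speed_measure \<alpha> \<sigma>)"
    and spectral: "spectral_data \<alpha> \<sigma> M X lam \<psi>"
    and I_finite: "(\<integral>\<^sup>+ x. ennreal (\<sigma> x powr (- \<alpha>) * \<bar>x\<bar> powr (\<alpha> - 1)) \<partial>lborel) < \<infinity>"
  shows "\<exists>\<nu>. quasi_stationary \<alpha> \<sigma> M X \<nu> \<and>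
      (\<forall>\<eta>. quasi_stationary \<alpha> \<sigma> M X \<eta> \<longrightarrow> \<eta> = \<nu>) \<and>
      (\<forall>A\<in>sets borel0.
         measure \<nu> A = (LINT x:A|speed_measure0 \<alpha> \<sigma>. \<psi> 0 x) / (LINT x|speed_measure0 \<alpha> \<sigma>. \<psi> 0 x)) \<and>
      (\<forall>x. x \<noteq> 0 \<longrightarrow> (\<forall>A\<in>sets borel0.
         ((\<lambda>t. conditional_prob \<alpha> \<sigma> M X t x A) \<longlongrightarrow> measure \<nu> A) at_top)) \<and>
      (\<forall>x. x \<noteq> 0 \<longrightarrow> (\<exists>C>0. \<forall>t\<ge>0.
         tv_norm_diff (conditional_law \<alpha> \<sigma> M X t x) \<nu> \<le> C * exp (- (lam 1 - lam 0) * t)))"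
proof -
 let ?\<mu> = "speed_measure \<alpha> \<sigma>"
 obtain X' where X': "stable_motion M \<alpha> X'" and ae: "AE w in M. \<forall>t\<ge>0. X t w = X' t w"
  using stable_motion_version[OF alpha stable] by blast
 interpret T: time_changed_motion M \<alpha> X' \<sigma>
  by (intro time_changed_motion.intro X' time_changed_motion_axioms.intro sigma_cont sigma_pos)
 \<comment> \<open>\<open>\<psi> n\<close> is only constrained off the origin; with the value
   \<open>0\<close> there it becomes a Borel function on the line.\<close>
 define \<phi> where "\<phi> n y = indicator (- {0}) y * \<psi> n y" for n y
 have on: "complete_orthonormal_on (speed_measure0 \<alpha> \<sigma>) \<psi>"
  and ev: "\<And>n t. 0 \<le> t \<Longrightarrow> AE x in speed_measure0 \<alpha> \<sigma>. (\<integral>y. \<psi> n y \<partial>killed_kernel \<alpha> \<sigma> M X t x) = exp (- lam n * t) * \<psi> n x"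
  and lam: "0 < lam 0" "lam 0 < lam 1" "incseq lam" and pos: "\<And>x. x \<noteq> 0 \<Longrightarrow> 0 < \<psi> 0 x"
  using spectral unfolding spectral_data_def by blast+
 have sets_mu: "sets ?\<mu> = sets borel" by (simp add: speed_measure_def)
 have nz: "AE x in ?\<mu>. x \<noteq> 0"
 proof -
  have m: "(\<lambda>x. ennreal (\<sigma> x powr - \<alpha>)) \<in> borel_measurable lborel" using T.spd_measurable unfolding T.spd_def[abs_def] by simp
  have "AE x in lborel. x \<noteq> (0::real)" by (rule AE_lborel_singleton)
  then show ?thesis unfolding speed_measure_def using m by (subst AE_density) auto
 qed
 have sq_phi: "square_integrable_on ?\<mu> (\<phi> n)" for n
  using on square_integrable_on_restrict[of \<alpha> \<sigma> "\<psi> n"] unfolding complete_orthonormal_on_def \<phi>_def[abs_def] by simp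
 have "orthonormal_basis ?\<mu> \<phi>"
 proof (rule orthonormal_basis.intro[OF speed_prob], unfold_locales)
  show "square_integrable_on ?\<mu> (\<phi> n)" for n by (rule sq_phi)
  show "(\<integral>x. \<phi> m x * \<phi> n x \<partial>?\<mu>) = (if m = n then 1 else 0)" for m n
  proof -
   have "(\<integral>x. \<phi> m x * \<phi> n x \<partial>?\<mu>) = (\<integral>x. \<psi> m x * \<psi> n x \<partial>speed_measure0 \<alpha> \<sigma>)"
    unfolding integral_speed_measure0 by (rule Bochner_Integration.integral_cong) (auto simp: \<phi>_def indicator_def)
   then show ?thesis using on unfolding complete_orthonormal_on_def by simp
  qed
  fix f assume f: "square_integrable_on ?\<mu> f" and z: "\<And>n. (\<integral>x. f x * \<phi> n x \<partial>?\<mu>) = 0"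
  have fm: "f \<in> borel_measurable ?\<mu>" using f by (simp add: square_integrable_on_def)
  have "square_integrable_on (speed_measure0 \<alpha> \<sigma>) f"
  proof -
   have "integrable ?\<mu> (\<lambda>x. (indicator (- {0}) x * f x)\<^sup>2)"
    by (rule Bochner_Integration.integrable_bound[where f="\<lambda>x. (f x)\<^sup>2"]) (use f fm sets_mu in \<open>auto simp: square_integrable_on_def indicator_def\<close>)
   then show ?thesis unfolding square_integrable_on_restrict using fm sets_mu by (auto simp: square_integrable_on_def)
  qed
  moreover have "(\<integral>x. f x * \<psi> n x \<partial>speed_measure0 \<alpha> \<sigma>) = 0" for n
  proof -
   have "(\<integral>x. f x * \<psi> n x \<partial>speed_measure0 \<alpha> \<sigma>) = (\<integral>x. f x * \<phi> n x \<partial>?\<mu>)"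
    unfolding integral_speed_measure0 by (rule Bochner_Integration.integral_cong) (auto simp: \<phi>_def)
   then show ?thesis using z by simp
  qed
  ultimately have "AE x in speed_measure0 \<alpha> \<sigma>. f x = 0" using on unfolding complete_orthonormal_on_def by blast
  then show "AE x in ?\<mu>. f x = 0"
   unfolding speed_measure0_def AE_restrict_space_iff[OF Omega_sets] using nz by eventually_elim auto
 qed
 then interpret K: killed_spectrum M \<alpha> X' \<sigma> \<phi> lam
 proof (intro killed_spectrum.intro killed_spectrum_axioms.intro T.time_changed_motion_axioms lam)
  show "(\<integral>\<^sup>+y. ennreal (pot0 \<alpha> y) \<partial>?\<mu>) < \<infinity>"
  proof -
   have "(\<integral>\<^sup>+y. ennreal (pot0 \<alpha> y) \<partial>?\<mu>) = (\<integral>\<^sup>+y. ennreal (T.spd y) * ennreal (pot0 \<alpha> y) \<partial>lborel)"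
    unfolding speed_measure_def T.spd_def[symmetric]
    by (rule nn_integral_density) (use pot0_measurable[OF alpha] T.spd_measurable in auto)
   \<comment> \<open>By scaling, \<open>pot0\<close> is a multiple of
     \<open>\<bar>y\<bar> powr (\<alpha> - 1)\<close>, so finiteness of the integral in the
     hypothesis is integrability of \<open>pot0\<close> for the speed measure.\<close>
   also have "\<dots> = (\<integral>\<^sup>+y. ennreal (pot0 \<alpha> 1) * ennreal (\<sigma> y powr (- \<alpha>) * \<bar>y\<bar> powr (\<alpha> - 1)) \<partial>lborel)"
    by (subst pot0_scaling[OF alpha]) (simp add: T.spd_def ennreal_mult[symmetric] less_imp_le[OF pot0_one_pos[OF alpha]] mult_ac)
   also have "\<dots> = ennreal (pot0 \<alpha> 1) * (\<integral>\<^sup>+y. ennreal (\<sigma> y powr (- \<alpha>) * \<bar>y\<bar> powr (\<alpha> - 1)) \<partial>lborel)"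
    by (rule nn_integral_cmult) (use T.spd_measurable in \<open>auto simp: T.spd_def[abs_def]\<close>)
   also have "\<dots> < \<infinity>" using I_finite by (simp add: ennreal_mult_less_top)
   finally show ?thesis .
  qed
  show "AE x in ?\<mu>. (\<integral>y. \<phi> n y \<partial>T.law t x) = exp (- lam n * t) * \<phi> n x" if t: "0 \<le> t" for n t
  proof -
   have "AE x in ?\<mu>. x \<in> - {0} \<longrightarrow> (\<integral>y. \<psi> n y \<partial>killed_kernel \<alpha> \<sigma> M X t x) = exp (- lam n * t) * \<psi> n x"
    using ev[OF t, of n] unfolding speed_measure0_def AE_restrict_space_iff[OF Omega_sets] .
   then show ?thesis
    using nz
   proof eventually_elim
    case (elim x)
    have "(\<integral>y. \<psi> n y \<partial>killed_kernel \<alpha> \<sigma> M X t x) = (\<integral>y. \<phi> n y \<partial>T.law t x)"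
     unfolding T.killed_kernel_law[OF ae elim(2) t] \<phi>_def by (subst integral_restrict_space) auto
    then show ?case using elim by (simp add: \<phi>_def)
   qed
  qed
  show "0 < \<phi> 0 x" if "x \<noteq> 0" for x using pos[OF that] that by (simp add: \<phi>_def)
 qed
 have nu_eq: "measure K.nu A = (LINT x:A|speed_measure0 \<alpha> \<sigma>. \<psi> 0 x) / (LINT x|speed_measure0 \<alpha> \<sigma>. \<psi> 0 x)"
  if A: "A \<in> sets borel0" for A
 proof -
  have "(LINT x:A|speed_measure0 \<alpha> \<sigma>. \<psi> 0 x) = K.mu.coef (indicator A) 0"
   unfolding set_lebesgue_integral_def integral_speed_measure0 K.mu.coef_def
   by (rule Bochner_Integration.integral_cong) (auto simp: \<phi>_def)
  moreover have "(LINT x|speed_measure0 \<alpha> \<sigma>. \<psi> 0 x) = K.Z"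
   unfolding integral_speed_measure0 K.Z_def \<phi>_def ..
  ultimately show ?thesis using K.measure_nu[OF A] by simp
 qed
 show ?thesis
  by (intro exI[of _ K.nu] conjI allI impI ballI nu_eq K.quasi_stationary_nu[OF ae] K.quasi_stationary_eq_nu[OF ae]
    K.Yaglom_limit[OF ae] K.tv_norm_bound[OF ae])
qed

end
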